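(* Let $\alpha>0$, $\tau:=1/\alpha$, $k\ge2$ an integer, and let $\mathcal I$ be a regular multilevel partition of $\mathbb R$. The homogeneous Besov spaces $\dot B^{\alpha,k}_\tau(\Phi)$, $\dot B^{\alpha,k}_\tau(E,q)$ and $\dot B^{\alpha,k}_\tau(Q,q)$ for all $q\in[1,\infty)$ are the same with equivalent norms: $$\|f\|_{\dot B^{\alpha,k}_\tau(\Phi)}\sim\|f\|_{\dot B^{\alpha,k}_\tau(E,q)}\sim\|f\|_{\dot B^{\alpha,k}_\tau(Q,q)},$$ with constants of equivalence depending only on $\alpha$, $k$, $q$, and the parameters of $\mathcal I$.
   Context: All functions are complex-valued. $\Pi_k$ is the set of univariate algebraic polynomials of degree at most $k-1$. $a\sim b$ means $c_1\le a/b\le c_2$ with positive constants $c_1,c_2$. BMO and VMO: $\|f\|_{\mathrm{BMO}}:=\sup_J \frac1{|J|}\int_J|f-\mathrm{Avg}_J f|\,dx$ over all compact intervals $J\subset\mathbb R$, with $\mathrm{Avg}_Jf=\frac1{|J|}\int_J f$. $\mathrm{BMO}$ is the set of $f\in L^1_{loc}(\mathbb R)$ with $\|f\|_{\mathrm{BMO}}<\infty$, functions differing by a constant being identified; $\mathrm{VMO}$ is the closure in the BMO norm of the set $C_0(\mathbb R)$ of continuous compactly supported functions. Regular multilevel partition: $\mathcal I=\bigcup_{m\in\mathbb Z}\mathcal I_m$, where (a) each $\mathcal I_m$ is a partition of $\mathbb R$ into compact intervals with disjoint interiors, $\mathcal I_m=\{[x_{m,j},x_{m,j+1}]:j\in\mathbb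 Z\}$ with $\cdots<x_{m,-1}<x_{m,0}<x_{m,1}<\cdots$; (b) $\mathcal I_{m+1}$ refines $\mathcal I_m$ and each $I\in\mathcal I_m$ has at least two and at most $M_0$ children in $\mathcal I_{m+1}$, $M_0\ge2$ a constant; (c) there is a constant $\lambda\ge1$ with $|I'|\le\lambda|I''|$ for all $I',I''\in\mathcal I_m$, $m\in\mathbb Z$. The parameters of $\mathcal I$ are $M_0,\lambda$. B-splines: $\mathcal Q_m:=\{[x_{m,j},x_{m,j+k}]:j\in\mathbb Z\}$, $\mathcal Q:=\bigcup_m\mathcal Q_m$. For $Q=[x_{m,j},x_{m,j+k}]\in\mathcal Q_m$, $\varphi_Q$ is the B-spline of degree $k-1$ with knots $x_{m,j},\dots,x_{m,j+k}$, normalized so that the B-splines of each level sum to $1$; its support is $Q$. The space $\dot B^{\alpha,k}_\tau(E,q)$: for $I=[x_{m,j},x_{m,j+1}]\in\mathcal I_m$ set $\Omega_I:=[x_{m,j+1-k},x_{m,j+k}]$. For a compact interval $J$, $E_k(f,J)_q:=\inf_{R\in\Pi_k}\|f-R\|_{L^q(J)}$ and $\omega_k(f,J)_q:=\sup_{h\in\mathbb R}\|\Delta_h^k(f,\cdot,J)\|_{L^q(J)}$, where $\Delta_h^k(f,x,J)=\sum_{i=0}^k(-1)^{k+i}\binom ki f(x+ih)$ if $[x,x+kh]\subset J$ and $0$ otherwise. $\dot B^{\alpha,k}_\tau(E,q)$ is the set of $f\in L^q_{loc}(\mathbb R)$ with $\|f\|_{\dot B^{\alpha,k}_\tau(E,q)}:=\big(\sum_{I\in\mathcal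 I}(|I|^{-1/q}\omega_k(f,\Omega_I)_q)^\tau\big)^{1/\tau}<\infty$ (equivalently with $E_k$ in place of $\omega_k$). The space $\dot B^{\alpha,k}_\tau(\Phi)$: the set of functions $f$ on $\mathbb R$ for which there is $P\in\Pi_k$ such that $f-P\in\mathrm{VMO}$ and $f-P=\sum_{Q\in\mathcal Q}a_Q\varphi_Q$ with unconditional convergence in BMO and $\sum_Q|a_Q|^\tau<\infty$; $\|f\|_{\dot B^{\alpha,k}_\tau(\Phi)}$ is the infimum of $\big(\sum_Q|a_Q|^\tau\big)^{1/\tau}$ over all such representations. The space $\dot B^{\alpha,k}_\tau(Q,q)$: for each compact interval $J$ let $P_{J,q}:L^q(J)\to\Pi_k$ be a fixed linear projector with $\|f-P_{J,q}(f)\|_{L^q(J)}\le A\,E_k(f,J)_q$ for all $f\in L^q(J)$, $A\ge1$ a fixed constant independent of $J$ and $f$. Put $\mathscr P_{m,q}(f):=\sum_{I\in\mathcal I_m}\mathbb 1_I P_{I,q}(f)$ for $f\in L^q_{loc}(\mathbb R)$. For a (possibly discontinuous) piecewise polynomial $S$ of degree $k-1$ over $\mathcal I_m$ let $T_m(S):=\sum_{Q\in\mathcal Q_m}\beta_Q(S)\varphi_Q$, where for $Q=[x_{m,j},x_{m,j+k}]$, $\beta_Q(S):=\sum_{\nu=0}^{k-1}(-1)^\nu\varpi_Q^{(k-\nu-1)}(\xi_Q)S^{(\nu)}(\xi_Q)$, $\varpi_Q(x):=\frac1{(k-1)!}\prod_{\nu=j+1}^{j+k-1}(x-x_{m,\nu})$,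 and $\xi_Q$ is a point in the interior of an interval of $\mathcal I_m$ contained in $Q$, this interval being fixed once and for all for each $Q$ (the value does not depend on the point within that interval). Put $T_{m,q}(f):=T_m(\mathscr P_{m,q}(f))$, and define $b_{Q,q}(f)$, $Q\in\mathcal Q_m$, uniquely by $T_{m,q}(f)-T_{m-1,q}(f)=\sum_{Q\in\mathcal Q_m}b_{Q,q}(f)\varphi_Q$. For $f\in L^q_{loc}(\mathbb R)$, $\|f\|_{\dot B^{\alpha,k}_\tau(Q,q)}:=\big(\sum_{Q\in\mathcal Q}(|Q|^{-1/q}\|b_{Q,q}(f)\varphi_Q\|_{L^q(\mathbb R)})^\tau\big)^{1/\tau}$, and $\dot B^{\alpha,k}_\tau(Q,q)$ is the set of $f\in L^q_{loc}(\mathbb R)$ for which this is finite.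
   Formalization: If some point is a knot of every level, the Q-space equals the E-space only up to adding functions of zero Q-norm (a truncated power has zero Q-norm but is not in the E-space); equality is literal otherwise. The constants for the Q-norm may also depend on the fixed projector constant A. *)

theory Defs
  imports "HOL-Analysis.Analysis" "HOL-Computational_Algebra.Computational_Algebra"
begin

section \<open>Function spaces on the real line\<close>

text \<open>
  Functions are not quotiented by equality almost everywhere; all norms below
  are insensitive to null sets of the Lebesgue measure.
\<close>

definition Pi_poly :: "nat \<Rightarrow> complex poly set" where
  "Pi_poly k = {p. degree p < k}"

definition poly_fun :: "complex poly \<Rightarrow> real \<Rightarrow> complex" where
  "poly_fun p t = poly p (complex_of_real t)"

definition Lq :: "real \<Rightarrow> real set \<Rightarrow> (real \<Rightarrow> complex) set" where
  "Lq q S = {f. set_borel_measurable lebesgue S f \<and>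
                set_integrable lebesgue S (\<lambda>t. cmod (f t) powr q)}"

definition Lq_norm :: "real \<Rightarrow> real set \<Rightarrow> (real \<Rightarrow> complex) \<Rightarrow> real" where
  "Lq_norm q S f = (LINT t:S|lebesgue. cmod (f t) powr q) powr (1 / q)"

definition Lq_loc :: "real \<Rightarrow> (real \<Rightarrow> complex) set" where
  "Lq_loc q = {f. \<forall>a b. f \<in> Lq q {a..b}}"

definition Avg :: "real \<Rightarrow> real \<Rightarrow> (real \<Rightarrow> complex) \<Rightarrow> complex" where
  "Avg a b f = (LINT t:{a..b}|lebesgue. f t) /\<^sub>R (b - a)"

text \<open>
  The BMO norm vanishes on constants, so the identification of functions
  differing by a constant is implicit in every convergence statement in BMO.
\<close>

definition bmo_norm :: "(real \<Rightarrow> complex) \<Rightarrow> ennreal" where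
  "bmo_norm f = (SUP (a, b) \<in> {(a, b). a < b}.
     ennreal ((LINT t:{a..b}|lebesgue. cmod (f t - Avg a b f)) / (b - a)))"

definition BMO :: "(real \<Rightarrow> complex) set" where
  "BMO = {f. (\<forall>a b. f absolutely_integrable_on {a..b}) \<and> bmo_norm f < \<infinity>}"

definition C0 :: "(real \<Rightarrow> complex) set" where
  "C0 = {g. continuous_on UNIV g \<and> (\<exists>R. \<forall>t. \<bar>t\<bar> > R \<longrightarrow> g t = 0)}"

definition VMO :: "(real \<Rightarrow> complex) set" where
  "VMO = {f \<in> BMO. \<forall>\<epsilon>>0. \<exists>g\<in>C0. bmo_norm (\<lambda>t. f t - g t) < \<epsilon>}"

definition E_k :: "nat \<Rightarrow> real \<Rightarrow> real \<Rightarrow> real \<Rightarrow> (real \<Rightarrow> complex) \<Rightarrow> real" where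
  "E_k k q a b f = (INF R \<in> Pi_poly k. Lq_norm q {a..b} (\<lambda>t. f t - poly_fun R t))"

definition fin_diff ::
  "nat \<Rightarrow> real \<Rightarrow> (real \<Rightarrow> complex) \<Rightarrow> real \<Rightarrow> real \<Rightarrow> real \<Rightarrow> complex" where
  "fin_diff k h f a b t =
     (if closed_segment t (t + real k * h) \<subseteq> {a..b}
      then \<Sum>i\<le>k. (-1) ^ (k + i) * of_nat (k choose i) * f (t + real i * h)
      else 0)"

definition omega_k :: "nat \<Rightarrow> real \<Rightarrow> real \<Rightarrow> real \<Rightarrow> (real \<Rightarrow> complex) \<Rightarrow> real" where
  "omega_k k q a b f = (SUP h. Lq_norm q {a..b} (fin_diff k h f a b))"


section \<open>Regular multilevel partitions and B-splines\<close>

text \<open>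
  \<open>x m j\<close> is the \<open>j\<close>-th knot of level \<open>m\<close>.  The intervals of level \<open>m\<close> and the
  B-spline supports of level \<open>m\<close> are indexed by \<open>j\<close>; since every interval has at
  least two children, no interval (and no support) occurs at two different
  levels, so sums over \<open>(m, j)\<close> are sums over the sets of all intervals
  (all supports).
\<close>

type_synonym knots = "int \<Rightarrow> int \<Rightarrow> real"

definition level_interval :: "knots \<Rightarrow> int \<Rightarrow> int \<Rightarrow> real set" where
  "level_interval x m j = {x m j .. x m (j + 1)}"

definition regular_multilevel_partition :: "nat \<Rightarrow> real \<Rightarrow> knots \<Rightarrow> bool" where
  "regular_multilevel_partition M\<^sub>0 lam x \<longleftrightarrow>
     (\<forall>m. strict_mono (x m) \<and> (\<Union>j. level_interval x m j) = UNIV) \<and>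
     (\<forall>m i. \<exists>j. level_interval x (m + 1) i \<subseteq> level_interval x m j) \<and>
     (\<forall>m j. 2 \<le> card {i. level_interval x (m + 1) i \<subseteq> level_interval x m j} \<and>
            card {i. level_interval x (m + 1) i \<subseteq> level_interval x m j} \<le> M\<^sub>0) \<and>
     (\<forall>m i j. x m (i + 1) - x m i \<le> lam * (x m (j + 1) - x m j))"

text \<open>
  Cox--de Boor recursion.  \<open>bspline y k j\<close> has order \<open>k\<close> (degree \<open>k - 1\<close>), knots
  \<open>y j, \<dots>, y (j + k)\<close>, and is normalized to a partition of unity in \<open>j\<close>.
\<close>

fun bspline :: "(int \<Rightarrow> real) \<Rightarrow> nat \<Rightarrow> int \<Rightarrow> real \<Rightarrow> real" where
  "bspline y 0 j t = 0"
| "bspline y (Suc 0) j t = (if y j \<le> t \<and> t < y (j + 1) then 1 else 0)"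
| "bspline y (Suc (Suc n)) j t =
     (t - y j) / (y (j + int (Suc n)) - y j) * bspline y (Suc n) j t +
     (y (j + int (Suc (Suc n))) - t) / (y (j + int (Suc (Suc n))) - y (j + 1))
       * bspline y (Suc n) (j + 1) t"

definition phi :: "knots \<Rightarrow> nat \<Rightarrow> int \<Rightarrow> int \<Rightarrow> real \<Rightarrow> complex" where
  "phi x k m j t = complex_of_real (bspline (x m) k j t)"

definition ell_norm :: "real \<Rightarrow> (int \<times> int \<Rightarrow> real) \<Rightarrow> real" where
  "ell_norm \<tau> c = (\<Sum>\<^sub>\<infinity>i. c i powr \<tau>) powr (1 / \<tau>)"


section \<open>The space defined by local moduli of smoothness\<close>

definition E_coef :: "knots \<Rightarrow> nat \<Rightarrow> real \<Rightarrow> (real \<Rightarrow> complex) \<Rightarrow> int \<times> int \<Rightarrow> real" where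
  "E_coef x k q f = (\<lambda>(m, j). (x m (j + 1) - x m j) powr (- 1 / q) *
     omega_k k q (x m (j + 1 - int k)) (x m (j + int k)) f)"

definition besov_E :: "knots \<Rightarrow> nat \<Rightarrow> real \<Rightarrow> real \<Rightarrow> (real \<Rightarrow> complex) set" where
  "besov_E x k \<tau> q = {f \<in> Lq_loc q. (\<lambda>i. E_coef x k q f i powr \<tau>) summable_on UNIV}"

definition besov_E_norm :: "knots \<Rightarrow> nat \<Rightarrow> real \<Rightarrow> real \<Rightarrow> (real \<Rightarrow> complex) \<Rightarrow> real" where
  "besov_E_norm x k \<tau> q f = ell_norm \<tau> (E_coef x k q f)"


section \<open>The space defined by B-spline representations\<close>

text \<open>Unconditional convergence is convergence of the net of finite partial sums.\<close>

definition Phi_rep ::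
  "knots \<Rightarrow> nat \<Rightarrow> real \<Rightarrow> (real \<Rightarrow> complex) \<Rightarrow> (int \<times> int \<Rightarrow> complex) \<Rightarrow> bool" where
  "Phi_rep x k \<tau> f a \<longleftrightarrow>
     (\<exists>P\<in>Pi_poly k.
        (\<lambda>t. f t - poly_fun P t) \<in> VMO \<and>
        ((\<lambda>F. bmo_norm (\<lambda>t. f t - poly_fun P t - (\<Sum>(m, j)\<in>F. a (m, j) * phi x k m j t)))
           \<longlongrightarrow> 0) (finite_subsets_at_top UNIV)) \<and>
     (\<lambda>i. cmod (a i) powr \<tau>) summable_on UNIV"

definition besov_Phi :: "knots \<Rightarrow> nat \<Rightarrow> real \<Rightarrow> (real \<Rightarrow> complex) set" where
  "besov_Phi x k \<tau> = {f. \<exists>a. Phi_rep x k \<tau> f a}"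

definition besov_Phi_norm :: "knots \<Rightarrow> nat \<Rightarrow> real \<Rightarrow> (real \<Rightarrow> complex) \<Rightarrow> real" where
  "besov_Phi_norm x k \<tau> f = (INF a \<in> {a. Phi_rep x k \<tau> f a}. ell_norm \<tau> (\<lambda>i. cmod (a i)))"


section \<open>The space defined by quasi-interpolants\<close>

text \<open>\<open>P a b\<close> is the projector for the interval \<open>[a, b]\<close>.\<close>

type_synonym projectors = "real \<Rightarrow> real \<Rightarrow> (real \<Rightarrow> complex) \<Rightarrow> complex poly"

definition near_best_projectors :: "nat \<Rightarrow> real \<Rightarrow> real \<Rightarrow> projectors \<Rightarrow> bool" where
  "near_best_projectors k q A P \<longleftrightarrow>
     (\<forall>a b. a < b \<longrightarrow>
        (\<forall>f\<in>Lq q {a..b}. P a b f \<in> Pi_poly k) \<and>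
        (\<forall>f\<in>Lq q {a..b}. \<forall>g\<in>Lq q {a..b}.
           (AE t\<in>{a..b} in lebesgue. f t = g t) \<longrightarrow> P a b f = P a b g) \<and>
        (\<forall>f\<in>Lq q {a..b}. \<forall>g\<in>Lq q {a..b}. P a b (\<lambda>t. f t + g t) = P a b f + P a b g) \<and>
        (\<forall>f\<in>Lq q {a..b}. \<forall>c. P a b (\<lambda>t. c * f t) = smult c (P a b f)) \<and>
        (\<forall>R\<in>Pi_poly k. P a b (poly_fun R) = R) \<and>
        (\<forall>f\<in>Lq q {a..b}.
           Lq_norm q {a..b} (\<lambda>t. f t - poly_fun (P a b f) t) \<le> A * E_k k q a b f))"

text \<open>
  A piecewise polynomial over level \<open>m\<close> is given by its polynomial pieces:
  \<open>S i\<close> is the piece on \<open>[x m i, x m (i + 1)]\<close>.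
\<close>

definition piecewise_proj ::
  "knots \<Rightarrow> projectors \<Rightarrow> int \<Rightarrow> (real \<Rightarrow> complex) \<Rightarrow> int \<Rightarrow> complex poly" where
  "piecewise_proj x P m f i = P (x m i) (x m (i + 1)) f"

text \<open>
  For \<open>Q = [x m j, x m (j + k)]\<close>, the index \<open>l m j\<close> names the chosen interval
  contained in \<open>Q\<close> and \<open>\<xi> m j\<close> the chosen point of its interior.
\<close>

definition valid_choice ::
  "knots \<Rightarrow> nat \<Rightarrow> (int \<Rightarrow> int \<Rightarrow> int) \<Rightarrow> (int \<Rightarrow> int \<Rightarrow> real) \<Rightarrow> bool" where
  "valid_choice x k l \<xi> \<longleftrightarrow>
     (\<forall>m j. j \<le> l m j \<and> l m j < j + int k \<and> \<xi> m j \<in> {x m (l m j) <..< x m (l m j + 1)})"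

definition varpi :: "knots \<Rightarrow> nat \<Rightarrow> int \<Rightarrow> int \<Rightarrow> complex poly" where
  "varpi x k m j = smult (1 / fact (k - 1))
     (\<Prod>\<nu> = 1..k - 1. [:- complex_of_real (x m (j + int \<nu>)), 1:])"

definition beta ::
  "knots \<Rightarrow> nat \<Rightarrow> (int \<Rightarrow> int \<Rightarrow> int) \<Rightarrow> (int \<Rightarrow> int \<Rightarrow> real) \<Rightarrow>
   int \<Rightarrow> int \<Rightarrow> (int \<Rightarrow> complex poly) \<Rightarrow> complex" where
  "beta x k l \<xi> m j S =
     (\<Sum>\<nu><k. (-1) ^ \<nu> * poly_fun ((pderiv ^^ (k - \<nu> - 1)) (varpi x k m j)) (\<xi> m j)
               * poly_fun ((pderiv ^^ \<nu>) (S (l m j))) (\<xi> m j))"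

definition T_op ::
  "knots \<Rightarrow> nat \<Rightarrow> projectors \<Rightarrow> (int \<Rightarrow> int \<Rightarrow> int) \<Rightarrow> (int \<Rightarrow> int \<Rightarrow> real) \<Rightarrow>
   int \<Rightarrow> (real \<Rightarrow> complex) \<Rightarrow> real \<Rightarrow> complex" where
  "T_op x k P l \<xi> m f t =
     (\<Sum>\<^sub>\<infinity>j. beta x k l \<xi> m j (piecewise_proj x P m f) * phi x k m j t)"

definition b_coef ::
  "knots \<Rightarrow> nat \<Rightarrow> projectors \<Rightarrow> (int \<Rightarrow> int \<Rightarrow> int) \<Rightarrow> (int \<Rightarrow> int \<Rightarrow> real) \<Rightarrow>
   (real \<Rightarrow> complex) \<Rightarrow> int \<Rightarrow> int \<Rightarrow> complex" where
  "b_coef x k P l \<xi> f m =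
     (THE b. \<forall>t. T_op x k P l \<xi> m f t - T_op x k P l \<xi> (m - 1) f t
                 = (\<Sum>\<^sub>\<infinity>j. b j * phi x k m j t))"

definition Q_coef ::
  "knots \<Rightarrow> nat \<Rightarrow> real \<Rightarrow> projectors \<Rightarrow> (int \<Rightarrow> int \<Rightarrow> int) \<Rightarrow> (int \<Rightarrow> int \<Rightarrow> real) \<Rightarrow>
   (real \<Rightarrow> complex) \<Rightarrow> int \<times> int \<Rightarrow> real" where
  "Q_coef x k q P l \<xi> f = (\<lambda>(m, j). (x m (j + int k) - x m j) powr (- 1 / q) *
     Lq_norm q UNIV (\<lambda>t. b_coef x k P l \<xi> f m j * phi x k m j t))"

definition besov_Q ::
  "knots \<Rightarrow> nat \<Rightarrow> real \<Rightarrow> real \<Rightarrow> projectors \<Rightarrow> (int \<Rightarrow> int \<Rightarrow> int) \<Rightarrow> (int \<Rightarrow> int \<Rightarrow> real) \<Rightarrow>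
   (real \<Rightarrow> complex) set" where
  "besov_Q x k \<tau> q P l \<xi> =
     {f \<in> Lq_loc q. (\<lambda>i. Q_coef x k q P l \<xi> f i powr \<tau>) summable_on UNIV}"

definition besov_Q_norm ::
  "knots \<Rightarrow> nat \<Rightarrow> real \<Rightarrow> real \<Rightarrow> projectors \<Rightarrow> (int \<Rightarrow> int \<Rightarrow> int) \<Rightarrow> (int \<Rightarrow> int \<Rightarrow> real) \<Rightarrow>
   (real \<Rightarrow> complex) \<Rightarrow> real" where
  "besov_Q_norm x k \<tau> q P l \<xi> f = ell_norm \<tau> (Q_coef x k q P l \<xi> f)"

text \<open>
  The functionals above are only semi-(quasi-)norms.  The first two vanish
  exactly on the polynomials of degree at most \<open>k - 1\<close> (up to null sets), but
  the kernel of the third can be larger: if some point \<open>s\<close> is a knot of every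
  level (e.g. \<open>s = 0\<close> for the dyadic partition), the truncated power
  \<open>max 0 (t - s) ^ (k - 1)\<close> is a spline over every level, hence is reproduced by
  every \<open>T_op\<close>, and has norm zero; it does not belong to \<open>besov_E\<close>.  As usual
  for homogeneous spaces, elements of norm zero have to be identified.
\<close>

definition besov_Q_null ::
  "knots \<Rightarrow> nat \<Rightarrow> real \<Rightarrow> real \<Rightarrow> projectors \<Rightarrow> (int \<Rightarrow> int \<Rightarrow> int) \<Rightarrow> (int \<Rightarrow> int \<Rightarrow> real) \<Rightarrow>
   (real \<Rightarrow> complex) set" where
  "besov_Q_null x k \<tau> q P l \<xi> =
     {h \<in> besov_Q x k \<tau> q P l \<xi>. besov_Q_norm x k \<tau> q P l \<xi> h = 0}"

end

theory Submission
 imports Defs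
begin

text \<open>
 Both equivalences rest on one estimate: for coefficients in \<open>\<ell>\<^sup>\<tau>\<close>, a spline sum deviates on an interval
 \<open>J\<close> from a constant by a sum over the levels that decays geometrically in the distance from the
 level of \<open>J\<close>. It bounds \<open>\<omega>\<^sub>k\<close> through a discrete Hardy inequality and a Schur test, and it bounds the
 BMO norm. Conversely, by Whitney's inequality \<open>f\<close> is locally close to polynomials, so the spline
 coefficients \<open>b\<close> of \<open>T\<^sub>m f - T\<^sub>m\<^sub>-\<^sub>1 f\<close> are bounded by moduli of nearby intervals of the levels \<open>m\<close> and \<open>m - 1\<close>.
 Then \<open>T\<^sub>n f - T\<^sub>-\<^sub>n f\<close> is a partial sum, \<open>T\<^sub>n f\<close> tends to \<open>f\<close>, and \<open>T\<^sub>-\<^sub>n f\<close> is, on a fixed interval, close to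
 a polynomial, or, if only \<open>b \<in> \<ell>\<^sup>\<tau>\<close> is known, equal to a polynomial plus a multiple of a truncated
 power at a knot \<open>s\<close> common to all levels. The oscillation of the partial sums controls these
 polynomials up to constants, so they converge; the truncated power is what spans the null space
 modulo polynomials.
\<close>

section \<open>Local Lebesgue norms\<close>

text \<open>Two obstacles shape the argument. Under one coarse B-spline there lie unboundedly many
  fine intervals, so its contributions to the moduli could not be summed if all of them counted.
  They do not: a level without a knot in the interval of \<open>E_coef\<close> is there a polynomial
  of degree at most k-1, invisible to \<open>omega_k\<close>, and only boundedly many fine intervals
  are close to a given coarse knot. Secondly, convergence in BMO is an L^1 statement up to
  constants, whereas q is arbitrary. Instead of the John-Nirenberg inequality, uniform L^q bounds of
  the partial sums are passed to the limit by Fatou's lemma. All constants are built from k, q,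
  \<tau>, \<open>lam\<close>, \<open>M\<^sub>0\<close> and \<open>A\<close>, never from
  \<open>x\<close>, as the order of quantifiers in the theorem demands.\<close>

abbreviation cut :: "real set => (real => complex) => real => complex" where
 "cut S f x \<equiv> indicator S x *\<^sub>R f x"

lemma norm_mono_real: "0 <= x ==> x <= y ==> norm x <= norm (y::real)"
 by simp

text \<open>Convexity of u^q at x/A and y/B with weights A/(A+B) and B/(A+B). When A and B are the
  L^q norms of two functions, the bracket integrates to 1, which is Minkowski's inequality.\<close>

lemma powr_convex_split:
 fixes x y A B q :: real
 assumes q: "1 <= q" and "0 <= x" "0 <= y" "0 < A" "0 < B"
 shows "(x+y) powr q <= (A+B) powr q*(A/(A+B)*(x/A) powr q+B/(A+B)*(y/B) powr q)"
proof -
 have key: "((x+y)/(A+B)) powr q <= A/(A+B)*(x/A) powr q+B/(A+B)*(y/B) powr q"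
 \<comment> \<open>\<open>powr_convex\<close> lives on the open half-line, so vanishing arguments
   are treated separately.\<close>
 proof (cases "x = 0 \<or> y = 0")
  case False
  have frac: "1-A/(A+B) = B/(A+B)" "0 <= A/(A+B)" "A/(A+B) <= 1"
   using assms by (auto simp: field_simps)
  from False have "x/A \<in> {0<..}" "y/B \<in> {0<..}" using assms by auto
  hence "(B/(A+B)*(y/B)+A/(A+B)*(x/A)) powr q <=
    B/(A+B)*(y/B) powr q+A/(A+B)*(x/A) powr q"
   using convex_onD[OF powr_convex[OF q], of "A/(A+B)" "y/B" "x/A"] assms frac
   by simp
  moreover have "B/(A+B)*(y/B)+A/(A+B)*(x/A) = (x+y)/(A+B)"
   using assms by (simp add: add_divide_distrib)
  ultimately show ?thesis by (metis add.commute)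
 next
  case True
  have *: "(z/(A+B)) powr q <= C/(A+B)*(z/C) powr q"
   if "0 < C" "C < A+B" "0 <= z" for C z
  proof -
   have "(z/(A+B)) powr q = (C/(A+B)) powr q*(z/C) powr q"
    using that assms by (simp add: powr_mult[symmetric])
   also have "... <= (C/(A+B)) powr 1*(z/C) powr q"
    using that assms q by (intro mult_right_mono powr_mono') auto
   finally show ?thesis using that assms by simp
  qed
  show ?thesis using True *[of A x] *[of B y] assms by auto
 qed
 have "(x+y) powr q = (A+B) powr q*((x+y)/(A+B)) powr q"
  using assms by (simp add: powr_mult[symmetric])
 thus ?thesis using key by (metis mult_left_mono powr_ge_zero)
qed

lemma Minkowski_complex:
 fixes F G :: "'a => complex"
 assumes q: "1 <= q" and [measurable]: "F \<in> borel_measurable M" "G \<in> borel_measurable M"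
  and F: "integrable M (\<lambda>x. cmod (F x) powr q)" and G: "integrable M (\<lambda>x. cmod (G x) powr q)"
 shows "integrable M (\<lambda>x. cmod (F x+G x) powr q)"
  and "(LINT x|M. cmod (F x+G x) powr q) powr (1/q)
    <= (LINT x|M. cmod (F x) powr q) powr (1/q)+(LINT x|M. cmod (G x) powr q) powr (1/q)"
proof -
 let ?W = "\<lambda>A B x. (A+B) powr q*(A/(A+B)*(cmod (F x)/A) powr q+B/(A+B)*(cmod (G x)/B) powr q)"
 have W: "?W A B = (\<lambda>x. (A+B) powr q*(A/(A+B)/A powr q * cmod (F x) powr q+B/(A+B)/B powr q * cmod (G x) powr q))"
  if "A > 0" "B > 0" for A B using that by (auto simp: powr_divide fun_eq_iff)
 have bd: "cmod (F x+G x) powr q <= ?W A B x" if "A > 0" "B > 0" for A B x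
 proof -
  have "cmod (F x+G x) powr q <= (cmod (F x)+cmod (G x)) powr q"
   using q by (intro powr_mono2 norm_triangle_ineq) auto
  thus ?thesis using powr_convex_split[OF q _ _ that, of "cmod (F x)" "cmod (G x)"] by simp
 qed
 have int: "integrable M (?W A B)" if "A > 0" "B > 0" for A B
  unfolding W[OF that] using F G by auto
 show I: "integrable M (\<lambda>x. cmod (F x+G x) powr q)"
 proof (rule Bochner_Integration.integrable_bound[OF int[of 1 1]])
  show "AE x in M. norm (cmod (F x+G x) powr q) <= norm (?W 1 1 x)"
   by (rule AE_I2, rule norm_mono_real, simp, rule bd) auto
 qed auto
 define a where "a = (LINT x|M. cmod (F x) powr q) powr (1/q)"
 define b where "b = (LINT x|M. cmod (G x) powr q) powr (1/q)"
 have ab: "a \<ge> 0" "b \<ge> 0" "a powr q = (LINT x|M. cmod (F x) powr q)" "b powr q = (LINT x|M. cmod (G x) powr q)"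
  using q by (auto simp: a_def b_def powr_powr)
 have "(LINT x|M. cmod (F x+G x) powr q) powr (1/q) <= a+b+e" if "e > 0" for e
 proof -
  \<comment> \<open>The shift by e/2 keeps both weights positive when a norm vanishes.\<close>
  let ?A = "a+e/2" and ?B = "b+e/2"
  have p: "?A > 0" "?B > 0" using ab that by auto
  have "(LINT x|M. cmod (F x+G x) powr q) <= (LINT x|M. ?W ?A ?B x)"
   using bd[OF p] by (intro integral_mono I int p)
  also have "... = (?A+?B) powr q*(?A/(?A+?B)*(a powr q/?A powr q)+?B/(?A+?B)*(b powr q/?B powr q))"
   unfolding W[OF p] using F G ab by (simp add: mult.commute)
  also have "... <= (?A+?B) powr q*(?A/(?A+?B)*1+?B/(?A+?B)*1)"
  proof -
   have "a powr q <= ?A powr q" "b powr q <= ?B powr q" using ab(1,2) that q by (auto intro!: powr_mono2)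
   hence "a powr q/?A powr q <= 1" "b powr q/?B powr q <= 1" using p by (auto simp: divide_le_eq)
   thus ?thesis using p by (intro mult_left_mono add_mono) auto
  qed
  also have "... = (?A+?B) powr q" using p by (simp add: add_divide_distrib[symmetric])
  finally have "(LINT x|M. cmod (F x+G x) powr q) powr (1/q) <= ((?A+?B) powr q) powr (1/q)"
   using q by (intro powr_mono2) auto
  also have "... = ?A+?B" using p q by (simp add: powr_powr)
  finally show ?thesis by (simp add: algebra_simps)
 qed
 thus "(LINT x|M. cmod (F x+G x) powr q) powr (1/q)
    <= (LINT x|M. cmod (F x) powr q) powr (1/q)+(LINT x|M. cmod (G x) powr q) powr (1/q)"
  unfolding a_def b_def by (rule field_le_epsilon)
qed

lemma cmod_indicator_powr:
 "cmod (cut S f x) powr q = indicator S x *\<^sub>R (cmod (f x) powr q)"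
 by (cases "x \<in> S") auto

lemma Lq_iff:
 "f \<in> Lq q S \<longleftrightarrow> (\<lambda>x. cut S f x) \<in> borel_measurable lebesgue \<and>
   integrable lebesgue (\<lambda>x. cmod (cut S f x) powr q)"
 unfolding Lq_def set_borel_measurable_def set_integrable_def cmod_indicator_powr by simp

lemma Lq_norm_eq:
 "Lq_norm q S f = (LINT x|lebesgue. cmod (cut S f x) powr q) powr (1/q)"
 unfolding Lq_norm_def set_lebesgue_integral_def cmod_indicator_powr by simp

lemma Lq_norm_nonneg [simp]: "0 <= Lq_norm q S f"
 by (simp add: Lq_norm_def)

lemma Lq_cong: "(\<And>t. t \<in> S ==> f t = g t) ==> f \<in> Lq q S \<longleftrightarrow> g \<in> Lq q S"
proof -
 assume "\<And>t. t \<in> S ==> f t = g t"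
 hence "(\<lambda>x. cut S f x) = (\<lambda>x. cut S g x)"
  by (auto simp: indicator_def of_bool_def fun_eq_iff)
 hence "\<And>x. cut S f x = cut S g x" by meson
 thus ?thesis unfolding Lq_iff by presburger
qed

lemma Lq_norm_cong: "(\<And>t. t \<in> S ==> f t = g t) ==> Lq_norm q S f = Lq_norm q S g"
proof -
 assume "\<And>t. t \<in> S ==> f t = g t"
 hence "(\<lambda>x. cut S f x) = (\<lambda>x. cut S g x)"
  by (auto simp: indicator_def of_bool_def fun_eq_iff)
 hence "\<And>x. cut S f x = cut S g x" by meson
 thus ?thesis unfolding Lq_norm_eq by presburger
qed

lemma Lq_AE_cong:
 assumes "AE t in lebesgue. t \<in> S --> f t = g t" and f: "f \<in> Lq q S"
 shows "g \<in> Lq q S" "Lq_norm q S g = Lq_norm q S f"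
proof -
 define F where "F = (\<lambda>x. cut S f x)"
 define G where "G = (\<lambda>x. cut S g x)"
 have "F x = G x" if "x \<in> S --> f x = g x" for x using that by (cases "x \<in> S") (simp_all add: F_def G_def)
 hence ae: "AE x in lebesgue. F x = G x"
  using assms(1) by (auto elim: eventually_mono)
 have F[measurable]: "F \<in> borel_measurable lebesgue" and iF: "integrable lebesgue (\<lambda>x. cmod (F x) powr q)"
  using f unfolding Lq_iff F_def by blast+
 have G[measurable]: "G \<in> borel_measurable lebesgue" by (rule borel_measurable_AE[OF F ae])
 have ae': "AE x in lebesgue. cmod (F x) powr q = cmod (G x) powr q"
  using ae by (rule eventually_mono) simp
 have "integrable lebesgue (\<lambda>x. cmod (G x) powr q)"
  by (rule integrable_cong_AE_imp[OF iF _ ae']) measurable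
 thus "g \<in> Lq q S" using G unfolding Lq_iff G_def by blast
 have "(LINT x|lebesgue. cmod (F x) powr q) = (LINT x|lebesgue. cmod (G x) powr q)"
  by (rule integral_cong_AE[OF _ _ ae']) measurable
 thus "Lq_norm q S g = Lq_norm q S f"
  unfolding Lq_norm_eq F_def G_def by simp
qed

lemma Lq_add:
 assumes "1 <= q" "f \<in> Lq q S" "g \<in> Lq q S"
 shows "(\<lambda>t. f t+g t) \<in> Lq q S" "Lq_norm q S (\<lambda>t. f t+g t) <= Lq_norm q S f+Lq_norm q S g"
 using Minkowski_complex[OF assms(1), of "\<lambda>x. cut S f x" lebesgue "\<lambda>x. cut S g x"] assms(2,3)
 by (auto simp: Lq_iff Lq_norm_eq scaleR_add_right)

lemma Lq_cmult:
 assumes "1 <= q" "f \<in> Lq q S"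
 shows "(\<lambda>t. c * f t) \<in> Lq q S" "Lq_norm q S (\<lambda>t. c * f t) = cmod c * Lq_norm q S f"
proof -
 have eq: "cmod (indicator S x *\<^sub>R (c * f x)) powr q = cmod c powr q * cmod (cut S f x) powr q" for x
  by (simp add: norm_mult powr_mult mult_ac)
 have m: "(\<lambda>x. indicator S x *\<^sub>R (c * f x)) \<in> borel_measurable lebesgue"
 proof -
  have [measurable]: "(\<lambda>x. cut S f x) \<in> borel_measurable lebesgue" using assms by (simp add: Lq_iff)
  have "(\<lambda>x. c*(cut S f x)) \<in> borel_measurable lebesgue" by measurable
  thus ?thesis by simp
 qed
 thus "(\<lambda>t. c * f t) \<in> Lq q S" using assms unfolding Lq_iff eq by auto
 show "Lq_norm q S (\<lambda>t. c * f t) = cmod c * Lq_norm q S f"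
  unfolding Lq_norm_eq eq using assms by (simp add: powr_mult powr_powr)
qed

lemma Lq_uminus:
 assumes "1 <= q" "f \<in> Lq q S"
 shows "(\<lambda>t. - f t) \<in> Lq q S" "Lq_norm q S (\<lambda>t. - f t) = Lq_norm q S f"
 using Lq_cmult[OF assms, of "-1"] by auto

lemma Lq_diff:
 assumes "1 <= q" "f \<in> Lq q S" "g \<in> Lq q S"
 shows "(\<lambda>t. f t-g t) \<in> Lq q S" "Lq_norm q S (\<lambda>t. f t-g t) <= Lq_norm q S f+Lq_norm q S g"
 using Lq_add[OF assms(1,2) Lq_uminus(1)[OF assms(1,3)]] Lq_uminus(2)[OF assms(1,3)] by auto

lemma Lq_zero [simp]: "1 <= q ==> (\<lambda>t. 0) \<in> Lq q S" "1 <= q ==> Lq_norm q S (\<lambda>t. 0) = 0"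
 by (auto simp: Lq_iff Lq_norm_eq)

lemma Lq_sum:
 assumes "1 <= q" "\<And>i. i \<in> A ==> f i \<in> Lq q S"
 shows "(\<lambda>t. \<Sum>i\<in>A. f i t) \<in> Lq q S" "Lq_norm q S (\<lambda>t. \<Sum>i\<in>A. f i t) <= (\<Sum>i\<in>A. Lq_norm q S (f i))"
proof -
 have "(\<lambda>t. \<Sum>i\<in>A. f i t) \<in> Lq q S \<and> Lq_norm q S (\<lambda>t. \<Sum>i\<in>A. f i t) <= (\<Sum>i\<in>A. Lq_norm q S (f i))"
  using assms
 proof (induction A rule: infinite_finite_induct)
  case (insert x F)
  hence "f x \<in> Lq q S" "(\<lambda>t. \<Sum>i\<in>F. f i t) \<in> Lq q S" by auto
  from Lq_add[OF assms(1) this] insert show ?case by fastforce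
 qed auto
 thus "(\<lambda>t. \<Sum>i\<in>A. f i t) \<in> Lq q S" "Lq_norm q S (\<lambda>t. \<Sum>i\<in>A. f i t) <= (\<Sum>i\<in>A. Lq_norm q S (f i))"
  by auto
qed

lemma Lq_subset:
 assumes "1 <= q" "f \<in> Lq q S" "T \<subseteq> S" "T \<in> sets lebesgue"
 shows "f \<in> Lq q T" "Lq_norm q T f <= Lq_norm q S f"
proof -
 have eq: "cut T f x = indicator T x *\<^sub>R (cut S f x)" for x
  using assms(3) by (auto simp: indicator_def)
 have [measurable]: "(\<lambda>x. cut S f x) \<in> borel_measurable lebesgue" "T \<in> sets lebesgue"
  using assms by (auto simp: Lq_iff)
 have m[measurable]: "(\<lambda>x. cut T f x) \<in> borel_measurable lebesgue"
  unfolding eq by measurable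
 have le: "cmod (cut T f x) powr q <= cmod (cut S f x) powr q" for x
  using assms(3) by (auto simp: indicator_def)
 have i: "integrable lebesgue (\<lambda>x. cmod (cut T f x) powr q)"
 proof (rule Bochner_Integration.integrable_bound[of _ "\<lambda>x. cmod (cut S f x) powr q"])
  show "(\<lambda>x. cmod (cut T f x) powr q) \<in> borel_measurable lebesgue" by measurable
  show "AE x in lebesgue. norm (cmod (cut T f x) powr q) <= norm (cmod (cut S f x) powr q)"
   by (rule AE_I2, rule norm_mono_real, simp, rule le)
 qed (use assms in \<open>auto simp: Lq_iff\<close>)
 show "f \<in> Lq q T" using m i by (simp add: Lq_iff)
 show "Lq_norm q T f <= Lq_norm q S f"
  unfolding Lq_norm_eq using assms
  by (intro powr_mono2 integral_mono i le) (auto simp: Lq_iff)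
qed

lemma Lq_bounded:
 assumes "1 <= q" "a <= b" "set_borel_measurable lebesgue {a..b} f" "\<And>t. t \<in> {a..b} ==> cmod (f t) <= B"
 shows "f \<in> Lq q {a..b}" "Lq_norm q {a..b} f <= B*(b-a) powr (1/q)"
proof -
 let ?I = "indicator {a..b} :: real => real"
 have B0: "0 <= B" using assms(2) assms(4)[of a] by (metis atLeastAtMost_iff norm_ge_zero order.refl order.trans)
 have m[measurable]: "(\<lambda>x. ?I x *\<^sub>R f x) \<in> borel_measurable lebesgue"
  using assms(3) by (simp add: set_borel_measurable_def)
 have le: "cmod (?I x *\<^sub>R f x) powr q <= B powr q*?I x" for x
  using assms(1,4) B0 by (auto simp: indicator_def intro!: powr_mono2)
 have iI: "integrable lebesgue (\<lambda>x. B powr q*?I x)"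
  by (intro integrable_mult_right) (auto simp: integrable_indicator_iff emeasure_lborel_Icc_eq)
 have i: "integrable lebesgue (\<lambda>x. cmod (?I x *\<^sub>R f x) powr q)"
 proof (rule Bochner_Integration.integrable_bound[OF iI])
  show "(\<lambda>x. cmod (?I x *\<^sub>R f x) powr q) \<in> borel_measurable lebesgue" by measurable
  show "AE x in lebesgue. norm (cmod (?I x *\<^sub>R f x) powr q) <= norm (B powr q*?I x)"
   by (rule AE_I2, rule norm_mono_real, simp, rule le)
 qed
 show "f \<in> Lq q {a..b}" using m i by (simp add: Lq_iff)
 have "(LINT x|lebesgue. cmod (?I x *\<^sub>R f x) powr q) <= (LINT x|lebesgue. B powr q*?I x)"
  by (intro integral_mono i iI le)
 also have "... = B powr q*(b-a)" using assms(2) by simp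
 finally have "Lq_norm q {a..b} f <= (B powr q*(b-a)) powr (1/q)"
  unfolding Lq_norm_eq using assms(1) by (intro powr_mono2) auto
 thus "Lq_norm q {a..b} f <= B*(b-a) powr (1/q)"
  using assms(1,2) B0 by (simp add: powr_mult powr_powr)
qed

lemma Lq_empty: "1 <= q ==> f \<in> Lq q {}" "1 <= q ==> Lq_norm q {} f = 0"
 by (auto simp: Lq_iff Lq_norm_eq)

lemma continuous_on_Lq:
 assumes "1 <= q" "continuous_on {a..b} f"
 shows "f \<in> Lq q {a..b}"
proof (cases "a <= b")
 case True
 have "compact (f ` {a..b})" using assms by (intro compact_continuous_image) auto
 then obtain B where "\<forall>t\<in>{a..b}. cmod (f t) <= B" by (auto dest!: compact_imp_bounded simp: bounded_iff)
 moreover have "set_borel_measurable lebesgue {a..b} f"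
  using assms(2) borel_measurable_continuous_on_indicator[of "{a..b}" f] unfolding set_borel_measurable_def
  by (auto intro: measurable_completion)
 ultimately show ?thesis using Lq_bounded(1)[OF assms(1) True] by blast
qed (use assms Lq_empty in auto)

lemma continuous_on_poly_fun: "continuous_on S (poly_fun p)"
 unfolding poly_fun_def by (intro continuous_intros)

lemma poly_fun_Lq [simp]: "1 <= q ==> poly_fun p \<in> Lq q {a..b}"
 by (intro continuous_on_Lq continuous_on_poly_fun)

text \<open>Normalized so that a constant has mean equal to its modulus on every interval. Estimates
  in terms of \<open>mn\<close> are invariant under translation and dilation.\<close>

definition mn :: "real => real => real => (real => complex) => real" where
 "mn q a b f = (b-a) powr (- 1/q) * Lq_norm q {a..b} f"

abbreviation "resid f p \<equiv> \<lambda>t. f t-poly_fun p t"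

lemma mn_nonneg [simp]: "0 <= mn q a b f" by (simp add: mn_def)

lemma mn_cong: "(\<And>t. a <= t ==> t <= b ==> f t = g t) ==> mn q a b f = mn q a b g"
 unfolding mn_def by (subst Lq_norm_cong[of _ f g]) auto

lemma mn_add: "1 <= q ==> f \<in> Lq q {a..b} ==> g \<in> Lq q {a..b} ==>
  mn q a b (\<lambda>t. f t+g t) <= mn q a b f+mn q a b g"
 unfolding mn_def using Lq_add(2)[of q f "{a..b}" g] by (simp add: distrib_left[symmetric] mult_left_mono)

lemma mn_diff: "1 <= q ==> f \<in> Lq q {a..b} ==> g \<in> Lq q {a..b} ==>
  mn q a b (\<lambda>t. f t-g t) <= mn q a b f+mn q a b g"
 unfolding mn_def using Lq_diff(2)[of q f "{a..b}" g] by (simp add: distrib_left[symmetric] mult_left_mono)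

lemma mn_cmult: "1 <= q ==> f \<in> Lq q {a..b} ==> mn q a b (\<lambda>t. c * f t) = cmod c * mn q a b f"
 unfolding mn_def by (simp add: Lq_cmult)

lemma mn_minus_commute: "mn q a b (\<lambda>t. f t-g t) = mn q a b (\<lambda>t. g t-f t)"
 unfolding mn_def Lq_norm_def by (simp add: norm_minus_commute)

lemma mn_sum: "1 <= q ==> (\<And>i. i \<in> A ==> f i \<in> Lq q {a..b}) ==>
  mn q a b (\<lambda>t. \<Sum>i\<in>A. f i t) <= (\<Sum>i\<in>A. mn q a b (f i))"
 unfolding mn_def using Lq_sum(2)[of q A f "{a..b}"] by (simp add: sum_distrib_left[symmetric] mult_left_mono)

lemma mn_bounded:
 assumes "1 <= q" "a < b" "set_borel_measurable lebesgue {a..b} f" "\<And>t. t \<in> {a..b} ==> cmod (f t) <= B"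
 shows "mn q a b f <= B"
proof -
 have "mn q a b f <= (b-a) powr (- 1/q)*(B*(b-a) powr (1/q))"
  unfolding mn_def using assms by (intro mult_left_mono Lq_bounded(2)) auto
 also have "... = B*((b-a) powr (- 1/q)*(b-a) powr (1/q))" by simp
 also have "... = B" using assms(1,2) by (subst powr_add[symmetric]) simp
 finally show ?thesis .
qed

lemma mn_const:
 assumes "1 <= q" "a < b" shows "mn q a b (\<lambda>t. c) = cmod c"
proof -
 have "(LINT t:{a..b}|lebesgue. cmod c powr q) = cmod c powr q*(b-a)"
  using assms by (simp add: set_lebesgue_integral_def mult.commute right_diff_distrib)
 hence "Lq_norm q {a..b} (\<lambda>t. c) = cmod c*(b-a) powr (1/q)"
  unfolding Lq_norm_def using assms by (simp only: powr_mult) (simp add: powr_mult powr_powr)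
 thus ?thesis unfolding mn_def using assms
  by (simp add: powr_minus)
qed

lemma Lq_norm_mn: "a < b ==> 1 <= q ==> Lq_norm q {a..b} f = (b-a) powr (1/q) * mn q a b f"
 by (simp add: mn_def powr_minus)

text \<open>Passing to a subinterval costs the ratio of the lengths to the power 1/q; since this
  ratio is at least 1, the exponent is dropped and the constants stay free of q.\<close>

lemma mn_mono:
 assumes "1 <= q" "f \<in> Lq q {c..d}" "c <= a" "a < b" "b <= d" "d-c <= K*(b-a)"
 shows "f \<in> Lq q {a..b}" "mn q a b f <= K * mn q c d f"
proof -
 show f: "f \<in> Lq q {a..b}" using assms by (intro Lq_subset(1)[OF assms(1,2)]) auto
 have K: "1 <= K"
 proof (rule ccontr)
  assume "\<not> 1 <= K"
  hence "K*(b-a) < 1*(b-a)" using assms(4) by (intro mult_strict_right_mono) auto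
  hence "K*(b-a) < b-a" by simp
  thus False using assms(3-6) by linarith
 qed
 have "mn q a b f <= (b-a) powr (- 1/q) * Lq_norm q {c..d} f"
  unfolding mn_def using assms by (intro mult_left_mono Lq_subset(2)) auto
 also have "... = (b-a) powr (- 1/q)*(d-c) powr (1/q) * mn q c d f"
  using assms by (simp add: Lq_norm_mn)
 also have "(b-a) powr (- 1/q)*(d-c) powr (1/q) = ((d-c)/(b-a)) powr (1/q)"
  using assms by (simp add: powr_divide powr_minus_divide)
 also have "... <= K powr (1/q)" using assms by (intro powr_mono2) (auto simp: field_simps)
 also have "... <= K powr 1" using assms K by (intro powr_mono) auto
 finally show "mn q a b f <= K * mn q c d f" using K by (simp add: mult_right_mono)
qed

text \<open>Hoelder's inequality between the exponents 1 and q: Young's inequality with a free scale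
  \<open>c\<close> is integrated, and \<open>c\<close> is taken just above the L^q mean.\<close>

lemma Lq_integrable_norm:
 assumes q: "1 <= q" and f: "f \<in> Lq q {a..b}"
 shows "f \<in> Lq 1 {a..b}" "a < b ==> mn 1 a b f <= mn q a b f"
proof -
 let ?F = "\<lambda>x. cut {a..b} f x" and ?I = "indicator {a..b} :: real => real"
 let ?G = "\<lambda>c x. c powr (1-q)/q * cmod (?F x) powr q+c*(1-1/q)*?I x"
 have pw: "cmod (?F x) powr 1 <= ?G c x" if c: "0 < c" for c x
 proof (cases "x \<in> {a..b} \<and> f x \<noteq> 0")
  case True
  have "(cmod (f x) powr q * c powr (1-q)) powr (1/q) * c powr (1-1/q)
   <= 1/q*(cmod (f x) powr q * c powr (1-q))+(1-1/q) * c"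
   using q c True by (intro Youngs_inequality_0) auto
  also have "(cmod (f x) powr q * c powr (1-q)) powr (1/q) * c powr (1-1/q) = cmod (f x)*(c powr ((1-q)/q) * c powr (1-1/q))"
   using q c by (simp add: powr_mult powr_powr)
  also have "c powr ((1-q)/q) * c powr (1-1/q) = 1" using q c by (simp add: powr_add[symmetric] diff_divide_distrib)
  finally show ?thesis using True by (simp add: mult_ac)
 next
  case False
  hence z: "?F x = 0" by auto
  have "0 <= c*(1-1/q)*?I x" using q c by (intro mult_nonneg_nonneg) auto
  thus ?thesis unfolding z by simp
 qed
 have iq: "integrable lebesgue (\<lambda>x. cmod (?F x) powr q)" using f unfolding Lq_iff by (rule conjunct2)
 have iI: "integrable lebesgue ?I" by (auto simp: integrable_indicator_iff emeasure_lborel_Icc_eq)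
 have iG: "integrable lebesgue (?G c)" for c
  by (intro Bochner_Integration.integrable_add integrable_mult_right iq iI)
 have m[measurable]: "?F \<in> borel_measurable lebesgue" using f unfolding Lq_iff by (rule conjunct1)
 have i1: "integrable lebesgue (\<lambda>x. cmod (?F x) powr 1)"
 proof (rule Bochner_Integration.integrable_bound[OF iG[of 1]])
  show "AE x in lebesgue. norm (cmod (?F x) powr 1) <= norm (?G 1 x)"
   by (rule AE_I2, rule norm_mono_real) (use pw[of 1] in auto)
 qed measurable
 thus "f \<in> Lq 1 {a..b}" unfolding Lq_iff using m by blast
 assume ab: "a < b"
 show "mn 1 a b f <= mn q a b f"
 proof (rule field_le_epsilon)
  fix e :: real assume e: "e > 0"
  define c where "c = mn q a b f+e"
  have c: "c > 0" "mn q a b f <= c" using e by (auto simp: c_def intro: add_nonneg_pos)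
  have "(LINT x|lebesgue. cmod (?F x) powr 1) <= (LINT x|lebesgue. ?G c x)"
   by (intro integral_mono i1 iG pw c)
  also have "... = c powr (1-q)/q*(LINT x|lebesgue. cmod (?F x) powr q)+c*(1-1/q)*(b-a)"
   using ab iq iI by (subst Bochner_Integration.integral_add) simp_all
  also have "(LINT x|lebesgue. cmod (?F x) powr q) = Lq_norm q {a..b} f powr q"
   unfolding Lq_norm_eq using q by (simp add: powr_powr)
  also have "... = (b-a) * mn q a b f powr q"
   unfolding Lq_norm_mn[OF ab q] using ab q by (simp add: powr_mult powr_powr)
  also have "c powr (1-q)/q*((b-a) * mn q a b f powr q) <= c powr (1-q)/q*((b-a) * c powr q)"
   using ab q c by (intro mult_left_mono powr_mono2) auto
  also have "c powr (1-q)/q*((b-a) * c powr q) = c/q*(b-a)"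
   using c(1) by (simp add: powr_diff)
  finally have "Lq_norm 1 {a..b} f <= c*(b-a)" unfolding Lq_norm_eq by (simp add: algebra_simps)
  thus "mn 1 a b f <= mn q a b f+e"
   unfolding c_def[symmetric] mn_def[of 1] using ab by (simp add: powr_minus_divide divide_le_eq)
 qed
qed

lemma Lq_integrable: "f \<in> Lq q S ==> integrable lebesgue (\<lambda>x. cmod (cut S f x) powr q)"
 unfolding Lq_iff by (rule conjunct2)

lemma Lq_measurable: "f \<in> Lq q S ==> (\<lambda>x. cut S f x) \<in> borel_measurable lebesgue"
 unfolding Lq_iff by (rule conjunct1)

lemma Lq_norm_powr: "1 <= q ==> Lq_norm q S f powr q = (LINT x|lebesgue. cmod (cut S f x) powr q)"
 unfolding Lq_norm_eq by (simp add: powr_powr)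

lemma Lq_norm_leI:
 assumes "1 <= q" "0 <= B" "(LINT x|lebesgue. cmod (cut S f x) powr q) <= B powr q"
 shows "Lq_norm q S f <= B"
proof -
 have "Lq_norm q S f <= (B powr q) powr (1/q)"
  unfolding Lq_norm_eq using assms by (intro powr_mono2) auto
 thus ?thesis using assms by (simp add: powr_powr)
qed

text \<open>L^1 convergence yields an almost everywhere convergent subsequence, and Fatou's lemma
  passes the L^q bound to the limit. This is how information given only in BMO reaches L^q.\<close>

lemma Lq_Fatou:
 assumes q: "1 <= q" and ab: "a < b" and u: "\<And>n. u n \<in> Lq q {a..b}" "\<And>n. mn q a b (u n) <= B"
  and f: "f \<in> Lq 1 {a..b}" and lim: "(\<lambda>n. mn 1 a b (\<lambda>t. u n t-f t)) \<longlonglongrightarrow> 0"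
 shows "f \<in> Lq q {a..b}" "mn q a b f <= B"
proof -
 define F where "F = (\<lambda>x. cut {a..b} f x)"
 define U where "U n = (\<lambda>x. indicator {a..b} x *\<^sub>R u n x)" for n
 have Fm: "F \<in> borel_measurable lebesgue" using Lq_measurable[OF f] by (simp add: F_def)
 have Um: "U n \<in> borel_measurable lebesgue" for n using Lq_measurable[OF u(1)[of n]] by (simp add: U_def)
 note [measurable] = Fm Um
 have B: "0 <= B" using u(2)[of 0] mn_nonneg order_trans by blast
 have d1: "(\<lambda>t. u n t-f t) \<in> Lq 1 {a..b}" for n
  by (rule Lq_diff(1)[OF _ Lq_integrable_norm(1)[OF q u(1)] f]) simp
 have UF: "indicator {a..b} x *\<^sub>R (u n x-f x) = U n x-F x" for n x
  by (simp add: U_def F_def scaleR_diff_right)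
 have int: "integrable lebesgue (\<lambda>x. cmod (U n x-F x) powr 1)" for n
  using Lq_integrable[OF d1[of n]] by (simp only: UF)
 hence int': "integrable lebesgue (\<lambda>x. U n x-F x)" for n
  by (subst integrable_norm_iff[symmetric]) auto
 have "(\<lambda>n. (b-a) * mn 1 a b (\<lambda>t. u n t-f t)) \<longlonglongrightarrow> 0"
  using tendsto_mult_left[OF lim, of "b-a"] by simp
 moreover have "(b-a) * mn 1 a b (\<lambda>t. u n t-f t) = (LINT x|lebesgue. norm (U n x-F x))" for n
 proof -
  have "Lq_norm 1 {a..b} (\<lambda>t. u n t-f t) = (LINT x|lebesgue. cmod (U n x-F x) powr 1)"
   unfolding Lq_norm_eq UF by simp
  moreover have "Lq_norm 1 {a..b} (\<lambda>t. u n t-f t) = (b-a) * mn 1 a b (\<lambda>t. u n t-f t)"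
   using Lq_norm_mn[OF ab, of 1] ab by simp
  ultimately show ?thesis by simp
 qed
 ultimately have "(\<lambda>n. (LINT x|lebesgue. norm (U n x-F x))) \<longlonglongrightarrow> 0" by simp
 from tendsto_L1_AE_subseq[OF int' this] obtain r :: "nat => nat"
  where r: "strict_mono r" "AE x in lebesgue. (\<lambda>n. U (r n) x-F x) \<longlonglongrightarrow> 0" by blast
 have lim2: "(\<lambda>n. ennreal (cmod (U (r n) x) powr q)) \<longlonglongrightarrow> ennreal (cmod (F x) powr q)"
  if "(\<lambda>n. U (r n) x-F x) \<longlonglongrightarrow> 0" for x
 proof -
  have "(\<lambda>n. U (r n) x) \<longlonglongrightarrow> F x" using that by (rule LIM_zero_cancel)
  hence "(\<lambda>n. cmod (U (r n) x)) \<longlonglongrightarrow> cmod (F x)" by (rule tendsto_norm)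
  hence "(\<lambda>n. cmod (U (r n) x) powr q) \<longlonglongrightarrow> cmod (F x) powr q"
   using q by (intro tendsto_powr') auto
  thus ?thesis by (rule tendsto_ennrealI)
 qed
 let ?K = "ennreal (B powr q*(b-a))"
 have le: "(\<integral>\<^sup>+x. ennreal (cmod (U n x) powr q) \<partial>lebesgue) <= ?K" for n
 proof -
  have "(\<integral>\<^sup>+x. ennreal (cmod (U n x) powr q) \<partial>lebesgue) = ennreal (LINT x|lebesgue. cmod (U n x) powr q)"
   using Lq_integrable[OF u(1)[of n]] by (intro nn_integral_eq_integral) (auto simp: U_def)
  also have "(LINT x|lebesgue. cmod (U n x) powr q) = Lq_norm q {a..b} (u n) powr q"
   using Lq_norm_powr[OF q, of "{a..b}" "u n"] by (simp add: U_def)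
  also have "... = mn q a b (u n) powr q*(b-a)"
   unfolding Lq_norm_mn[OF ab q] using ab q by (simp add: powr_mult powr_powr)
  also have "... <= B powr q*(b-a)"
   using u(2)[of n] ab q by (intro mult_right_mono powr_mono2) auto
  finally show ?thesis by (simp add: ennreal_leI)
 qed
 have "(\<integral>\<^sup>+x. ennreal (cmod (F x) powr q) \<partial>lebesgue) <= (\<integral>\<^sup>+x. liminf (\<lambda>n. ennreal (cmod (U (r n) x) powr q)) \<partial>lebesgue)"
 proof (rule nn_integral_mono_AE)
  show "AE x in lebesgue. ennreal (cmod (F x) powr q) <= liminf (\<lambda>n. ennreal (cmod (U (r n) x) powr q))"
   using r(2) by (rule eventually_mono) (simp add: lim_imp_Liminf[OF _ lim2])
 qed
 also have "... <= liminf (\<lambda>n. \<integral>\<^sup>+x. ennreal (cmod (U (r n) x) powr q) \<partial>lebesgue)"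
  by (rule nn_integral_liminf) measurable
 also have "... <= liminf (\<lambda>n. ?K)"
  by (rule Liminf_mono) (simp add: le)
 also have "... = ?K" by (rule Liminf_const) simp
 finally have K: "(\<integral>\<^sup>+x. ennreal (cmod (F x) powr q) \<partial>lebesgue) <= ?K" .
 have iF: "integrable lebesgue (\<lambda>x. cmod (F x) powr q)"
 proof (rule integrableI_bounded)
  show "(\<lambda>x. cmod (F x) powr q) \<in> borel_measurable lebesgue" by measurable
  have "(\<integral>\<^sup>+x. ennreal (norm (cmod (F x) powr q)) \<partial>lebesgue) <= ?K" using K by simp
  thus "(\<integral>\<^sup>+x. ennreal (norm (cmod (F x) powr q)) \<partial>lebesgue) < \<infinity>"
   by (rule le_less_trans) simp
 qed
 thus "f \<in> Lq q {a..b}" using Fm unfolding Lq_iff F_def by blast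
 have "ennreal (LINT x|lebesgue. cmod (F x) powr q) <= ?K"
  using K nn_integral_eq_integral[OF iF] by simp
 hence "(LINT x|lebesgue. cmod (F x) powr q) <= B powr q*(b-a)"
  using ab by (subst (asm) ennreal_le_iff) auto
 also have "... = (B*(b-a) powr (1/q)) powr q" using ab B q by (simp add: powr_mult powr_powr)
 finally have "Lq_norm q {a..b} f <= B*(b-a) powr (1/q)"
  using B q by (intro Lq_norm_leI) (auto simp: F_def)
 hence "mn q a b f <= (b-a) powr (- 1/q)*(B*(b-a) powr (1/q))"
  unfolding mn_def by (intro mult_left_mono) auto
 also have "... = B" using ab by (simp add: powr_minus)
 finally show "mn q a b f <= B" .
qed

lemma Lq_affine:
 assumes q: "1 <= q" and c: "c > 0" and f: "f \<in> Lq q {s+c * a..s+c * b}"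
 shows "(\<lambda>t. f (s+c * t)) \<in> Lq q {a..b}" "mn q a b (\<lambda>t. f (s+c * t)) = mn q (s+c * a) (s+c * b) f"
proof -
 define F where "F = (\<lambda>x. cut {s+c * a..s+c * b} f x)"
 have ind: "indicator {a..b} x *\<^sub>R f (s+c * x) = F (s+c * x)" for x
  using c by (simp add: F_def indicator_def)
 have Fm[measurable]: "F \<in> borel_measurable lebesgue" using Lq_measurable[OF f] by (simp add: F_def)
 have "(\<lambda>x. s+c * x) \<in> lebesgue \<rightarrow>\<^sub>M lebesgue"
  using lebesgue_affine_measurable[where c= "\<lambda>x::real. c" and t=s] c by simp
 hence m: "(\<lambda>x. F (s+c * x)) \<in> borel_measurable lebesgue"
  by (rule measurable_compose) (rule Fm)
 have iF: "integrable lebesgue (\<lambda>x. cmod (F x) powr q)" using Lq_integrable[OF f] by (simp add: F_def)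
 have "integrable lebesgue (\<lambda>x. cmod (F (s+c * x)) powr q)"
  using lebesgue_integrable_real_affine[OF iF, of c s] c by simp
 thus "(\<lambda>t. f (s+c * t)) \<in> Lq q {a..b}" unfolding Lq_iff ind using m by blast
 have eq: "(LINT x|lebesgue. cmod (F x) powr q) = c*(LINT x|lebesgue. cmod (F (s+c * x)) powr q)"
  using lebesgue_integral_real_affine[of c "\<lambda>x. cmod (F x) powr q" s] c by simp
 have "Lq_norm q {s+c * a..s+c * b} f = (c*(LINT x|lebesgue. cmod (F (s+c * x)) powr q)) powr (1/q)"
  unfolding Lq_norm_eq eq[symmetric] by (simp add: F_def)
 also have "... = c powr (1/q) * Lq_norm q {a..b} (\<lambda>t. f (s+c * t))"
  unfolding Lq_norm_eq ind using c by (simp add: powr_mult)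
 finally have N: "Lq_norm q {s+c * a..s+c * b} f = c powr (1/q) * Lq_norm q {a..b} (\<lambda>t. f (s+c * t))" .
 have "(s+c * b)-(s+c * a) = c*(b-a)" by (simp add: algebra_simps)
 hence "((s+c * b)-(s+c * a)) powr (- 1/q) = c powr (- 1/q)*(b-a) powr (- 1/q)"
  using c by (simp add: powr_mult)
 thus "mn q a b (\<lambda>t. f (s+c * t)) = mn q (s+c * a) (s+c * b) f"
  unfolding mn_def N using c by (simp add: powr_minus)
qed

lemma Lq_shift:
 assumes q: "1 <= q" and f: "f \<in> Lq q {a+s..b+s}"
 shows "(\<lambda>t. f (t+s)) \<in> Lq q {a..b}" "mn q a b (\<lambda>t. f (t+s)) = mn q (a+s) (b+s) f"
  "Lq_norm q {a..b} (\<lambda>t. f (t+s)) = Lq_norm q {a+s..b+s} f"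
proof -
 have f': "f \<in> Lq q {s+1 * a..s+1 * b}" using f by (simp add: add.commute)
 show 1: "(\<lambda>t. f (t+s)) \<in> Lq q {a..b}" using Lq_affine(1)[OF q _ f'] by (simp add: add.commute)
 show 2: "mn q a b (\<lambda>t. f (t+s)) = mn q (a+s) (b+s) f" using Lq_affine(2)[OF q _ f'] by (simp add: add.commute)
 show "Lq_norm q {a..b} (\<lambda>t. f (t+s)) = Lq_norm q {a+s..b+s} f"
 proof (cases "a < b")
  case True
  thus ?thesis using 2 Lq_norm_mn[OF True q, of "\<lambda>t. f (t+s)"] Lq_norm_mn[of "a+s" "b+s" q f] q by simp
 next
  case False
  have *: "Lq_norm q {c..d} g = 0" if "\<not> c < d" for c d and g :: "real => complex"
  proof (cases "c = d")
   case True
   have "AE x in lebesgue. x \<noteq> c" by (simp add: AE_lborel_singleton AE_completion)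
   hence "AE t in lebesgue. t \<in> {c..d} --> 0 = g t" unfolding True[symmetric] by (rule eventually_mono) auto
   from Lq_AE_cong(2)[OF this, of q] q show ?thesis by simp
  qed (use that q Lq_empty in auto)
  show ?thesis using False by (simp add: *)
 qed
qed

lemma Lq_zero_outside:
 assumes "T \<subseteq> S" "\<And>t. t \<in> S-T ==> f t = 0"
 shows "f \<in> Lq q S \<longleftrightarrow> f \<in> Lq q T" "Lq_norm q S f = Lq_norm q T f"
proof -
 have "cut S f x = cut T f x" for x
 proof (cases "x \<in> T")
  case True thus ?thesis using assms(1) by (auto simp: indicator_def)
 next
  case False thus ?thesis using assms(2) by (cases "x \<in> S") auto
 qed
 thus "f \<in> Lq q S \<longleftrightarrow> f \<in> Lq q T" "Lq_norm q S f = Lq_norm q T f"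
  unfolding Lq_iff Lq_norm_eq by presburger+
qed

section \<open>Finite differences and moduli of smoothness\<close>

definition kdiff :: "nat => real => (real => complex) => real => complex" where
 "kdiff k h f t = (\<Sum>i\<le>k. (-1) ^ (k+i) * of_nat (k choose i) * f (t+real i * h))"

lemma fin_diff_Lq:
 assumes q: "1 <= q" and f: "f \<in> Lq q {a..b}"
 shows "fin_diff k h f a b \<in> Lq q {a..b}" "Lq_norm q {a..b} (fin_diff k h f a b) <= 2 ^ k * Lq_norm q {a..b} f"
proof -
 \<comment> \<open>\<open>{a1..b1}\<close> is the set of base points whose whole segment stays in
   \<open>{a..b}\<close>, for either sign of \<open>h\<close>. On it \<open>fin_diff\<close> is
   \<open>kdiff\<close>, and each of the k+1 translates stays in \<open>{a..b}\<close>.\<close>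
 define a1 where "a1 = max a (a-real k * h)"
 define b1 where "b1 = min b (b-real k * h)"
 have T: "{a1..b1} \<subseteq> {a..b}" by (auto simp: a1_def b1_def)
 have iff: "t \<in> {a1..b1} \<longleftrightarrow> closed_segment t (t+real k * h) \<subseteq> {a..b}" for t
  by (auto simp: a1_def b1_def closed_segment_eq_real_ivl)
 have sub: "{a1+real i * h..b1+real i * h} \<subseteq> {a..b}" if "i <= k" for i
 proof (cases "h \<ge> 0")
  case True
  hence "real i * h <= real k * h" "0 <= real i * h" using that by (auto intro: mult_right_mono)
  thus ?thesis by (auto simp: a1_def b1_def)
 next
  case False
  hence "real k * h <= real i * h" "real i * h <= 0" using that
   by (auto intro: mult_right_mono_neg mult_nonneg_nonpos)
  thus ?thesis by (auto simp: a1_def b1_def)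
 qed
 have z: "fin_diff k h f a b t = 0" if "t \<in> {a..b}-{a1..b1}" for t
 proof -
  have "\<not> closed_segment t (t+real k * h) \<subseteq> {a..b}" using that iff[of t] by blast
  thus ?thesis unfolding fin_diff_def by (rule if_not_P)
 qed
 have eq: "fin_diff k h f a b t = kdiff k h f t" if "t \<in> {a1..b1}" for t
  unfolding fin_diff_def kdiff_def using that iff[of t] by (simp only: if_True simp_thms)
 have fi: "f \<in> Lq q {a1+real i * h..b1+real i * h}" if "i <= k" for i
  by (rule Lq_subset(1)[OF q f sub[OF that]]) simp
 have fs: "(\<lambda>t. f (t+real i * h)) \<in> Lq q {a1..b1}" if "i <= k" for i
  by (rule Lq_shift(1)[OF q fi[OF that]])
 have fsn: "Lq_norm q {a1..b1} (\<lambda>t. f (t+real i * h)) <= Lq_norm q {a..b} f" if "i <= k" for i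
  unfolding Lq_shift(3)[OF q fi[OF that]] by (rule Lq_subset(2)[OF q f sub[OF that]]) simp
 have L: "kdiff k h f \<in> Lq q {a1..b1}"
  unfolding kdiff_def by (rule Lq_sum(1)[OF q]) (auto intro!: Lq_cmult(1)[OF q] fs)
 hence "fin_diff k h f a b \<in> Lq q {a1..b1}" by (subst Lq_cong[OF eq])
 thus "fin_diff k h f a b \<in> Lq q {a..b}" using Lq_zero_outside(1)[of "{a1..b1}" "{a..b}" "fin_diff k h f a b" q, OF T] z by metis
 have "Lq_norm q {a..b} (fin_diff k h f a b) = Lq_norm q {a1..b1} (kdiff k h f)"
  using Lq_zero_outside(2)[of "{a1..b1}" "{a..b}" "fin_diff k h f a b" q, OF T] z
   Lq_norm_cong[of "{a1..b1}" "fin_diff k h f a b" "kdiff k h f" q] eq by metis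
 also have "... <= (\<Sum>i\<le>k. Lq_norm q {a1..b1} (\<lambda>t. ((-1) ^ (k+i) * of_nat (k choose i)) * f (t+real i * h)))"
  unfolding kdiff_def by (rule Lq_sum(2)[OF q]) (auto intro!: Lq_cmult(1)[OF q] fs)
 also have "... = (\<Sum>i\<le>k. real (k choose i) * Lq_norm q {a1..b1} (\<lambda>t. f (t+real i * h)))"
  by (intro sum.cong refl) (simp add: Lq_cmult(2)[OF q fs] norm_mult norm_power)
 also have "... <= (\<Sum>i\<le>k. real (k choose i) * Lq_norm q {a..b} f)"
  by (intro sum_mono mult_left_mono fsn) auto
 also have "... = 2 ^ k * Lq_norm q {a..b} f"
  unfolding sum_distrib_right[symmetric] using choose_row_sum[of k] by (metis of_nat_numeral of_nat_power of_nat_sum)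
 finally show "Lq_norm q {a..b} (fin_diff k h f a b) <= 2 ^ k * Lq_norm q {a..b} f" .
qed

lemma fin_diff_add:
 "fin_diff k h (\<lambda>t. f t+g t) a b t = fin_diff k h f a b t+fin_diff k h g a b t"
 by (simp add: fin_diff_def sum.distrib distrib_left)

lemma fin_diff_diff:
 "fin_diff k h (\<lambda>t. f t-g t) a b t = fin_diff k h f a b t-fin_diff k h g a b t"
 by (simp add: fin_diff_def sum_subtractf right_diff_distrib)

text \<open>Pascal's rule. It lets inductions on the order peel off one first difference.\<close>

lemma kdiff_Suc: "kdiff (Suc k) h f t = kdiff k h (\<lambda>t. f (t+h)-f t) t"
proof -
 let ?s = "\<lambda>i. (-1) ^ (k+i) :: complex"
 have "kdiff k h (\<lambda>t. f (t+h)-f t) t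
   = (\<Sum>i\<le>k. ?s i * of_nat (k choose i) * f (t+real (Suc i) * h))-(\<Sum>i\<le>k. ?s i * of_nat (k choose i) * f (t+real i * h))"
  unfolding kdiff_def sum_subtractf[symmetric] by (intro sum.cong refl) (simp add: algebra_simps)
 also have "(\<Sum>i\<le>k. ?s i * of_nat (k choose i) * f (t+real i * h))
   = - ((-1) ^ (Suc k) * f t)-(\<Sum>i\<le>k. ?s i * of_nat (k choose Suc i) * f (t+real (Suc i) * h))"
 proof -
  have "(\<Sum>i\<le>k. ?s i * of_nat (k choose i) * f (t+real i * h)) = (\<Sum>i\<le>Suc k. ?s i * of_nat (k choose i) * f (t+real i * h))"
   by simp
  also have "... = ?s 0 * of_nat (k choose 0) * f (t+real 0 * h)+(\<Sum>i\<le>k. ?s (Suc i) * of_nat (k choose Suc i) * f (t+real (Suc i) * h))"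
   by (rule sum.atMost_Suc_shift)
  finally show ?thesis by (simp add: sum_negf)
 qed
 also have "(\<Sum>i\<le>k. ?s i * of_nat (k choose i) * f (t+real (Suc i) * h)) -
   (- ((-1) ^ (Suc k) * f t)-(\<Sum>i\<le>k. ?s i * of_nat (k choose Suc i) * f (t+real (Suc i) * h)))
   = (-1) ^ (Suc k) * f t+(\<Sum>i\<le>k. ?s i * of_nat (Suc k choose Suc i) * f (t+real (Suc i) * h))"
  by (simp add: sum.distrib[symmetric] algebra_simps)
 also have "... = kdiff (Suc k) h f t"
  unfolding kdiff_def sum.atMost_Suc_shift by simp
 finally show ?thesis ..
qed

text \<open>Differencing lowers the degree by one. The new leading coefficient is recorded because
  it later bounds the old one by means of the polynomial.\<close>

lemma poly_fun_shift_diff_degree: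
 fixes p :: "complex poly"
 assumes "\<And>i. i > n ==> coeff p i = 0"
 shows "\<exists>r. (\<forall>t. poly_fun r t = poly_fun p (t+h)-poly_fun p t) \<and> (\<forall>i\<ge>n. coeff r i = 0)
   \<and> (n > 0 --> coeff r (n-1) = of_nat n * h * coeff p n)"
proof -
 define H where "H = complex_of_real h"
 define r where "r = (\<Sum>j\<le>n. smult (coeff p j) ([:H, 1:] ^ j-[:0, 1:] ^ j))"
 have p: "p = (\<Sum>j\<le>n. monom (coeff p j) j)"
  using poly_as_sum_of_monoms'[of p n] assms by (metis degree_le not_less)
 have 1: "poly_fun r t = poly_fun p (t+h)-poly_fun p t" for t
 proof -
  have "poly_fun p s = (\<Sum>j\<le>n. coeff p j * of_real s ^ j)" for s
   unfolding poly_fun_def by (subst p) (simp add: poly_sum poly_monom)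
  thus ?thesis
  proof -
   have "poly_fun r t = (\<Sum>j\<le>n. coeff p j*(of_real (t+h) ^ j - of_real t ^ j))"
    unfolding r_def by (simp add: poly_fun_def poly_sum poly_power H_def add.commute)
   thus ?thesis unfolding \<open>\<And>s. poly_fun p s = _\<close> by (simp add: right_diff_distrib sum_subtractf)
  qed
 qed
 have cf: "coeff ([:H, 1:] ^ j-[:0, 1:] ^ j) i = (if i < j then of_nat (j choose i) * H ^ (j-i) else 0)" for i j
 proof (cases "i <= j")
  case True
  thus ?thesis by (auto simp: coeff_linear_poly_power power_0_left)
 next
  case False
  have "degree ([:H, 1:] ^ j) = j" "degree ([:0::complex, 1:] ^ j) = j" by (simp_all add: degree_linear_power)
  thus ?thesis using False by (simp add: coeff_eq_0)
 qed
 have cr: "coeff r i = (\<Sum>j\<le>n. coeff p j*(if i < j then of_nat (j choose i) * H ^ (j-i) else 0))" for i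
  unfolding r_def by (simp only: coeff_sum coeff_smult cf)
 have 2: "coeff r i = 0" if "i \<ge> n" for i
  unfolding cr using that by (intro sum.neutral) auto
 have 3: "coeff r (n-1) = of_nat n * H * coeff p n" if "n > 0"
 proof -
  have "coeff r (n-1) = (\<Sum>j\<in>{n}. coeff p j*(if n-1 < j then of_nat (j choose (n-1)) * H ^ (j-(n-1)) else 0))"
   unfolding cr by (rule sum.mono_neutral_right) auto
  also have "... = coeff p n*(of_nat (n choose (n-1)) * H ^ (n-(n-1)))" using that by simp
  also have "n choose (n-1) = n" using that binomial_symmetric[of 1 n] by simp
  also have "n-(n-1) = 1" using that by simp
  finally show ?thesis by simp
 qed
 show ?thesis using 1 2 3 unfolding H_def by blast
qed

lemma kdiff_poly_eq_0:
 assumes "\<And>i. i \<ge> k ==> coeff p i = 0"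
 shows "kdiff k h (poly_fun p) t = 0"
 using assms
proof (induction k arbitrary: p)
 case 0
 hence "p = 0" by (intro poly_eqI) auto
 thus ?case by (simp add: kdiff_def poly_fun_def)
next
 case (Suc k)
 from poly_fun_shift_diff_degree[of k p h] Suc.prems obtain r
  where r: "\<And>t. poly_fun r t = poly_fun p (t+h)-poly_fun p t" "\<And>i. i \<ge> k ==> coeff r i = 0"
  by (meson Suc_leI)
 have "kdiff (Suc k) h (poly_fun p) t = kdiff k h (poly_fun r) t"
  by (simp only: kdiff_Suc r(1)[symmetric])
 thus ?case using Suc.IH[OF r(2)] by simp
qed

lemma Pi_poly_iff: "k \<ge> 1 ==> p \<in> Pi_poly k \<longleftrightarrow> (\<forall>i\<ge>k. coeff p i = 0)"
 unfolding Pi_poly_def mem_Collect_eq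
 by (metis One_nat_def coeff_eq_0 degree_0 degree_lessI le_less_trans less_eq_Suc_le not_le not_less leading_coeff_0_iff)

lemma fin_diff_poly_eq_0: "p \<in> Pi_poly k ==> fin_diff k h (poly_fun p) a b t = 0"
 using kdiff_poly_eq_0[of k p h t] by (auto simp: fin_diff_def kdiff_def Pi_poly_def coeff_eq_0)

lemma omega_bdd_above:
 assumes "1 <= q" "f \<in> Lq q {a..b}"
 shows "bdd_above (range (\<lambda>h. Lq_norm q {a..b} (fin_diff k h f a b)))"
 using fin_diff_Lq(2)[OF assms] by (intro bdd_aboveI[where M="2 ^ k * Lq_norm q {a..b} f"]) auto

lemma fin_diff_le_omega:
 assumes "1 <= q" "f \<in> Lq q {a..b}"
 shows "Lq_norm q {a..b} (fin_diff k h f a b) <= omega_k k q a b f"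
 unfolding omega_k_def by (rule cSUP_upper[OF _ omega_bdd_above[OF assms]]) simp

lemma omega_nonneg: "1 <= q ==> f \<in> Lq q {a..b} ==> 0 <= omega_k k q a b f"
 using fin_diff_le_omega[of q f a b k 0] Lq_norm_nonneg order_trans by blast

text \<open>The easy direction of Whitney's inequality: differences of order k annihilate
  \<open>p\<close> and increase an L^q norm at most by the factor 2^k.\<close>

lemma omega_le_poly:
 assumes "1 <= q" "f \<in> Lq q {a..b}" "p \<in> Pi_poly k"
 shows "omega_k k q a b f <= 2 ^ k * Lq_norm q {a..b} (resid f p)"
 unfolding omega_k_def
proof (rule cSUP_least)
 fix h
 have "(resid f p) \<in> Lq q {a..b}" using assms by (intro Lq_diff(1)) auto
 from fin_diff_Lq(2)[OF assms(1) this, of k h]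
 have "Lq_norm q {a..b} (fin_diff k h (resid f p) a b) <= 2 ^ k * Lq_norm q {a..b} (resid f p)" .
 moreover have "fin_diff k h (resid f p) a b = fin_diff k h f a b"
  by (rule ext) (simp add: fin_diff_diff fin_diff_poly_eq_0[OF assms(3)])
 ultimately show "Lq_norm q {a..b} (fin_diff k h f a b) <= 2 ^ k * Lq_norm q {a..b} (resid f p)" by simp
qed simp

section \<open>Density of continuous functions\<close>

lemma Lq_tendsto_0:
 assumes q: "1 <= q" and g: "g \<in> Lq q {a..b}"
  and u: "\<And>n. set_borel_measurable lebesgue {a..b} (u n)" "\<And>n t. t \<in> {a..b} ==> cmod (u n t) <= cmod (g t)"
  and lim: "AE t in lebesgue. t \<in> {a..b} --> (\<lambda>n. u n t) \<longlonglongrightarrow> 0"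
 shows "(\<lambda>n. mn q a b (u n)) \<longlonglongrightarrow> 0"
proof -
 let ?I = "indicator {a..b} :: real => real"
 have [measurable]: "(\<lambda>x. ?I x *\<^sub>R u n x) \<in> borel_measurable lebesgue" for n
  using u(1)[of n] by (simp add: set_borel_measurable_def)
 have "(\<lambda>n. LINT x|lebesgue. cmod (?I x *\<^sub>R u n x) powr q) \<longlonglongrightarrow> integral\<^sup>L (lebesgue :: real measure) (\<lambda>x. 0 :: real)"
 proof (rule integral_dominated_convergence[where f="\<lambda>x::real. 0::real" and s="\<lambda>n x. cmod (?I x *\<^sub>R u n x) powr q" and w="\<lambda>x. cmod (?I x *\<^sub>R g x) powr q"])
  show "integrable lebesgue (\<lambda>x. cmod (?I x *\<^sub>R g x) powr q)" by (rule Lq_integrable[OF g])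
  show "(\<lambda>x. cmod (?I x *\<^sub>R u n x) powr q) \<in> borel_measurable lebesgue" for n by measurable
  show "AE x in lebesgue. (\<lambda>n. cmod (?I x *\<^sub>R u n x) powr q) \<longlonglongrightarrow> 0"
   using lim
  proof (rule eventually_mono)
   fix x assume x: "x \<in> {a..b} --> (\<lambda>n. u n x) \<longlonglongrightarrow> 0"
   show "(\<lambda>n. cmod (?I x *\<^sub>R u n x) powr q) \<longlonglongrightarrow> 0"
   proof (cases "x \<in> {a..b}")
    case True
    hence "(\<lambda>n. cmod (u n x)) \<longlonglongrightarrow> 0" using x tendsto_norm_zero by blast
    hence "(\<lambda>n. cmod (u n x) powr q) \<longlonglongrightarrow> 0 powr q" using q by (intro tendsto_powr') auto
    thus ?thesis using True by simp
   qed simp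
  qed
  show "AE x in lebesgue. norm (cmod (?I x *\<^sub>R u n x) powr q) <= cmod (?I x *\<^sub>R g x) powr q" for n
  proof (rule AE_I2)
   fix x show "norm (cmod (?I x *\<^sub>R u n x) powr q) <= cmod (?I x *\<^sub>R g x) powr q"
    using u(2)[of x n] q by (cases "x \<in> {a..b}") (auto intro: powr_mono2)
  qed
 qed simp
 hence "(\<lambda>n. (LINT x|lebesgue. cmod (?I x *\<^sub>R u n x) powr q) powr (1/q)) \<longlonglongrightarrow> 0 powr (1/q)"
  using q by (intro tendsto_powr') auto
 hence "(\<lambda>n. (b-a) powr (- 1/q) * Lq_norm q {a..b} (u n)) \<longlonglongrightarrow> (b-a) powr (- 1/q)*0"
  unfolding Lq_norm_eq by (intro tendsto_mult_left) simp
 thus ?thesis unfolding mn_def by simp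
qed

text \<open>Two dominated limits: first the values are truncated to a large disc, then the function
  is approximated almost everywhere by continuous functions truncated to the same disc, hence
  uniformly bounded.\<close>

lemma Lq_continuous_dense:
 assumes q: "1 <= q" and ab: "a < b" and f: "f \<in> Lq q {a..b}" and e: "e > 0"
 shows "\<exists>g. continuous_on UNIV g \<and> mn q a b (\<lambda>t. f t-g t) < e"
proof -
 define F where "F = (\<lambda>x. cut {a..b} f x)"
 have Fm: "F \<in> borel_measurable lebesgue" using Lq_measurable[OF f] by (simp add: F_def)
 \<comment> \<open>Nearest-point projection onto the disc of radius n. It is continuous, so
   truncation preserves continuity, and it moves z by at most |z|, which provides the dominating
   function.\<close>
 define clip where "clip n z = closest_point (cball (0::complex) (real n)) z" for n z
 have clip_cont: "continuous_on S (clip n)" for S n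
  unfolding clip_def by (rule continuous_on_closest_point) auto
 have clip_bd: "cmod (clip n z) <= real n" for n z
  using closest_point_in_set[of "cball (0::complex) (real n)" z] unfolding clip_def by simp
 have clip_le: "cmod (z-clip n z) <= cmod z" for n z
  using closest_point_le[of "cball (0::complex) (real n)" 0 z] unfolding clip_def by (simp add: dist_norm)
 have clip_id: "clip n z = z" if "cmod z <= real n" for n z
  unfolding clip_def by (rule closest_point_self) (use that in simp)
 have clip_m: "(\<lambda>x. clip n (F x)) \<in> borel_measurable lebesgue" for n
  using measurable_compose[OF Fm borel_measurable_continuous_onI[OF clip_cont]] .
 have set_m: "set_borel_measurable lebesgue {a..b} w" if "w \<in> borel_measurable lebesgue" for w :: "real => complex"
  unfolding set_borel_measurable_def by (rule borel_measurable_scaleR[OF borel_measurable_indicator that]) simp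
 have fF: "t \<in> {a..b} ==> f t = F t" for t by (simp add: F_def)
 have FL: "F \<in> Lq q {a..b}" using f Lq_cong[of "{a..b}" f F q, OF fF] by simp
 have "(\<lambda>n. mn q a b (\<lambda>t. F t-clip n (F t))) \<longlonglongrightarrow> 0"
 proof (rule Lq_tendsto_0[OF q FL])
  show "set_borel_measurable lebesgue {a..b} (\<lambda>t. F t-clip n (F t))" for n
   by (rule set_m) (intro borel_measurable_diff Fm clip_m)
  show "cmod (F t-clip n (F t)) <= cmod (F t)" for n t by (rule clip_le)
  show "AE t in lebesgue. t \<in> {a..b} --> (\<lambda>n. F t-clip n (F t)) \<longlonglongrightarrow> 0"
  proof (intro AE_I2 impI)
   fix t
   obtain N :: nat where N: "cmod (F t) <= real N" using real_arch_simple by blast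
   have "\<forall>\<^sub>F n in sequentially. F t-clip n (F t) = 0"
    using eventually_ge_at_top[of N] by (rule eventually_mono) (use N clip_id in force)
   thus "(\<lambda>n. F t-clip n (F t)) \<longlonglongrightarrow> 0" by (rule tendsto_eventually)
  qed
 qed
 hence "\<forall>\<^sub>F n in sequentially. mn q a b (\<lambda>t. F t-clip n (F t)) < e/2"
  using e by (intro order_tendstoD) auto
 then obtain n where n: "mn q a b (\<lambda>t. F t-clip n (F t)) < e/2"
  by (meson eventually_happens sequentially_bot)
 have "F measurable_on UNIV" by (rule lebesgue_measurable_imp_measurable_on[OF Fm]) simp
 then obtain N g where N: "negligible N" and g: "\<And>m. continuous_on UNIV (g m)"
  and lim: "\<And>x. x \<notin> N ==> (\<lambda>m. g m x) \<longlonglongrightarrow> F x"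
  unfolding measurable_on_def by auto
 have gc: "continuous_on UNIV (\<lambda>x. clip n (g m x))" for m
  by (rule continuous_on_compose2[OF clip_cont[of UNIV] g]) simp
 have gm: "(\<lambda>x. clip n (g m x)) \<in> borel_measurable lebesgue" for m
 proof -
  have "(\<lambda>x. clip n (g m x)) \<in> borel_measurable lborel"
   using borel_measurable_continuous_onI[OF gc[of m]] by simp
  thus ?thesis by (rule measurable_completion)
 qed
 have "(\<lambda>m. mn q a b (\<lambda>t. clip n (F t)-clip n (g m t))) \<longlonglongrightarrow> 0"
 proof (rule Lq_tendsto_0[OF q])
  show "(\<lambda>t. 2 * of_nat n) \<in> Lq q {a..b}" by (intro continuous_on_Lq q continuous_intros)
  show "set_borel_measurable lebesgue {a..b} (\<lambda>t. clip n (F t)-clip n (g m t))" for m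
   by (rule set_m) (intro borel_measurable_diff gm clip_m)
  show "cmod (clip n (F t)-clip n (g m t)) <= cmod (2 * of_nat n)" for m t
   using norm_triangle_ineq4[of "clip n (F t)" "clip n (g m t)"] clip_bd[of n "F t"] clip_bd[of n "g m t"]
   by (simp add: norm_mult)
  have "AE x in lebesgue. x \<notin> N" using N by (intro AE_not_in) (simp add: negligible_iff_null_sets)
  thus "AE t in lebesgue. t \<in> {a..b} --> (\<lambda>m. clip n (F t)-clip n (g m t)) \<longlonglongrightarrow> 0"
  proof (rule eventually_mono)
   fix t assume "t \<notin> N"
   from lim[OF this] have "(\<lambda>m. clip n (g m t)) \<longlonglongrightarrow> clip n (F t)"
    using clip_cont[of UNIV n] by (intro continuous_on_tendsto_compose[of UNIV "clip n"]) auto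
   hence "(\<lambda>m. clip n (F t)-clip n (g m t)) \<longlonglongrightarrow> clip n (F t)-clip n (F t)"
    by (intro tendsto_intros)
   thus "t \<in> {a..b} --> (\<lambda>m. clip n (F t)-clip n (g m t)) \<longlonglongrightarrow> 0" by simp
  qed
 qed
 hence "\<forall>\<^sub>F m in sequentially. mn q a b (\<lambda>t. clip n (F t)-clip n (g m t)) < e/2"
  using e by (intro order_tendstoD) auto
 then obtain m where m: "mn q a b (\<lambda>t. clip n (F t)-clip n (g m t)) < e/2"
  by (meson eventually_happens sequentially_bot)
 have c1: "(\<lambda>t. clip n (F t)) \<in> Lq q {a..b}"
  using Lq_bounded(1)[OF q _ set_m[OF clip_m] clip_bd] ab by simp
 have c2: "(\<lambda>t. clip n (g m t)) \<in> Lq q {a..b}"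
  by (intro continuous_on_Lq q continuous_on_subset[OF gc]) simp
 have "mn q a b (\<lambda>t. f t-clip n (g m t)) = mn q a b (\<lambda>t. (F t-clip n (F t))+(clip n (F t)-clip n (g m t)))"
  by (rule mn_cong) (simp add: fF)
 also have "... <= mn q a b (\<lambda>t. F t-clip n (F t))+mn q a b (\<lambda>t. clip n (F t)-clip n (g m t))"
  by (intro mn_add Lq_diff(1) q FL c1 c2)
 also have "... < e" using n m by simp
 finally show ?thesis using gc by blast
qed

section \<open>Inequalities for polynomials\<close>

text \<open>Induction on the degree instead of compactness: the difference with step L/2 has degree
  n, its leading coefficient is (n+1)L/2 times the old one, and its mean over
  \<open>{0..L/2}\<close> is at most 4 times the mean of \<open>p\<close> over
  \<open>{0..L}\<close>.\<close>

lemma top_coeff_bound: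
 "\<exists>C>0. \<forall>p. (\<forall>i>n. coeff p i = 0) --> cmod (coeff p n) <= C * mn 1 0 L (poly_fun p)" if "L > 0"
 using that
proof (induction n arbitrary: L)
 case 0
 have "cmod (coeff p 0) <= 1 * mn 1 0 L (poly_fun p)" if "\<forall>i>0. coeff p i = 0" for p
 proof -
  have "poly_fun p t = coeff p 0" for t
   unfolding poly_fun_def poly_altdef using that by (simp add: sum.atMost_shift)
  hence "poly_fun p = (\<lambda>t. coeff p 0)" by blast
  thus ?thesis using mn_const[of 1 0 L] 0 by simp
 qed
 thus ?case using zero_less_one by blast
next
 case (Suc n)
 have L2: "L/2 > 0" using Suc.prems by simp
 obtain C where C: "C > 0" "\<And>p. (\<forall>i>n. coeff p i = 0) ==> cmod (coeff p n) <= C * mn 1 0 (L/2) (poly_fun p)"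
  using Suc.IH[OF L2] by blast
 define D where "D = C*4/(real (Suc n)*(L/2))"
 have "cmod (coeff p (Suc n)) <= D * mn 1 0 L (poly_fun p)" if p: "\<forall>i>Suc n. coeff p i = 0" for p
 proof -
  obtain r where r: "\<And>t. poly_fun r t = poly_fun p (t+L/2)-poly_fun p t" "\<And>i. i \<ge> Suc n ==> coeff r i = 0"
   "coeff r n = of_nat (Suc n) * complex_of_real (L/2) * coeff p (Suc n)"
   using poly_fun_shift_diff_degree[of "Suc n" p "L/2"] p
   by (metis diff_Suc_1 zero_less_Suc)
  have m: "poly_fun p \<in> Lq 1 {0..L}" by simp
  have "mn 1 0 (L/2) (poly_fun r) = mn 1 0 (L/2) (\<lambda>t. poly_fun p (t+L/2)-poly_fun p t)"
   by (rule mn_cong) (rule r(1))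
  also have "... <= mn 1 0 (L/2) (\<lambda>t. poly_fun p (t+L/2))+mn 1 0 (L/2) (poly_fun p)"
   by (intro mn_diff Lq_shift(1)) auto
  also have "mn 1 0 (L/2) (\<lambda>t. poly_fun p (t+L/2)) = mn 1 (L/2) L (poly_fun p)"
   using Lq_shift(2)[of 1 "poly_fun p" 0 "L/2" "L/2"] by simp
  also have "mn 1 (L/2) L (poly_fun p) <= 2 * mn 1 0 L (poly_fun p)"
   by (rule mn_mono(2)) (use Suc.prems in auto)
  also have "mn 1 0 (L/2) (poly_fun p) <= 2 * mn 1 0 L (poly_fun p)"
   by (rule mn_mono(2)) (use Suc.prems in auto)
  finally have "mn 1 0 (L/2) (poly_fun r) <= 4 * mn 1 0 L (poly_fun p)" by simp
  hence "C * mn 1 0 (L/2) (poly_fun r) <= C*(4 * mn 1 0 L (poly_fun p))"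
   using C(1) by (intro mult_left_mono) auto
  moreover have "cmod (coeff r n) <= C * mn 1 0 (L/2) (poly_fun r)" using r(2) by (intro C(2)) auto
  ultimately have "(real (Suc n)*(L/2)) * cmod (coeff p (Suc n)) <= C*4 * mn 1 0 L (poly_fun p)"
   unfolding r(3) norm_mult norm_of_nat norm_of_real using L2 by simp
  moreover have "c <= A/X * M" if "X > 0" "X * c <= A * M" for X c A M :: real
   using that by (simp add: field_simps)
  moreover have "real (Suc n)*(L/2) > 0" using L2 by (intro mult_pos_pos) auto
  ultimately show ?thesis unfolding D_def by blast
 qed
 moreover have "D > 0" unfolding D_def using C(1) L2 by (intro divide_pos_pos mult_pos_pos) auto
 ultimately show ?case by blast
qed

text \<open>The leading coefficient is bounded first. Subtracting its monomial lowers the degree and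
  enlarges the mean at most by the factor 1+C1.\<close>

lemma coeffs_bound:
 "\<exists>C>0. \<forall>p. (\<forall>i\<ge>n. coeff p i = 0) --> (\<forall>i. cmod (coeff p i) <= C * mn 1 0 1 (poly_fun p))"
proof (induction n)
 case 0
 show ?case by (intro exI[of _ 1]) auto
next
 case (Suc n)
 obtain C1 where C1: "C1 > 0" "\<And>p. (\<forall>i>n. coeff p i = 0) ==> cmod (coeff p n) <= C1 * mn 1 0 1 (poly_fun p)"
  using top_coeff_bound[of 1 n] by auto
 obtain C2 where C2: "C2 > 0" "\<And>p i. (\<forall>i\<ge>n. coeff p i = 0) ==> cmod (coeff p i) <= C2 * mn 1 0 1 (poly_fun p)"
  using Suc.IH by auto
 define C where "C = max C1 (C2*(1+C1))"
 have "cmod (coeff p i) <= C * mn 1 0 1 (poly_fun p)" if p: "\<forall>i\<ge>Suc n. coeff p i = 0" for p i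
 proof -
  have top: "cmod (coeff p n) <= C1 * mn 1 0 1 (poly_fun p)" using p by (intro C1(2)) auto
  let ?r = "p-monom (coeff p n) n"
  have "mn 1 0 1 (poly_fun ?r) = mn 1 0 1 (\<lambda>t. poly_fun p t-poly_fun (monom (coeff p n) n) t)"
   by (rule mn_cong) (simp add: poly_fun_def)
  also have "... <= mn 1 0 1 (poly_fun p)+mn 1 0 1 (poly_fun (monom (coeff p n) n))"
   by (intro mn_diff) auto
  also have "mn 1 0 1 (poly_fun (monom (coeff p n) n)) <= cmod (coeff p n)"
  proof (rule mn_bounded)
   show "set_borel_measurable lebesgue {0..1} (poly_fun (monom (coeff p n) n))"
    using Lq_measurable[OF poly_fun_Lq[of 1]] by (simp add: set_borel_measurable_def)
   show "cmod (poly_fun (monom (coeff p n) n) t) <= cmod (coeff p n)" if "t \<in> {0..1}" for t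
    using that by (simp add: poly_fun_def poly_monom norm_mult norm_power mult_left_le power_le_one)
  qed auto
  also have "... <= C1 * mn 1 0 1 (poly_fun p)" by (rule top)
  finally have le: "mn 1 0 1 (poly_fun ?r) <= (1+C1) * mn 1 0 1 (poly_fun p)" by (simp add: distrib_right)
  show ?thesis
  proof (cases "i = n")
   case True
   thus ?thesis using top mult_right_mono[of C1 C "mn 1 0 1 (poly_fun p)"] by (simp add: C_def)
  next
   case False
   have "cmod (coeff p i) = cmod (coeff ?r i)" using False by simp
   also have "... <= C2 * mn 1 0 1 (poly_fun ?r)"
   proof (rule C2(2), intro allI impI)
    fix j assume "n <= j"
    thus "coeff ?r j = 0" using p by (cases "j = n") auto
   qed
   also have "... <= C2*((1+C1) * mn 1 0 1 (poly_fun p))" using le C2(1) by (intro mult_left_mono) auto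
   also have "... = C2*(1+C1) * mn 1 0 1 (poly_fun p)" by simp
   also have "... <= C * mn 1 0 1 (poly_fun p)" by (intro mult_right_mono) (auto simp: C_def)
   finally show ?thesis .
  qed
 qed
 moreover have "C > 0" using C1(1) by (simp add: C_def)
 ultimately show ?case by blast
qed

text \<open>Affine rescaling to the unit interval and the coefficient bound there. The parameter
  \<open>N\<close> admits points up to N interval lengths away, which is needed to compare
  polynomials attached to different intervals.\<close>

lemma poly_Markov:
 assumes k: "1 <= k" and N: "1 <= N"
 shows "\<exists>C>0. \<forall>p\<in>Pi_poly k. \<forall>a b t. a < b --> \<bar>t-a\<bar> <= N*(b-a) -->
   cmod (poly_fun p t) <= C * mn 1 a b (poly_fun p) \<and>
   cmod (poly_fun (pderiv p) t) <= C/(b-a) * mn 1 a b (poly_fun p)"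
proof -
 obtain C where C: "C > 0" "\<And>p i. (\<forall>i\<ge>k. coeff p i = 0) ==> cmod (coeff p i) <= C * mn 1 0 1 (poly_fun p)"
  using coeffs_bound[of k] by auto
 define D where "D = real k * real (Suc k) * C * N ^ k"
 have D0: "D > 0" using C(1) N k by (simp add: D_def)
 have "cmod (poly_fun p t) <= D * mn 1 a b (poly_fun p) \<and> cmod (poly_fun (pderiv p) t) <= D/(b-a) * mn 1 a b (poly_fun p)"
  if p: "p \<in> Pi_poly k" and ab: "a < b" and t: "\<bar>t-a\<bar> <= N*(b-a)" for p a b t
 proof -
  let ?L = "b-a"
  define r where "r = pcompose p [:complex_of_real a, complex_of_real ?L:]"
  define s where "s = (t-a)/?L"
  have L: "?L > 0" using ab by simp
  have s: "\<bar>s\<bar> <= N" "t = a+?L * s" using t L by (auto simp: s_def abs_divide divide_le_eq)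
  have pr: "poly_fun r u = poly_fun p (a+?L * u)" for u
   by (simp add: r_def poly_fun_def poly_pcompose mult.commute)
  have dr: "poly_fun (pderiv r) u = of_real ?L * poly_fun (pderiv p) (a+?L * u)" for u
   by (simp add: r_def poly_fun_def poly_pcompose pderiv_pcompose pderiv_pCons mult.commute)
  have "degree r < k"
   using p degree_pcompose_le[of p "[:complex_of_real a, complex_of_real ?L:]"] ab
   unfolding r_def Pi_poly_def by (auto simp: degree_pcompose)
  hence rk: "\<forall>i\<ge>k. coeff r i = 0" and rdeg: "degree r < k" by (auto intro: coeff_eq_0)
  have "mn 1 0 1 (poly_fun r) = mn 1 0 1 (\<lambda>u. poly_fun p (a+?L * u))" by (rule mn_cong) (rule pr)
  also have "... = mn 1 a b (poly_fun p)"
   using Lq_affine(2)[of 1 ?L "poly_fun p" a 0 1] L by simp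
  finally have M: "mn 1 0 1 (poly_fun r) = mn 1 a b (poly_fun p)" .
  have cb: "cmod (coeff r i) <= C * mn 1 a b (poly_fun p)" for i
   using C(2)[OF rk, of i] by (simp add: M)
  have Np: "N ^ i <= N ^ k" if "i <= k" for i using N that by (intro power_increasing) auto
  have ev: "cmod (poly_fun w s) <= real k * B * N ^ k" if w: "\<And>i. i \<ge> k ==> coeff w i = 0" and B: "\<And>i. cmod (coeff w i) <= B" for w B
  proof -
   have B0: "0 <= B" using B[of 0] norm_ge_zero order_trans by blast
   have dw: "degree w <= k-1" using w k by (intro degree_le) (metis One_nat_def Suc_pred less_eq_Suc_le not_le less_Suc_eq_le allI impI)
   have "poly_fun w s = (\<Sum>i<k. coeff w i * of_real s ^ i)"
   proof -
    have "poly_fun w s = (\<Sum>i\<le>degree w. coeff w i * of_real s ^ i)" by (simp add: poly_fun_def poly_altdef)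
    also have "... = (\<Sum>i<k. coeff w i * of_real s ^ i)"
     by (rule sum.mono_neutral_left) (use dw k in \<open>auto simp: coeff_eq_0\<close>)
    finally show ?thesis .
   qed
   hence "cmod (poly_fun w s) <= (\<Sum>i<k. cmod (coeff w i * of_real s ^ i))" by (simp add: norm_sum)
   also have "... <= (\<Sum>i<k. B * N ^ k)"
   proof (rule sum_mono)
    fix i assume "i \<in> {..<k}"
    hence "\<bar>s\<bar> ^ i <= N ^ k" using power_mono[OF s(1), of i] Np[of i] by auto
    thus "cmod (coeff w i * of_real s ^ i) <= B * N ^ k"
     unfolding norm_mult norm_power norm_of_real using B[of i] B0 by (intro mult_mono) auto
   qed
   finally show ?thesis by simp
  qed
  have mn0: "0 <= C * mn 1 a b (poly_fun p)" using C(1) by simp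
  have "cmod (poly_fun r s) <= real k*(C * mn 1 a b (poly_fun p)) * N ^ k"
   by (rule ev) (use rk cb in auto)
  also have "... <= real (Suc k)*(real k*(C * mn 1 a b (poly_fun p)) * N ^ k)"
   using mult_right_mono[of 1 "real (Suc k)" "real k*(C * mn 1 a b (poly_fun p)) * N ^ k"] mn0 N by simp
  also have "... = D * mn 1 a b (poly_fun p)" by (simp add: D_def)
  finally have 1: "cmod (poly_fun p t) <= D * mn 1 a b (poly_fun p)" by (simp only: pr s(2)[symmetric])
  have "cmod (poly_fun (pderiv r) s) <= real k*(real (Suc k)*(C * mn 1 a b (poly_fun p))) * N ^ k"
  proof (rule ev)
   show "coeff (pderiv r) i = 0" if "i \<ge> k" for i using rk that by (simp add: coeff_pderiv)
   show "cmod (coeff (pderiv r) i) <= real (Suc k)*(C * mn 1 a b (poly_fun p))" for i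
   proof (cases "i <= k")
    case True
    have "cmod (coeff (pderiv r) i) = real (Suc i) * cmod (coeff r (Suc i))"
     by (simp only: coeff_pderiv norm_mult norm_of_nat)
    also have "... <= real (Suc k)*(C * mn 1 a b (poly_fun p))"
     using True cb by (intro mult_mono) auto
    finally show ?thesis .
   next
    case False
    hence "coeff (pderiv r) i = 0" using rk by (simp add: coeff_pderiv)
    thus ?thesis using mn0 by simp
   qed
  qed
  also have "... = D * mn 1 a b (poly_fun p)" by (simp add: D_def)
  finally have "cmod (of_real ?L) * cmod (poly_fun (pderiv p) t) <= D * mn 1 a b (poly_fun p)"
   unfolding dr s(2)[symmetric] norm_mult .
  hence "?L * cmod (poly_fun (pderiv p) t) <= D * mn 1 a b (poly_fun p)"
   unfolding norm_of_real using L by simp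
  hence "cmod (poly_fun (pderiv p) t) <= D/?L * mn 1 a b (poly_fun p)"
   using L by (simp add: field_simps)
  with 1 show ?thesis by blast
 qed
 with D0 show ?thesis by blast
qed

lemma poly_fun_mn_bounded:
 assumes "1 <= q" "a < b" "\<And>t. t \<in> {a..b} ==> cmod (poly_fun p t) <= B"
 shows "mn q a b (poly_fun p) <= B"
proof (rule mn_bounded[OF assms(1,2) _ assms(3)])
 show "set_borel_measurable lebesgue {a..b} (poly_fun p)"
  using Lq_measurable[OF poly_fun_Lq[of 1]] by (simp add: set_borel_measurable_def)
qed

lemma Pi_poly_pderiv: "p \<in> Pi_poly k ==> pderiv p \<in> Pi_poly k"
 by (simp add: Pi_poly_def degree_pderiv)

lemma poly_higher_Markov:
 assumes k: "1 <= k" and N: "1 <= N"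
 shows "\<exists>C>0. \<forall>p\<in>Pi_poly k. \<forall>a b t. a < b --> \<bar>t-a\<bar> <= N*(b-a) -->
   cmod (poly_fun ((pderiv ^^ \<nu>) p) t) <= C/(b-a) ^ \<nu> * mn 1 a b (poly_fun p)"
proof -
 obtain C where C: "C > 0" "\<And>p a b t. p \<in> Pi_poly k ==> a < b ==> \<bar>t-a\<bar> <= N*(b-a) ==>
   cmod (poly_fun p t) <= C * mn 1 a b (poly_fun p) \<and>
   cmod (poly_fun (pderiv p) t) <= C/(b-a) * mn 1 a b (poly_fun p)"
  using poly_Markov[OF k N] by blast
 have "\<forall>p\<in>Pi_poly k. \<forall>a b t. a < b --> \<bar>t-a\<bar> <= N*(b-a) -->
   cmod (poly_fun ((pderiv ^^ \<nu>) p) t) <= C ^ Suc \<nu>/(b-a) ^ \<nu> * mn 1 a b (poly_fun p)"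
 proof (induction \<nu>)
  case 0
  thus ?case using C(2) by simp
 next
  case (Suc \<nu>)
  show ?case
  proof (intro ballI allI impI)
   fix p a b t assume p: "p \<in> Pi_poly k" and ab: "a < b" and t: "\<bar>t-a\<bar> <= N*(b-a)"
   have "(pderiv ^^ Suc \<nu>) p = (pderiv ^^ \<nu>) (pderiv p)" by (simp add: funpow_swap1)
   hence "cmod (poly_fun ((pderiv ^^ Suc \<nu>) p) t) <= C ^ Suc \<nu>/(b-a) ^ \<nu> * mn 1 a b (poly_fun (pderiv p))"
    using Suc.IH Pi_poly_pderiv[OF p] ab t by simp
   also have "mn 1 a b (poly_fun (pderiv p)) <= C/(b-a) * mn 1 a b (poly_fun p)"
   proof (rule poly_fun_mn_bounded)
    fix u assume "u \<in> {a..b}"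
    hence "\<bar>u-a\<bar> <= 1*(b-a)" by simp
    also have "... <= N*(b-a)" using N ab by (intro mult_right_mono) auto
    finally show "cmod (poly_fun (pderiv p) u) <= C/(b-a) * mn 1 a b (poly_fun p)"
     using C(2)[OF p ab] by blast
   qed (use ab in auto)
   hence "C ^ Suc \<nu>/(b-a) ^ \<nu> * mn 1 a b (poly_fun (pderiv p))
    <= C ^ Suc \<nu>/(b-a) ^ \<nu>*(C/(b-a) * mn 1 a b (poly_fun p))"
    using C(1) ab by (intro mult_left_mono) auto
   also have "... = C ^ Suc (Suc \<nu>)/(b-a) ^ Suc \<nu> * mn 1 a b (poly_fun p)"
    by (simp add: mult_ac)
   finally show "cmod (poly_fun ((pderiv ^^ Suc \<nu>) p) t) <= C ^ Suc (Suc \<nu>)/(b-a) ^ Suc \<nu> * mn 1 a b (poly_fun p)"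
    by (simp add: mult.assoc)
  qed
 qed
 moreover have "C ^ Suc \<nu> > 0" using C(1) by simp
 ultimately show ?thesis by blast
qed

section \<open>B-splines and their dual functionals\<close>

definition knot_seq :: "(int => real) => bool" where
 "knot_seq y \<longleftrightarrow> strict_mono y \<and> (\<forall>t. \<exists>l. y l <= t \<and> t < y (l+1))"

lemma knot_seq_less: "knot_seq y ==> i < j ==> y i < y j"
 unfolding knot_seq_def by (blast dest: strict_monoD)

lemma knot_seq_less_iff: "knot_seq y ==> y i < y j \<longleftrightarrow> i < j"
 unfolding knot_seq_def by (simp add: strict_mono_less)

lemma knot_seq_le_iff: "knot_seq y ==> y i <= y j \<longleftrightarrow> i <= j"
 unfolding knot_seq_def by (simp add: strict_mono_less_eq)

text \<open>With w_j(t) = (t - y_j)/(y_(j+n+1) - y_j), the weights of the recursion are w_j and 1 -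
  w_(j+1). In this form a sum over j regroups into affine combinations of neighbouring
  coefficients.\<close>

lemma bspline_step:
 assumes y: "knot_seq y"
 shows "bspline y (Suc (Suc n)) j t =
  (t-y j)/(y (j+int (Suc n))-y j) * bspline y (Suc n) j t +
  (1-(t-y (j+1))/(y (j+1+int (Suc n))-y (j+1))) * bspline y (Suc n) (j+1) t"
proof -
 have "j+1 < j+int (Suc (Suc n))" by simp
 from knot_seq_less[OF y this] have "y (j+int (Suc (Suc n)))-y (j+1) \<noteq> 0" by simp
 moreover have e: "j+1+int (Suc n) = j+int (Suc (Suc n))" by simp
 ultimately have "(y (j+int (Suc (Suc n)))-t)/(y (j+int (Suc (Suc n)))-y (j+1))
   = 1-(t-y (j+1))/(y (j+1+int (Suc n))-y (j+1))"
  unfolding e by (simp add: diff_divide_eq_iff)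
 thus ?thesis by (simp only: bspline.simps)
qed

declare bspline.simps(3) [simp del]

lemma bspline_eq_0:
 assumes y: "knot_seq y" and "t < y j \<or> y (j+int (Suc n)) <= t"
 shows "bspline y (Suc n) j t = 0"
 using assms(2)
proof (induction n arbitrary: j)
 case (Suc n)
 have "y j < y (j+1)" "y (j+int (Suc n)) < y (j+int (Suc (Suc n)))"
  by (rule knot_seq_less[OF y], simp)+
 hence "t < y j \<or> y (j+int (Suc n)) <= t" "t < y (j+1) \<or> y (j+1+int (Suc n)) <= t"
  using Suc.prems by (auto simp: add.commute add.left_commute)
 thus ?case using Suc.IH by (simp add: bspline_step[OF y])
qed auto

lemma bspline_nonneg:
 assumes y: "knot_seq y"
 shows "0 <= bspline y (Suc n) j t"
proof (induction n arbitrary: j)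
 case (Suc n)
 have w: "y j < y (j+int (Suc n))" for j by (rule knot_seq_less[OF y]) simp
 have 1: "0 <= (t-y j)/(y (j+int (Suc n))-y j) * bspline y (Suc n) j t" for j
 proof (cases "t < y j")
  case True thus ?thesis using bspline_eq_0[OF y] by simp
 next
  case False thus ?thesis using w[of j] Suc.IH by (intro mult_nonneg_nonneg divide_nonneg_pos) auto
 qed
 have 2: "0 <= (1-(t-y j)/(y (j+int (Suc n))-y j)) * bspline y (Suc n) j t" for j
 proof (cases "y (j+int (Suc n)) <= t")
  case True thus ?thesis using bspline_eq_0[OF y, of t j n] by simp
 next
  case False
  hence "(t-y j)/(y (j+int (Suc n))-y j) <= 1" using w[of j] by (simp add: divide_le_eq)
  thus ?thesis using Suc.IH by (intro mult_nonneg_nonneg) auto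
 qed
 show ?case unfolding bspline_step[OF y] by (intro add_nonneg_nonneg 1 2)
qed auto

text \<open>One step of de Boor's algorithm. The B-splines of lower order with indices
  \<open>l-int (Suc n)\<close> and \<open>l+1\<close> vanish at \<open>t\<close>, so after the index
  shift both sums run over the same range.\<close>

lemma bspline_sum_step:
 assumes y: "knot_seq y" and t: "y l <= t" "t < y (l+1)"
 shows "(\<Sum>j\<in>{l-int (Suc n)..l}. a j * bspline y (Suc (Suc n)) j t) =
  (\<Sum>j\<in>{l-int n..l}. (a j*((t-y j)/(y (j+int (Suc n))-y j)) +
    a (j-1)*(1-(t-y j)/(y (j+int (Suc n))-y j))) * bspline y (Suc n) j t)"
proof -
 let ?w = "\<lambda>j. (t-y j)/(y (j+int (Suc n))-y j)"
 let ?B = "\<lambda>j. bspline y (Suc n) j t"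
 have z1: "?B (l-int (Suc n)) = 0" using t by (intro bspline_eq_0[OF y]) auto
 have z2: "?B (l+1) = 0" using t by (intro bspline_eq_0[OF y]) auto
 have "(\<Sum>j\<in>{l-int (Suc n)..l}. a j * bspline y (Suc (Suc n)) j t) =
   (\<Sum>j\<in>{l-int (Suc n)..l}. a j*?w j*?B j)+(\<Sum>j\<in>{l-int (Suc n)..l}. a j*(1-?w (j+1))*?B (j+1))"
  unfolding sum.distrib[symmetric] by (intro sum.cong refl) (simp only: bspline_step[OF y] distrib_left mult.assoc)
 also have "(\<Sum>j\<in>{l-int (Suc n)..l}. a j*?w j*?B j) = (\<Sum>j\<in>{l-int n..l}. a j*?w j*?B j)"
 proof (rule sum.mono_neutral_right)
  show "\<forall>i\<in>{l-int (Suc n)..l}-{l-int n..l}. a i*?w i*?B i = 0"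
  proof
   fix i assume "i \<in> {l-int (Suc n)..l}-{l-int n..l}"
   hence "i = l-int (Suc n)" by auto
   thus "a i*?w i*?B i = 0" using z1 by simp
  qed
 qed auto
 also have "(\<Sum>j\<in>{l-int (Suc n)..l}. a j*(1-?w (j+1))*?B (j+1)) = (\<Sum>j\<in>{l-int n..l+1}. a (j-1)*(1-?w j)*?B j)"
  by (rule sum.reindex_bij_witness[of _ "\<lambda>j. j-1" "\<lambda>j. j+1"]) auto
 also have "... = (\<Sum>j\<in>{l-int n..l}. a (j-1)*(1-?w j)*?B j)"
 proof (rule sum.mono_neutral_right)
  show "\<forall>i\<in>{l-int n..l+1}-{l-int n..l}. a (i-1)*(1-?w i)*?B i = 0"
  proof
   fix i assume "i \<in> {l-int n..l+1}-{l-int n..l}"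
   hence "i = l+1" by auto
   thus "a (i-1)*(1-?w i)*?B i = 0" using z2 by simp
  qed
 qed auto
 finally show ?thesis unfolding sum.distrib[symmetric] by (simp only: distrib_right)
qed

lemma bspline_unity:
 assumes y: "knot_seq y" and t: "y l <= t" "t < y (l+1)"
 shows "(\<Sum>j\<in>{l-int n..l}. bspline y (Suc n) j t) = 1"
proof (induction n)
 case 0
 thus ?case using t by simp
next
 case (Suc n)
 have "(\<Sum>j\<in>{l-int (Suc n)..l}. bspline y (Suc (Suc n)) j t) = (\<Sum>j\<in>{l-int (Suc n)..l}. 1 * bspline y (Suc (Suc n)) j t)"
  by simp
 also have "... = (\<Sum>j\<in>{l-int n..l}. bspline y (Suc n) j t)"
  unfolding bspline_sum_step[OF y t] by (intro sum.cong refl) (simp add: algebra_simps)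
 finally show ?case using Suc by simp
qed

lemma bspline_le_1:
 assumes y: "knot_seq y"
 shows "bspline y (Suc n) j t <= 1"
proof -
 obtain l where l: "y l <= t" "t < y (l+1)" using y unfolding knot_seq_def by blast
 show ?thesis
 proof (cases "j \<in> {l-int n..l}")
  case True
  hence "bspline y (Suc n) j t <= (\<Sum>j\<in>{l-int n..l}. bspline y (Suc n) j t)"
   by (intro member_le_sum bspline_nonneg[OF y]) auto
  thus ?thesis using bspline_unity[OF y l] by simp
 next
  case False
  hence "j \<ge> l+1 \<or> j+int (Suc n) <= l" by auto
  hence "y (l+1) <= y j \<or> y (j+int (Suc n)) <= y l" by (simp only: knot_seq_le_iff[OF y])
  hence "bspline y (Suc n) j t = 0" using l by (intro bspline_eq_0[OF y]) auto
  thus ?thesis by simp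
 qed
qed

text \<open>The products for j-1 and j share all factors but one, so the affine combination in de
  Boor's step interpolates the linear function y - s at t and produces the factor t - s.\<close>

lemma bspline_Marsden:
 assumes y: "knot_seq y" and t: "y l <= t" "t < y (l+1)"
 shows "(\<Sum>j\<in>{l-int n..l}. (\<Prod>\<nu>=1..n. y (j+int \<nu>)-s) * bspline y (Suc n) j t) = (t-s) ^ n"
proof (induction n)
 case 0
 thus ?case using t by simp
next
 case (Suc n)
 have coef: "(\<Prod>\<nu>=1..Suc n. y (j+int \<nu>)-s)*((t-y j)/(y (j+int (Suc n))-y j)) +
   (\<Prod>\<nu>=1..Suc n. y (j-1+int \<nu>)-s)*(1-(t-y j)/(y (j+int (Suc n))-y j))
   = (t-s)*(\<Prod>\<nu>=1..n. y (j+int \<nu>)-s)" for j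
 proof -
  let ?c = "\<Prod>\<nu>=1..n. y (j+int \<nu>)-s" and ?d = "y (j+int (Suc n))-y j"
  have d: "?d \<noteq> 0" using knot_seq_less[OF y, of j "j+int (Suc n)"] by simp
  have 1: "(\<Prod>\<nu>=1..Suc n. y (j+int \<nu>)-s) = ?c*(y (j+int (Suc n))-s)"
   by (simp add: prod.nat_ivl_Suc')
  have "(\<Prod>\<nu>=1..Suc n. y (j-1+int \<nu>)-s) = (\<Prod>\<nu>\<in>{0..n}. y (j+int \<nu>)-s)"
   by (rule prod.reindex_bij_witness[of _ Suc "\<lambda>i. i-1"]) (auto simp: algebra_simps of_nat_diff)
  also have "... = (y j-s)*?c" by (simp add: prod.atLeast_Suc_atMost)
  finally have 2: "(\<Prod>\<nu>=1..Suc n. y (j-1+int \<nu>)-s) = (y j-s)*?c" .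
  have gen: "c*(b-s) * w+(a-s) * c*(1-w) = (t-s) * c" if "w*(b-a) = t-a" for c b w a
  proof -
   have "c*(b-s) * w+(a-s) * c*(1-w) = c*(w*(b-a)+a-s)" by (simp add: algebra_simps)
   thus ?thesis unfolding that by simp
  qed
  show ?thesis unfolding 1 2 by (rule gen) (use d in simp)
 qed
 show ?case
  unfolding bspline_sum_step[OF y t] coef power_Suc Suc.IH[symmetric] sum_distrib_left
  by (intro sum.cong refl) simp
qed

text \<open>The value at 0 is 0^n, hence 1 for n = 0, in agreement with the half-open intervals of
  the B-splines of order 1.\<close>

definition tpow :: "nat => real => real" where
 "tpow n u = (if 0 <= u then u ^ n else 0)"

text \<open>The weight of the knot i in the divided difference over the knots j, ..., j+n+1.\<close>

definition knot_coef :: "(int => real) => nat => int => int => real" where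
 "knot_coef y n j i = 1/(\<Prod>i'\<in>{j..j+int (Suc n)}-{i}. y i-y i')"

text \<open>The B-spline as a divided difference of truncated powers. It shows, unlike the
  recursion, that crossing a knot changes the polynomial piece only by a multiple of the n-th power
  at that knot.\<close>

lemma bspline_tpow:
 assumes y: "knot_seq y"
 shows "bspline y (Suc n) j t = (-1) ^ Suc n*(y (j+int (Suc n))-y j) *
   (\<Sum>i\<in>{j..j+int (Suc n)}. knot_coef y n j i * tpow n (t-y i))"
proof (induction n arbitrary: j)
 case 0
 have e: "{j..j+int (Suc 0)} = {j, j+1}" by auto
 have lt: "y j < y (j+1)" by (rule knot_seq_less[OF y]) simp
 have s: "{j, j+1}-{j} = {j+1}" "{j, j+1}-{j+1} = {j}" by auto
 have c: "knot_coef y 0 j j = 1/(y j-y (j+1))" "knot_coef y 0 j (j+1) = 1/(y (j+1)-y j)"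
  unfolding knot_coef_def e s by simp_all
 have "(\<Sum>i\<in>{j, j+1}. knot_coef y 0 j i * tpow 0 (t-y i)) = tpow 0 (t-y j)/(y j-y (j+1))+tpow 0 (t-y (j+1))/(y (j+1)-y j)"
  by (subst sum.insert) (simp_all add: c)
 moreover have "(y (j+1)-y j)*(u/(y j-y (j+1))+v/(y (j+1)-y j)) = v-u" for u v
 proof -
  have "u/(y j-y (j+1)) = - (u/(y (j+1)-y j))" by (metis minus_diff_eq minus_divide_right)
  hence "u/(y j-y (j+1))+v/(y (j+1)-y j) = (v-u)/(y (j+1)-y j)"
   by (simp add: diff_divide_distrib)
  thus ?thesis using lt by simp
 qed
 ultimately have S: "(y (j+1)-y j)*(\<Sum>i\<in>{j, j+1}. knot_coef y 0 j i * tpow 0 (t-y i)) = tpow 0 (t-y (j+1))-tpow 0 (t-y j)"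
  by simp
 have gen: "(-1) ^ Suc 0 * A * S = b-a" if "A * S = a-b" for A S a b :: real using that by simp
 have j1: "j+int (Suc 0) = j+1" by simp
 have "bspline y (Suc 0) j t = tpow 0 (t-y j)-tpow 0 (t-y (j+1))" using lt by (simp add: tpow_def)
 thus ?case unfolding e unfolding j1 gen[OF S] .
next
 case (Suc n)
 let ?z = "y (j+int (Suc (Suc n)))"
 let ?R = "{j..j+int (Suc (Suc n))}"
 let ?E = "\<lambda>i. knot_coef y (Suc n) j i"
 let ?T = "\<lambda>i. tpow n (t-y i)"
 have ne: "y i-y i' \<noteq> 0" if "i \<noteq> i'" for i i'
  using that knot_seq_less[OF y, of i i'] knot_seq_less[OF y, of i' i] by (cases "i < i'") auto
 \<comment> \<open>Removing a knot from a divided difference multiplies the other weights by the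
   difference to that knot. The formula gives 0 at the removed knot itself, so both sums may run
   over all knots.\<close>
 have r1: "knot_coef y n j i = ?E i*(y i-?z)" if "i \<in> {j..j+int (Suc n)}" for i
 proof -
  have "?R-{i} = insert (j+int (Suc (Suc n))) ({j..j+int (Suc n)}-{i})" using that by auto
  hence "(\<Prod>i'\<in>?R-{i}. y i-y i') = (y i-?z)*(\<Prod>i'\<in>{j..j+int (Suc n)}-{i}. y i-y i')"
   by (simp add: prod.insert)
  moreover have "y i-?z \<noteq> 0" using that by (intro ne) auto
  ultimately show ?thesis unfolding knot_coef_def by simp
 qed
 have r2: "knot_coef y n (j+1) i = ?E i*(y i-y j)" if "i \<in> {j+1..j+1+int (Suc n)}" for i
 proof -
  have "?R-{i} = insert j ({j+1..j+1+int (Suc n)}-{i})" using that by auto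
  hence "(\<Prod>i'\<in>?R-{i}. y i-y i') = (y i-y j)*(\<Prod>i'\<in>{j+1..j+1+int (Suc n)}-{i}. y i-y i')"
   by (simp add: prod.insert)
  moreover have "y i-y j \<noteq> 0" using that by (intro ne) auto
  ultimately show ?thesis unfolding knot_coef_def by simp
 qed
 have s1: "(\<Sum>i\<in>{j..j+int (Suc n)}. knot_coef y n j i*?T i) = (\<Sum>i\<in>?R. ?E i*(y i-?z)*?T i)"
 proof -
  have "(\<Sum>i\<in>{j..j+int (Suc n)}. knot_coef y n j i*?T i) = (\<Sum>i\<in>{j..j+int (Suc n)}. ?E i*(y i-?z)*?T i)"
   by (intro sum.cong refl) (simp only: r1)
  also have "... = (\<Sum>i\<in>?R. ?E i*(y i-?z)*?T i)"
  proof (rule sum.mono_neutral_left)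
   show "\<forall>i\<in>?R-{j..j+int (Suc n)}. ?E i*(y i-?z)*?T i = 0"
   proof
    fix i assume "i \<in> ?R-{j..j+int (Suc n)}"
    hence "i = j+int (Suc (Suc n))" by auto
    thus "?E i*(y i-?z)*?T i = 0" by simp
   qed
  qed auto
  finally show ?thesis .
 qed
 have s2: "(\<Sum>i\<in>{j+1..j+1+int (Suc n)}. knot_coef y n (j+1) i*?T i) = (\<Sum>i\<in>?R. ?E i*(y i-y j)*?T i)"
 proof -
  have "(\<Sum>i\<in>{j+1..j+1+int (Suc n)}. knot_coef y n (j+1) i*?T i) = (\<Sum>i\<in>{j+1..j+1+int (Suc n)}. ?E i*(y i-y j)*?T i)"
   by (intro sum.cong refl) (simp only: r2)
  also have "... = (\<Sum>i\<in>?R. ?E i*(y i-y j)*?T i)"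
  proof (rule sum.mono_neutral_left)
   show "\<forall>i\<in>?R-{j+1..j+1+int (Suc n)}. ?E i*(y i-y j)*?T i = 0"
   proof
    fix i assume "i \<in> ?R-{j+1..j+1+int (Suc n)}"
    hence "i = j" by auto
    thus "?E i*(y i-y j)*?T i = 0" by simp
   qed
  qed auto
  finally show ?thesis .
 qed
 have d1: "y (j+int (Suc n))-y j \<noteq> 0" by (rule ne) simp
 have d2: "y (j+1+int (Suc n))-y (j+1) \<noteq> 0" by (rule ne) simp
 have e: "y (j+1+int (Suc n)) = ?z" by (simp add: add.commute add.left_commute)
 have d2': "?z-y (j+1) \<noteq> 0" using d2 unfolding e .
 have u1: "(t-y j)/(y (j+int (Suc n))-y j) * bspline y (Suc n) j t =
   (-1) ^ Suc n*(t-y j)*(\<Sum>i\<in>?R. ?E i*(y i-?z)*?T i)"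
  unfolding Suc.IH s1 using d1 by simp
 have u2: "(1-(t-y (j+1))/(y (j+1+int (Suc n))-y (j+1))) * bspline y (Suc n) (j+1) t =
   (-1) ^ Suc n*(?z-t)*(\<Sum>i\<in>?R. ?E i*(y i-y j)*?T i)"
 proof -
  have gen: "(1-(t-a)/(z-a))*(s*(z-a) * S) = s*(z-t) * S" if "z-a \<noteq> 0" for a z s S
  proof -
   have "1-(t-a)/(z-a) = (z-t)/(z-a)" using that by (simp add: diff_divide_eq_iff)
   thus ?thesis using that by simp
  qed
  show ?thesis unfolding Suc.IH s2 e by (rule gen[OF d2'])
 qed
 have tp: "u * tpow n u = tpow (Suc n) u" for u by (simp add: tpow_def)
 have "bspline y (Suc (Suc n)) j t = (-1) ^ Suc n*(\<Sum>i\<in>?R. ?E i*?T i*((t-y j)*(y i-?z)+(?z-t)*(y i-y j)))"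
 proof -
  have gen: "s * a * X+s * b * Y = s*(a * X+b * Y)" for s a b X Y :: real by (simp add: algebra_simps)
  have sm: "a*(\<Sum>i\<in>?R. ?E i*(y i-?z)*?T i)+b*(\<Sum>i\<in>?R. ?E i*(y i-y j)*?T i)
    = (\<Sum>i\<in>?R. ?E i*?T i*(a*(y i-?z)+b*(y i-y j)))" for a b
   unfolding sum_distrib_left sum.distrib[symmetric]
   by (intro sum.cong refl) (simp only: distrib_left mult_ac)
  show ?thesis unfolding bspline_step[OF y] u1 u2 by (rule trans[OF gen]) (simp only: sm)
 qed
 also have "... = (-1) ^ Suc n*(\<Sum>i\<in>?R. - (?z-y j)*(?E i * tpow (Suc n) (t-y i)))"
 proof -
  have "?E i*?T i*((t-y j)*(y i-?z)+(?z-t)*(y i-y j)) = - (?z-y j)*(?E i * tpow (Suc n) (t-y i))" for i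
  proof -
   have "(t-y j)*(y i-?z)+(?z-t)*(y i-y j) = - (?z-y j)*(t-y i)" by (simp add: algebra_simps)
   hence "?E i*?T i*((t-y j)*(y i-?z)+(?z-t)*(y i-y j)) = - (?z-y j)*(?E i*((t-y i)*?T i))"
    by (simp only: mult_ac)
   thus ?thesis by (simp only: tp)
  qed
  thus ?thesis by presburger
 qed
 also have "... = (-1) ^ Suc (Suc n)*(?z-y j)*(\<Sum>i\<in>?R. ?E i * tpow (Suc n) (t-y i))"
 proof -
  have gen: "s*(- a * S) = (-1 * s) * a * S" for s a S :: real by simp
  show ?thesis unfolding sum_distrib_left[symmetric] power_Suc[of _ "Suc n"] by (rule gen)
 qed
 finally show ?case .
qed

lemma poly_eq_0_interval:
 assumes "a < b" "\<And>t. a <= t ==> t < b ==> poly_fun p t = 0"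
 shows "p = 0"
proof (rule ccontr)
 assume "p \<noteq> 0"
 hence "finite {z. poly p z = 0}" by (rule poly_roots_finite)
 moreover have "complex_of_real ` {a..<b} \<subseteq> {z. poly p z = 0}" using assms(2) by (auto simp: poly_fun_def)
 ultimately have "finite (complex_of_real ` {a..<b})" by (rule rev_finite_subset)
 hence "finite {a..<b}" by (rule finite_imageD) (simp add: inj_on_def)
 thus False using assms(1) infinite_Ico by blast
qed

lemma poly_eqI_interval:
 assumes "a < b" "\<And>t. a <= t ==> t < b ==> poly_fun p t = poly_fun r t"
 shows "p = r"
 using poly_eq_0_interval[OF assms(1), of "p-r"] assms(2) by (simp add: poly_fun_def)

lemma poly_fun_simps:
 "poly_fun (p+r) t = poly_fun p t+poly_fun r t"
 "poly_fun (p-r) t = poly_fun p t-poly_fun r t"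
 "poly_fun (smult c p) t = c * poly_fun p t"
 "poly_fun (p * r) t = poly_fun p t * poly_fun r t"
 "poly_fun (p ^ n) t = poly_fun p t ^ n"
 "poly_fun 0 t = 0" "poly_fun 1 t = 1"
 by (simp_all add: poly_fun_def)

lemma poly_fun_sum: "poly_fun (\<Sum>i\<in>A. p i) t = (\<Sum>i\<in>A. poly_fun (p i) t)"
 by (simp add: poly_fun_def poly_sum)

lemma poly_fun_lin: "poly_fun [:- of_real s, 1:] t = of_real (t-s)"
 by (simp add: poly_fun_def)

text \<open>Pieces are polynomials, not functions, so that jumps and derivatives at knots are
  available algebraically. The explicit 0 outside the support lets sums run over larger index
  sets.\<close>

definition bpiece :: "(int => real) => nat => int => int => complex poly" where
 "bpiece y k j l = (if j <= l \<and> l < j+int k then \<Sum>i\<in>{j..l}.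
   smult (of_real ((-1) ^ k*(y (j+int k)-y j) * knot_coef y (k-1) j i)) ([:- of_real (y i), 1:] ^ (k-1)) else 0)"

text \<open>For t in the l-th interval a truncated power is the full power or 0, according to
  whether its knot has index at most l. The formula also holds outside the support, which lets the
  jump be computed uniformly in l.\<close>

lemma bspline_piece_aux:
 assumes y: "knot_seq y" and t: "y l <= t" "t < y (l+1)"
 shows "of_real (bspline y (Suc n) j t) = poly_fun (\<Sum>i\<in>{j..min l (j+int (Suc n))}.
   smult (of_real ((-1) ^ Suc n*(y (j+int (Suc n))-y j) * knot_coef y n j i)) ([:- of_real (y i), 1:] ^ n)) t"
proof -
 have pos: "0 <= t-y i \<longleftrightarrow> i <= l" for i
 proof (cases "i <= l")
  case True hence "y i <= y l" using knot_seq_le_iff[OF y] by blast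
  thus ?thesis using t True by simp
 next
  case False hence "y (l+1) <= y i" using knot_seq_le_iff[OF y, of "l+1" i] by simp
  thus ?thesis using t False by simp
 qed
 have "(\<Sum>i\<in>{j..j+int (Suc n)}. knot_coef y n j i * tpow n (t-y i))
   = (\<Sum>i\<in>{j..min l (j+int (Suc n))}. knot_coef y n j i*(t-y i) ^ n)"
 proof -
  have "(\<Sum>i\<in>{j..j+int (Suc n)}. knot_coef y n j i * tpow n (t-y i)) =
   (\<Sum>i\<in>{j..min l (j+int (Suc n))}. knot_coef y n j i * tpow n (t-y i))"
   by (rule sum.mono_neutral_right) (use pos in \<open>auto simp: tpow_def\<close>)
  also have "... = (\<Sum>i\<in>{j..min l (j+int (Suc n))}. knot_coef y n j i*(t-y i) ^ n)"
   by (intro sum.cong refl) (use pos in \<open>auto simp: tpow_def\<close>)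
  finally show ?thesis .
 qed
 hence B: "bspline y (Suc n) j t = (\<Sum>i\<in>{j..min l (j+int (Suc n))}. ((-1) ^ Suc n*(y (j+int (Suc n))-y j) * knot_coef y n j i)*(t-y i) ^ n)"
  unfolding bspline_tpow[OF y] by (simp only: sum_distrib_left mult.assoc)
 show ?thesis unfolding B poly_fun_sum poly_fun_simps poly_fun_lin of_real_sum of_real_mult of_real_power ..
qed

lemma bspline_piece:
 assumes y: "knot_seq y" and t: "y l <= t" "t < y (l+1)"
 shows "complex_of_real (bspline y (Suc n) j t) = poly_fun (bpiece y (Suc n) j l) t"
proof (cases "j <= l \<and> l < j+int (Suc n)")
 case True
 hence "min l (j+int (Suc n)) = l" by simp
 thus ?thesis using bspline_piece_aux[OF y t, of n j] unfolding bpiece_def if_P[OF True] diff_Suc_1 by presburger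
next
 case False
 hence "l+1 <= j \<or> j+int (Suc n) <= l" by auto
 hence "y (l+1) <= y j \<or> y (j+int (Suc n)) <= y l" by (simp only: knot_seq_le_iff[OF y])
 hence "bspline y (Suc n) j t = 0" using t by (intro bspline_eq_0[OF y]) auto
 thus ?thesis unfolding bpiece_def if_not_P[OF False] by (simp add: poly_fun_def)
qed

lemma Pi_poly_add: "p \<in> Pi_poly k ==> r \<in> Pi_poly k ==> p+r \<in> Pi_poly k"
 unfolding Pi_poly_def mem_Collect_eq by (rule degree_add_less)

lemma Pi_poly_diff: "p \<in> Pi_poly k ==> r \<in> Pi_poly k ==> p-r \<in> Pi_poly k"
 unfolding Pi_poly_def mem_Collect_eq by (rule degree_diff_less)

lemma Pi_poly_smult: "p \<in> Pi_poly k ==> smult c p \<in> Pi_poly k"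
 unfolding Pi_poly_def mem_Collect_eq using degree_smult_le le_less_trans by blast

lemma Pi_poly_0: "0 < k ==> 0 \<in> Pi_poly k"
 unfolding Pi_poly_def by simp

lemma Pi_poly_sum: "0 < k ==> (\<And>i. i \<in> A ==> p i \<in> Pi_poly k) ==> (\<Sum>i\<in>A. p i) \<in> Pi_poly k"
 by (induction A rule: infinite_finite_induct) (auto intro: Pi_poly_add Pi_poly_0)

lemma Pi_poly_lin_power: "[:a, 1:] ^ n \<in> Pi_poly (Suc n)"
 unfolding Pi_poly_def by (simp add: degree_linear_power)

lemma Pi_poly_const: "0 < k ==> [:c:] \<in> Pi_poly k"
 unfolding Pi_poly_def by simp

lemma bpiece_Pi: "bpiece y (Suc n) j l \<in> Pi_poly (Suc n)"
proof (cases "j <= l \<and> l < j+int (Suc n)")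
 case True
 show ?thesis unfolding bpiece_def if_P[OF True] diff_Suc_1
  by (intro Pi_poly_sum Pi_poly_smult Pi_poly_lin_power) simp
next
 case False
 show ?thesis unfolding bpiece_def if_not_P[OF False] by (intro Pi_poly_0) simp
qed

text \<open>Passing from piece l-1 to piece l adds exactly the term of the knot l.\<close>

lemma bpiece_jump:
 assumes y: "knot_seq y"
 shows "\<exists>c. bpiece y (Suc n) j l-bpiece y (Suc n) j (l-1) = smult c ([:- of_real (y l), 1:] ^ n)"
proof -
 let ?g = "\<lambda>i. smult (of_real ((-1) ^ Suc n*(y (j+int (Suc n))-y j) * knot_coef y n j i)) ([:- complex_of_real (y i), 1:] ^ n)"
 let ?S = "\<lambda>l. \<Sum>i\<in>{j..min l (j+int (Suc n))}. ?g i"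
 have eq: "bpiece y (Suc n) j l = ?S l" for l
 proof (rule poly_eqI_interval)
  show "y l < y (l+1)" by (rule knot_seq_less[OF y]) simp
  fix t assume t: "y l <= t" "t < y (l+1)"
  show "poly_fun (bpiece y (Suc n) j l) t = poly_fun (?S l) t"
   unfolding bspline_piece[OF y t, symmetric] by (rule bspline_piece_aux[OF y t])
 qed
 show ?thesis
 proof (cases "j <= l \<and> l <= j+int (Suc n)")
  case True
  hence "{j..min l (j+int (Suc n))} = insert l {j..min (l-1) (j+int (Suc n))}" by auto
  moreover have "l \<notin> {j..min (l-1) (j+int (Suc n))}" by auto
  ultimately have "?S l = ?g l+?S (l-1)" by (simp only: sum.insert finite_atLeastAtMost_int simp_thms not_False_eq_True)
  hence "?S l-?S (l-1) = ?g l" by (simp only: add_diff_cancel_right')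
  thus ?thesis unfolding eq by blast
 next
  case False
  hence "{j..min l (j+int (Suc n))} = {j..min (l-1) (j+int (Suc n))}" by auto
  hence "?S l-?S (l-1) = smult 0 ([:- of_real (y l), 1:] ^ n)" by (simp only: diff_self smult_0_left)
  thus ?thesis unfolding eq by blast
 qed
qed

lemma bpiece_unity:
 assumes y: "knot_seq y"
 shows "(\<Sum>j\<in>{l-int n..l}. bpiece y (Suc n) j l) = 1"
proof (rule poly_eqI_interval)
 show "y l < y (l+1)" by (rule knot_seq_less[OF y]) simp
 fix t assume t: "y l <= t" "t < y (l+1)"
 have "poly_fun (\<Sum>j\<in>{l-int n..l}. bpiece y (Suc n) j l) t = of_real (\<Sum>j\<in>{l-int n..l}. bspline y (Suc n) j t)"
  unfolding poly_fun_sum by (simp add: bspline_piece[OF y t])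
 thus "poly_fun (\<Sum>j\<in>{l-int n..l}. bpiece y (Suc n) j l) t = poly_fun 1 t"
  by (simp add: bspline_unity[OF y t] poly_fun_simps)
qed

section \<open>The dual functionals of de Boor and Fix\<close>

definition pairing :: "nat => complex poly => complex poly => complex poly" where
 "pairing k \<psi> p = (\<Sum>\<nu><k. smult ((-1) ^ \<nu>) ((pderiv ^^ (k-\<nu> - 1)) \<psi>*(pderiv ^^ \<nu>) p))"

lemma higher_pderiv_eq_0: "p \<in> Pi_poly k ==> (pderiv ^^ k) p = 0"
proof -
 assume "p \<in> Pi_poly k"
 hence "coeff ((pderiv ^^ k) p) n = 0" for n
  unfolding Pi_poly_def by (simp add: coeff_higher_pderiv coeff_eq_0)
 thus ?thesis by (intro poly_eqI) simp
qed

text \<open>The derivative telescopes in \<nu>, and its two end terms contain a k-th derivative of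
  \<open>\<psi>\<close> or of \<open>p\<close>. Hence the pairing is constant, so that
  \<open>beta\<close> does not depend on the position of \<xi> within its interval.\<close>

lemma pderiv_pairing:
 assumes "\<psi> \<in> Pi_poly k" "p \<in> Pi_poly k"
 shows "pderiv (pairing k \<psi> p) = 0"
proof -
 define g where "g \<nu> = smult ((-1) ^ \<nu>) ((pderiv ^^ (k-\<nu>)) \<psi>*(pderiv ^^ \<nu>) p)" for \<nu>
 have "pderiv (smult ((-1) ^ \<nu>) ((pderiv ^^ (k-\<nu> - 1)) \<psi>*(pderiv ^^ \<nu>) p)) = g \<nu> - g (Suc \<nu>)" if "\<nu> < k" for \<nu>
 proof -
  from that obtain m where m: "k-\<nu> = Suc m" by (metis Suc_diff_Suc)
  hence m': "k-\<nu> - 1 = m" "k-Suc \<nu> = m" by auto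
  show ?thesis unfolding g_def m m' by (simp add: pderiv_smult pderiv_mult smult_add_right mult.commute)
 qed
 hence "pderiv (pairing k \<psi> p) = (\<Sum>\<nu><k. g \<nu> - g (Suc \<nu>))"
  unfolding pairing_def higher_pderiv_sum[of 1, simplified] by (intro sum.cong refl) auto
 also have "... = g 0-g k" by (rule sum_lessThan_telescope')
 also have "... = 0" unfolding g_def by (simp add: higher_pderiv_eq_0 assms)
 finally show ?thesis .
qed

lemma pairing_const:
 assumes "\<psi> \<in> Pi_poly k" "p \<in> Pi_poly k"
 shows "poly (pairing k \<psi> p) u = poly (pairing k \<psi> p) v"
proof -
 have "degree (pairing k \<psi> p) = 0" using pderiv_pairing[OF assms] by (simp add: pderiv_eq_0_iff)
 then obtain c where "pairing k \<psi> p = [:c:]" by (metis degree_0_id)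
 thus ?thesis by simp
qed

lemma smult_sum_right: "smult c (\<Sum>i\<in>A. p i) = (\<Sum>i\<in>A. smult c (p i))"
 by (induction A rule: infinite_finite_induct) (simp_all add: smult_add_right)

lemma pairing_linear:
 "pairing k \<psi> (p+r) = pairing k \<psi> p+pairing k \<psi> r"
 "pairing k \<psi> (smult c p) = smult c (pairing k \<psi> p)"
 "pairing k (smult c \<psi>) p = smult c (pairing k \<psi> p)"
 "pairing k (\<psi>+\<phi>) p = pairing k \<psi> p+pairing k \<phi> p"
 "pairing k \<psi> 0 = 0" "pairing k 0 p = 0"
 unfolding pairing_def
 by (simp_all add: higher_pderiv_add higher_pderiv_smult sum.distrib[symmetric] smult_add_right distrib_left distrib_right smult_sum_right mult.commute)

lemma pairing_sum:
 "pairing k \<psi> (\<Sum>i\<in>A. p i) = (\<Sum>i\<in>A. pairing k \<psi> (p i))"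
 "pairing k (\<Sum>i\<in>A. p i) r = (\<Sum>i\<in>A. pairing k (p i) r)"
 by (induction A rule: infinite_finite_induct) (simp_all add: pairing_linear)

lemma higher_pderiv_lin_power:
 fixes a :: complex
 shows "\<nu> <= n ==> (pderiv ^^ \<nu>) ([:a, 1:] ^ n) = smult (fact n/fact (n-\<nu>)) ([:a, 1:] ^ (n-\<nu>))"
proof (induction \<nu>)
 case (Suc \<nu>)
 then obtain m where m: "n-\<nu> = Suc m" "n-Suc \<nu> = m" by (metis Suc_diff_Suc Suc_le_lessD)
 have "(pderiv ^^ Suc \<nu>) ([:a, 1:] ^ n) = pderiv (smult (fact n/fact (Suc m)) ([:a, 1:] ^ Suc m))"
  using Suc m by simp
 also have "... = smult (fact n/fact (Suc m)) (smult (of_nat (Suc m)) ([:a, 1:] ^ m)*[:1:])"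
  unfolding pderiv_smult pderiv_power_Suc by (simp add: pderiv_pCons)
 also have "... = smult (fact n/fact (Suc m) * of_nat (Suc m)) ([:a, 1:] ^ m)" by simp
 also have "fact n/fact (Suc m) * of_nat (Suc m) = (fact n/fact m :: complex)"
  unfolding fact_Suc by (simp del: of_nat_Suc)
 finally show ?case using m by simp
qed simp

definition dual_poly :: "(int => real) => nat => int => complex poly" where
 "dual_poly y k j = smult (1/fact (k-1)) (\<Prod>\<nu>=1..k-1. [:- complex_of_real (y (j+int \<nu>)), 1:])"

text \<open>Evaluation at 0 is as good as at any point, the pairing being constant on polynomials of
  degree below k.\<close>

definition dual :: "(int => real) => nat => int => complex poly => complex" where
 "dual y k j p = poly (pairing k (dual_poly y k j) p) 0"

lemma degree_prod_lin: "degree (\<Prod>\<nu>=1..n. [:- c \<nu>, 1:] :: complex poly) = n"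
 by (subst degree_prod_sum_eq) auto

lemma dual_poly_Pi: "dual_poly y (Suc n) j \<in> Pi_poly (Suc n)"
 unfolding dual_poly_def by (intro Pi_poly_smult) (simp only: Pi_poly_def mem_Collect_eq degree_prod_lin diff_Suc_1 lessI)

lemma dual_eval:
 "p \<in> Pi_poly (Suc n) ==> dual y (Suc n) j p = poly (pairing (Suc n) (dual_poly y (Suc n) j) p) u"
 unfolding dual_def by (rule pairing_const[OF dual_poly_Pi])

lemma dual_linear:
 "dual y k j (p+r) = dual y k j p+dual y k j r"
 "dual y k j (smult c p) = c * dual y k j p"
 "dual y k j 0 = 0"
 unfolding dual_def by (simp_all add: pairing_linear)

lemma dual_diff: "dual y k j (p-r) = dual y k j p-dual y k j r"
 using dual_linear(1)[of y k j p "smult (-1) r"] dual_linear(2)[of y k j "-1" r] by simp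

lemma dual_sum: "dual y k j (\<Sum>i\<in>A. p i) = (\<Sum>i\<in>A. dual y k j (p i))"
 by (induction A rule: infinite_finite_induct) (simp_all add: dual_linear)

text \<open>At \<open>u\<close> only the n-th derivative of the power survives, so each pairing
  reduces to one summand.\<close>

lemma pairing_lin_power:
 assumes p: "p \<in> Pi_poly (Suc n)"
 shows "poly (pairing (Suc n) ([:- u, 1:] ^ n) p) u = fact n * poly p u"
  and "poly (pairing (Suc n) p ([:- u, 1:] ^ n)) u = (-1) ^ n * fact n * poly p u"
proof -
 have z: "poly ((pderiv ^^ \<nu>) ([:- u, 1:] ^ n)) u = (if \<nu> = n then fact n else 0)" if "\<nu> <= n" for \<nu>
  using higher_pderiv_lin_power[OF that, of "- u"] that by (auto simp: poly_power power_0_left)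
 have "poly (pairing (Suc n) ([:- u, 1:] ^ n) p) u = (\<Sum>\<nu><Suc n. if \<nu> = 0 then fact n * poly p u else 0)"
  unfolding pairing_def poly_sum
 proof (intro sum.cong refl)
  fix \<nu> assume "\<nu> \<in> {..<Suc n}"
  hence "poly ((pderiv ^^ (Suc n-\<nu> - 1)) ([:- u, 1:] ^ n)) u = (if \<nu> = 0 then fact n else 0)"
   by (subst z) auto
  thus "poly (smult ((-1) ^ \<nu>) ((pderiv ^^ (Suc n-\<nu> - 1)) ([:- u, 1:] ^ n)*(pderiv ^^ \<nu>) p)) u =
   (if \<nu> = 0 then fact n * poly p u else 0)" by auto
 qed
 thus "poly (pairing (Suc n) ([:- u, 1:] ^ n) p) u = fact n * poly p u" by simp
 have "poly (pairing (Suc n) p ([:- u, 1:] ^ n)) u = (\<Sum>\<nu><Suc n. if \<nu> = n then (-1) ^ n * fact n * poly p u else 0)"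
  unfolding pairing_def poly_sum
 proof (intro sum.cong refl)
  fix \<nu> assume "\<nu> \<in> {..<Suc n}"
  hence "poly ((pderiv ^^ \<nu>) ([:- u, 1:] ^ n)) u = (if \<nu> = n then fact n else 0)" by (subst z) auto
  thus "poly (smult ((-1) ^ \<nu>) ((pderiv ^^ (Suc n-\<nu> - 1)) p*(pderiv ^^ \<nu>) ([:- u, 1:] ^ n))) u =
   (if \<nu> = n then (-1) ^ n * fact n * poly p u else 0)" by auto
 qed
 thus "poly (pairing (Suc n) p ([:- u, 1:] ^ n)) u = (-1) ^ n * fact n * poly p u" by simp
qed

text \<open>Pairing a polynomial with \<open>(x - t)\<^sup>n\<close> evaluates it at \<open>t\<close>, so Marsden's identity, read as an
 identity between polynomials in the dual variable, becomes the reproduction formula.\<close>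

lemma dual_reproduces:
 assumes y: "knot_seq y" and t: "y l <= t" "t < y (l+1)" and p: "p \<in> Pi_poly (Suc n)"
 shows "poly_fun p t = (\<Sum>j\<in>{l-int n..l}. dual y (Suc n) j p * of_real (bspline y (Suc n) j t))"
proof -
 let ?t = "complex_of_real t"
 have "smult (1/fact n) ([:- ?t, 1:] ^ n) = (\<Sum>j\<in>{l-int n..l}. smult (of_real (bspline y (Suc n) j t)) (dual_poly y (Suc n) j))"
 proof (rule poly_eqI_interval)
  show "(0::real) < 1" by simp
  fix s :: real
  have "poly_fun (\<Sum>j\<in>{l-int n..l}. smult (of_real (bspline y (Suc n) j t)) (dual_poly y (Suc n) j)) s =
   (\<Sum>j\<in>{l-int n..l}. of_real (1/fact n*(bspline y (Suc n) j t*(\<Prod>\<nu>=1..n. s-y (j+int \<nu>)))))"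
   unfolding poly_fun_sum by (intro sum.cong refl) (simp add: poly_fun_def dual_poly_def poly_prod)
  also have "... = of_real (1/fact n*((-1) ^ n*(\<Sum>j\<in>{l-int n..l}. (\<Prod>\<nu>=1..n. y (j+int \<nu>)-s) * bspline y (Suc n) j t)))"
  proof -
   have "(\<Prod>\<nu>=1..n. s-y (j+int \<nu>)) = (-1) ^ n*(\<Prod>\<nu>=1..n. y (j+int \<nu>)-s)" for j
   proof -
    have "(\<Prod>\<nu>=1..n. s-y (j+int \<nu>)) = (\<Prod>\<nu>=1..n. (-1)*(y (j+int \<nu>)-s))" by (intro prod.cong refl) simp
    also have "... = (-1) ^ n*(\<Prod>\<nu>=1..n. y (j+int \<nu>)-s)" by (subst prod.distrib) simp
    finally show ?thesis .
   qed
   hence "1/fact n*(bspline y (Suc n) j t*(\<Prod>\<nu>=1..n. s-y (j+int \<nu>))) =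
    1/fact n*((-1) ^ n*((\<Prod>\<nu>=1..n. y (j+int \<nu>)-s) * bspline y (Suc n) j t))" for j
    by (simp only: mult_ac)
   thus ?thesis by (simp only: of_real_sum sum_distrib_left)
  qed
  also have "... = of_real (1/fact n*((-1) ^ n*(t-s) ^ n))" unfolding bspline_Marsden[OF y t] ..
  also have "(-1) ^ n*(t-s) ^ n = (s-t) ^ n" by (simp add: power_mult_distrib[symmetric])
  also have "complex_of_real (1/fact n*(s-t) ^ n) = poly_fun (smult (1/fact n) ([:- ?t, 1:] ^ n)) s"
   by (simp add: poly_fun_simps poly_fun_lin)
  finally show "poly_fun (smult (1/fact n) ([:- ?t, 1:] ^ n)) s =
   poly_fun (\<Sum>j\<in>{l-int n..l}. smult (of_real (bspline y (Suc n) j t)) (dual_poly y (Suc n) j)) s" ..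
 qed
 hence "poly (pairing (Suc n) (smult (1/fact n) ([:- ?t, 1:] ^ n)) p) ?t =
  (\<Sum>j\<in>{l-int n..l}. of_real (bspline y (Suc n) j t) * poly (pairing (Suc n) (dual_poly y (Suc n) j) p) ?t)"
  by (simp add: pairing_sum pairing_linear poly_sum)
 moreover have "poly (pairing (Suc n) (smult (1/fact n) ([:- ?t, 1:] ^ n)) p) ?t = poly_fun p t"
  by (simp add: pairing_linear pairing_lin_power(1)[OF p] poly_fun_def)
 ultimately show ?thesis by (simp add: dual_eval[OF p, of y _ ?t] mult.commute)
qed

text \<open>Pairing with the n-th power at \<open>y i\<close> evaluates the dual polynomial at
  \<open>y i\<close>, and the interior knots of the support are its roots. Hence the functional does
  not see the jumps of a spline at these knots.\<close>

lemma dual_knot_power: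
 assumes y: "knot_seq y" and i: "j < i" "i < j+int (Suc n)"
 shows "dual y (Suc n) j ([:- of_real (y i), 1:] ^ n) = 0"
proof -
 define \<nu> where "\<nu> = nat (i-j)"
 have \<nu>: "\<nu> \<in> {1..n}" "i = j+int \<nu>" using i by (auto simp: \<nu>_def)
 have "poly (dual_poly y (Suc n) j) (of_real (y i)) = 0"
  unfolding dual_poly_def using \<nu> by (auto simp: poly_prod intro!: prod_zero)
 thus ?thesis
  using dual_eval[OF Pi_poly_lin_power, of y n j _ "of_real (y i)"] pairing_lin_power(2)[OF dual_poly_Pi] by simp
qed

lemma dual_1: "dual y (Suc n) j 1 = 1"
proof -
 have z: "(pderiv ^^ \<nu>) (1 :: complex poly) = (if \<nu> = 0 then 1 else 0)" for \<nu>
  by (cases \<nu>) (simp_all add: funpow_swap1)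
 have "pairing (Suc n) (dual_poly y (Suc n) j) 1 = (\<Sum>\<nu><Suc n. if \<nu> = 0 then (pderiv ^^ n) (dual_poly y (Suc n) j) else 0)"
  unfolding pairing_def z by (intro sum.cong refl) auto
 hence "dual y (Suc n) j 1 = coeff ((pderiv ^^ n) (dual_poly y (Suc n) j)) 0"
  unfolding dual_def by (simp add: poly_0_coeff_0)
 also have "... = fact n * coeff (dual_poly y (Suc n) j) n"
  by (simp add: coeff_higher_pderiv pochhammer_fact)
 also have "coeff (dual_poly y (Suc n) j) n = 1/fact n * lead_coeff (\<Prod>\<nu>=1..n. [:- complex_of_real (y (j+int \<nu>)), 1:])"
  unfolding dual_poly_def degree_prod_lin by simp
 also have "lead_coeff (\<Prod>\<nu>=1..n. [:- complex_of_real (y (j+int \<nu>)), 1:]) = 1"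
  unfolding lead_coeff_prod by simp
 finally show ?thesis by simp
qed

text \<open>The jump condition expresses that derivatives up to order k-2 are continuous at every
  knot.\<close>

definition spline :: "(int => real) => nat => (int => complex poly) => bool" where
 "spline y k p \<longleftrightarrow> (\<forall>l. p l \<in> Pi_poly k \<and> (\<exists>c. p l-p (l-1) = smult c ([:- of_real (y l), 1:] ^ (k-1))))"

lemma spline_bpiece: "knot_seq y ==> spline y (Suc n) (bpiece y (Suc n) j)"
 unfolding spline_def using bpiece_Pi bpiece_jump by simp

lemma spline_dual_indep:
 assumes y: "knot_seq y" and p: "spline y (Suc n) p"
  and l: "j <= l" "l < j+int (Suc n)" "j <= l'" "l' < j+int (Suc n)"
 shows "dual y (Suc n) j (p l) = dual y (Suc n) j (p l')"
proof -
 have *: "dual y (Suc n) j (p (j+int i)) = dual y (Suc n) j (p j)" if "i < Suc n" for i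
  using that
 proof (induction i)
  case (Suc i)
  obtain c where c: "p (j+int (Suc i))-p (j+int (Suc i)-1) = smult c ([:- of_real (y (j+int (Suc i))), 1:] ^ n)"
   using p[unfolded spline_def, rule_format, of "j+int (Suc i)"] by auto
  have "dual y (Suc n) j (p (j+int (Suc i)))-dual y (Suc n) j (p (j+int (Suc i)-1)) = 0"
   unfolding dual_diff[symmetric] c dual_linear using Suc.prems by (subst dual_knot_power[OF y]) auto
  thus ?case using Suc by simp
 qed simp
 have "l = j+int (nat (l-j))" "l' = j+int (nat (l'-j))" using l by auto
 thus ?thesis using *[of "nat (l-j)"] *[of "nat (l'-j)"] l by auto
qed

text \<open>For i different from j the functional is moved to that end interval of its support on
  which the i-th B-spline vanishes. The diagonal value then follows from the partition of unity and
  \<open>dual_1\<close>.\<close>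

lemma dual_bpiece:
 assumes y: "knot_seq y" and l: "j <= l" "l < j+int (Suc n)"
 shows "dual y (Suc n) j (bpiece y (Suc n) i l) = (if i = j then 1 else 0)"
proof -
 have 1: "dual y (Suc n) j (bpiece y (Suc n) i l) = 0" if "i \<noteq> j" "j <= l" "l < j+int (Suc n)" for i l
 proof (cases "j < i")
  case True
  have "dual y (Suc n) j (bpiece y (Suc n) i l) = dual y (Suc n) j (bpiece y (Suc n) i j)"
   by (rule spline_dual_indep[OF y spline_bpiece[OF y]]) (use that in auto)
  also have "bpiece y (Suc n) i j = 0" unfolding bpiece_def using True by simp
  finally show ?thesis by (simp add: dual_linear)
 next
  case False
  have "dual y (Suc n) j (bpiece y (Suc n) i l) = dual y (Suc n) j (bpiece y (Suc n) i (j+int n))"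
   by (rule spline_dual_indep[OF y spline_bpiece[OF y]]) (use that in auto)
  also have "bpiece y (Suc n) i (j+int n) = 0" unfolding bpiece_def using False that(1) by simp
  finally show ?thesis by (simp add: dual_linear)
 qed
 have "1 = dual y (Suc n) j (\<Sum>i\<in>{l-int n..l}. bpiece y (Suc n) i l)"
  unfolding bpiece_unity[OF y] dual_1 ..
 also have "... = (\<Sum>i\<in>{l-int n..l}. if i = j then dual y (Suc n) j (bpiece y (Suc n) j l) else 0)"
  unfolding dual_sum
 proof (intro sum.cong refl)
  fix i
  show "dual y (Suc n) j (bpiece y (Suc n) i l) = (if i = j then dual y (Suc n) j (bpiece y (Suc n) j l) else 0)"
   using 1[OF _ l, of i] by (cases "i = j") simp_all
 qed
 also have "... = dual y (Suc n) j (bpiece y (Suc n) j l)" using l by (simp add: sum.delta)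
 finally show ?thesis using 1[OF _ l] by auto
qed

definition cpiece :: "(int => real) => nat => (int => complex) => int => complex poly" where
 "cpiece y k a l = (\<Sum>j\<in>{l-int (k-1)..l}. smult (a j) (bpiece y k j l))"

lemma cpiece_Pi: "cpiece y (Suc n) a l \<in> Pi_poly (Suc n)"
 unfolding cpiece_def by (intro Pi_poly_sum Pi_poly_smult bpiece_Pi) simp

lemma cpiece_eq:
 assumes "finite A" "{l-int n..l} \<subseteq> A"
 shows "cpiece y (Suc n) a l = (\<Sum>j\<in>A. smult (a j) (bpiece y (Suc n) j l))"
 unfolding cpiece_def diff_Suc_1
 by (rule sum.mono_neutral_left) (use assms in \<open>auto simp: bpiece_def\<close>)

lemma spline_cpiece:
 assumes y: "knot_seq y" shows "spline y (Suc n) (cpiece y (Suc n) a)"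
 unfolding spline_def
proof (intro allI conjI cpiece_Pi)
 fix l
 let ?A = "{l-int n-1..l}"
 have "\<forall>j. \<exists>c. bpiece y (Suc n) j l-bpiece y (Suc n) j (l-1) = smult c ([:- of_real (y l), 1:] ^ n)"
  using bpiece_jump[OF y] by blast
 then obtain c where c: "\<And>j. bpiece y (Suc n) j l-bpiece y (Suc n) j (l-1) = smult (c j) ([:- of_real (y l), 1:] ^ n)"
  by metis
 have "cpiece y (Suc n) a l-cpiece y (Suc n) a (l-1) = (\<Sum>j\<in>?A. smult (a j) (bpiece y (Suc n) j l-bpiece y (Suc n) j (l-1)))"
 proof -
  have "cpiece y (Suc n) a l = (\<Sum>j\<in>?A. smult (a j) (bpiece y (Suc n) j l))" by (rule cpiece_eq) auto
  moreover have "cpiece y (Suc n) a (l-1) = (\<Sum>j\<in>?A. smult (a j) (bpiece y (Suc n) j (l-1)))" by (rule cpiece_eq) auto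
  ultimately show ?thesis by (simp only: sum_subtractf smult_diff_right)
 qed
 also have "... = smult (\<Sum>j\<in>?A. a j * c j) ([:- of_real (y l), 1:] ^ n)"
  unfolding c smult_smult smult_sum ..
 finally show "\<exists>c. cpiece y (Suc n) a l-cpiece y (Suc n) a (l-1) = smult c ([:- of_real (y l), 1:] ^ (Suc n-1))"
  unfolding diff_Suc_1 by blast
qed

lemma dual_cpiece:
 assumes y: "knot_seq y" and l: "j <= l" "l < j+int (Suc n)"
 shows "dual y (Suc n) j (cpiece y (Suc n) a l) = a j"
proof -
 have "dual y (Suc n) j (cpiece y (Suc n) a l) = (\<Sum>i\<in>{l-int n..l}. if i = j then a j else 0)"
  unfolding cpiece_def dual_sum dual_linear dual_bpiece[OF y l] diff_Suc_1 by (intro sum.cong refl) auto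
 also have "... = a j" using l by (simp add: sum.delta)
 finally show ?thesis .
qed

lemma poly_fun_cpiece:
 assumes y: "knot_seq y" and t: "y l <= t" "t < y (l+1)"
 shows "poly_fun (cpiece y (Suc n) a l) t = (\<Sum>j\<in>{l-int n..l}. a j * of_real (bspline y (Suc n) j t))"
 unfolding cpiece_def poly_fun_sum poly_fun_simps bspline_piece[OF y t] diff_Suc_1 ..

text \<open>The Curry-Schoenberg theorem with explicit coefficients. Each piece is reproduced by its
  own dual values, and jumps do not change these, so the coefficient of j may be read off any
  interval \<open>s j\<close> of the support.\<close>

lemma spline_eq_cpiece:
 assumes y: "knot_seq y" and p: "spline y (Suc n) p" and s: "\<And>j. j <= s j \<and> s j < j+int (Suc n)"
 shows "p l = cpiece y (Suc n) (\<lambda>j. dual y (Suc n) j (p (s j))) l"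
proof (rule poly_eqI_interval)
 show "y l < y (l+1)" by (rule knot_seq_less[OF y]) simp
 fix t assume t: "y l <= t" "t < y (l+1)"
 have "p l \<in> Pi_poly (Suc n)" using p by (simp add: spline_def)
 from dual_reproduces[OF y t this]
 have "poly_fun (p l) t = (\<Sum>j\<in>{l-int n..l}. dual y (Suc n) j (p l) * of_real (bspline y (Suc n) j t))" .
 also have "... = (\<Sum>j\<in>{l-int n..l}. dual y (Suc n) j (p (s j)) * of_real (bspline y (Suc n) j t))"
 proof (intro sum.cong refl arg_cong2[where f="(*)"])
  fix j assume "j \<in> {l-int n..l}"
  thus "dual y (Suc n) j (p l) = dual y (Suc n) j (p (s j))"
   using s[of j] by (intro spline_dual_indep[OF y p]) auto
 qed
 finally show "poly_fun (p l) t = poly_fun (cpiece y (Suc n) (\<lambda>j. dual y (Suc n) j (p (s j))) l) t"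
  unfolding poly_fun_cpiece[OF y t] .
qed

text \<open>Order 2 is the first continuous order. In the recursion the affine weights may be
  clamped to [0,1], because the B-splines they multiply vanish wherever clamping changes them; what
  remains are products of bounded Lipschitz functions.\<close>

lemma bspline_Lipschitz:
 "\<exists>C>0. \<forall>y h j s t. knot_seq y --> h > 0 --> (\<forall>i. h <= y (i+1)-y i) -->
   \<bar>bspline y (Suc (Suc n)) j s-bspline y (Suc (Suc n)) j t\<bar> <= C/h*\<bar>s-t\<bar>"
proof (induction n)
 case 0
 have "\<bar>bspline y (Suc (Suc 0)) j s-bspline y (Suc (Suc 0)) j t\<bar> <= 1/h*\<bar>s-t\<bar>"
  if y: "knot_seq y" and h: "h > 0" "\<And>i. h <= y (i+1)-y i" for y h j s t
 proof -
  let ?a = "y j" and ?b = "y (j+1)" and ?c = "y (j+1+1)"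
  have g: "h <= ?b-?a" "h <= ?c-?b" using h(2) by blast+
  define u where "u t = (t-?a)/(?b-?a)" for t
  define v where "v t = (?c-t)/(?c-?b)" for t
  have v': "1-(t-?b)/(?c-?b) = v t" for t
   unfolding v_def using g h(1) by (simp add: diff_divide_eq_iff)
  have hat: "bspline y (Suc (Suc 0)) j t = max 0 (min (u t) (v t))" for t
  proof -
   have "bspline y (Suc (Suc 0)) j t = u t*(if ?a <= t \<and> t < ?b then 1 else 0)+v t*(if ?b <= t \<and> t < ?c then 1 else 0)"
    unfolding bspline_step[OF y] by (simp add: v'[symmetric] u_def)
   moreover have "u t <= 0" if "t < ?a" unfolding u_def using that g h(1) by (intro divide_nonpos_pos) auto
   moreover have "0 <= u t" if "?a <= t" unfolding u_def using that g h(1) by (intro divide_nonneg_pos) auto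
   moreover have "u t <= 1" if "t < ?b" unfolding u_def using that g h(1) by (simp add: divide_le_eq)
   moreover have "1 <= u t" if "?b <= t" unfolding u_def using that g h(1) by (simp add: le_divide_eq)
   moreover have "v t <= 0" if "?c <= t" unfolding v_def using that g h(1) by (intro divide_nonpos_pos) auto
   moreover have "0 <= v t" if "t < ?c" unfolding v_def using that g h(1) by (intro divide_nonneg_pos) auto
   moreover have "v t <= 1" if "?b <= t" unfolding v_def using that g h(1) by (simp add: divide_le_eq)
   moreover have "1 <= v t" if "t < ?b" unfolding v_def using that g h(1) by (simp add: le_divide_eq)
   ultimately show ?thesis using g h(1)
    by (cases "t < ?a"; cases "t < ?b"; cases "t < ?c") (auto simp: max_def min_def)
  qed
  have L: "\<bar>(s-t)/d\<bar> <= 1/h*\<bar>s-t\<bar>" if "h <= d" for d s t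
   using that h(1) by (simp add: abs_divide divide_left_mono)
  have "u s-u t = (s-t)/(?b-?a)" "v s-v t = (t-s)/(?c-?b)"
   unfolding u_def v_def by (simp_all add: diff_divide_distrib[symmetric])
  hence "\<bar>u s-u t\<bar> <= 1/h*\<bar>s-t\<bar>" "\<bar>v s-v t\<bar> <= 1/h*\<bar>s-t\<bar>"
   using L[OF g(1), of s t] L[OF g(2), of t s] by (simp_all add: abs_minus_commute)
  thus ?thesis unfolding hat by (simp add: max_def min_def abs_if split: if_splits)
 qed
 thus ?case using zero_less_one by blast
next
 case (Suc n)
 obtain C where C: "C > 0" "\<And>y h j s t. knot_seq y ==> h > 0 ==> (\<And>i. h <= y (i+1)-y i) ==>
   \<bar>bspline y (Suc (Suc n)) j s-bspline y (Suc (Suc n)) j t\<bar> <= C/h*\<bar>s-t\<bar>"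
  using Suc.IH by blast
 have "\<bar>bspline y (Suc (Suc (Suc n))) j s-bspline y (Suc (Suc (Suc n))) j t\<bar> <= 2*(1+C)/h*\<bar>s-t\<bar>"
  if y: "knot_seq y" and h: "h > 0" "\<And>i. h <= y (i+1)-y i" for y h j s t
 proof -
  let ?B = "\<lambda>j. bspline y (Suc (Suc n)) j"
  define d where "d j = y (j+int (Suc (Suc n)))-y j" for j
  define c where "c j t = max 0 (min 1 ((t-y j)/d j))" for j t
  have d: "h <= d j" for j
  proof -
   have "h <= y (j+1)-y j" by (rule h(2))
   also have "y (j+1) <= y (j+int (Suc (Suc n)))" by (simp add: knot_seq_le_iff[OF y])
   finally show ?thesis by (simp add: d_def)
  qed
  have out: "?B j t = 0" if "(t-y j)/d j < 0 \<or> 1 < (t-y j)/d j" for j t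
  proof (rule bspline_eq_0[OF y])
   have "0 < d j" using d h(1) less_le_trans by blast
   thus "t < y j \<or> y (j+int (Suc (Suc n))) <= t"
    using that by (auto simp: divide_less_0_iff less_divide_eq d_def)
  qed
  have e1: "(t-y j)/d j*?B j t = c j t*?B j t" for j t
   using out[of t j] by (cases "(t-y j)/d j < 0 \<or> 1 < (t-y j)/d j") (auto simp: c_def max_def min_def)
  have e2: "(1-(t-y j)/d j)*?B j t = (1-c j t)*?B j t" for j t
   using e1[of t j] by (simp only: left_diff_distrib)
  have cL: "\<bar>c j s-c j t\<bar> <= 1/h*\<bar>s-t\<bar>" for j
  proof -
   have "\<bar>c j s-c j t\<bar> <= \<bar>(s-y j)/d j-(t-y j)/d j\<bar>" unfolding c_def by (simp add: max_def min_def abs_if split: if_splits)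
   also have "... = \<bar>s-t\<bar>/d j" using d[of j] h(1) by (simp add: diff_divide_distrib[symmetric] abs_divide)
   also have "... <= \<bar>s-t\<bar>/h" using d[of j] h(1) by (intro divide_left_mono) auto
   finally show ?thesis by simp
  qed
  have c01: "0 <= c j t" "c j t <= 1" for j t by (auto simp: c_def)
  have B01: "0 <= ?B j t" "?B j t <= 1" for j t using bspline_nonneg[OF y] bspline_le_1[OF y] by blast+
  have pr: "\<bar>a * b-a' * b'\<bar> <= e1+e2" if "\<bar>a-a'\<bar> <= e1" "\<bar>b-b'\<bar> <= e2" "0 <= b" "b <= 1" "0 <= a'" "a' <= 1"
   for a a' b b' e1 e2 :: real
  proof -
   have "a * b-a' * b' = (a-a') * b+a'*(b-b')" by (simp add: algebra_simps)
   hence "\<bar>a * b-a' * b'\<bar> <= \<bar>a-a'\<bar> * b+a'*\<bar>b-b'\<bar>"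
    using abs_triangle_ineq[of "(a-a') * b" "a'*(b-b')"] that(3,5) by (simp add: abs_mult)
   also have "... <= \<bar>a-a'\<bar>*1+1*\<bar>b-b'\<bar>" using that by (intro add_mono mult_mono) auto
   also have "... = \<bar>a-a'\<bar>+\<bar>b-b'\<bar>" by simp
   finally show ?thesis using that(1,2) by linarith
  qed
  have BL: "\<bar>?B j s-?B j t\<bar> <= C/h*\<bar>s-t\<bar>" for j by (rule C(2)[OF y h])
  have t1: "\<bar>c j s*?B j s-c j t*?B j t\<bar> <= 1/h*\<bar>s-t\<bar>+C/h*\<bar>s-t\<bar>" for j
   by (rule pr[OF cL BL B01 c01])
  have t2: "\<bar>(1-c j s)*?B j s-(1-c j t)*?B j t\<bar> <= 1/h*\<bar>s-t\<bar>+C/h*\<bar>s-t\<bar>" for j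
  proof (rule pr[OF _ BL B01])
   show "\<bar>(1-c j s)-(1-c j t)\<bar> <= 1/h*\<bar>s-t\<bar>" using cL[of j] by linarith
   show "0 <= 1-c j t" "1-c j t <= 1" using c01[of j t] by auto
  qed
  have st: "bspline y (Suc (Suc (Suc n))) j r = c j r*?B j r+(1-c (j+1) r)*?B (j+1) r" for r
   unfolding bspline_step[OF y, of "Suc n" j r] d_def[symmetric] e1 e2 ..
  have "\<bar>bspline y (Suc (Suc (Suc n))) j s-bspline y (Suc (Suc (Suc n))) j t\<bar> <= 2*(1/h*\<bar>s-t\<bar>+C/h*\<bar>s-t\<bar>)"
  proof -
   have "\<bar>a+b-(a'+b')\<bar> <= 2 * e" if "\<bar>a-a'\<bar> <= e" "\<bar>b-b'\<bar> <= e" for a b a' b' e :: real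
    using that by linarith
   from this[OF t1[of j] t2[of "j+1"]] show ?thesis unfolding st .
  qed
  also have "... = 2*(1+C)/h*\<bar>s-t\<bar>" by (simp add: add_divide_distrib distrib_right)
  finally show ?thesis .
 qed
 moreover have "2*(1+C) > 0" using C(1) by simp
 ultimately show ?case by blast
qed

section \<open>Multilevel partitions\<close>

lemma Bernoulli_powr:
 assumes "0 <= u" "1 <= (p::real)" shows "u <= (u powr p+(p-1))/p"
proof (cases "u = 0")
 case False
 have "(u powr p) powr (1/p)*1 powr (1-1/p) <= 1/p*(u powr p)+(1-1/p)*1"
  using assms False by (intro Youngs_inequality_0) auto
 hence "u <= 1/p*(u powr p)+(1-1/p)" using assms by (simp add: powr_powr)
 also have "... = (u powr p+(p-1))/p" using assms by (simp add: add_divide_distrib diff_divide_distrib)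
 finally show ?thesis .
qed (use assms in auto)

text \<open>Jensen's inequality for weights of total at most \<open>W\<close>. The tangent
  inequality \<open>Bernoulli_powr\<close> is scaled by \<open>c\<close>, the p-th power mean of
  \<open>x\<close>, for which the two resulting terms add up to at most c times W.\<close>

lemma power_mean:
 fixes w x :: "'a => real"
 assumes A: "finite A" and w: "\<And>i. i \<in> A ==> 0 <= w i" and x: "\<And>i. i \<in> A ==> 0 <= x i" and p: "1 <= p"
  and W: "(\<Sum>i\<in>A. w i) <= W" "0 < W"
 shows "(\<Sum>i\<in>A. w i * x i) powr p <= W powr (p-1)*(\<Sum>i\<in>A. w i * x i powr p)"
proof (cases "(\<Sum>i\<in>A. w i * x i powr p) = 0")
 case True
 hence "\<forall>i\<in>A. w i * x i powr p = 0"
  using A w by (subst (asm) sum_nonneg_eq_0_iff) auto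
 hence "\<forall>i\<in>A. w i * x i = 0" by auto
 hence "(\<Sum>i\<in>A. w i * x i) = 0" by (intro sum.neutral) auto
 thus ?thesis using True by simp
next
 case False
 define S where "S = (\<Sum>i\<in>A. w i * x i powr p)"
 have S: "S > 0" unfolding S_def using False w by (metis (no_types, lifting) less_eq_real_def mult_nonneg_nonneg powr_ge_zero sum_nonneg)
 define c where "c = (S/W) powr (1/p)"
 have c: "c > 0" "c powr p = S/W" using S W p by (auto simp: c_def powr_powr)
 have "(\<Sum>i\<in>A. w i * x i) <= (\<Sum>i\<in>A. w i*(c*(((x i/c) powr p+(p-1))/p)))"
 proof (intro sum_mono mult_left_mono w)
  fix i assume i: "i \<in> A"
  have "x i = c*(x i/c)" using c by simp
  also have "... <= c*(((x i/c) powr p+(p-1))/p)"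
   using c x[OF i] p by (intro mult_left_mono Bernoulli_powr) auto
  finally show "x i <= c*(((x i/c) powr p+(p-1))/p)" .
 qed
 also have "... = (\<Sum>i\<in>A. c/p/c powr p*(w i * x i powr p)+c/p*(p-1) * w i)"
 proof (rule sum.cong[OF refl])
  fix i
  have gen: "a*(c*((z/d+(p-1))/p)) = c/p/d*(a * z)+c/p*(p-1) * a" for a z d
   using p by (simp add: add_divide_distrib distrib_left mult_ac)
  show "w i*(c*(((x i/c) powr p+(p-1))/p)) = c/p/c powr p*(w i * x i powr p)+c/p*(p-1) * w i"
   unfolding powr_divide by (rule gen)
 qed
 also have "... = c/p/c powr p * S+c/p*(p-1)*(\<Sum>i\<in>A. w i)"
  unfolding sum.distrib sum_distrib_left[symmetric] S_def ..
 also have "... <= c/p/c powr p * S+c/p*(p-1) * W"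
  using c p W by (intro add_left_mono mult_left_mono) auto
 also have "... = c * W"
 proof -
  have "c/p/c powr p * S = c/p * W" using c(2) S W by simp
  moreover have "r * W+r*(p-1) * W = r * p * W" for r by (simp add: algebra_simps)
  moreover have "c/p * p = c" using p by simp
  ultimately show ?thesis by (simp only:)
 qed
 finally have "(\<Sum>i\<in>A. w i * x i) powr p <= (c * W) powr p"
  using p w x by (intro powr_mono2) (auto intro!: sum_nonneg)
 also have "... = S/W * W powr p" using c W by (simp add: powr_mult)
 also have "... = W powr (p-1) * S" using W by (simp add: powr_diff)
 finally show ?thesis unfolding S_def .
qed

lemma powr_sum_subadd:
 fixes c :: "'a => real"
 assumes A: "finite A" and c: "\<And>i. i \<in> A ==> 0 <= c i" and p: "0 < p" "p <= 1"
 shows "(\<Sum>i\<in>A. c i) powr p <= (\<Sum>i\<in>A. c i powr p)"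
proof (cases "(\<Sum>i\<in>A. c i) = 0")
 case True thus ?thesis using p by (simp add: sum_nonneg)
next
 case False
 define S where "S = (\<Sum>i\<in>A. c i)"
 have S: "S > 0" using False c sum_nonneg[of A c] unfolding S_def by force
 have "S powr p = (\<Sum>i\<in>A. c i/S) * S powr p" unfolding sum_divide_distrib[symmetric] using S by (simp add: S_def)
 also have "... <= (\<Sum>i\<in>A. (c i/S) powr p) * S powr p"
 proof (intro mult_right_mono sum_mono)
  fix i assume i: "i \<in> A"
  have "c i <= S" unfolding S_def using A c i by (intro member_le_sum) auto
  hence "(c i/S) powr 1 <= (c i/S) powr p" using p S c[OF i] by (intro powr_mono') auto
  thus "c i/S <= (c i/S) powr p" using c[OF i] S by simp
 qed simp
 also have "... = (\<Sum>i\<in>A. c i powr p)" using S by (simp add: powr_divide sum_divide_distrib[symmetric])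
 finally show ?thesis unfolding S_def .
qed

lemma le_powr_sum:
 fixes c :: "'a => real"
 assumes "finite A" "\<And>i. i \<in> A ==> 0 <= c i" "0 < p" "i \<in> A"
 shows "c i <= (\<Sum>i\<in>A. c i powr p) powr (1/p)"
proof -
 have "c i powr p <= (\<Sum>i\<in>A. c i powr p)" using assms by (intro member_le_sum) auto
 hence "(c i powr p) powr (1/p) <= (\<Sum>i\<in>A. c i powr p) powr (1/p)" using assms by (intro powr_mono2) auto
 thus ?thesis using assms by (simp add: powr_powr)
qed

text \<open>The origin of the exponent 1/max q \<tau>. For \<tau> at most q, the surplus power
  q-\<tau> is absorbed into the l^\<tau> norm and \<theta>^(1/q) remains; for larger \<tau>,
  Jensen's inequality with exponent \<tau>/q leaves \<theta>^(1/\<tau>).\<close>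

lemma weighted_lp_bound:
 fixes w \<alpha> :: "'a => real"
 assumes A: "finite A" and w: "\<And>i. i \<in> A ==> 0 <= w i" "\<And>i. i \<in> A ==> w i <= \<theta>" "(\<Sum>i\<in>A. w i) <= 1"
  and \<alpha>: "\<And>i. i \<in> A ==> 0 <= \<alpha> i" and q: "1 <= q" and \<tau>: "0 < \<tau>" and \<theta>: "0 < \<theta>"
 shows "(\<Sum>i\<in>A. w i*\<alpha> i powr q) <= (\<theta> powr (1/max q \<tau>)*(\<Sum>i\<in>A. \<alpha> i powr \<tau>) powr (1/\<tau>)) powr q"
proof (cases "\<tau> <= q")
 case True
 define B where "B = (\<Sum>i\<in>A. \<alpha> i powr \<tau>) powr (1/\<tau>)"
 have B0: "0 <= B" by (simp add: B_def)
 have BT: "B powr \<tau> = (\<Sum>i\<in>A. \<alpha> i powr \<tau>)" unfolding B_def using \<tau> by (simp add: powr_powr sum_nonneg)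
 have le: "\<alpha> i <= B" if "i \<in> A" for i unfolding B_def by (rule le_powr_sum[OF A \<alpha> \<tau> that])
 have "(\<Sum>i\<in>A. w i*\<alpha> i powr q) <= (\<Sum>i\<in>A. \<theta>*(\<alpha> i powr \<tau> * B powr (q-\<tau>)))"
 proof (intro sum_mono mult_mono w(2))
  fix i assume i: "i \<in> A"
  have "\<alpha> i powr q = \<alpha> i powr \<tau>*\<alpha> i powr (q-\<tau>)" by (simp add: powr_add[symmetric])
  also have "... <= \<alpha> i powr \<tau> * B powr (q-\<tau>)"
   using True \<alpha>[OF i] le[OF i] by (intro mult_left_mono powr_mono2) auto
  finally show "\<alpha> i powr q <= \<alpha> i powr \<tau> * B powr (q-\<tau>)" .
 qed (use \<theta> in auto)
 also have "... = \<theta>*(B powr \<tau> * B powr (q-\<tau>))" unfolding sum_distrib_left[symmetric] sum_distrib_right[symmetric] BT ..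
 also have "... = \<theta> * B powr q" by (simp add: powr_add[symmetric])
 also have "... = (\<theta> powr (1/max q \<tau>) * B) powr q" using True q \<theta> B0 by (simp add: powr_mult powr_powr max_def)
 finally show ?thesis unfolding B_def .
next
 case False
 define S where "S = (\<Sum>i\<in>A. \<alpha> i powr \<tau>)"
 have S0: "0 <= S" by (simp add: S_def sum_nonneg)
 have "(\<Sum>i\<in>A. w i*\<alpha> i powr q) powr (\<tau>/q) <= 1 powr (\<tau>/q-1)*(\<Sum>i\<in>A. w i*(\<alpha> i powr q) powr (\<tau>/q))"
  by (rule power_mean[OF A w(1) _ _ w(3)]) (use False q in auto)
 also have "... = (\<Sum>i\<in>A. w i*\<alpha> i powr \<tau>)" using q by (simp add: powr_powr)
 also have "... <= (\<Sum>i\<in>A. \<theta>*\<alpha> i powr \<tau>)" by (intro sum_mono mult_right_mono w) auto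
 also have "... = \<theta> * S" by (simp add: S_def sum_distrib_left)
 finally have "((\<Sum>i\<in>A. w i*\<alpha> i powr q) powr (\<tau>/q)) powr (q/\<tau>) <= (\<theta> * S) powr (q/\<tau>)"
  using q \<tau> by (intro powr_mono2) auto
 hence "(\<Sum>i\<in>A. w i*\<alpha> i powr q) <= (\<theta> * S) powr (q/\<tau>)"
  using q \<tau> w by (simp add: powr_powr sum_nonneg)
 also have "... = (\<theta> powr (1/max q \<tau>) * S powr (1/\<tau>)) powr q"
  using False q \<tau> \<theta> S0 by (simp add: powr_mult powr_powr max_def)
 finally show ?thesis unfolding S_def .
qed

lemma geometric_int_sum:
 fixes \<delta> :: real
 assumes "finite A" "0 < \<delta>" "\<delta> < 1"
 shows "(\<Sum>n\<in>A. \<delta> ^ nat \<bar>n-m\<bar>) <= 2/(1-\<delta>)"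
proof -
 have 1: "(\<Sum>n\<in>B. \<delta> ^ nat \<bar>n-m\<bar>) <= 1/(1-\<delta>)" if "finite B" "inj_on (\<lambda>n. nat \<bar>n-m\<bar>) B" for B
 proof -
  have "(\<Sum>n\<in>B. \<delta> ^ nat \<bar>n-m\<bar>) = (\<Sum>i\<in>(\<lambda>n. nat \<bar>n-m\<bar>) ` B. \<delta> ^ i)"
   using that by (simp add: sum.reindex)
  also have "... <= (\<Sum>i. \<delta> ^ i)" using that assms by (intro sum_le_suminf summable_geometric) auto
  also have "... = 1/(1-\<delta>)" using assms by (intro suminf_geometric) auto
  finally show ?thesis .
 qed
 have "A = {n\<in>A. m <= n} \<union> {n\<in>A. n < m}" by auto
 hence "(\<Sum>n\<in>A. \<delta> ^ nat \<bar>n-m\<bar>) = (\<Sum>n\<in>{n\<in>A. m <= n}. \<delta> ^ nat \<bar>n-m\<bar>)+(\<Sum>n\<in>{n\<in>A. n < m}. \<delta> ^ nat \<bar>n-m\<bar>)"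
  using assms(1) by (subst sum.union_disjoint[symmetric]) auto
 also have "... <= 1/(1-\<delta>)+1/(1-\<delta>)"
  using assms(1) by (intro add_mono 1) (auto simp: inj_on_def)
 finally show ?thesis by simp
qed

text \<open>A discrete Hardy inequality. For \<tau> at most 1 the power is subadditive, which puts
  the exponent \<tau> on the ratio; for larger \<tau> convexity preserves the ratio. Hence
  \<open>min 1 \<tau>\<close>.\<close>

lemma Hardy_geometric:
 fixes b :: "int => real"
 assumes A: "finite A" and \<delta>: "0 < \<delta>" "\<delta> < 1" and b: "\<And>n. n \<in> A ==> 0 <= b n" and \<tau>: "0 < \<tau>"
 shows "(\<Sum>n\<in>A. \<delta> ^ nat \<bar>n-m\<bar> * b n) powr \<tau> <=
  (2/(1-\<delta>)) powr \<tau>*(\<Sum>n\<in>A. (\<delta> powr min 1 \<tau>) ^ nat \<bar>n-m\<bar> * b n powr \<tau>)"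
proof -
 have W1: "1 <= 2/(1-\<delta>)" using \<delta> by (simp add: le_divide_eq)
 show ?thesis
 proof (cases "\<tau> <= 1")
  case True
  have "(\<Sum>n\<in>A. \<delta> ^ nat \<bar>n-m\<bar> * b n) powr \<tau> <= (\<Sum>n\<in>A. (\<delta> ^ nat \<bar>n-m\<bar> * b n) powr \<tau>)"
   using \<delta> b \<tau> True by (intro powr_sum_subadd[OF A]) auto
  also have "... = (\<Sum>n\<in>A. (\<delta> powr min 1 \<tau>) ^ nat \<bar>n-m\<bar> * b n powr \<tau>)"
   using True \<delta> by (intro sum.cong refl) (simp add: powr_mult powr_realpow[symmetric] powr_powr mult.commute)
  also have "... <= (2/(1-\<delta>)) powr \<tau>*(\<Sum>n\<in>A. (\<delta> powr min 1 \<tau>) ^ nat \<bar>n-m\<bar> * b n powr \<tau>)"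
   using mult_right_mono[OF ge_one_powr_ge_zero[OF W1, of \<tau>]] \<tau>
   by (metis (no_types, lifting) less_imp_le mult_1 mult_nonneg_nonneg powr_ge_zero sum_nonneg zero_le_power)
  finally show ?thesis .
 next
  case False
  have "(\<Sum>n\<in>A. \<delta> ^ nat \<bar>n-m\<bar> * b n) powr \<tau> <= (2/(1-\<delta>)) powr (\<tau> - 1)*(\<Sum>n\<in>A. \<delta> ^ nat \<bar>n-m\<bar> * b n powr \<tau>)"
   using \<delta> b False by (intro power_mean[OF A] geometric_int_sum[OF A]) auto
  also have "... <= (2/(1-\<delta>)) powr \<tau>*(\<Sum>n\<in>A. \<delta> ^ nat \<bar>n-m\<bar> * b n powr \<tau>)"
   using \<delta> W1 by (intro mult_right_mono powr_mono sum_nonneg) auto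
  finally show ?thesis using False \<delta> by simp
 qed
qed

section \<open>Lengths and knots across the levels\<close>

definition len :: "knots => int => int => real" where
 "len x m j = x m (j+1)-x m j"

text \<open>Interval 0 represents its level; the others are comparable to it with factor
  \<open>lam\<close>.\<close>

definition mesh :: "knots => int => real" where
 "mesh x m = len x m 0"

locale multilevel =
 fixes M\<^sub>0 :: nat and lam :: real and x :: knots
 assumes reg: "regular_multilevel_partition M\<^sub>0 lam x" and lam: "1 <= lam"
begin

abbreviation "mnI q m i \<equiv> mn q (x m i) (x m (i+1))"

text \<open>A child of length L has a sibling of length at least L/lam, so the parent has length at
  least L + L/lam, which is L/rho.\<close>

definition "rho = lam/(1+lam)"

lemma rho: "0 < rho" "rho < 1" using lam by (auto simp: rho_def)

lemma knots: "knot_seq (x m)"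
 unfolding knot_seq_def
proof (intro conjI allI)
 show sm: "strict_mono (x m)" using reg by (simp add: regular_multilevel_partition_def)
 fix t
 have "t \<in> (\<Union>j. level_interval x m j)" using reg by (simp add: regular_multilevel_partition_def)
 then obtain j where j: "x m j <= t" "t <= x m (j+1)" by (auto simp: level_interval_def)
 show "\<exists>l. x m l <= t \<and> t < x m (l+1)"
 proof (cases "t < x m (j+1)")
  case False
  hence "t = x m (j+1)" using j by simp
  moreover have "x m (j+1) < x m (j+1+1)" using sm by (simp add: strict_mono_less)
  ultimately show ?thesis by (intro exI[of _ "j+1"]) auto
 qed (use j in blast)
qed

lemma x_less_iff: "x m i < x m j \<longleftrightarrow> i < j" by (rule knot_seq_less_iff[OF knots])
lemma x_le_iff: "x m i <= x m j \<longleftrightarrow> i <= j" by (rule knot_seq_le_iff[OF knots])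
lemma x_eq_iff: "x m i = x m j \<longleftrightarrow> i = j" by (metis order_antisym order_refl x_le_iff)

lemma x_cover: obtains l where "x m l <= t" "t < x m (l+1)"
 using knots unfolding knot_seq_def by blast

lemma len_pos: "0 < len x m j" by (simp add: len_def x_less_iff)
lemma mesh_pos: "0 < mesh x m" by (simp add: mesh_def len_pos)

lemma len_le: "len x m i <= lam * len x m j"
 using reg by (simp add: regular_multilevel_partition_def len_def)

lemma len_le_mesh: "len x m i <= lam * mesh x m" and mesh_le_len: "mesh x m <= lam * len x m i"
 using len_le by (auto simp: mesh_def)

lemma mesh_le_len': "mesh x m/lam <= len x m i"
 using mesh_le_len[of m i] lam by (simp add: divide_le_eq mult.commute)

lemma x_diff_bounds:
 assumes "i <= j"
 shows "x m j-x m i <= real_of_int (j-i)*(lam * mesh x m)" "real_of_int (j-i)*(mesh x m/lam) <= x m j-x m i"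
proof -
 have "x m (i+int n)-x m i <= real n*(lam * mesh x m) \<and> real n*(mesh x m/lam) <= x m (i+int n)-x m i" for n
 proof (induction n)
  case (Suc n)
  have "x m (i+int (Suc n))-x m (i+int n) = len x m (i+int n)" by (simp add: len_def add.commute add.left_commute)
  thus ?case using Suc len_le_mesh[of m "i+int n"] mesh_le_len'[of m "i+int n"]
   by (simp add: distrib_right add_divide_distrib)
 qed simp
 from this[of "nat (j-i)"] assms show "x m j-x m i <= real_of_int (j-i)*(lam * mesh x m)"
  "real_of_int (j-i)*(mesh x m/lam) <= x m j-x m i" by auto
qed

lemma parent: obtains j where "x m j <= x (m+1) i" "x (m+1) (i+1) <= x m (j+1)"
proof -
 obtain j where "level_interval x (m+1) i \<subseteq> level_interval x m j"
  using reg unfolding regular_multilevel_partition_def by blast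
 moreover have "x (m+1) i <= x (m+1) (i+1)" by (simp add: x_le_iff)
 ultimately show ?thesis using that unfolding level_interval_def by (auto simp: atLeastatMost_subset_iff)
qed

text \<open>A coarse knot strictly inside a fine interval would lie strictly inside the coarse
  parent of that interval, between two consecutive knots of its own level.\<close>

lemma knots_nested_Suc: "x m j \<in> range (x (m+1))"
proof -
 obtain i where i: "x (m+1) i <= x m j" "x m j < x (m+1) (i+1)" by (rule x_cover)
 obtain j' where j': "x m j' <= x (m+1) i" "x (m+1) (i+1) <= x m (j'+1)" by (rule parent)
 have "x (m+1) i = x m j"
 proof (rule ccontr)
  assume "x (m+1) i \<noteq> x m j"
  hence "x m j' < x m j" "x m j < x m (j'+1)" using i j' by auto
  thus False by (simp add: x_less_iff)
 qed
 thus ?thesis by (metis rangeI)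
qed

lemma knots_nested:
 assumes "m <= n" shows "range (x m) \<subseteq> range (x n)"
proof -
 have "range (x m) \<subseteq> range (x (m+int N))" for N
 proof (induction N)
  case (Suc N)
  have "x (m+int N) j \<in> range (x (m+int N+1))" for j by (rule knots_nested_Suc)
  hence "range (x (m+int N)) \<subseteq> range (x (m+int N+1))" by blast
  thus ?case using Suc by (simp add: add.commute add.left_commute)
 qed simp
 from this[of "nat (n-m)"] assms show ?thesis by simp
qed

lemma child_len:
 assumes j: "x m j <= x (m+1) i" "x (m+1) (i+1) <= x m (j+1)"
 shows "len x (m+1) i <= rho * len x m j"
proof -
 let ?S = "{i. level_interval x (m+1) i \<subseteq> level_interval x m j}"
 have S: "i \<in> ?S \<longleftrightarrow> x m j <= x (m+1) i \<and> x (m+1) (i+1) <= x m (j+1)" for i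
  using x_le_iff[of "m+1" i "i+1"] by (auto simp: level_interval_def atLeastatMost_subset_iff)
 have c2: "2 <= card ?S" using reg unfolding regular_multilevel_partition_def by blast
 have "\<exists>i'\<in>?S. i' \<noteq> i"
 proof (rule ccontr)
  assume "\<not> (\<exists>i'\<in>?S. i' \<noteq> i)"
  hence "?S \<subseteq> {i}" by blast
  hence "card ?S <= card {i}" by (intro card_mono) auto
  with c2 show False by simp
 qed
 then obtain i' where i': "i' \<in> ?S" "i' \<noteq> i" by blast
 have i'b: "x m j <= x (m+1) i'" "x (m+1) (i'+1) <= x m (j+1)" using i'(1) S by blast+
 have "len x (m+1) i+len x (m+1) i' <= len x m j"
 proof (cases "i < i'")
  case True
  hence "x (m+1) (i+1) <= x (m+1) i'" by (simp add: x_le_iff)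
  thus ?thesis unfolding len_def using i'b j by linarith
 next
  case False
  hence "x (m+1) (i'+1) <= x (m+1) i" using i'(2) by (simp add: x_le_iff)
  thus ?thesis unfolding len_def using i'b j by linarith
 qed
 moreover have "len x (m+1) i <= lam * len x (m+1) i'" by (rule len_le)
 ultimately have "len x (m+1) i+lam * len x (m+1) i <= lam * len x m j"
  using lam mult_left_mono[of "len x (m+1) i+len x (m+1) i'" "len x m j" lam] by (simp add: distrib_left)
 thus ?thesis using lam unfolding rho_def by (simp add: field_simps)
qed

lemma ancestor_len: "\<exists>j. x m j <= x (m+int N) i \<and> x (m+int N) (i+1) <= x m (j+1) \<and> len x (m+int N) i <= rho ^ N * len x m j"
proof (induction N arbitrary: i)
 case 0
 show ?case by (intro exI[of _ i]) simp
next
 case (Suc N)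
 have e: "m+int (Suc N) = m+int N+1" by simp
 obtain i' where i': "x (m+int N) i' <= x (m+int N+1) i" "x (m+int N+1) (i+1) <= x (m+int N) (i'+1)" by (rule parent)
 obtain j where j: "x m j <= x (m+int N) i'" "x (m+int N) (i'+1) <= x m (j+1)" "len x (m+int N) i' <= rho ^ N * len x m j"
  using Suc.IH by blast
 have "len x (m+int N+1) i <= rho * len x (m+int N) i'" by (rule child_len[OF i'])
 also have "... <= rho*(rho ^ N * len x m j)" using j(3) rho by (intro mult_left_mono) auto
 finally have "len x (m+int N+1) i <= rho ^ Suc N * len x m j" by simp
 thus ?case unfolding e using i' j by (intro exI[of _ j]) auto
qed

lemma mesh_decay:
 assumes "m <= n" shows "mesh x n <= lam * rho ^ nat (n-m) * mesh x m"
proof -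
 obtain j where "len x (m+int (nat (n-m))) 0 <= rho ^ nat (n-m) * len x m j"
  using ancestor_len by blast
 hence "mesh x n <= rho ^ nat (n-m) * len x m j" using assms by (simp add: mesh_def)
 also have "... <= rho ^ nat (n-m)*(lam * mesh x m)" using rho by (intro mult_left_mono len_le_mesh) auto
 finally show ?thesis by (simp add: mult_ac)
qed

lemma mesh_mono: "m <= n ==> mesh x n <= lam * mesh x m"
proof -
 assume "m <= n"
 hence "mesh x n <= lam * rho ^ nat (n-m) * mesh x m" by (rule mesh_decay)
 also have "... <= lam*1 * mesh x m"
  using rho lam mesh_pos[of m] by (intro mult_right_mono mult_left_mono power_le_one) auto
 finally show ?thesis by simp
qed

text \<open>Two consecutive coarse knots have fine indices a and b, and the b-a intervals between
  them are the children, at most \<open>M\<^sub>0\<close> in number.\<close>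

lemma mesh_le_child: "mesh x m <= real M\<^sub>0 * lam * mesh x (m+1)"
proof -
 obtain a where a: "x m 0 = x (m+1) a" using knots_nested_Suc[of m 0] by blast
 obtain b where b: "x m 1 = x (m+1) b" using knots_nested_Suc[of m 1] by blast
 have "x (m+1) a < x (m+1) b" using x_less_iff[of m 0 1] a b by simp
 hence ab: "a < b" by (simp add: x_less_iff)
 have "{i. level_interval x (m+1) i \<subseteq> level_interval x m 0} = {a..b-1}"
 proof -
  have "level_interval x (m+1) i \<subseteq> level_interval x m 0 \<longleftrightarrow> a <= i \<and> i+1 <= b" for i
   using x_le_iff[of "m+1" i "i+1"] by (simp add: level_interval_def atLeastatMost_subset_iff a b x_le_iff)
  thus ?thesis by auto
 qed
 moreover have "card {i. level_interval x (m+1) i \<subseteq> level_interval x m 0} <= M\<^sub>0"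
  using reg unfolding regular_multilevel_partition_def by blast
 ultimately have c: "b-a <= int M\<^sub>0" by simp
 have "mesh x m = x (m+1) b-x (m+1) a" by (simp add: mesh_def len_def a b)
 also have "... <= real_of_int (b-a)*(lam * mesh x (m+1))" using ab by (intro x_diff_bounds) simp
 also have "... <= real M\<^sub>0*(lam * mesh x (m+1))"
  using c lam mesh_pos[of "m+1"] by (intro mult_right_mono) (auto simp: of_int_le_iff[symmetric, where 'a=real] simp del: of_int_le_iff)
 finally show ?thesis by simp
qed

lemma mesh_small: assumes "0 < L" shows "\<exists>n0\<ge>0. \<forall>n\<ge>n0. mesh x n < L"
proof -
 have "(\<lambda>N. lam * rho ^ N * mesh x 0) \<longlonglongrightarrow> lam*0 * mesh x 0"
  using rho by (intro tendsto_intros LIMSEQ_power_zero) auto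
 hence "\<forall>\<^sub>F N in sequentially. lam * rho ^ N * mesh x 0 < L" using assms by (intro order_tendstoD) auto
 then obtain N0 where N0: "\<And>N. N \<ge> N0 ==> lam * rho ^ N * mesh x 0 < L" unfolding eventually_sequentially by blast
 show ?thesis
 proof (intro exI[of _ "int N0"] conjI allI impI)
  fix n assume "int N0 <= n"
  thus "mesh x n < L" using mesh_decay[of 0 n] N0[of "nat n"] by force
 qed simp
qed

lemma mesh_large: "\<exists>n0\<ge>0. \<forall>n\<ge>n0. L < mesh x (- n)"
proof -
 define L' where "L' = max L 1"
 have L': "L' > 0" "L <= L'" by (auto simp: L'_def)
 have "(\<lambda>N. L'*(lam * rho ^ N)) \<longlonglongrightarrow> L'*(lam*0)"
  using rho by (intro tendsto_intros LIMSEQ_power_zero) auto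
 hence "\<forall>\<^sub>F N in sequentially. L'*(lam * rho ^ N) < mesh x 0" using mesh_pos[of 0] by (intro order_tendstoD) auto
 then obtain N0 where N0: "\<And>N. N \<ge> N0 ==> L'*(lam * rho ^ N) < mesh x 0" unfolding eventually_sequentially by blast
 show ?thesis
 proof (intro exI[of _ "int N0"] conjI allI impI)
  fix n assume n: "int N0 <= n"
  have "L'*(lam * rho ^ nat n) < mesh x 0" using N0[of "nat n"] n by force
  also have "... <= lam * rho ^ nat n * mesh x (- n)" using mesh_decay[of "- n" 0] n by simp
  finally have "(lam * rho ^ nat n) * L' < (lam * rho ^ nat n) * mesh x (- n)" by (simp add: mult_ac)
  hence "L' < mesh x (- n)" using lam rho by (subst (asm) mult_less_cancel_left_pos) auto
  thus "L < mesh x (- n)" using L' by simp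
 qed simp
qed

text \<open>\<open>mesh\<close> is monotone only up to the factor \<open>lam\<close>, so the level
  is found as a crossing between the two ends of the scale.\<close>

lemma mesh_scale: assumes "0 < L" obtains m where "L <= mesh x m" "mesh x (m+1) < L"
proof -
 obtain n0 where n0: "n0 \<ge> 0" "\<forall>n\<ge>n0. mesh x n < L" using mesh_small[OF assms] by blast
 obtain n1 where n1: "n1 \<ge> 0" "\<forall>n\<ge>n1. L < mesh x (- n)" using mesh_large by blast
 have "\<exists>m. L <= mesh x m \<and> mesh x (m+1) < L"
 proof (rule ccontr)
  assume *: "\<not> (\<exists>m. L <= mesh x m \<and> mesh x (m+1) < L)"
  have "L <= mesh x (- n1+int N)" for N
  proof (induction N)
   case 0
   thus ?case using n1 by (simp add: less_imp_le)
  next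
   case (Suc N)
   hence "L <= mesh x (- n1+int N+1)" using * by (metis not_less)
   moreover have "- n1+int N+1 = - n1+int (Suc N)" by simp
   ultimately show ?case by (simp only:)
  qed
  from this[of "nat (n0+n1)"] n0 n1 show False by force
 qed
 thus ?thesis using that by blast
qed

lemma knot_count:
 "finite {j. A <= x m j \<and> x m j <= B}" "0 <= D ==> B-A <= D * mesh x m ==> real (card {j. A <= x m j \<and> x m j <= B}) <= 2 * D * lam+3"
proof -
 let ?S = "{j. A <= x m j \<and> x m j <= B}"
 have diff: "\<bar>real_of_int (i-j)\<bar> <= D * lam" if "i \<in> ?S" "j \<in> ?S" "B-A <= D * mesh x m" for i j D
 proof -
  have *: "real_of_int (i-j) <= D * lam" if "j <= i" "i \<in> ?S" "j \<in> ?S" for i j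
  proof -
   have "real_of_int (i-j)*(mesh x m/lam) <= x m i-x m j" using that by (intro x_diff_bounds)
   also have "... <= B-A" using that by auto
   also have "... <= D * mesh x m" by fact
   finally have "real_of_int (i-j) * mesh x m <= D * lam * mesh x m" using lam by (simp add: field_simps)
   thus ?thesis using mesh_pos[of m] by simp
  qed
  show ?thesis using *[of j i] *[of i j] that by (cases "j <= i") auto
 qed
 have sub: "?S \<subseteq> {j-\<lceil>D * lam\<rceil>..j+\<lceil>D * lam\<rceil>}" if "j \<in> ?S" "B-A <= D * mesh x m" for j D
 proof
  fix i assume i: "i \<in> ?S"
  have "\<bar>real_of_int (i-j)\<bar> <= D * lam" by (rule diff[OF i that])
  hence "real_of_int \<bar>i-j\<bar> <= real_of_int \<lceil>D * lam\<rceil>" using le_of_int_ceiling[of "D * lam"] by linarith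
  hence "\<bar>i-j\<bar> <= \<lceil>D * lam\<rceil>" by (simp only: of_int_le_iff)
  thus "i \<in> {j-\<lceil>D * lam\<rceil>..j+\<lceil>D * lam\<rceil>}" by auto
 qed
 show fin: "finite ?S"
 proof (cases "?S = {}")
  case False
  then obtain j where "j \<in> ?S" by blast
  thus ?thesis using sub[of j "(B-A)/mesh x m"] mesh_pos[of m] by (auto intro: finite_subset)
 qed (simp only: finite.emptyI)
 assume D: "0 <= D" "B-A <= D * mesh x m"
 show "real (card ?S) <= 2 * D * lam+3"
 proof (cases "?S = {}")
  case True
  have "0 <= 2 * D * lam+3" using D lam by simp
  thus ?thesis unfolding True by simp
 next
  case False
  then obtain j where j: "j \<in> ?S" by blast
  have "card ?S <= card {j-\<lceil>D * lam\<rceil>..j+\<lceil>D * lam\<rceil>}" by (rule card_mono[OF _ sub[OF j D(2)]]) simp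
  also have "... = nat (2*\<lceil>D * lam\<rceil>+1)" by simp
  finally have "real (card ?S) <= real (nat (2*\<lceil>D * lam\<rceil>+1))" by simp
  also have "... = 2 * real_of_int \<lceil>D * lam\<rceil>+1"
  proof -
   have "0 <= \<lceil>D * lam\<rceil>" using D lam by (simp add: zero_le_ceiling less_le_trans[of "-1" 0])
   thus ?thesis by simp
  qed
  also have "... <= 2*(D * lam+1)+1"
   using mult_left_mono[OF of_int_ceiling_le_add_one[of "D * lam"], of 2] by simp
  finally show ?thesis by (simp add: mult.assoc)
 qed
qed

end

section \<open>Spline series of one level and their decay\<close>

lemma powr_le_cancel: "0 < q ==> 0 <= b ==> a powr q <= b powr q ==> a <= (b::real)"
 using powr_less_mono2[of q b a] by (meson not_less)

text \<open>A fixed choice for each order, so that the constants derived from it are common to all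
  partitions.\<close>

definition bspline_Lip :: "nat => real" where
 "bspline_Lip k = (SOME C. C > 0 \<and> (\<forall>y h j s t. knot_seq y --> h > 0 --> (\<forall>i. h <= y (i+1)-y i) -->
   \<bar>bspline y k j s-bspline y k j t\<bar> <= C/h*\<bar>s-t\<bar>))"

lemma bspline_Lip:
 assumes "2 <= k"
 shows "bspline_Lip k > 0"
  "knot_seq y ==> h > 0 ==> (\<And>i. h <= y (i+1)-y i) ==>
   \<bar>bspline y k j s-bspline y k j t\<bar> <= bspline_Lip k/h*\<bar>s-t\<bar>"
proof -
 obtain n where k: "k = Suc (Suc n)" using assms by (metis add_2_eq_Suc le_Suc_ex)
 have "bspline_Lip k > 0 \<and> (\<forall>y h j s t. knot_seq y --> h > 0 --> (\<forall>i. h <= y (i+1)-y i) -->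
   \<bar>bspline y k j s-bspline y k j t\<bar> <= bspline_Lip k/h*\<bar>s-t\<bar>)"
  unfolding bspline_Lip_def k by (rule someI_ex) (rule bspline_Lipschitz)
 thus "bspline_Lip k > 0"
  "knot_seq y ==> h > 0 ==> (\<And>i. h <= y (i+1)-y i) ==>
   \<bar>bspline y k j s-bspline y k j t\<bar> <= bspline_Lip k/h*\<bar>s-t\<bar>" by blast+
qed

definition lev :: "knots => nat => (int \<times> int => complex) => int => real => complex" where
 "lev x k a m t = (\<Sum>\<^sub>\<infinity>j. a (m, j) * phi x k m j t)"

text \<open>The closed inequalities also admit B-splines that merely touch the interval; the set
  serves every point of \<open>{u..v}\<close> and still has bounded cardinality on comparable or
  coarser levels.\<close>

definition supp_idx :: "knots => nat => int => real => real => int set" where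
 "supp_idx x k m u v = {j. x m j <= v \<and> u <= x m (j+int k)}"

lemma Lq_norm_degenerate: "1 <= q ==> \<not> a < b ==> Lq_norm q {a..b} f = 0"
proof (cases "a = b")
 case True
 assume q: "1 <= q"
 have "AE x in lebesgue. x \<noteq> a" by (simp add: AE_lborel_singleton AE_completion)
 hence "AE t in lebesgue. t \<in> {a..b} --> 0 = f t" unfolding True[symmetric] by (rule eventually_mono) auto
 from Lq_AE_cong(2)[OF this, of q] q show ?thesis by simp
qed (auto simp: Lq_empty)

lemma Lq_split:
 assumes y: "knot_seq y" and q: "1 <= q" and f: "f \<in> Lq q {y a..y b}"
 shows "Lq_norm q {y a..y b} f powr q <= (\<Sum>l\<in>{a..<b}. Lq_norm q {y l..y (l+1)} f powr q)"
proof (cases "a < b")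
 case True
 let ?g = "\<lambda>l x. cmod (cut {y l..y (l+1)} f x) powr q"
 have sub: "{y l..y (l+1)} \<subseteq> {y a..y b}" if "l \<in> {a..<b}" for l
  using that knot_seq_le_iff[OF y, of a l] knot_seq_le_iff[OF y, of "l+1" b] by auto
 have fl: "f \<in> Lq q {y l..y (l+1)}" if "l \<in> {a..<b}" for l
  by (rule Lq_subset(1)[OF q f sub[OF that]]) simp
 have pw: "cmod (cut {y a..y b} f x) powr q <= (\<Sum>l\<in>{a..<b}. ?g l x)" for x
 proof (cases "x \<in> {y a..y b}")
  case True
  obtain l where l: "y l <= x" "x < y (l+1)" using y unfolding knot_seq_def by blast
  have "\<exists>l\<in>{a..<b}. x \<in> {y l..y (l+1)}"
  proof (cases "l < b")
   case True
   have "\<not> l+1 <= a" using l \<open>x \<in> _\<close> knot_seq_le_iff[OF y, of "l+1" a] by auto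
   thus ?thesis using True l by (intro bexI[of _ l]) auto
  next
   case False
   hence "y b <= y l" using knot_seq_le_iff[OF y] by simp
   hence "x = y b" using l \<open>x \<in> _\<close> by auto
   thus ?thesis using \<open>a < b\<close> knot_seq_le_iff[OF y, of "b-1" b] by (intro bexI[of _ "b-1"]) auto
  qed
  then obtain l where "l \<in> {a..<b}" "x \<in> {y l..y (l+1)}" by blast
  hence "cmod (cut {y a..y b} f x) powr q = ?g l x" using True by simp
  also have "... <= (\<Sum>l\<in>{a..<b}. ?g l x)" by (rule member_le_sum) (use \<open>l \<in> _\<close> in auto)
  finally show ?thesis .
 qed (simp add: sum_nonneg)
 have "Lq_norm q {y a..y b} f powr q <= (LINT x|lebesgue. (\<Sum>l\<in>{a..<b}. ?g l x))"
  unfolding Lq_norm_powr[OF q]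
  by (intro integral_mono pw Bochner_Integration.integrable_sum Lq_integrable f fl)
 also have "... = (\<Sum>l\<in>{a..<b}. Lq_norm q {y l..y (l+1)} f powr q)"
  unfolding Lq_norm_powr[OF q] by (intro Bochner_Integration.integral_sum Lq_integrable fl)
 finally show ?thesis .
next
 case False
 hence "y b <= y a" using knot_seq_le_iff[OF y] by simp
 hence "Lq_norm q {y a..y b} f = 0" by (intro Lq_norm_degenerate q) simp
 thus ?thesis by (simp add: sum_nonneg)
qed

text \<open>Every j lies in at most k of the windows.\<close>

lemma sum_int_shift_le:
 fixes g :: "int => real"
 assumes k: "0 < k" and "finite Z" "\<And>j. 0 <= g j" "\<And>l i. l \<in> L ==> i < k ==> l-int i \<in> Z" "finite L"
 shows "(\<Sum>l\<in>L. \<Sum>j\<in>{l-int (k-1)..l}. g j) <= real k*(\<Sum>j\<in>Z. g j)"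
proof -
 have "(\<Sum>j\<in>{l-int (k-1)..l}. g j) = (\<Sum>i<k. g (l-int i))" for l
  by (rule sum.reindex_bij_witness[of _ "\<lambda>i. l-int i" "\<lambda>j. nat (l-j)"]) (use k in auto)
 hence "(\<Sum>l\<in>L. \<Sum>j\<in>{l-int (k-1)..l}. g j) = (\<Sum>i<k. \<Sum>l\<in>L. g (l-int i))"
  by (simp add: sum.swap[of _ L])
 also have "... <= (\<Sum>i<k. \<Sum>j\<in>Z. g j)"
 proof (rule sum_mono)
  fix i assume i: "i \<in> {..<k}"
  have "(\<Sum>l\<in>L. g (l-int i)) = (\<Sum>j\<in>(\<lambda>l. l-int i) ` L. g j)"
   by (subst sum.reindex) (auto simp: inj_on_def)
  also have "... <= (\<Sum>j\<in>Z. g j)" using assms i by (intro sum_mono2) auto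
  finally show "(\<Sum>l\<in>L. g (l-int i)) <= (\<Sum>j\<in>Z. g j)" .
 qed
 also have "... = real k*(\<Sum>j\<in>Z. g j)" by simp
 finally show ?thesis .
qed

context multilevel begin

lemma phi_eq_0: "0 < k ==> t < x m j \<or> x m (j+int k) <= t ==> phi x k m j t = 0"
 using bspline_eq_0[OF knots, of t m j "k-1"] by (simp add: phi_def)

lemma cmod_phi: "0 < k ==> cmod (phi x k m j t) = bspline (x m) k j t"
 using bspline_nonneg[OF knots, of m "k-1" j t] by (simp add: phi_def)

lemma phi_le_1: "0 < k ==> cmod (phi x k m j t) <= 1"
 using bspline_le_1[OF knots, of m "k-1" j t] by (simp add: cmod_phi)

lemma lev_eq_sum:
 assumes "0 < k" "x m l <= t" "t < x m (l+1)" "finite A" "{l-int (k-1)..l} \<subseteq> A"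
 shows "lev x k a m t = (\<Sum>j\<in>A. a (m, j) * phi x k m j t)"
proof -
 have "((\<lambda>j. a (m, j) * phi x k m j t) has_sum (\<Sum>j\<in>A. a (m, j) * phi x k m j t)) UNIV"
 proof (rule has_sum_finite_neutralI)
  fix j assume "j \<in> UNIV-A"
  hence "j \<notin> {l-int (k-1)..l}" using assms(5) by blast
  hence "j < l-int (k-1) \<or> l < j" unfolding atLeastAtMost_iff by linarith
  hence "j+int k <= l \<or> l+1 <= j" using assms(1) by auto
  hence "x m (j+int k) <= x m l \<or> x m (l+1) <= x m j" by (simp add: x_le_iff)
  hence "phi x k m j t = 0" using assms by (intro phi_eq_0) auto
  thus "a (m, j) * phi x k m j t = 0" by simp
 qed (use assms in auto)
 thus ?thesis unfolding lev_def by (rule infsumI)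
qed

lemma lev_cpiece:
 assumes "0 < k" "x m l <= t" "t < x m (l+1)"
 shows "lev x k a m t = poly_fun (cpiece (x m) k (\<lambda>j. a (m, j)) l) t"
proof -
 obtain n where k: "k = Suc n" using assms gr0_conv_Suc by blast
 show ?thesis
  using lev_eq_sum[OF assms, of "{l-int (k-1)..l}" a] poly_fun_cpiece[OF knots assms(2,3), of n]
  by (simp add: k phi_def)
qed

lemma lev_bound_pt:
 assumes "0 < k" "x m l <= t" "t < x m (l+1)" "\<And>j. j \<in> {l-int (k-1)..l} ==> cmod (a (m, j)) <= B"
 shows "cmod (lev x k a m t) <= B"
proof -
 have "cmod (lev x k a m t) <= (\<Sum>j\<in>{l-int (k-1)..l}. cmod (a (m, j) * phi x k m j t))"
  using lev_eq_sum[OF assms(1-3), of "{l-int (k-1)..l}" a] by (simp add: norm_sum)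
 also have "... <= (\<Sum>j\<in>{l-int (k-1)..l}. B * bspline (x m) k j t)"
  unfolding norm_mult cmod_phi[OF assms(1)]
  using bspline_nonneg[OF knots, of m "k-1" _ t] assms by (intro sum_mono mult_right_mono) auto
 also have "... = B" unfolding sum_distrib_left[symmetric]
  using bspline_unity[OF knots assms(2,3), of "k-1"] assms(1) by simp
 finally show ?thesis .
qed

lemma phi_Lipschitz:
 assumes "2 <= k"
 shows "cmod (phi x k m j s-phi x k m j t) <= bspline_Lip k * lam/mesh x m*\<bar>s-t\<bar>"
proof -
 have "\<bar>bspline (x m) k j s-bspline (x m) k j t\<bar> <= bspline_Lip k/(mesh x m/lam)*\<bar>s-t\<bar>"
  using mesh_pos[of m] lam mesh_le_len'[of m] by (intro bspline_Lip(2)[OF assms knots]) (auto simp: len_def)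
 thus ?thesis by (simp add: phi_def of_real_diff[symmetric] del: of_real_diff)
qed

lemma phi_continuous: "2 <= k ==> continuous_on S (phi x k m j)"
proof -
 assume k: "2 <= k"
 have "(bspline_Lip k * lam/mesh x m)-lipschitz_on S (phi x k m j)"
  using phi_Lipschitz[OF k, of m j] bspline_Lip(1)[OF k] lam mesh_pos[of m]
  by (intro lipschitz_onI) (auto simp: dist_norm)
 thus ?thesis by (rule lipschitz_on_continuous_on)
qed

lemma supp_idx_finite_card:
 assumes "u <= v"
 shows "finite (supp_idx x k m u v)"
  "v-u <= E * mesh x m ==> real (card (supp_idx x k m u v)) <= 2*(E+real k * lam) * lam+3"
proof -
 let ?A = "u-real k*(lam * mesh x m)"
 have sub: "supp_idx x k m u v \<subseteq> {j. ?A <= x m j \<and> x m j <= v}"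
 proof
  fix j assume "j \<in> supp_idx x k m u v"
  thus "j \<in> {j. ?A <= x m j \<and> x m j <= v}"
   using x_diff_bounds(1)[of j "j+int k" m] by (simp add: supp_idx_def)
 qed
 show fin: "finite (supp_idx x k m u v)" by (rule finite_subset[OF sub knot_count(1)])
 assume E: "v-u <= E * mesh x m"
 have E0: "0 <= E" using E assms mesh_pos[of m] by (metis diff_ge_0_iff_ge order_trans zero_le_mult_iff not_less less_imp_le)
 have "real (card (supp_idx x k m u v)) <= real (card {j. ?A <= x m j \<and> x m j <= v})"
  using card_mono[OF knot_count(1) sub] by simp
 also have "... <= 2*(E+real k * lam) * lam+3"
  using E E0 lam by (intro knot_count(2)) (auto simp: algebra_simps)
 finally show "real (card (supp_idx x k m u v)) <= 2*(E+real k * lam) * lam+3" .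
qed

lemma lev_supp_idx:
 assumes "0 < k" "u <= t" "t <= v"
 shows "lev x k a m t = (\<Sum>j\<in>supp_idx x k m u v. a (m, j) * phi x k m j t)"
proof -
 have "u <= v" using assms by simp
 note fin = supp_idx_finite_card(1)[OF this, of k m]
 have "((\<lambda>j. a (m, j) * phi x k m j t) has_sum (\<Sum>j\<in>supp_idx x k m u v. a (m, j) * phi x k m j t)) UNIV"
 proof (rule has_sum_finite_neutralI[OF fin])
  fix j assume "j \<in> UNIV-supp_idx x k m u v"
  hence "t < x m j \<or> x m (j+int k) <= t" using assms by (auto simp: supp_idx_def)
  thus "a (m, j) * phi x k m j t = 0" using phi_eq_0[OF assms(1)] by simp
 qed auto
 thus ?thesis unfolding lev_def by (rule infsumI)
qed

lemma lev_continuous: "2 <= k ==> continuous_on {u..v} (lev x k a m)"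
proof -
 assume k: "2 <= k"
 have "continuous_on {u..v} (\<lambda>t. \<Sum>j\<in>supp_idx x k m u v. a (m, j) * phi x k m j t)"
  by (intro continuous_intros phi_continuous k)
 thus ?thesis using lev_supp_idx[of k u _ v a m] k by (subst continuous_on_cong[OF refl]) auto
qed

lemma lev_Lq: "2 <= k ==> 1 <= q ==> lev x k a m \<in> Lq q {u..v}"
 by (intro continuous_on_Lq lev_continuous)

lemma lev_Lipschitz:
 assumes "2 <= k" "s \<in> {u..v}" "t \<in> {u..v}"
 shows "cmod (lev x k a m s-lev x k a m t) <= bspline_Lip k * lam/mesh x m*\<bar>s-t\<bar>*(\<Sum>j\<in>supp_idx x k m u v. cmod (a (m, j)))"
proof -
 have k: "0 < k" using assms by simp
 have "lev x k a m s-lev x k a m t = (\<Sum>j\<in>supp_idx x k m u v. a (m, j)*(phi x k m j s-phi x k m j t))"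
  using assms k by (simp add: lev_supp_idx[of k u _ v] sum_subtractf right_diff_distrib)
 hence "cmod (lev x k a m s-lev x k a m t) <= (\<Sum>j\<in>supp_idx x k m u v. cmod (a (m, j)) * cmod (phi x k m j s-phi x k m j t))"
  by (simp add: norm_mult[symmetric] norm_sum)
 also have "... <= (\<Sum>j\<in>supp_idx x k m u v. cmod (a (m, j))*(bspline_Lip k * lam/mesh x m*\<bar>s-t\<bar>))"
  by (intro sum_mono mult_left_mono phi_Lipschitz assms) auto
 also have "... = bspline_Lip k * lam/mesh x m*\<bar>s-t\<bar>*(\<Sum>j\<in>supp_idx x k m u v. cmod (a (m, j)))"
  unfolding sum_distrib_right[symmetric] by (rule mult.commute)
 finally show ?thesis .
qed

text \<open>One rate for both directions: fine levels decay like this power of \<open>rho\<close>,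
  coarse levels even like \<open>rho\<close> itself.\<close>

definition "delta q \<tau> = rho powr (1/max q \<tau>)"

lemma delta:
 assumes q: "1 <= q" shows "0 < delta q \<tau>" "delta q \<tau> < 1" "rho <= delta q \<tau>"
proof -
 from q have m: "0 < 1/max q \<tau>" "1/max q \<tau> <= 1" by (auto simp: max_def)
 show "0 < delta q \<tau>" using rho by (simp add: delta_def)
 have "rho powr (1/max q \<tau>) < 1 powr (1/max q \<tau>)" using rho m by (intro powr_less_mono2) auto
 thus "delta q \<tau> < 1" unfolding delta_def by simp
 have "rho powr 1 <= rho powr (1/max q \<tau>)" using rho m by (intro powr_mono') auto
 thus "rho <= delta q \<tau>" using rho unfolding delta_def by simp
qed

text \<open>On an interval of level n the spline is bounded by the k coefficients active there.
  Every such interval occupies only a share \<theta> of \<open>{u..v}\<close>, so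
  \<open>weighted_lp_bound\<close> turns the shortness of the intervals into decay.\<close>

lemma fine_est:
 assumes k: "2 <= k" and q: "1 <= q" and \<tau>: "0 < \<tau>" and mn: "m <= n" and N: "1 <= N"
  and u: "u = x m i" and v: "v = x m (i+int N)"
 shows "mn q u v (lev x k a n) <= lam ^ 3 * real k powr (1/\<tau>) * delta q \<tau> ^ nat \<bar>n-m\<bar> *
   (\<Sum>j\<in>supp_idx x k n u v. cmod (a (n, j)) powr \<tau>) powr (1/\<tau>)"
proof -
 have k0: "0 < k" using k by simp
 obtain a0 where a0: "u = x n a0" using knots_nested[OF mn] u by blast
 obtain b0 where b0: "v = x n b0" using knots_nested[OF mn] v by blast
 have uv: "u < v" unfolding u v x_less_iff using N by simp
 hence ab: "a0 < b0" using a0 b0 x_less_iff by simp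
 define \<alpha> where "\<alpha> l = (\<Sum>j\<in>{l-int (k-1)..l}. cmod (a (n, j)) powr \<tau>) powr (1/\<tau>)" for l
 have lb: "cmod (lev x k a n t) <= \<alpha> l" if t: "t \<in> {x n l..x n (l+1)}" for l t
 proof -
  have "norm (lev x k a n t) <= \<alpha> l"
  proof (rule continuous_on_closure_norm_le[where s="{x n l..<x n (l+1)}" and f="lev x k a n"])
   have cl: "closure {x n l..<x n (l+1)} = {x n l..x n (l+1)}" by (simp add: x_less_iff closure_atLeastLessThan)
   show "continuous_on (closure {x n l..<x n (l+1)}) (lev x k a n)" unfolding cl by (rule lev_continuous[OF k])
   show "t \<in> closure {x n l..<x n (l+1)}" unfolding cl by (rule t)
   show "\<forall>y\<in>{x n l..<x n (l+1)}. norm (lev x k a n y) <= \<alpha> l"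
   proof
    fix y assume "y \<in> {x n l..<x n (l+1)}"
    thus "norm (lev x k a n y) <= \<alpha> l"
     unfolding \<alpha>_def by (intro lev_bound_pt[OF k0] le_powr_sum[where c="\<lambda>j. cmod (a (n, j))"] \<tau>) auto
   qed
  qed
  thus ?thesis by simp
 qed
 define J where "J = v-u"
 have J: "0 < J" using uv by (simp add: J_def)
 \<comment> \<open>One factor \<open>lam\<close> each for an interval against mesh n, for mesh n
   against mesh m, and for mesh m against the length of \<open>{u..v}\<close>.\<close>
 define \<theta> where "\<theta> = lam ^ 3 * rho ^ nat \<bar>n-m\<bar>"
 have \<theta>0: "0 < \<theta>" using lam rho by (simp add: \<theta>_def)
 have meshJ: "mesh x m <= lam * J"
 proof -
  have "real_of_int (i+int N-i)*(mesh x m/lam) <= J"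
   unfolding J_def u v by (rule x_diff_bounds(2)) simp
  moreover have "1*(mesh x m/lam) <= real N*(mesh x m/lam)"
   using N mesh_pos[of m] lam by (intro mult_right_mono) auto
  ultimately have "mesh x m/lam <= J" by simp
  thus ?thesis using lam by (simp add: divide_le_eq mult.commute)
 qed
 have w\<theta>: "len x n l/J <= \<theta>" for l
 proof -
  have "len x n l <= lam * mesh x n" by (rule len_le_mesh)
  also have "... <= lam*(lam * rho ^ nat (n-m) * mesh x m)" using lam by (intro mult_left_mono mesh_decay mn) auto
  also have "... <= lam*(lam * rho ^ nat (n-m)*(lam * J))" using lam rho meshJ by (intro mult_left_mono) auto
  also have "... = \<theta> * J" using mn by (simp add: \<theta>_def power3_eq_cube)
  finally show ?thesis using J by (simp add: divide_le_eq)
 qed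
 have wsum: "(\<Sum>l\<in>{a0..<b0}. len x n l/J) <= 1"
 proof -
  have "(\<Sum>l\<in>{a0..<a0+int r}. len x n l) = x n (a0+int r)-x n a0" for r
  proof (induction r)
   case (Suc r)
   have "{a0..<a0+int (Suc r)} = insert (a0+int r) {a0..<a0+int r}" by auto
   thus ?case using Suc by (simp add: len_def add.commute add.left_commute)
  qed simp
  from this[of "nat (b0-a0)"] have "(\<Sum>l\<in>{a0..<b0}. len x n l) = J" using ab by (simp add: J_def a0 b0)
  thus ?thesis using J by (simp add: sum_divide_distrib[symmetric])
 qed
 have L: "lev x k a n \<in> Lq q {u..v}" by (rule lev_Lq[OF k q])
 have "mn q u v (lev x k a n) powr q = Lq_norm q {u..v} (lev x k a n) powr q/J"
 proof -
  have "Lq_norm q {u..v} (lev x k a n) powr q = J * mn q u v (lev x k a n) powr q"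
   unfolding Lq_norm_mn[OF uv q] using uv q by (simp add: powr_mult powr_powr J_def)
  thus ?thesis using J by simp
 qed
 also have "... <= (\<Sum>l\<in>{a0..<b0}. Lq_norm q {x n l..x n (l+1)} (lev x k a n) powr q)/J"
  using Lq_split[OF knots q L[unfolded a0 b0]] J by (intro divide_right_mono) (auto simp: a0 b0)
 also have "... <= (\<Sum>l\<in>{a0..<b0}. len x n l*\<alpha> l powr q)/J"
 proof (intro divide_right_mono sum_mono)
  fix l
  have "Lq_norm q {x n l..x n (l+1)} (lev x k a n) <= \<alpha> l * len x n l powr (1/q)"
   unfolding len_def
  proof (rule Lq_bounded(2)[OF q _ _ lb])
   show "set_borel_measurable lebesgue {x n l..x n (l+1)} (lev x k a n)"
    using Lq_measurable[OF lev_Lq[OF k q]] by (simp add: set_borel_measurable_def)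
  qed (simp_all add: x_le_iff)
  hence "Lq_norm q {x n l..x n (l+1)} (lev x k a n) powr q <= (\<alpha> l * len x n l powr (1/q)) powr q"
   using q by (intro powr_mono2) auto
  also have "... = len x n l*\<alpha> l powr q" using q len_pos[of n l] by (simp add: powr_mult powr_powr \<alpha>_def)
  finally show "Lq_norm q {x n l..x n (l+1)} (lev x k a n) powr q <= len x n l*\<alpha> l powr q" .
 qed (use J in auto)
 also have "... = (\<Sum>l\<in>{a0..<b0}. len x n l/J*\<alpha> l powr q)" by (simp add: sum_divide_distrib)
 also have "... <= (\<theta> powr (1/max q \<tau>)*(\<Sum>l\<in>{a0..<b0}. \<alpha> l powr \<tau>) powr (1/\<tau>)) powr q"
  using J len_pos w\<theta> wsum q \<tau> \<theta>0 by (intro weighted_lp_bound) (auto simp: \<alpha>_def intro: less_imp_le)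
 finally have 0: "mn q u v (lev x k a n) powr q <= (\<theta> powr (1/max q \<tau>)*(\<Sum>l\<in>{a0..<b0}. \<alpha> l powr \<tau>) powr (1/\<tau>)) powr q" .
 have q0: "0 < q" using q by simp
 have 1: "mn q u v (lev x k a n) <= \<theta> powr (1/max q \<tau>)*(\<Sum>l\<in>{a0..<b0}. \<alpha> l powr \<tau>) powr (1/\<tau>)"
  by (rule powr_le_cancel[OF q0 _ 0]) (intro mult_nonneg_nonneg powr_ge_zero)
 have Z: "(\<Sum>l\<in>{a0..<b0}. \<alpha> l powr \<tau>) <= real k*(\<Sum>j\<in>supp_idx x k n u v. cmod (a (n, j)) powr \<tau>)"
 proof -
  have "(\<Sum>l\<in>{a0..<b0}. \<alpha> l powr \<tau>) = (\<Sum>l\<in>{a0..<b0}. \<Sum>j\<in>{l-int (k-1)..l}. cmod (a (n, j)) powr \<tau>)"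
   unfolding \<alpha>_def using \<tau> by (intro sum.cong refl) (simp add: powr_powr sum_nonneg)
  also have "... <= real k*(\<Sum>j\<in>supp_idx x k n u v. cmod (a (n, j)) powr \<tau>)"
  proof (rule sum_int_shift_le[OF k0])
   show "finite (supp_idx x k n u v)" using uv by (intro supp_idx_finite_card) simp
   fix l i' assume "l \<in> {a0..<b0}" "i' < k"
   thus "l-int i' \<in> supp_idx x k n u v" by (auto simp: supp_idx_def a0 b0 x_le_iff)
  qed auto
  finally show ?thesis .
 qed
 have "\<theta> powr (1/max q \<tau>) = (lam ^ 3) powr (1/max q \<tau>) * delta q \<tau> ^ nat \<bar>n-m\<bar>"
 proof -
  have "(rho ^ r) powr e = (rho powr e) ^ r" for r e
  proof -
   have "(rho ^ r) powr e = (rho powr real r) powr e" using rho by (simp only: powr_realpow)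
   also have "... = (rho powr e) powr real r" by (simp only: powr_powr mult.commute)
   also have "... = (rho powr e) ^ r" using rho by (intro powr_realpow) simp
   finally show ?thesis .
  qed
  thus ?thesis unfolding \<theta>_def delta_def using lam rho by (simp only: powr_mult)
 qed
 also have "... <= lam ^ 3 * delta q \<tau> ^ nat \<bar>n-m\<bar>"
 proof -
  have "(lam ^ 3) powr (1/max q \<tau>) <= (lam ^ 3) powr 1"
   using lam q by (intro powr_mono) (auto simp: max_def)
  thus ?thesis using lam delta(1)[OF q, of \<tau>] by (intro mult_right_mono) auto
 qed
 finally have \<theta>': "\<theta> powr (1/max q \<tau>) <= lam ^ 3 * delta q \<tau> ^ nat \<bar>n-m\<bar>" .
 have "(\<Sum>l\<in>{a0..<b0}. \<alpha> l powr \<tau>) powr (1/\<tau>) <= (real k*(\<Sum>j\<in>supp_idx x k n u v. cmod (a (n, j)) powr \<tau>)) powr (1/\<tau>)"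
  using Z \<tau> by (intro powr_mono2) (auto intro: sum_nonneg)
 also have "... = real k powr (1/\<tau>)*(\<Sum>j\<in>supp_idx x k n u v. cmod (a (n, j)) powr \<tau>) powr (1/\<tau>)"
  by (simp add: powr_mult sum_nonneg)
 finally have "\<theta> powr (1/max q \<tau>)*(\<Sum>l\<in>{a0..<b0}. \<alpha> l powr \<tau>) powr (1/\<tau>) <=
   (lam ^ 3 * delta q \<tau> ^ nat \<bar>n-m\<bar>)*(real k powr (1/\<tau>)*(\<Sum>j\<in>supp_idx x k n u v. cmod (a (n, j)) powr \<tau>) powr (1/\<tau>))"
  using \<theta>' lam delta(1)[OF q, of \<tau>] by (intro mult_mono) auto
 with 1 show ?thesis by (simp add: mult_ac)
qed

text \<open>The factors are the Lipschitz constant of a B-spline, the length of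
  \<open>{u..v}\<close> in units of the mesh, the number of active B-splines, and the constant of
  the mesh ratio.\<close>

definition "coarse_const k N = bspline_Lip k * lam*(real N * lam)*(2*(real N * lam * lam+real k * lam) * lam+3) * lam"

lemma coarse_const_pos: "2 <= k ==> 1 <= N ==> 0 < coarse_const k N"
 unfolding coarse_const_def using lam bspline_Lip(1)[of k]
 by (intro mult_pos_pos add_nonneg_pos mult_nonneg_nonneg) auto

text \<open>A coarse spline varies slowly on \<open>{u..v}\<close>: its Lipschitz constant is of
  order 1/mesh n, the length of order mesh m. Only the oscillation is small, hence the subtracted
  value at \<open>u\<close>.\<close>

lemma coarse_est:
 assumes k: "2 <= k" and q: "1 <= q" and \<tau>: "0 < \<tau>" and nm: "n <= m" and N: "1 <= N"
  and u: "u = x m i" and v: "v = x m (i+int N)"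
 shows "mn q u v (\<lambda>t. lev x k a n t-lev x k a n u) <= coarse_const k N * delta q \<tau> ^ nat \<bar>n-m\<bar> *
   (\<Sum>j\<in>supp_idx x k n u v. cmod (a (n, j)) powr \<tau>) powr (1/\<tau>)"
proof -
 have uv: "u < v" unfolding u v x_less_iff using N by simp
 define A where "A = (\<Sum>j\<in>supp_idx x k n u v. cmod (a (n, j)) powr \<tau>) powr (1/\<tau>)"
 have A0: "0 <= A" by (simp add: A_def)
 have fin: "finite (supp_idx x k n u v)" using uv by (intro supp_idx_finite_card) simp
 have vu: "v-u <= real N*(lam * mesh x m)"
  using x_diff_bounds(1)[of i "i+int N" m] by (simp add: u v)
 have mm: "mesh x m <= lam * mesh x n" by (rule mesh_mono[OF nm])
 have "v-u <= (real N * lam * lam) * mesh x n"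
 proof -
  have "real N*(lam * mesh x m) <= real N*(lam*(lam * mesh x n))"
   using mm lam by (intro mult_left_mono) auto
  thus ?thesis using vu by (simp add: mult_ac)
 qed
 from supp_idx_finite_card(2)[OF less_imp_le[OF uv] this, of k]
 have card: "real (card (supp_idx x k n u v)) <= 2*(real N * lam * lam+real k * lam) * lam+3" .
 have sumA: "(\<Sum>j\<in>supp_idx x k n u v. cmod (a (n, j))) <= (2*(real N * lam * lam+real k * lam) * lam+3) * A"
 proof -
  have "(\<Sum>j\<in>supp_idx x k n u v. cmod (a (n, j))) <= (\<Sum>j\<in>supp_idx x k n u v. A)"
   unfolding A_def by (intro sum_mono le_powr_sum[OF fin _ \<tau>, where c="\<lambda>j. cmod (a (n, j))"]) auto
  also have "... = real (card (supp_idx x k n u v)) * A" by simp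
  also have "... <= (2*(real N * lam * lam+real k * lam) * lam+3) * A" using card A0 by (intro mult_right_mono)
  finally show ?thesis .
 qed
 have mr: "mesh x m/mesh x n <= lam * delta q \<tau> ^ nat \<bar>n-m\<bar>"
 proof -
  have "mesh x m <= lam * rho ^ nat (m-n) * mesh x n" by (rule mesh_decay[OF nm])
  also have "... <= lam * delta q \<tau> ^ nat (m-n) * mesh x n"
   using lam rho delta(3)[OF q, of \<tau>] mesh_pos[of n] by (intro mult_right_mono mult_left_mono power_mono) auto
  finally show ?thesis using mesh_pos[of n] nm by (simp add: divide_le_eq)
 qed
 show ?thesis unfolding A_def[symmetric]
 proof (rule mn_bounded[OF q uv])
  have "(\<lambda>t. lev x k a n t-lev x k a n u) \<in> Lq q {u..v}"
   by (intro continuous_on_Lq[OF q] continuous_intros lev_continuous[OF k])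
  from Lq_measurable[OF this] show "set_borel_measurable lebesgue {u..v} (\<lambda>t. lev x k a n t-lev x k a n u)"
   by (simp add: set_borel_measurable_def)
  fix t assume t: "t \<in> {u..v}"
  define K where "K = 2*(real N * lam * lam+real k * lam) * lam+3"
  have K0: "0 <= K" unfolding K_def using lam by simp
  have L0: "0 < bspline_Lip k" by (rule bspline_Lip(1)[OF k])
  have "cmod (lev x k a n t-lev x k a n u) <= bspline_Lip k * lam/mesh x n*\<bar>t-u\<bar>*(\<Sum>j\<in>supp_idx x k n u v. cmod (a (n, j)))"
   using lev_Lipschitz[OF k t, of u a n] uv by simp
  also have "... <= bspline_Lip k * lam/mesh x n*(real N*(lam * mesh x m))*(K * A)"
   using t vu sumA L0 lam mesh_pos[of n] by (intro mult_mono mult_left_mono) (auto simp: K_def sum_nonneg)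
  also have "... = bspline_Lip k * lam*(real N * lam) * K * A*(mesh x m/mesh x n)" by simp
  also have "... <= bspline_Lip k * lam*(real N * lam) * K * A*(lam * delta q \<tau> ^ nat \<bar>n-m\<bar>)"
   using L0 lam K0 A0 by (intro mult_left_mono mr mult_nonneg_nonneg) auto
  also have "... = coarse_const k N * delta q \<tau> ^ nat \<bar>n-m\<bar> * A"
   unfolding coarse_const_def K_def by (simp only: mult_ac)
  finally show "cmod (lev x k a n t-lev x k a n u) <= coarse_const k N * delta q \<tau> ^ nat \<bar>n-m\<bar> * A" .
 qed
qed

definition "core_const k \<tau> N = lam ^ 3 * real k powr (1/\<tau>)+coarse_const k N"

lemma core_const_pos: "2 <= k ==> 1 <= N ==> 0 < core_const k \<tau> N"
 unfolding core_const_def using coarse_const_pos[of k N] lam by (intro add_nonneg_pos) auto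

lemma core_est:
 assumes k: "2 <= k" and q: "1 <= q" and \<tau>: "0 < \<tau>" and fin: "finite NN" and N: "1 <= N"
  and u: "u = x m i" and v: "v = x m (i+int N)"
 shows "\<exists>c. mn q u v (\<lambda>t. (\<Sum>n\<in>NN. lev x k a n t)-c) <= core_const k \<tau> N *
  (\<Sum>n\<in>NN. delta q \<tau> ^ nat \<bar>n-m\<bar>*(\<Sum>j\<in>supp_idx x k n u v. cmod (a (n, j)) powr \<tau>) powr (1/\<tau>))"
proof -
 \<comment> \<open>Fine levels are small themselves, coarse ones only after removing their value at
   \<open>u\<close>; \<open>c\<close> is the sum of these values.\<close>
 let ?c = "\<lambda>n. if m <= n then 0 else lev x k a n u"
 let ?T = "\<lambda>n. delta q \<tau> ^ nat \<bar>n-m\<bar>*(\<Sum>j\<in>supp_idx x k n u v. cmod (a (n, j)) powr \<tau>) powr (1/\<tau>)"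
 have T0: "0 <= ?T n" for n using delta(1)[OF q, of \<tau>] by simp
 have "mn q u v (\<lambda>t. (\<Sum>n\<in>NN. lev x k a n t)-(\<Sum>n\<in>NN. ?c n)) = mn q u v (\<lambda>t. \<Sum>n\<in>NN. lev x k a n t-?c n)"
  by (simp only: sum_subtractf)
 also have "... <= (\<Sum>n\<in>NN. mn q u v (\<lambda>t. lev x k a n t-?c n))"
  by (intro mn_sum[OF q] continuous_on_Lq[OF q] continuous_intros lev_continuous[OF k])
 also have "... <= (\<Sum>n\<in>NN. core_const k \<tau> N*?T n)"
 proof (rule sum_mono)
  fix n
  show "mn q u v (\<lambda>t. lev x k a n t-?c n) <= core_const k \<tau> N*?T n"
  proof (cases "m <= n")
   case True
   have "mn q u v (lev x k a n) <= lam ^ 3 * real k powr (1/\<tau>)*?T n"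
    using fine_est[OF k q \<tau> True N u v, of a] by (simp add: mult.assoc)
   also have "... <= core_const k \<tau> N*?T n"
    unfolding core_const_def using T0[of n] coarse_const_pos[OF k N] by (intro mult_right_mono) auto
   finally show ?thesis using True by simp
  next
   case False
   hence "n <= m" by simp
   have "mn q u v (\<lambda>t. lev x k a n t-lev x k a n u) <= coarse_const k N*?T n"
    using coarse_est[OF k q \<tau> \<open>n <= m\<close> N u v, of a] by (simp add: mult.assoc)
   also have "... <= core_const k \<tau> N*?T n"
    unfolding core_const_def using T0[of n] lam by (intro mult_right_mono) auto
   finally show ?thesis using False by simp
  qed
 qed
 finally show ?thesis unfolding sum_distrib_left[symmetric] by blast
qed

end

section \<open>Mean oscillation of spline sums\<close>

lemma mn1_eq: "a < b ==> mn 1 a b f = (LINT t:{a..b}|lebesgue. cmod (f t))/(b-a)"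
proof -
 assume "a < b"
 have "0 <= (LINT t:{a..b}|lebesgue. cmod (f t))"
  unfolding set_lebesgue_integral_def by (intro integral_nonneg_AE AE_I2) (simp add: indicator_def)
 thus ?thesis unfolding mn_def Lq_norm_def using \<open>a < b\<close> by (simp add: powr_minus_divide)
qed

lemma Lq1_set_integrable: "f \<in> Lq 1 S \<longleftrightarrow> set_integrable lebesgue S f"
proof
 assume f: "f \<in> Lq 1 S"
 have "integrable lebesgue (\<lambda>x. cmod (cut S f x))" using Lq_integrable[OF f] by simp
 thus "set_integrable lebesgue S f" unfolding set_integrable_def
  by (subst (asm) integrable_norm_iff) (rule Lq_measurable[OF f])
next
 assume f: "set_integrable lebesgue S f"
 hence 1: "integrable lebesgue (\<lambda>x. cut S f x)" by (simp add: set_integrable_def)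
 hence "integrable lebesgue (\<lambda>x. cmod (cut S f x) powr 1)" using integrable_norm[OF 1] by simp
 thus "f \<in> Lq 1 S" unfolding Lq_iff using borel_measurable_integrable[OF 1] by blast
qed

lemma Avg_close:
 assumes ab: "a < b" and f: "f \<in> Lq 1 {a..b}"
 shows "cmod (Avg a b f-c) <= mn 1 a b (\<lambda>t. f t-c)"
proof -
 have fi: "set_integrable lebesgue {a..b} f" using f Lq1_set_integrable by blast
 have ci: "set_integrable lebesgue {a..b} (\<lambda>t. c)"
  using continuous_on_Lq[of 1 a b "\<lambda>t. c"] Lq1_set_integrable by force
 have "(LINT t:{a..b}|lebesgue. c) = (b-a) *\<^sub>R c" using ab by (simp add: set_lebesgue_integral_def)
 hence "Avg a b f-c = (LINT t:{a..b}|lebesgue. f t-c) /\<^sub>R (b-a)"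
  unfolding Avg_def set_integral_diff(2)[OF fi ci] using ab by (simp add: scaleR_diff_right)
 hence "cmod (Avg a b f-c) = cmod (LINT t:{a..b}|lebesgue. f t-c)/(b-a)"
  using ab by (simp add: divide_inverse mult.commute)
 also have "... <= (LINT t:{a..b}|lebesgue. cmod (f t-c))/(b-a)"
  using ab by (intro divide_right_mono set_integral_norm_bound set_integral_diff(1) fi ci) auto
 finally show ?thesis using mn1_eq[OF ab] by simp
qed

text \<open>Up to a factor 2 the average may be replaced by any constant, in particular by the one
  that \<open>core_est\<close> provides.\<close>

lemma mn_Avg_le:
 assumes ab: "a < b" and f: "f \<in> Lq 1 {a..b}"
 shows "mn 1 a b (\<lambda>t. f t-Avg a b f) <= 2 * mn 1 a b (\<lambda>t. f t-c)"
proof -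
 have c: "(\<lambda>t. d) \<in> Lq 1 {a..b}" for d :: complex by (intro continuous_on_Lq continuous_intros) simp
 have "mn 1 a b (\<lambda>t. f t-Avg a b f) = mn 1 a b (\<lambda>t. (f t-c)-(Avg a b f-c))" by simp
 also have "... <= mn 1 a b (\<lambda>t. f t-c)+mn 1 a b (\<lambda>t. Avg a b f-c)"
  by (intro mn_diff Lq_diff(1) f c) auto
 also have "mn 1 a b (\<lambda>t. Avg a b f-c) = cmod (Avg a b f-c)" using ab by (intro mn_const) auto
 finally show ?thesis using Avg_close[OF ab f, of c] by simp
qed

lemma bmo_norm_eq: "bmo_norm f = (SUP (a, b) \<in> {(a, b). a < b}. ennreal (mn 1 a b (\<lambda>t. f t-Avg a b f)))"
 unfolding bmo_norm_def by (intro SUP_cong refl) (auto simp: mn1_eq)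

lemma bmo_norm_leI:
 assumes "\<And>a b. a < b ==> mn 1 a b (\<lambda>t. f t-Avg a b f) <= B"
 shows "bmo_norm f <= ennreal B"
 unfolding bmo_norm_eq by (intro SUP_least) (auto intro!: ennreal_leI assms)

lemma bmo_norm_less_mn:
 assumes "bmo_norm f < ennreal e" "a < b" shows "mn 1 a b (\<lambda>t. f t-Avg a b f) < e"
proof -
 have "ennreal (mn 1 a b (\<lambda>t. f t-Avg a b f)) <= bmo_norm f"
  unfolding bmo_norm_eq by (rule SUP_upper2[of "(a, b)"]) (use assms(2) in auto)
 also have "... < ennreal e" by (rule assms(1))
 finally show ?thesis by (simp add: ennreal_less_iff)
qed

lemma has_sum_sum:
 fixes f :: "'a => 'b => real"
 assumes "\<And>a. a \<in> A ==> (f a has_sum s a) U"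
 shows "((\<lambda>x. \<Sum>a\<in>A. f a x) has_sum (\<Sum>a\<in>A. s a)) U"
 using assms
proof (induction A rule: infinite_finite_induct)
 case (insert a F)
 hence "((\<lambda>x. f a x+(\<Sum>a\<in>F. f a x)) has_sum s a+(\<Sum>a\<in>F. s a)) U"
  by (intro has_sum_add) auto
 thus ?case using insert by simp
qed (simp_all add: has_sum_0)

text \<open>Schur's test on l^1, for which bounded column sums suffice. The sequence
  \<open>s\<close> will consist of \<tau>-th powers, so one test serves every \<tau>.\<close>

lemma Schur_infsum:
 fixes w :: "'g => 'p => real"
 assumes w: "\<And>g p. 0 <= w g p" and s: "\<And>p. 0 <= s p" "s summable_on UNIV" and C: "0 <= C"
  and col: "\<And>G p. finite G ==> (\<Sum>g\<in>G. w g p) <= C"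
 shows "(\<lambda>p. w g p * s p) summable_on UNIV"
  "(\<lambda>g. \<Sum>\<^sub>\<infinity>p. w g p * s p) summable_on UNIV"
  "(\<Sum>\<^sub>\<infinity>g. \<Sum>\<^sub>\<infinity>p. w g p * s p) <= C*(\<Sum>\<^sub>\<infinity>p. s p)"
proof -
 have Cs: "(\<lambda>p. C * s p) summable_on UNIV" by (rule summable_on_cmult_right[OF s(2)])
 have ws: "(\<lambda>p. w g p * s p) summable_on UNIV" for g
 proof (rule summable_on_comparison_test[OF Cs])
  fix p show "w g p * s p <= C * s p" using col[of "{g}" p] s(1) by (intro mult_right_mono) auto
 qed (use w s in auto)
 thus "(\<lambda>p. w g p * s p) summable_on UNIV" .
 have fin: "(\<Sum>g\<in>G. \<Sum>\<^sub>\<infinity>p. w g p * s p) <= C*(\<Sum>\<^sub>\<infinity>p. s p)" if "finite G" for G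
 proof -
  have hs: "((\<lambda>p. \<Sum>g\<in>G. w g p * s p) has_sum (\<Sum>g\<in>G. \<Sum>\<^sub>\<infinity>p. w g p * s p)) UNIV"
   by (intro has_sum_sum has_sum_infsum ws)
  hence "(\<Sum>g\<in>G. \<Sum>\<^sub>\<infinity>p. w g p * s p) = (\<Sum>\<^sub>\<infinity>p. \<Sum>g\<in>G. w g p * s p)"
   by (simp add: infsumI)
  also have "... <= (\<Sum>\<^sub>\<infinity>p. C * s p)"
  proof (rule infsum_mono)
   show "(\<lambda>p. \<Sum>g\<in>G. w g p * s p) summable_on UNIV" using hs by (rule has_sum_imp_summable)
   show "(\<Sum>g\<in>G. w g p * s p) <= C * s p" for p
    unfolding sum_distrib_right[symmetric] by (intro mult_right_mono col that s)
  qed (rule Cs)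
  also have "... = C*(\<Sum>\<^sub>\<infinity>p. s p)" by (rule infsum_cmult_right') 
  finally show ?thesis .
 qed
 have nn: "0 <= (\<Sum>\<^sub>\<infinity>p. w g p * s p)" for g by (intro infsum_nonneg mult_nonneg_nonneg w s)
 show sm: "(\<lambda>g. \<Sum>\<^sub>\<infinity>p. w g p * s p) summable_on UNIV"
  by (rule nonneg_bdd_above_summable_on) (use nn fin in \<open>auto intro!: bdd_aboveI2\<close>)
 show "(\<Sum>\<^sub>\<infinity>g. \<Sum>\<^sub>\<infinity>p. w g p * s p) <= C*(\<Sum>\<^sub>\<infinity>p. s p)"
  by (rule infsum_le_finite_sums[OF sm fin])
qed

context multilevel begin

definition "bmo_const k \<tau> = (let N = 1+nat \<lceil>lam\<rceil> in
  2*(real N * real M\<^sub>0 * lam\<^sup>2) * core_const k \<tau> N*(2/(1-delta 1 \<tau>)))"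

text \<open>\<open>core_est\<close> needs end points at knots of one level. The level is chosen with
  mesh just above v-u; its intervals may be shorter than the mesh by the factor \<open>lam\<close>,
  so after the interval of \<open>u\<close> another \<lceil>lam\<rceil> of them are needed to reach
  \<open>v\<close>.\<close>

lemma aligned_cover:
 assumes uv: "u < v" and N: "N = 1+nat \<lceil>lam\<rceil>"
 obtains m i where "x m i <= u" "v <= x m (i+int N)" "x m (i+int N)-x m i <= (real N * real M\<^sub>0 * lam\<^sup>2)*(v-u)"
proof -
 obtain m where m: "v-u <= mesh x m" "mesh x (m+1) < v-u" using mesh_scale[of "v-u"] uv by auto
 obtain i where i: "x m i <= u" "u < x m (i+1)" by (rule x_cover)
 have c: "lam <= real (nat \<lceil>lam\<rceil>)" using lam by linarith
 have "real_of_int (i+int N-(i+1))*(mesh x m/lam) <= x m (i+int N)-x m (i+1)"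
  by (rule x_diff_bounds(2)) (simp add: N)
 moreover have "lam*(mesh x m/lam) <= real_of_int (i+int N-(i+1))*(mesh x m/lam)"
  using c lam mesh_pos[of m] by (intro mult_right_mono) (auto simp: N)
 ultimately have v: "v <= x m (i+int N)" using m(1) i(2) lam by simp
 have "x m (i+int N)-x m i <= real N*(lam * mesh x m)" using x_diff_bounds(1)[of i "i+int N" m] by simp
 also have "... <= real N*(lam*(real M\<^sub>0 * lam*(v-u)))"
 proof -
  have "mesh x m <= real M\<^sub>0 * lam * mesh x (m+1)" by (rule mesh_le_child)
  also have "... <= real M\<^sub>0 * lam*(v-u)" using m(2) lam by (intro mult_left_mono) auto
  finally show ?thesis using lam by (intro mult_left_mono) auto
 qed
 also have "... = (real N * real M\<^sub>0 * lam\<^sup>2)*(v-u)" by (simp add: power2_eq_square)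
 finally show ?thesis using that i v by blast
qed

text \<open>With a common bound for the l^\<tau> norms of the levels, only the geometric factors are
  summed, and the number of levels disappears. This gives BMO bounds as well as uniform local L^q
  bounds of partial sums.\<close>

lemma core_est_unif:
 assumes k: "2 <= k" and q: "1 <= q" and \<tau>: "0 < \<tau>" and fin: "finite NN" and N: "1 <= N" and B: "0 <= B"
  and hB: "\<And>n Z. n \<in> NN ==> finite Z ==> (\<Sum>j\<in>Z. cmod (a (n, j)) powr \<tau>) powr (1/\<tau>) <= B"
 shows "\<exists>c. mn q (x m i) (x m (i+int N)) (\<lambda>t. (\<Sum>n\<in>NN. lev x k a n t)-c) <= core_const k \<tau> N*(2/(1-delta q \<tau>)) * B"
proof -
 let ?u = "x m i" and ?v = "x m (i+int N)"
 obtain c where c: "mn q ?u ?v (\<lambda>t. (\<Sum>n\<in>NN. lev x k a n t)-c) <= core_const k \<tau> N *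
  (\<Sum>n\<in>NN. delta q \<tau> ^ nat \<bar>n-m\<bar>*(\<Sum>j\<in>supp_idx x k n ?u ?v. cmod (a (n, j)) powr \<tau>) powr (1/\<tau>))"
  using core_est[OF k q \<tau> fin N refl refl] by blast
 have uv: "?u <= ?v" by (simp add: x_le_iff)
 have "(\<Sum>n\<in>NN. delta q \<tau> ^ nat \<bar>n-m\<bar>*(\<Sum>j\<in>supp_idx x k n ?u ?v. cmod (a (n, j)) powr \<tau>) powr (1/\<tau>))
  <= (\<Sum>n\<in>NN. delta q \<tau> ^ nat \<bar>n-m\<bar> * B)"
  using delta(1)[OF q, of \<tau>] by (intro sum_mono mult_left_mono hB supp_idx_finite_card uv) auto
 also have "... = (\<Sum>n\<in>NN. delta q \<tau> ^ nat \<bar>n-m\<bar>) * B" by (simp add: sum_distrib_right)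
 also have "... <= (2/(1-delta q \<tau>)) * B"
  using geometric_int_sum[OF fin delta(1,2)[OF q]] B by (intro mult_right_mono) auto
 finally have "core_const k \<tau> N*(\<Sum>n\<in>NN. delta q \<tau> ^ nat \<bar>n-m\<bar>*(\<Sum>j\<in>supp_idx x k n ?u ?v. cmod (a (n, j)) powr \<tau>) powr (1/\<tau>))
  <= core_const k \<tau> N*((2/(1-delta q \<tau>)) * B)"
  using core_const_pos[OF k N, of \<tau>] by (intro mult_left_mono) auto
 with c show ?thesis by (intro exI[of _ c]) (simp add: mult.assoc)
qed

lemma levs_continuous: "2 <= k ==> continuous_on {u..v} (\<lambda>t. \<Sum>n\<in>NN. lev x k a n t)"
 by (intro continuous_intros lev_continuous)

lemma bmo_est:
 assumes k: "2 <= k" and \<tau>: "0 < \<tau>" and fin: "finite NN" and B: "0 <= B" and uv: "u < v"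
  and hB: "\<And>n Z. n \<in> NN ==> finite Z ==> (\<Sum>j\<in>Z. cmod (a (n, j)) powr \<tau>) powr (1/\<tau>) <= B"
 shows "mn 1 u v (\<lambda>t. (\<Sum>n\<in>NN. lev x k a n t)-Avg u v (\<lambda>t. \<Sum>n\<in>NN. lev x k a n t)) <= bmo_const k \<tau> * B"
proof -
 define N where "N = 1+nat \<lceil>lam\<rceil>"
 define K where "K = real N * real M\<^sub>0 * lam\<^sup>2"
 let ?S = "\<lambda>t. \<Sum>n\<in>NN. lev x k a n t"
 have N1: "1 <= N" by (simp add: N_def)
 obtain m i where mi: "x m i <= u" "v <= x m (i+int N)" "x m (i+int N)-x m i <= K*(v-u)"
  using aligned_cover[OF uv N_def] unfolding K_def by blast
 obtain c where c: "mn 1 (x m i) (x m (i+int N)) (\<lambda>t. ?S t-c) <= core_const k \<tau> N*(2/(1-delta 1 \<tau>)) * B"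
  using core_est_unif[OF k _ \<tau> fin N1 B hB, of 1] by auto
 have SL: "(\<lambda>t. ?S t-c) \<in> Lq 1 {u'..v'}" for u' v'
  by (intro continuous_on_Lq continuous_intros lev_continuous[OF k]) simp
 have SL': "?S \<in> Lq 1 {u..v}" by (intro continuous_on_Lq continuous_intros lev_continuous[OF k]) simp
 have K0: "0 <= K" using lam by (simp add: K_def)
 have "mn 1 u v (\<lambda>t. ?S t-Avg u v ?S) <= 2 * mn 1 u v (\<lambda>t. ?S t-c)" by (rule mn_Avg_le[OF uv SL'])
 also have "mn 1 u v (\<lambda>t. ?S t-c) <= K * mn 1 (x m i) (x m (i+int N)) (\<lambda>t. ?S t-c)"
  by (rule mn_mono(2)[OF _ SL mi(1) uv mi(2,3)]) simp
 also have "... <= K*(core_const k \<tau> N*(2/(1-delta 1 \<tau>)) * B)" using c K0 by (rule mult_left_mono)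
 finally show ?thesis unfolding bmo_const_def Let_def N_def[symmetric] K_def[symmetric] by (simp add: mult_ac)
qed

text \<open>The kernel that bounds the \<tau>-th power of the modulus at \<open>g\<close> by the
  \<tau>-th powers of the coefficients at \<open>p\<close>. The first condition removes coarser
  levels without a knot in the interval of \<open>g\<close>, as they are polynomials there.\<close>

definition wgt :: "nat => real => real => int \<times> int => int \<times> int => real" where
 "wgt k q \<tau> g p = (if (fst g <= fst p \<or> (\<exists>l. x (fst g) (snd g+1-int k) <= x (fst p) l \<and> x (fst p) l <= x (fst g) (snd g+int k)))
    \<and> snd p \<in> supp_idx x k (fst p) (x (fst g) (snd g+1-int k)) (x (fst g) (snd g+int k))
   then (delta q \<tau> powr min 1 \<tau>) ^ nat \<bar>fst p-fst g\<bar> else 0)"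

definition "count1 k = 2*(real k * lam * lam+2 * real k * lam) * lam+3"
definition "count2 k = (2*(real k * lam+4 * real k * lam * lam) * lam+3)*(2*(2 * real k * lam) * lam+3)"
definition "wgt_const k q \<tau> = (count1 k+count2 k)*(2/(1-delta q \<tau> powr min 1 \<tau>))"

lemma x_shift_bounds: "x m (j+int n) <= x m j+real n*(lam * mesh x m)" "x m j-real n*(lam * mesh x m) <= x m (j-int n)"
 using x_diff_bounds(1)[of j "j+int n" m] x_diff_bounds(1)[of "j-int n" j m] by auto

text \<open>For m at most n, one support meets boundedly many of the enlarged intervals. For m > n
  their number is unbounded, but only those containing a knot of level n count: boundedly many such
  knots are near the support, and boundedly many intervals near each knot.\<close>

lemma wgt_count:
 assumes k: "2 <= k" and H: "finite H"
 shows "real (card {j\<in>H. wgt k q \<tau> (m, j) (n, i) \<noteq> 0}) <= count1 k+count2 k"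
proof -
 have c0: "0 <= count1 k" "0 <= count2 k" using lam by (auto simp: count1_def count2_def)
 let ?W = "{j\<in>H. wgt k q \<tau> (m, j) (n, i) \<noteq> 0}"
 have W: "(m <= n \<or> (\<exists>l. x m (j+1-int k) <= x n l \<and> x n l <= x m (j+int k))) \<and> x n i <= x m (j+int k) \<and> x m (j+1-int k) <= x n (i+int k)"
  if "j \<in> ?W" for j using that by (auto simp: wgt_def supp_idx_def split: if_splits)
 have lo: "x m j-real k*(lam * mesh x m) <= x m (j+1-int k)" for j
  using x_shift_bounds(2)[of m j k] x_le_iff[of m "j-int k" "j+1-int k"] by linarith
 have hi: "x m (j+int k) <= x m j+real k*(lam * mesh x m)" for m j by (rule x_shift_bounds)
 show ?thesis
 proof (cases "m <= n")
  case True
  let ?A = "x n i-real k*(lam * mesh x m)" and ?B = "x n i+real k*(lam * mesh x n)+real k*(lam * mesh x m)"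
  have sub: "?W \<subseteq> {j. ?A <= x m j \<and> x m j <= ?B}"
  proof
   fix j assume "j \<in> ?W"
   from W[OF this] lo[of j] hi[of m j] hi[of n i] show "j \<in> {j. ?A <= x m j \<and> x m j <= ?B}" by auto
  qed
  have "real k*(lam * mesh x n) <= real k*(lam*(lam * mesh x m))"
   using mesh_mono[OF True] lam by (intro mult_left_mono) auto
  hence BA: "?B-?A <= (real k * lam * lam+2 * real k * lam) * mesh x m" by (simp add: algebra_simps)
  have "real (card ?W) <= real (card {j. ?A <= x m j \<and> x m j <= ?B})"
   using card_mono[OF knot_count(1) sub] by simp
  also have "... <= count1 k" unfolding count1_def using BA lam by (intro knot_count(2)) auto
  finally show ?thesis using c0 by simp
 next
  case False
  hence nm: "n <= m" by simp
  have mm: "mesh x m <= lam * mesh x n" by (rule mesh_mono[OF nm])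
  let ?D = "real k*(lam * mesh x m)"
  have D: "?D <= real k * lam * lam * mesh x n"
  proof -
   have "real k*(lam * mesh x m) <= real k*(lam*(lam * mesh x n))" using mm lam by (intro mult_left_mono) auto
   thus ?thesis by (simp add: mult_ac)
  qed
  let ?L = "{l. x n i-2*(real k * lam * lam * mesh x n) <= x n l \<and> x n l <= x n i+real k*(lam * mesh x n)+2*(real k * lam * lam * mesh x n)}"
  let ?J = "\<lambda>l. {j. x n l-?D <= x m j \<and> x m j <= x n l+?D}"
  have Lfin: "finite ?L" by (rule knot_count(1))
  have Lc: "real (card ?L) <= 2*(real k * lam+4 * real k * lam * lam) * lam+3"
   using lam mesh_pos[of n] by (intro knot_count(2)) (auto simp: algebra_simps)
  have Jc: "real (card (?J l)) <= 2*(2 * real k * lam) * lam+3" for l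
   using lam by (intro knot_count(2)) (auto simp: algebra_simps)
  have sub: "?W \<subseteq> (\<Union>l\<in>?L. ?J l)"
  proof
   fix j assume "j \<in> ?W"
   from W[OF this] False obtain l where l: "x m (j+1-int k) <= x n l" "x n l <= x m (j+int k)"
    and ii: "x n i <= x m (j+int k)" "x m (j+1-int k) <= x n (i+int k)" by auto
   have "l \<in> ?L" using l ii lo[of j] hi[of m j] hi[of n i] D by auto
   moreover have "j \<in> ?J l" using l lo[of j] hi[of m j] by auto
   ultimately show "j \<in> (\<Union>l\<in>?L. ?J l)" by blast
  qed
  have Jf: "finite (?J l)" for l by (rule knot_count(1))
  have "card ?W <= card (\<Union>l\<in>?L. ?J l)" by (rule card_mono[OF finite_UN_I[OF Lfin Jf] sub])
  also have "... <= (\<Sum>l\<in>?L. card (?J l))" by (rule card_UN_le[OF Lfin])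
  finally have "real (card ?W) <= real (\<Sum>l\<in>?L. card (?J l))" by (rule of_nat_mono)
  also have "... = (\<Sum>l\<in>?L. real (card (?J l)))" by (rule of_nat_sum)
  also have "... <= (\<Sum>l\<in>?L. 2*(2 * real k * lam) * lam+3)" by (intro sum_mono Jc)
  also have "... = real (card ?L)*(2*(2 * real k * lam) * lam+3)" by simp
  also have "... <= count2 k" unfolding count2_def using Lc lam by (intro mult_right_mono) auto
  finally show ?thesis using c0 by simp
 qed
qed

lemma delta_min: "1 <= q ==> 0 < \<tau> ==> 0 < delta q \<tau> powr min 1 \<tau> \<and> delta q \<tau> powr min 1 \<tau> < 1"
 using delta[of q \<tau>] powr_less_mono2[of "min 1 \<tau>" "delta q \<tau>" 1] by auto

lemma wgt_nonneg: "0 <= wgt k q \<tau> g p" by (simp add: wgt_def)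

lemma wgt_const_nonneg: "1 <= q ==> 0 < \<tau> ==> 0 <= wgt_const k q \<tau>"
 unfolding wgt_const_def using lam delta_min[of q \<tau>] by (auto simp: count1_def count2_def intro!: mult_nonneg_nonneg divide_nonneg_nonneg)

lemma wgt_column:
 assumes k: "2 <= k" and q: "1 <= q" and \<tau>: "0 < \<tau>" and G: "finite G"
 shows "(\<Sum>g\<in>G. wgt k q \<tau> g p) <= wgt_const k q \<tau>"
proof -
 obtain n i where p: "p = (n, i)" by force
 let ?d = "delta q \<tau> powr min 1 \<tau>"
 have d: "0 < ?d" "?d < 1" using delta_min[OF q \<tau>] by auto
 have c0: "0 <= count1 k+count2 k" using lam by (auto simp: count1_def count2_def)
 have "(\<Sum>g\<in>G. wgt k q \<tau> g p) <= (\<Sum>g\<in>fst ` G \<times> snd ` G. wgt k q \<tau> g p)"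
  using G by (intro sum_mono2 wgt_nonneg) (auto intro: rev_image_eqI)
 also have "... = (\<Sum>m\<in>fst ` G. \<Sum>j\<in>snd ` G. wgt k q \<tau> (m, j) p)" by (simp add: sum.cartesian_product)
 also have "... <= (\<Sum>m\<in>fst ` G. ?d ^ nat \<bar>m-n\<bar>*(count1 k+count2 k))"
 proof (rule sum_mono)
  fix m
  have "(\<Sum>j\<in>snd ` G. wgt k q \<tau> (m, j) p) = (\<Sum>j\<in>{j\<in>snd ` G. wgt k q \<tau> (m, j) p \<noteq> 0}. wgt k q \<tau> (m, j) p)"
   using G by (intro sum.mono_neutral_right) auto
  also have "... <= (\<Sum>j\<in>{j\<in>snd ` G. wgt k q \<tau> (m, j) p \<noteq> 0}. ?d ^ nat \<bar>m-n\<bar>)"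
   by (intro sum_mono) (auto simp: wgt_def p abs_minus_commute)
  also have "... = real (card {j\<in>snd ` G. wgt k q \<tau> (m, j) p \<noteq> 0})*?d ^ nat \<bar>m-n\<bar>" by simp
  also have "... <= (count1 k+count2 k)*?d ^ nat \<bar>m-n\<bar>"
   using d G unfolding p by (intro mult_right_mono wgt_count k) auto
  finally show "(\<Sum>j\<in>snd ` G. wgt k q \<tau> (m, j) p) <= ?d ^ nat \<bar>m-n\<bar>*(count1 k+count2 k)" by (simp add: mult.commute)
 qed
 also have "... = (\<Sum>m\<in>fst ` G. ?d ^ nat \<bar>m-n\<bar>)*(count1 k+count2 k)" by (simp add: sum_distrib_right)
 also have "... <= (2/(1-?d))*(count1 k+count2 k)"
  using G d c0 by (intro mult_right_mono geometric_int_sum) auto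
 finally show ?thesis unfolding wgt_const_def by (simp add: mult.commute)
qed

end

section \<open>From B-spline representations to moduli of smoothness\<close>

lemma Lq_locD: "f \<in> Lq_loc q ==> f \<in> Lq q {a..b}"
 by (simp add: Lq_loc_def)

lemma poly_fun_const: "poly_fun [:c:] t = c"
 by (simp add: poly_fun_def)

lemma sum_le_infsum:
 fixes s :: "'p => real"
 assumes "s summable_on UNIV" "\<And>p. 0 <= s p" "finite A" shows "sum s A <= infsum s UNIV"
 by (rule finite_sum_le_infsum) (use assms in auto)

context multilevel begin

lemma E_coef_nonneg: "1 <= q ==> f \<in> Lq_loc q ==> 0 <= E_coef x k q f g"
 by (cases g) (auto simp: E_coef_def intro!: mult_nonneg_nonneg omega_nonneg Lq_locD)

lemma levs_Lq: "2 <= k ==> 1 <= q ==> (\<lambda>t. \<Sum>n\<in>NN. lev x k a n t) \<in> Lq q {u..v}"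
 by (intro continuous_on_Lq levs_continuous)

lemma lev_poly:
 assumes k: "0 < k" and no: "\<And>l. \<not> (u <= x n l \<and> x n l <= v)" and uv: "u <= v"
 shows "\<exists>p\<in>Pi_poly k. \<forall>t\<in>{u..v}. lev x k a n t = poly_fun p t"
proof -
 obtain K where K: "k = Suc K" using k gr0_conv_Suc by blast
 obtain l where l: "x n l <= u" "u < x n (l+1)" by (rule x_cover)
 have "v < x n (l+1)" using no[of "l+1"] l by force
 thus ?thesis
  using lev_cpiece[OF k, of n l _ a] l cpiece_Pi[of "x n" K "\<lambda>j. a (n, j)" l]
  by (intro bexI[of _ "cpiece (x n) k (\<lambda>j. a (n, j)) l"]) (auto simp: K)
qed

definition "Elev_const k q \<tau> = (2 ^ k*(real (2 * k-1) * lam\<^sup>2) * core_const k \<tau> (2 * k-1)) powr \<tau>*(2/(1-delta q \<tau>)) powr \<tau>"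

lemma Elev_const_nonneg: "0 <= Elev_const k q \<tau>" by (simp add: Elev_const_def)

lemma len_ratio:
 assumes q: "1 <= q" and N: "1 <= N"
 shows "len x m j powr (- 1/q)*(x m (i+int N)-x m i) powr (1/q) <= real N * lam\<^sup>2"
proof -
 let ?J = "x m (i+int N)-x m i"
 have J: "?J <= (real N * lam\<^sup>2) * len x m j"
 proof -
  have "?J <= real N*(lam * mesh x m)" using x_diff_bounds(1)[of i "i+int N" m] by simp
  also have "... <= real N*(lam*(lam * len x m j))" using lam by (intro mult_left_mono mesh_le_len) auto
  finally show ?thesis by (simp add: power2_eq_square mult_ac)
 qed
 have J0: "0 < ?J" using N by (simp add: x_less_iff)
 have R: "1 <= real N * lam\<^sup>2"
 proof -
  have "1*1 <= real N * lam\<^sup>2" using N lam by (intro mult_mono) auto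
  thus ?thesis by simp
 qed
 have "len x m j powr (- 1/q)*?J powr (1/q) = (?J/len x m j) powr (1/q)"
  using len_pos[of m j] J0 by (simp add: powr_divide powr_minus_divide)
 also have "... <= (real N * lam\<^sup>2) powr (1/q)"
  using J J0 len_pos[of m j] q by (intro powr_mono2) (auto simp: divide_le_eq)
 also have "... <= (real N * lam\<^sup>2) powr 1" using R q by (intro powr_mono) auto
 finally show ?thesis using R by simp
qed

text \<open>The polynomial \<open>P\<close> collects the levels that are polynomials on the interval
  together with the constant from \<open>core_est\<close>. The remaining levels are summed by
  \<open>Hardy_geometric\<close>, which produces the kernel \<open>wgt\<close>.\<close>

lemma E_level_bound:
 assumes k: "2 <= k" and q: "1 <= q" and \<tau>: "0 < \<tau>" and fin: "finite NN"
  and a: "(\<lambda>p. cmod (a p) powr \<tau>) summable_on UNIV"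
 shows "E_coef x k q (\<lambda>t. \<Sum>n\<in>NN. lev x k a n t) g powr \<tau> <=
  Elev_const k q \<tau>*(\<Sum>\<^sub>\<infinity>p. wgt k q \<tau> g p * cmod (a p) powr \<tau>)"
proof -
 obtain m j where g: "g = (m, j)" by force
 \<comment> \<open>The interval of \<open>E_coef\<close>, from knot j+1-k to knot j+k, consists of
   2k-1 intervals of level m.\<close>
 define N where "N = 2 * k-1"
 define i where "i = j+1-int k"
 have N1: "1 <= N" using k by (simp add: N_def)
 have iN: "i+int N = j+int k" using k by (simp add: i_def N_def)
 define u where "u = x m i"
 define v where "v = x m (i+int N)"
 have uv: "u < v" using N1 by (simp add: u_def v_def x_less_iff)
 define NN' where "NN' = {n\<in>NN. m <= n \<or> (\<exists>l. u <= x n l \<and> x n l <= v)}"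
 have fin': "finite NN'" using fin by (simp add: NN'_def)
 have k0: "0 < k" using k by simp
 have "\<exists>p\<in>Pi_poly k. \<forall>t\<in>{u..v}. lev x k a n t = poly_fun p t" if "n \<in> NN-NN'" for n
  using that uv by (intro lev_poly[OF k0]) (auto simp: NN'_def)
 then obtain p where p: "\<And>n. n \<in> NN-NN' ==> p n \<in> Pi_poly k"
  "\<And>n t. n \<in> NN-NN' ==> t \<in> {u..v} ==> lev x k a n t = poly_fun (p n) t" by metis
 let ?s = "\<lambda>n. \<Sum>i\<in>supp_idx x k n u v. cmod (a (n, i)) powr \<tau>"
 obtain c where c: "mn q u v (\<lambda>t. (\<Sum>n\<in>NN'. lev x k a n t)-c) <= core_const k \<tau> N *
  (\<Sum>n\<in>NN'. delta q \<tau> ^ nat \<bar>n-m\<bar>*?s n powr (1/\<tau>))"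
  using core_est[OF k q \<tau> fin' N1 u_def v_def] by blast
 let ?S = "\<lambda>t. \<Sum>n\<in>NN. lev x k a n t"
 define P where "P = (\<Sum>n\<in>NN-NN'. p n)+[:c:]"
 have P: "P \<in> Pi_poly k" unfolding P_def using k0 p(1) by (intro Pi_poly_add Pi_poly_sum Pi_poly_const) auto
 have SP: "?S t-poly_fun P t = (\<Sum>n\<in>NN'. lev x k a n t)-c" if "t \<in> {u..v}" for t
 proof -
  have "?S t = (\<Sum>n\<in>NN'. lev x k a n t)+(\<Sum>n\<in>NN-NN'. lev x k a n t)"
   using sum.subset_diff[of NN' NN "\<lambda>n. lev x k a n t"] fin by (simp add: NN'_def add.commute)
  also have "(\<Sum>n\<in>NN-NN'. lev x k a n t) = (\<Sum>n\<in>NN-NN'. poly_fun (p n) t)"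
   using p(2) that by (intro sum.cong refl) auto
  finally show ?thesis by (simp add: P_def poly_fun_simps poly_fun_sum poly_fun_const)
 qed
 let ?K = "2 ^ k*(real N * lam\<^sup>2) * core_const k \<tau> N"
 let ?H = "\<Sum>n\<in>NN'. delta q \<tau> ^ nat \<bar>n-m\<bar>*?s n powr (1/\<tau>)"
 have H0: "0 <= ?H" using delta(1)[OF q, of \<tau>] by (intro sum_nonneg) auto
 have E0: "0 <= E_coef x k q ?S g"
  unfolding E_coef_def g by (auto intro!: mult_nonneg_nonneg omega_nonneg q levs_Lq k)
 have "E_coef x k q ?S g = len x m j powr (- 1/q) * omega_k k q u v ?S"
 proof -
  have "u = x m (j+1-int k)" "v = x m (j+int k)" by (simp_all only: u_def v_def iN) (simp add: i_def)
  thus ?thesis by (simp add: E_coef_def g len_def)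
 qed
 also have "... <= len x m j powr (- 1/q)*(2 ^ k * Lq_norm q {u..v} (\<lambda>t. ?S t-poly_fun P t))"
  by (intro mult_left_mono omega_le_poly q levs_Lq k P) auto
 also have "Lq_norm q {u..v} (\<lambda>t. ?S t-poly_fun P t) = (v-u) powr (1/q) * mn q u v (\<lambda>t. (\<Sum>n\<in>NN'. lev x k a n t)-c)"
  using Lq_norm_cong[of "{u..v}" "\<lambda>t. ?S t-poly_fun P t" "\<lambda>t. (\<Sum>n\<in>NN'. lev x k a n t)-c" q] SP Lq_norm_mn[OF uv q] by simp
 also have "len x m j powr (- 1/q)*(2 ^ k*((v-u) powr (1/q) * mn q u v (\<lambda>t. (\<Sum>n\<in>NN'. lev x k a n t)-c)))
   = 2 ^ k*(len x m j powr (- 1/q)*(v-u) powr (1/q)) * mn q u v (\<lambda>t. (\<Sum>n\<in>NN'. lev x k a n t)-c)" by simp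
 also have "... <= 2 ^ k*(real N * lam\<^sup>2)*(core_const k \<tau> N*?H)"
  by (rule mult_mono[OF mult_left_mono[OF len_ratio[OF q N1, of m j i, folded u_def v_def]] c]) (use lam in simp_all)
 finally have E: "E_coef x k q ?S g <= ?K*?H" by (simp add: mult.assoc)
 have K0: "0 <= ?K" using core_const_pos[OF k N1, of \<tau>] lam by simp
 have s0: "0 <= ?s n" for n by (simp add: sum_nonneg)
 let ?d = "delta q \<tau> powr min 1 \<tau>"
 have "E_coef x k q ?S g powr \<tau> <= (?K*?H) powr \<tau>" using E E0 \<tau> by (intro powr_mono2) auto
 also have "... = ?K powr \<tau>*?H powr \<tau>" using K0 H0 by (simp only: powr_mult)
 also have "?H powr \<tau> <= (2/(1-delta q \<tau>)) powr \<tau>*(\<Sum>n\<in>NN'. ?d ^ nat \<bar>n-m\<bar>*(?s n powr (1/\<tau>)) powr \<tau>)"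
  by (rule Hardy_geometric[OF fin' delta(1,2)[OF q] _ \<tau>]) simp
 also have "(\<Sum>n\<in>NN'. ?d ^ nat \<bar>n-m\<bar>*(?s n powr (1/\<tau>)) powr \<tau>) = (\<Sum>n\<in>NN'. \<Sum>i\<in>supp_idx x k n u v. ?d ^ nat \<bar>n-m\<bar> * cmod (a (n, i)) powr \<tau>)"
  using \<tau> s0 by (intro sum.cong refl) (simp add: powr_powr sum_distrib_left)
 also have "... = (\<Sum>p\<in>Sigma NN' (\<lambda>n. supp_idx x k n u v). wgt k q \<tau> g p * cmod (a p) powr \<tau>)"
 proof -
  have "wgt k q \<tau> g (n, i') = ?d ^ nat \<bar>n-m\<bar>" if "n \<in> NN'" "i' \<in> supp_idx x k n u v" for n i'
   unfolding wgt_def using that by (auto simp: g NN'_def u_def v_def iN) (auto simp: i_def)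
  hence "(\<Sum>n\<in>NN'. \<Sum>i\<in>supp_idx x k n u v. ?d ^ nat \<bar>n-m\<bar> * cmod (a (n, i)) powr \<tau>)
   = (\<Sum>n\<in>NN'. \<Sum>i\<in>supp_idx x k n u v. wgt k q \<tau> g (n, i) * cmod (a (n, i)) powr \<tau>)"
   by (intro sum.cong refl) simp
  also have "... = (\<Sum>(n, i)\<in>Sigma NN' (\<lambda>n. supp_idx x k n u v). wgt k q \<tau> g (n, i) * cmod (a (n, i)) powr \<tau>)"
   by (rule sum.Sigma) (use fin' uv in \<open>auto intro!: supp_idx_finite_card\<close>)
  finally show ?thesis by (simp add: case_prod_unfold)
 qed
 also have "... <= (\<Sum>\<^sub>\<infinity>p. wgt k q \<tau> g p * cmod (a p) powr \<tau>)"
 proof (rule sum_le_infsum)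
  show "(\<lambda>p. wgt k q \<tau> g p * cmod (a p) powr \<tau>) summable_on UNIV"
   by (rule Schur_infsum(1)[OF wgt_nonneg _ a wgt_const_nonneg[OF q \<tau>] wgt_column[OF k q \<tau>]]) simp
  show "finite (Sigma NN' (\<lambda>n. supp_idx x k n u v))" using fin' uv by (auto intro!: supp_idx_finite_card)
 qed (simp add: wgt_nonneg)
 finally have "E_coef x k q ?S g powr \<tau> <= ?K powr \<tau>*((2/(1-delta q \<tau>)) powr \<tau>*(\<Sum>\<^sub>\<infinity>p. wgt k q \<tau> g p * cmod (a p) powr \<tau>))"
  by (simp add: mult_left_mono)
 thus ?thesis by (simp add: Elev_const_def N_def mult.assoc)
qed

definition restr :: "(int \<times> int) set => (int \<times> int => complex) => int \<times> int => complex" where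
 "restr F a p = (if p \<in> F then a p else 0)"

text \<open>Regroups an arbitrary finite partial sum by levels, the form to which
  \<open>core_est\<close> applies.\<close>

lemma sum_phi_lev:
 assumes F: "finite F"
 shows "(\<Sum>(m, j)\<in>F. a (m, j) * phi x k m j t) = (\<Sum>n\<in>fst ` F. lev x k (restr F a) n t)"
proof -
 have l: "lev x k (restr F a) n t = (\<Sum>j\<in>{j. (n, j) \<in> F}. a (n, j) * phi x k n j t)" for n
 proof -
  have fin: "finite {j. (n, j) \<in> F}" using F by (rule finite_subset[rotated, OF finite_imageI[of F snd]]) (auto intro: rev_image_eqI)
  have "((\<lambda>j. restr F a (n, j) * phi x k n j t) has_sum (\<Sum>j\<in>{j. (n, j) \<in> F}. restr F a (n, j) * phi x k n j t)) UNIV"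
   by (rule has_sum_finite_neutralI[OF fin]) (auto simp: restr_def)
  hence "lev x k (restr F a) n t = (\<Sum>j\<in>{j. (n, j) \<in> F}. restr F a (n, j) * phi x k n j t)"
   unfolding lev_def by (rule infsumI)
  thus ?thesis by (simp add: restr_def)
 qed
 have fj: "finite {j. (n, j) \<in> F}" for n
  using F by (rule finite_subset[rotated, OF finite_imageI[of F snd]]) (auto intro: rev_image_eqI)
 have "F = Sigma (fst ` F) (\<lambda>n. {j. (n, j) \<in> F})" by force
 hence "(\<Sum>(m, j)\<in>F. a (m, j) * phi x k m j t) = (\<Sum>(m, j)\<in>Sigma (fst ` F) (\<lambda>n. {j. (n, j) \<in> F}). a (m, j) * phi x k m j t)" by simp
 also have "... = (\<Sum>n\<in>fst ` F. \<Sum>j\<in>{j. (n, j) \<in> F}. a (n, j) * phi x k n j t)"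
  using F fj by (subst sum.Sigma) auto
 finally show ?thesis by (simp add: l)
qed

lemma restr_powr_le: "cmod (restr F a p) powr \<tau> <= cmod (a p) powr \<tau>"
 by (simp add: restr_def)

lemma restr_summable:
 assumes "(\<lambda>p. cmod (a p) powr \<tau>) summable_on UNIV"
 shows "(\<lambda>p. cmod (restr F a p) powr \<tau>) summable_on UNIV"
 by (rule summable_on_comparison_test[OF assms]) (auto simp: restr_def)

lemma level_norm_le:
 assumes a: "(\<lambda>p. cmod (a p) powr \<tau>) summable_on UNIV" and \<tau>: "0 < \<tau>" and Z: "finite Z"
 shows "(\<Sum>j\<in>Z. cmod (a (n, j)) powr \<tau>) powr (1/\<tau>) <= ell_norm \<tau> (\<lambda>p. cmod (a p))"
proof -
 have "(\<Sum>j\<in>Z. cmod (a (n, j)) powr \<tau>) = (\<Sum>p\<in>Pair n ` Z. cmod (a p) powr \<tau>)"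
  by (subst sum.reindex) (auto simp: inj_on_def)
 also have "... <= (\<Sum>\<^sub>\<infinity>p. cmod (a p) powr \<tau>)" using Z by (intro sum_le_infsum a) auto
 finally show ?thesis unfolding ell_norm_def using \<tau> by (intro powr_mono2) (auto intro: sum_nonneg)
qed

lemma ell_norm_nonneg: "0 <= ell_norm \<tau> c" by (simp add: ell_norm_def)

lemma ell_norm_restr:
 assumes "(\<lambda>p. cmod (a p) powr \<tau>) summable_on UNIV" "0 < \<tau>"
 shows "ell_norm \<tau> (\<lambda>p. cmod (restr F a p)) <= ell_norm \<tau> (\<lambda>p. cmod (a p))"
 unfolding ell_norm_def using assms(2)
 by (intro powr_mono2 infsum_mono restr_summable assms restr_powr_le infsum_nonneg) auto

text \<open>BMO convergence is L^1 convergence on each interval after adding suitable constants.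
  Uniform L^q bounds of the partial sums and of their differences then pass to \<open>g\<close> by
  Fatou's lemma.\<close>

lemma Phi_rep_in_Lq:
 assumes k: "2 <= k" and q: "1 <= q" and \<tau>: "0 < \<tau>" and a: "(\<lambda>p. cmod (a p) powr \<tau>) summable_on UNIV"
  and g: "\<And>u v. g \<in> Lq 1 {u..v}"
  and F: "\<And>r::nat. finite (F r)" "\<And>(r::nat) u v. u < v ==>
    mn 1 u v (\<lambda>t. (g t-(\<Sum>n\<in>fst ` F r. lev x k (restr (F r) a) n t))-Avg u v (\<lambda>t. g t-(\<Sum>n\<in>fst ` F r. lev x k (restr (F r) a) n t))) < 1/(real r+1)"
 shows "g \<in> Lq q {u..v}"
  and "u < v ==> (\<And>r. Lq_norm q {u..v} (fin_diff k h (\<lambda>t. \<Sum>n\<in>fst ` F r. lev x k (restr (F r) a) n t) u v) <= B)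
   ==> Lq_norm q {u..v} (fin_diff k h g u v) <= B"
proof -
 let ?S = "\<lambda>r t. \<Sum>n\<in>fst ` F r. lev x k (restr (F r) a) n t"
 define e where "e r u v = Avg u v (\<lambda>t. g t-?S r t)" for r u v
 have S1: "?S r \<in> Lq q' {u..v}" if "1 <= q'" for q' r u v by (rule levs_Lq[OF k that])
 have c1: "(\<lambda>t. c) \<in> Lq q' {u..v}" if "1 <= q'" for c :: complex and q' u v by (intro continuous_on_Lq that continuous_intros)
 have v1: "mn 1 u v (\<lambda>t. (?S r t+e r u v)-g t) < 1/(real r+1)" if "u < v" for r u v
 proof -
  have "mn 1 u v (\<lambda>t. (?S r t+e r u v)-g t) = mn 1 u v (\<lambda>t. g t-(?S r t+e r u v))" by (rule mn_minus_commute)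
  also have "... = mn 1 u v (\<lambda>t. (g t-?S r t)-e r u v)" by (simp add: algebra_simps)
  also have "... < 1/(real r+1)" unfolding e_def by (rule F(2)[OF that])
  finally show ?thesis .
 qed
 have lim0: "(\<lambda>r. 1/(real r+1)) \<longlonglongrightarrow> 0"
  using LIMSEQ_inverse_real_of_nat by (simp add: inverse_eq_divide add.commute)
 \<comment> \<open>The uniform bound requires end points at knots; a general interval is then
   covered by one of this kind.\<close>
 have aligned: "g \<in> Lq q {x 0 i..x 0 (i+int N)}" if N: "1 <= N" for i N
 proof -
  let ?u = "x 0 i" and ?v = "x 0 (i+int N)"
  have uv: "?u < ?v" using N by (simp add: x_less_iff)
  define B where "B = core_const k \<tau> N*(2/(1-delta q \<tau>)) * ell_norm \<tau> (\<lambda>p. cmod (a p))"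
  have "\<exists>c. mn q ?u ?v (\<lambda>t. ?S r t-c) <= B" for r
   unfolding B_def
  proof (rule core_est_unif[OF k q \<tau> _ N ell_norm_nonneg])
   show "finite (fst ` F r)" using F(1) by simp
   show "(\<Sum>j\<in>Z. cmod (restr (F r) a (n, j)) powr \<tau>) powr (1/\<tau>) <= ell_norm \<tau> (\<lambda>p. cmod (a p))" if "finite Z" for n Z
    using level_norm_le[OF restr_summable[OF a] \<tau> that, of "F r" n] ell_norm_restr[OF a \<tau>, of "F r"] by linarith
  qed
  then obtain c where c: "\<And>r. mn q ?u ?v (\<lambda>t. ?S r t-c r) <= B" by metis
  define B' where "B' = B+(1+mn 1 ?u ?v g+B)"
  have mq: "mn q ?u ?v (\<lambda>t. ?S r t+e r ?u ?v) <= B'" for r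
  proof -
   have Sc: "(\<lambda>t. ?S r t-c r) \<in> Lq q {?u..?v}" by (intro Lq_diff(1) q S1 c1)
   \<comment> \<open>Subtracting \<open>c r\<close> makes the partial sum bounded in L^q, adding
     \<open>e r\<close> makes it close to \<open>g\<close> in L^1. Comparing the two in L^1 bounds
     the sum of these constants uniformly in \<open>r\<close>.\<close>
   have "cmod (c r+e r ?u ?v) = mn 1 ?u ?v (\<lambda>t. c r+e r ?u ?v)" using uv by (intro mn_const[symmetric]) auto
   also have "... = mn 1 ?u ?v (\<lambda>t. (((?S r t+e r ?u ?v)-g t)+g t)-(?S r t-c r))" by (simp add: add.commute)
   also have "... <= mn 1 ?u ?v (\<lambda>t. ((?S r t+e r ?u ?v)-g t)+g t)+mn 1 ?u ?v (\<lambda>t. ?S r t-c r)"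
    by (intro mn_diff Lq_add(1) Lq_diff(1) S1 c1 g) auto
   also have "mn 1 ?u ?v (\<lambda>t. ((?S r t+e r ?u ?v)-g t)+g t) <= mn 1 ?u ?v (\<lambda>t. (?S r t+e r ?u ?v)-g t)+mn 1 ?u ?v g"
    by (intro mn_add Lq_add(1) Lq_diff(1) S1 c1 g) auto
   also have "mn 1 ?u ?v (\<lambda>t. (?S r t+e r ?u ?v)-g t) <= 1"
    using v1[OF uv, of r] by (rule order_trans[OF less_imp_le]) simp
   also have "mn 1 ?u ?v (\<lambda>t. ?S r t-c r) <= B"
    using Lq_integrable_norm(2)[OF q Sc uv] c[of r] by linarith
   finally have ce: "cmod (c r+e r ?u ?v) <= 1+mn 1 ?u ?v g+B" by simp
   have "mn q ?u ?v (\<lambda>t. ?S r t+e r ?u ?v) = mn q ?u ?v (\<lambda>t. (?S r t-c r)+(c r+e r ?u ?v))" by simp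
   also have "... <= mn q ?u ?v (\<lambda>t. ?S r t-c r)+mn q ?u ?v (\<lambda>t. c r+e r ?u ?v)"
    by (intro mn_add q Sc c1)
   also have "mn q ?u ?v (\<lambda>t. c r+e r ?u ?v) = cmod (c r+e r ?u ?v)" by (rule mn_const[OF q uv])
   finally show ?thesis using ce c[of r] unfolding B'_def by linarith
  qed
  show ?thesis
  proof (rule Lq_Fatou(1)[OF q uv])
   show "(\<lambda>t. ?S r t+e r ?u ?v) \<in> Lq q {?u..?v}" for r by (intro Lq_add(1) q S1 c1)
   show "mn q ?u ?v (\<lambda>t. ?S r t+e r ?u ?v) <= B'" for r by (rule mq)
   show "g \<in> Lq 1 {?u..?v}" by (rule g)
   show "(\<lambda>r. mn 1 ?u ?v (\<lambda>t. ?S r t+e r ?u ?v-g t)) \<longlonglongrightarrow> 0"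
    by (rule tendsto_sandwich[OF _ _ tendsto_const lim0]) (auto intro!: always_eventually less_imp_le v1[OF uv])
  qed
 qed
 show gq: "g \<in> Lq q {u..v}" for u v
 proof -
  obtain i where i: "x 0 i <= u" "u < x 0 (i+1)" by (rule x_cover)
  obtain i' where i': "x 0 i' <= max u v" "max u v < x 0 (i'+1)" by (rule x_cover)
  have "x 0 i < x 0 (i'+1)" using i i' by linarith
  hence "i < i'+1" by (simp add: x_less_iff)
  hence N: "1 <= nat (i'+1-i)" "i+int (nat (i'+1-i)) = i'+1" by auto
  show ?thesis
   by (rule Lq_subset(1)[OF q aligned[OF N(1), of i]]) (use i i' N(2) in auto)
 qed
 assume uv: "u < v" and B: "\<And>r. Lq_norm q {u..v} (fin_diff k h (?S r) u v) <= B"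
 define B1 where "B1 = (v-u) powr (- 1/q) * B"
 have "mn q u v (fin_diff k h g u v) <= B1"
 proof (rule Lq_Fatou(2)[OF q uv])
  show "fin_diff k h (?S r) u v \<in> Lq q {u..v}" for r by (rule fin_diff_Lq(1)[OF q S1[OF q]])
  show "mn q u v (fin_diff k h (?S r) u v) <= B1" for r unfolding mn_def B1_def by (intro mult_left_mono B) auto
  show "fin_diff k h g u v \<in> Lq 1 {u..v}" by (rule fin_diff_Lq(1)[OF _ g]) simp
  show "(\<lambda>r. mn 1 u v (\<lambda>t. fin_diff k h (?S r) u v t-fin_diff k h g u v t)) \<longlonglongrightarrow> 0"
  proof (rule tendsto_sandwich[OF _ _ tendsto_const])
   show "(\<lambda>r. 2 ^ k*(1/(real r+1))) \<longlonglongrightarrow> 0" using tendsto_mult_left[OF lim0, of "2 ^ k"] by simp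
   show "\<forall>\<^sub>F r in sequentially. mn 1 u v (\<lambda>t. fin_diff k h (?S r) u v t-fin_diff k h g u v t) <= 2 ^ k*(1/(real r+1))"
   proof (intro always_eventually allI)
    fix r
    let ?w = "\<lambda>t. (?S r t+e r u v)-g t"
    have w: "?w \<in> Lq 1 {u..v}" by (intro Lq_add(1) Lq_diff(1) S1 c1 g) auto
    have cp: "[:e r u v:] \<in> Pi_poly k" using k by (intro Pi_poly_const) simp
    have "fin_diff k h (?S r) u v t-fin_diff k h g u v t = fin_diff k h ?w u v t" for t
    proof -
     have "fin_diff k h ?w u v t = fin_diff k h (?S r) u v t+fin_diff k h (poly_fun [:e r u v:]) u v t-fin_diff k h g u v t"
      unfolding fin_diff_diff fin_diff_add poly_fun_const ..
     thus ?thesis unfolding fin_diff_poly_eq_0[OF cp] by simp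
    qed
    hence "mn 1 u v (\<lambda>t. fin_diff k h (?S r) u v t-fin_diff k h g u v t) = (v-u) powr (- 1/1) * Lq_norm 1 {u..v} (fin_diff k h ?w u v)"
     by (simp add: mn_def)
    also have "... <= (v-u) powr (- 1/1)*(2 ^ k * Lq_norm 1 {u..v} ?w)"
     by (intro mult_left_mono fin_diff_Lq(2) w) auto
    also have "... = 2 ^ k * mn 1 u v ?w" by (simp add: mn_def)
    also have "... <= 2 ^ k*(1/(real r+1))" using v1[OF uv, of r] by (intro mult_left_mono) auto
    finally show "mn 1 u v (\<lambda>t. fin_diff k h (?S r) u v t-fin_diff k h g u v t) <= 2 ^ k*(1/(real r+1))" .
   qed
  qed simp
 qed
 thus "Lq_norm q {u..v} (fin_diff k h g u v) <= B"
  unfolding mn_def B1_def using uv by (subst (asm) mult_le_cancel_left_pos) auto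
qed

definition "PhiE_const k q \<tau> = (Elev_const k q \<tau> * wgt_const k q \<tau>) powr (1/\<tau>)"

theorem Phi_to_E:
 assumes k: "2 <= k" and q: "1 <= q" and \<tau>: "0 < \<tau>" and rep: "Phi_rep x k \<tau> f a"
 shows "f \<in> besov_E x k \<tau> q" "besov_E_norm x k \<tau> q f <= PhiE_const k q \<tau> * ell_norm \<tau> (\<lambda>p. cmod (a p))"
proof -
 from rep obtain P where P: "P \<in> Pi_poly k" and V: "(resid f P) \<in> VMO"
  and lim: "((\<lambda>F. bmo_norm (\<lambda>t. f t-poly_fun P t-(\<Sum>(m, j)\<in>F. a (m, j) * phi x k m j t))) \<longlongrightarrow> 0) (finite_subsets_at_top UNIV)"
  and a: "(\<lambda>p. cmod (a p) powr \<tau>) summable_on UNIV"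
  unfolding Phi_rep_def by blast
 define g where "g = (resid f P)"
 have g1: "g \<in> Lq 1 {u..v}" for u v
  using V unfolding VMO_def BMO_def g_def Lq1_set_integrable by blast
 \<comment> \<open>The net of finite sets is replaced by a sequence: for each \<open>r\<close>, a
   set whose partial sum is within 1/(r+1) of \<open>g\<close> in BMO.\<close>
 define Q where "Q r F \<longleftrightarrow> bmo_norm (\<lambda>t. g t-(\<Sum>(m, j)\<in>F. a (m, j) * phi x k m j t)) < ennreal (1/(real r+1))" for r :: nat and F
 have ev: "\<forall>\<^sub>F F in finite_subsets_at_top UNIV. Q r F" for r
  unfolding Q_def using lim unfolding g_def by (rule order_tendstoD) (simp add: ennreal_less_zero_iff)
 have "\<exists>F. finite F \<and> Q r F" for r
 proof -
  obtain X where X: "finite X" "\<forall>Y. finite Y \<and> X \<subseteq> Y \<and> Y \<subseteq> UNIV --> Q r Y"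
   using ev[of r, unfolded eventually_finite_subsets_at_top] by (elim exE conjE)
  hence "Q r X" by simp
  with X(1) show ?thesis by blast
 qed
 hence "\<forall>r. \<exists>F. finite F \<and> Q r F" by (rule allI)
 hence "\<exists>F. \<forall>r. finite (F r) \<and> Q r (F r)" by (rule choice)
 then obtain F where FQ: "\<forall>r. finite (F r) \<and> Q r (F r)" by (elim exE)
 have F: "\<And>r. finite (F r)"
  "\<And>r. bmo_norm (\<lambda>t. g t-(\<Sum>(m, j)\<in>F r. a (m, j) * phi x k m j t)) < ennreal (1/(real r+1))"
  using FQ unfolding Q_def by simp_all
 let ?S = "\<lambda>r t. \<Sum>n\<in>fst ` F r. lev x k (restr (F r) a) n t"
 have F2: "mn 1 u v (\<lambda>t. (g t-?S r t)-Avg u v (\<lambda>t. g t-?S r t)) < 1/(real r+1)" if "u < v" for r u v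
  using bmo_norm_less_mn[OF F(2)[of r] that] by (simp only: sum_phi_lev[OF F(1)])
 note main = Phi_rep_in_Lq[OF k q \<tau> a g1 F(1) F2]
 have gq: "g \<in> Lq q {u..v}" for u v by (rule main(1))
 have fg: "f = (\<lambda>t. g t+poly_fun P t)" by (simp add: g_def)
 have fq: "f \<in> Lq q {u..v}" for u v unfolding fg by (intro Lq_add(1) q gq poly_fun_Lq)
 hence floc: "f \<in> Lq_loc q" by (simp add: Lq_loc_def)
 \<comment> \<open>The partial sums have restricted coefficients, so this one majorant, formed with
   all coefficients, bounds their moduli for every \<open>r\<close>.\<close>
 define U where "U G = (\<Sum>\<^sub>\<infinity>p. wgt k q \<tau> G p * cmod (a p) powr \<tau>)" for G
 have s0: "0 <= cmod (a p) powr \<tau>" for p by simp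
 note Schur = Schur_infsum[where w="wgt k q \<tau>" and s="\<lambda>p. cmod (a p) powr \<tau>", OF wgt_nonneg s0 a wgt_const_nonneg[OF q \<tau>] wgt_column[OF k q \<tau>]]
 have U0: "0 <= U G" for G unfolding U_def by (intro infsum_nonneg mult_nonneg_nonneg wgt_nonneg) simp
 have Ebd: "E_coef x k q f G powr \<tau> <= Elev_const k q \<tau> * U G" for G
 proof -
  obtain m j where G: "G = (m, j)" by force
  define u where "u = x m (j+1-int k)"
  define v where "v = x m (j+int k)"
  have uv: "u < v" using k by (simp add: u_def v_def x_less_iff)
  define L where "L = len x m j powr (- 1/q)"
  have L: "0 < L" using len_pos[of m j] by (simp add: L_def)
  define B where "B = (Elev_const k q \<tau> * U G) powr (1/\<tau>)"
  have SB: "L * omega_k k q u v (?S r) <= B" for r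
  proof -
   have "E_coef x k q (?S r) G powr \<tau> <= Elev_const k q \<tau>*(\<Sum>\<^sub>\<infinity>p. wgt k q \<tau> G p * cmod (restr (F r) a p) powr \<tau>)"
    by (rule E_level_bound[OF k q \<tau> _ restr_summable[OF a]]) (use F(1) in simp)
   also have "... <= Elev_const k q \<tau> * U G"
   proof (intro mult_left_mono Elev_const_nonneg, unfold U_def, rule infsum_mono)
    show "(\<lambda>p. wgt k q \<tau> G p * cmod (restr (F r) a p) powr \<tau>) summable_on UNIV"
     by (rule summable_on_comparison_test[OF Schur(1)[of G]]) (auto intro!: mult_left_mono restr_powr_le wgt_nonneg mult_nonneg_nonneg)
    show "(\<lambda>p. wgt k q \<tau> G p * cmod (a p) powr \<tau>) summable_on UNIV" by (rule Schur(1))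
   qed (intro mult_left_mono restr_powr_le wgt_nonneg)
   finally have "(E_coef x k q (?S r) G powr \<tau>) powr (1/\<tau>) <= B" unfolding B_def using \<tau> by (intro powr_mono2) auto
   moreover have "E_coef x k q (?S r) G = L * omega_k k q u v (?S r)"
    by (simp add: E_coef_def G L_def u_def v_def len_def)
   moreover have "0 <= L * omega_k k q u v (?S r)" using L by (intro mult_nonneg_nonneg omega_nonneg q levs_Lq k) auto
   ultimately show ?thesis using \<tau> by (simp add: powr_powr)
  qed
  have "omega_k k q u v f <= B/L"
   unfolding omega_k_def
  proof (rule cSUP_least)
   fix h
   have "fin_diff k h f u v = fin_diff k h g u v"
    by (rule ext) (simp add: fg fin_diff_add fin_diff_poly_eq_0[OF P])
   moreover have "Lq_norm q {u..v} (fin_diff k h g u v) <= B/L"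
   proof (rule main(2)[OF _ uv])
    fix r
    have "L * Lq_norm q {u..v} (fin_diff k h (?S r) u v) <= L * omega_k k q u v (?S r)"
     using L by (intro mult_left_mono fin_diff_le_omega q levs_Lq k) auto
    also have "... <= B" by (rule SB)
    finally show "Lq_norm q {u..v} (fin_diff k h (?S r) u v) <= B/L" using L by (simp add: le_divide_eq mult.commute)
   qed auto
   ultimately show "Lq_norm q {u..v} (fin_diff k h f u v) <= B/L" by simp
  qed simp
  hence "E_coef x k q f G <= B" using L by (simp add: E_coef_def G L_def u_def v_def len_def le_divide_eq mult.commute)
  hence "E_coef x k q f G powr \<tau> <= B powr \<tau>" using \<tau> E_coef_nonneg[OF q floc] by (intro powr_mono2) auto
  also have "... = Elev_const k q \<tau> * U G" unfolding B_def using \<tau> U0[of G] Elev_const_nonneg by (simp add: powr_powr)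
  finally show ?thesis .
 qed
 have Us: "U summable_on UNIV" unfolding U_def by (rule Schur(2))
 have EU: "(\<lambda>G. Elev_const k q \<tau> * U G) summable_on UNIV" by (rule summable_on_cmult_right[OF Us])
 have Es: "(\<lambda>G. E_coef x k q f G powr \<tau>) summable_on UNIV"
  by (rule summable_on_comparison_test[OF EU]) (use Ebd in auto)
 show "f \<in> besov_E x k \<tau> q" using floc Es by (simp add: besov_E_def)
 have "(\<Sum>\<^sub>\<infinity>G. E_coef x k q f G powr \<tau>) <= (\<Sum>\<^sub>\<infinity>G. Elev_const k q \<tau> * U G)"
  by (rule infsum_mono[OF Es EU Ebd])
 also have "... = Elev_const k q \<tau>*(\<Sum>\<^sub>\<infinity>G. U G)" by (rule infsum_cmult_right')
 also have "... <= Elev_const k q \<tau>*(wgt_const k q \<tau>*(\<Sum>\<^sub>\<infinity>p. cmod (a p) powr \<tau>))"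
  unfolding U_def by (intro mult_left_mono Schur(3) Elev_const_nonneg)
 finally have "(\<Sum>\<^sub>\<infinity>G. E_coef x k q f G powr \<tau>) powr (1/\<tau>) <= (Elev_const k q \<tau> * wgt_const k q \<tau>*(\<Sum>\<^sub>\<infinity>p. cmod (a p) powr \<tau>)) powr (1/\<tau>)"
  using \<tau> by (intro powr_mono2) (auto intro: infsum_nonneg simp: mult.assoc)
 also have "... = PhiE_const k q \<tau> * ell_norm \<tau> (\<lambda>p. cmod (a p))"
 proof -
  have "0 <= Elev_const k q \<tau> * wgt_const k q \<tau>" by (intro mult_nonneg_nonneg Elev_const_nonneg wgt_const_nonneg q \<tau>)
  moreover have "0 <= (\<Sum>\<^sub>\<infinity>p. cmod (a p) powr \<tau>)" by (intro infsum_nonneg) simp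
  ultimately show ?thesis unfolding PhiE_const_def ell_norm_def by (simp only: powr_mult)
 qed
 finally show "besov_E_norm x k \<tau> q f <= PhiE_const k q \<tau> * ell_norm \<tau> (\<lambda>p. cmod (a p))"
  by (simp add: besov_E_norm_def ell_norm_def)
qed

end

text \<open>Differences with k independent steps. The induction behind Whitney's inequality produces
  these, while \<open>omega_k\<close> controls equal steps only.\<close>

fun md :: "nat => (nat => real) => (real => complex) => real => complex" where
 "md 0 c f = f"
| "md (Suc k) c f = md k c (\<lambda>t. f (t+c k)-f t)"

section \<open>Whitney's inequality\<close>

definition alt :: "(nat => real) => nat set => (real => complex) => real => complex" where
 "alt c A f t = (\<Sum>S\<in>Pow A. (-1) ^ card S * f (t+sum c S))"

lemma alt_insert:
 assumes "finite A" "i \<notin> A"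
 shows "alt c (insert i A) f t = alt c A f t-alt c A f (t+c i)"
proof -
 have "alt c (insert i A) f t = (\<Sum>S\<in>Pow A. (-1) ^ card S * f (t+sum c S))+(\<Sum>S\<in>insert i ` Pow A. (-1) ^ card S * f (t+sum c S))"
  unfolding alt_def Pow_insert using assms by (intro sum.union_disjoint) auto
 also have "(\<Sum>S\<in>insert i ` Pow A. (-1) ^ card S * f (t+sum c S)) = (\<Sum>S\<in>Pow A. - ((-1) ^ card S * f (t+c i+sum c S)))"
 proof (subst sum.reindex)
  show "inj_on (insert i) (Pow A)" using assms(2) by (auto simp: inj_on_def)
  have "(-1) ^ card (insert i S) * f (t+sum c (insert i S)) = - ((-1) ^ card S * f (t+c i+sum c S))" if "S \<in> Pow A" for S
  proof -
   have "finite S" "i \<notin> S" using that assms finite_subset by auto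
   thus ?thesis by (simp add: add.assoc)
  qed
  thus "sum ((\<lambda>S. (-1) ^ card S * f (t+sum c S)) \<circ> insert i) (Pow A) = (\<Sum>S\<in>Pow A. - ((-1) ^ card S * f (t+c i+sum c S)))"
   by (intro sum.cong refl) (simp only: comp_def)
 qed
 finally show ?thesis unfolding alt_def by (simp add: sum_negf)
qed

lemma alt_zero:
 assumes "finite A" "i \<in> A" "c i = 0" shows "alt c A f t = 0"
proof -
 have A: "A = insert i (A-{i})" using assms(2) by auto
 show ?thesis by (subst A, subst alt_insert) (use assms in auto)
qed

lemma alt_diff: "alt c A (\<lambda>t. f t-g t) t = alt c A f t-alt c A g t"
 unfolding alt_def by (simp add: right_diff_distrib sum_subtractf)

lemma alt_shift: "alt c A (\<lambda>t. f (t+h)) t = alt c A f (t+h)"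
 unfolding alt_def by (intro sum.cong refl) (simp add: add_ac)

lemma md_alt: "md k c f t = (-1) ^ k * alt c {..<k} f t"
proof (induction k arbitrary: f)
 case 0
 show ?case by (simp add: alt_def)
next
 case (Suc k)
 have "md (Suc k) c f t = (-1) ^ k*(alt c {..<k} f (t+c k)-alt c {..<k} f t)"
  by (simp only: md.simps Suc alt_diff alt_shift)
 also have "alt c {..<k} f (t+c k)-alt c {..<k} f t = - alt c {..<Suc k} f t"
  unfolding lessThan_Suc by (subst alt_insert) auto
 finally show ?case by simp
qed

text \<open>Mixed differences through differences with equal steps. After expanding
  \<open>kdiff\<close>, the terms with fixed i form an alternating sum with the steps c_j(1 -
  i/(j+1)). For i \<ge> 1 the step with j = i-1 is zero and the sum vanishes, so only i = 0
  survives.\<close>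

lemma md_kdiff:
 "md k c f t = (\<Sum>S\<in>Pow {..<k}. (-1) ^ card S * kdiff k (- (\<Sum>j\<in>S. c j/real (Suc j))) f (t+sum c S))"
proof -
 let ?c = "\<lambda>i j. c j*(1-real i/real (Suc j))"
 have "(\<Sum>S\<in>Pow {..<k}. (-1) ^ card S * kdiff k (- (\<Sum>j\<in>S. c j/real (Suc j))) f (t+sum c S))
  = (\<Sum>S\<in>Pow {..<k}. \<Sum>i\<le>k. (-1) ^ (k+i) * of_nat (k choose i)*((-1) ^ card S * f (t+sum (?c i) S)))"
 proof (rule sum.cong[OF refl])
  fix S
  have e: "t+sum c S+real i * - (\<Sum>j\<in>S. c j/real (Suc j)) = t+sum (?c i) S" for i
  proof -
   have "sum (?c i) S = sum c S-(\<Sum>j\<in>S. real i*(c j/real (Suc j)))"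
    unfolding sum_subtractf[symmetric] by (intro sum.cong refl) (simp add: right_diff_distrib)
   thus ?thesis by (simp add: sum_distrib_left)
  qed
  show "(-1) ^ card S * kdiff k (- (\<Sum>j\<in>S. c j/real (Suc j))) f (t+sum c S)
   = (\<Sum>i\<le>k. (-1) ^ (k+i) * of_nat (k choose i)*((-1) ^ card S * f (t+sum (?c i) S)))"
   unfolding kdiff_def e sum_distrib_left by (intro sum.cong refl) (simp only: mult_ac)
 qed
 also have "... = (\<Sum>i\<le>k. (-1) ^ (k+i) * of_nat (k choose i) * alt (?c i) {..<k} f t)"
  unfolding alt_def sum_distrib_left by (rule sum.swap)
 also have "... = (\<Sum>i\<in>{0}. (-1) ^ (k+i) * of_nat (k choose i) * alt (?c i) {..<k} f t)"
 proof (rule sum.mono_neutral_right)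
  show "\<forall>i\<in>{..k}-{0}. (-1) ^ (k+i) * of_nat (k choose i) * alt (?c i) {..<k} f t = 0"
  proof
   fix i assume i: "i \<in> {..k}-{0}"
   have "alt (?c i) {..<k} f t = 0"
    by (rule alt_zero[of _ "i-1"]) (use i in auto)
   thus "(-1) ^ (k+i) * of_nat (k choose i) * alt (?c i) {..<k} f t = 0" by simp
  qed
 qed auto
 also have "... = md k c f t" unfolding md_alt by simp
 finally show ?thesis ..
qed

lemma kdiff_Lq_le_omega:
 assumes q: "1 <= q" and f: "f \<in> Lq q {A..B}" and H: "0 <= H" and ab: "A <= a-real k * H" "b <= B"
 shows "kdiff k (- H) f \<in> Lq q {a..b}" "Lq_norm q {a..b} (kdiff k (- H) f) <= omega_k k q A B f"
proof -
 have eq: "fin_diff k (- H) f A B t = kdiff k (- H) f t" if t: "t \<in> {a..b}" for t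
 proof -
  have kH: "0 <= real k * H" using H by simp
  have "closed_segment t (t+real k * - H) \<subseteq> {A..B}"
   using t ab kH by (auto simp: closed_segment_eq_real_ivl)
  thus ?thesis unfolding fin_diff_def kdiff_def by (simp only: if_True)
 qed
 have kH: "0 <= real k * H" using H by simp
 have sub: "{a..b} \<subseteq> {A..B}" using ab kH by auto
 have L: "fin_diff k (- H) f A B \<in> Lq q {a..b}"
  by (rule Lq_subset(1)[OF q fin_diff_Lq(1)[OF q f] sub]) simp
 thus "kdiff k (- H) f \<in> Lq q {a..b}" using Lq_cong[of "{a..b}" "fin_diff k (- H) f A B" "kdiff k (- H) f" q] eq by simp
 have "Lq_norm q {a..b} (kdiff k (- H) f) = Lq_norm q {a..b} (fin_diff k (- H) f A B)"
  by (rule Lq_norm_cong) (simp add: eq)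
 also have "... <= Lq_norm q {A..B} (fin_diff k (- H) f A B)"
  by (rule Lq_subset(2)[OF q fin_diff_Lq(1)[OF q f] sub]) simp
 also have "... <= omega_k k q A B f" by (rule fin_diff_le_omega[OF q f])
 finally show "Lq_norm q {a..b} (kdiff k (- H) f) <= omega_k k q A B f" .
qed

text \<open>The margins come from \<open>md_kdiff\<close>: base points move to the right by at most
  k times t, and each of the k backward steps has length at most k times t.\<close>

lemma md_le_omega:
 assumes q: "1 <= q" and f: "f \<in> Lq q {A..B}" and t: "0 <= t" and c: "\<And>j. j < k ==> c j \<in> {0..t}"
  and ab: "A <= a-real k*(real k * t)" "b+real k * t <= B"
 shows "Lq_norm q {a..b} (md k c f) <= 2 ^ k * omega_k k q A B f"
proof -
 let ?H = "\<lambda>S. \<Sum>j\<in>S. c j/real (Suc j)"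
 have bd: "0 <= sum c S" "sum c S <= real k * t" "0 <= ?H S" "?H S <= real k * t" if S: "S \<in> Pow {..<k}" for S
 proof -
  have fin: "finite S" using S finite_subset by auto
  have cd: "card S <= k" using card_mono[of "{..<k}" S] S by simp
  have 1: "0 <= c j" "c j <= t" "0 <= c j/real (Suc j)" "c j/real (Suc j) <= t" if "j \<in> S" for j
  proof -
   show 0: "0 <= c j" "c j <= t" using c[of j] that S by auto
   thus "0 <= c j/real (Suc j)" by simp
   have "c j/real (Suc j) <= c j/1" using 0 by (intro divide_left_mono) auto
   thus "c j/real (Suc j) <= t" using 0 by simp
  qed
  show "0 <= sum c S" "0 <= ?H S" using 1 by (auto intro: sum_nonneg)
  have "real (card S) * t <= real k * t" using cd t by (intro mult_right_mono) auto
  thus "sum c S <= real k * t" "?H S <= real k * t"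
   using sum_bounded_above[of S c t] sum_bounded_above[of S "\<lambda>j. c j/real (Suc j)" t] 1 by auto
 qed
 have sub: "kdiff k (- ?H S) f \<in> Lq q {a+sum c S..b+sum c S}"
  "Lq_norm q {a+sum c S..b+sum c S} (kdiff k (- ?H S) f) <= omega_k k q A B f" if S: "S \<in> Pow {..<k}" for S
 proof -
  have "real k*?H S <= real k*(real k * t)" using bd[OF S] by (intro mult_left_mono) auto
  hence 1: "A <= a+sum c S-real k*?H S" "b+sum c S <= B" using bd[OF S] ab by linarith+
  show "kdiff k (- ?H S) f \<in> Lq q {a+sum c S..b+sum c S}"
   "Lq_norm q {a+sum c S..b+sum c S} (kdiff k (- ?H S) f) <= omega_k k q A B f"
   by (rule kdiff_Lq_le_omega[OF q f bd(3)[OF S] 1])+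
 qed
 note sh = Lq_shift[OF q sub(1)]
 have "Lq_norm q {a..b} (md k c f) <= (\<Sum>S\<in>Pow {..<k}. Lq_norm q {a..b} (\<lambda>u. (-1) ^ card S * kdiff k (- ?H S) f (u+sum c S)))"
  unfolding md_kdiff by (rule Lq_sum(2)[OF q]) (rule Lq_cmult(1)[OF q sh(1)])
 also have "... <= (\<Sum>S\<in>Pow {..<k}. omega_k k q A B f)"
 proof (rule sum_mono)
  fix S assume S: "S \<in> Pow {..<k}"
  have "Lq_norm q {a..b} (\<lambda>u. (-1) ^ card S * kdiff k (- ?H S) f (u+sum c S)) = Lq_norm q {a..b} (\<lambda>u. kdiff k (- ?H S) f (u+sum c S))"
   unfolding Lq_cmult(2)[OF q sh(1)[OF S], of "(-1) ^ card S"] by (simp add: norm_power)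
  also have "... <= omega_k k q A B f" unfolding sh(3)[OF S] by (rule sub(2)[OF S])
  finally show "Lq_norm q {a..b} (\<lambda>u. (-1) ^ card S * kdiff k (- ?H S) f (u+sum c S)) <= omega_k k q A B f" .
 qed
 also have "... = 2 ^ k * omega_k k q A B f" by (simp add: card_Pow)
 finally show ?thesis .
qed

text \<open>Allows a function to be replaced by a Borel one, for which integrals over the product
  space can be interchanged.\<close>

lemma omega_AE_le:
 assumes q: "1 <= q" and f: "f \<in> Lq q {a..b}" and ae: "AE t in lebesgue. t \<in> {a..b} --> f t = g t"
 shows "omega_k k q a b g <= omega_k k q a b f"
 unfolding omega_k_def[of k q a b g]
proof (rule cSUP_least)
 fix h
 have g: "g \<in> Lq q {a..b}" by (rule Lq_AE_cong(1)[OF ae f])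
 have d: "(\<lambda>t. g t-f t) \<in> Lq q {a..b}" by (intro Lq_diff(1) q f g)
 have "AE t in lebesgue. t \<in> {a..b} --> 0 = g t-f t" using ae by (rule eventually_mono) simp
 from Lq_AE_cong(2)[OF this, of q] have z: "Lq_norm q {a..b} (\<lambda>t. g t-f t) = 0" using q by simp
 have "Lq_norm q {a..b} (fin_diff k h g a b) = Lq_norm q {a..b} (\<lambda>t. fin_diff k h f a b t+fin_diff k h (\<lambda>t. g t-f t) a b t)"
  by (simp add: fin_diff_diff)
 also have "... <= Lq_norm q {a..b} (fin_diff k h f a b)+Lq_norm q {a..b} (fin_diff k h (\<lambda>t. g t-f t) a b)"
  by (intro Lq_add(2) q fin_diff_Lq(1) f d)
 also have "Lq_norm q {a..b} (fin_diff k h (\<lambda>t. g t-f t) a b) <= 0" using fin_diff_Lq(2)[OF q d, of k h] z by simp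
 finally show "Lq_norm q {a..b} (fin_diff k h g a b) <= omega_k k q a b f" using fin_diff_le_omega[OF q f, of k h] by simp
qed simp

definition avg :: "real => (real => complex) => complex" where
 "avg t H = (LINT h:{0..t}|lborel. H h) /\<^sub>R t"

lemma borel_Lq:
 fixes H :: "real => complex"
 assumes "H \<in> borel_measurable borel"
 shows "H \<in> Lq q {a..b} \<longleftrightarrow> integrable lborel (\<lambda>x. cmod (cut {a..b} H x) powr q)"
  and "Lq_norm q {a..b} H = (LINT x|lborel. cmod (cut {a..b} H x) powr q) powr (1/q)"
proof -
 note [measurable] = assms
 have m: "(\<lambda>x. cut {a..b} H x) \<in> borel_measurable lborel" by measurable
 have m': "(\<lambda>x. cmod (cut {a..b} H x) powr q) \<in> borel_measurable lborel" by measurable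
 show "H \<in> Lq q {a..b} \<longleftrightarrow> integrable lborel (\<lambda>x. cmod (cut {a..b} H x) powr q)"
  unfolding Lq_iff integrable_completion[OF m'] using measurable_completion[OF m] by blast
 show "Lq_norm q {a..b} H = (LINT x|lborel. cmod (cut {a..b} H x) powr q) powr (1/q)"
  unfolding Lq_norm_eq integral_completion[OF m'] ..
qed

lemma avg_le_mn:
 assumes t: "0 < t" and H: "H \<in> borel_measurable borel" "H \<in> Lq 1 {0..t}"
 shows "cmod (avg t H) <= mn 1 0 t H"
proof -
 have i: "integrable lborel (\<lambda>x. cmod (cut {0..t} H x))"
  using borel_Lq(1)[OF H(1), of 1 0 t] H(2) by simp
 have "cmod (avg t H) = cmod (LINT h|lborel. cut {0..t} H h)/t"
  unfolding avg_def set_lebesgue_integral_def using t by (simp add: divide_inverse mult.commute)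
 also have "... <= (LINT h|lborel. cmod (cut {0..t} H h))/t"
  using t by (intro divide_right_mono integral_norm_bound) auto
 also have "... = mn 1 0 t H"
  unfolding mn_def borel_Lq(2)[OF H(1)] using t by (simp add: powr_minus_divide)
 finally show ?thesis .
qed

text \<open>Minkowski's integral inequality for averages, from monotonicity of the means in the
  variable \<open>h\<close> and Tonelli's theorem in extended nonnegative integrals.\<close>

lemma avg_Lq:
 assumes q: "1 <= q" and t: "0 < t" and ab: "a < b" and \<omega>: "0 <= \<omega>"
  and H[measurable]: "(\<lambda>(x, h). H x h) \<in> borel_measurable (borel \<Otimes>\<^sub>M borel)"
  and bd: "\<And>h. h \<in> {0..t} ==> (\<lambda>x. H x h) \<in> Lq q {a..b}" "\<And>h. h \<in> {0..t} ==> Lq_norm q {a..b} (\<lambda>x. H x h) <= \<omega>"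
 shows "(\<lambda>x. avg t (H x)) \<in> borel_measurable borel" "(\<lambda>x. avg t (H x)) \<in> Lq q {a..b}" "Lq_norm q {a..b} (\<lambda>x. avg t (H x)) <= \<omega>"
proof -
 have H': "(\<lambda>(x, h). H x h) \<in> borel_measurable (lborel \<Otimes>\<^sub>M lborel)" by measurable
 have Hx[measurable]: "H x \<in> borel_measurable borel" for x
  using measurable_Pair2[OF H, of x] by simp
 have Hh[measurable]: "(\<lambda>x. H x h) \<in> borel_measurable borel" for h
  using measurable_Pair1[OF H, of h] by simp
 show Am[measurable]: "(\<lambda>x. avg t (H x)) \<in> borel_measurable borel"
  unfolding avg_def set_lebesgue_integral_def
  by (intro borel_measurable_scaleR borel_measurable_const lborel.borel_measurable_lebesgue_integral[of _ borel, simplified]) (use H in measurable)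
 define I where "I x = indicator {a..b} x" for x :: real
 define J where "J h = (indicator {0..t} h :: real)" for h
 let ?P = "\<lambda>x h. ennreal (indicator {a..b} x*(indicator {0..t} h * cmod (H x h) powr q))"
 have pt: "ennreal (cmod (indicator {a..b} x *\<^sub>R avg t (H x)) powr q) <= (\<integral>\<^sup>+h. ?P x h \<partial>lborel)/ennreal t" for x
 proof (cases "x \<in> {a..b}")
  case x: True
  show ?thesis
  proof (cases "H x \<in> Lq q {0..t}")
   case True
   have 1: "cmod (avg t (H x)) <= mn q 0 t (H x)"
    using avg_le_mn[OF t Hx Lq_integrable_norm(1)[OF q True]] Lq_integrable_norm(2)[OF q True t] by linarith
   have i: "integrable lborel (\<lambda>h. cmod (indicator {0..t} h *\<^sub>R H x h) powr q)" using True borel_Lq(1)[OF Hx] by blast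
   have "cmod (avg t (H x)) powr q <= mn q 0 t (H x) powr q" using 1 q by (intro powr_mono2) auto
   also have "... = Lq_norm q {0..t} (H x) powr q/t"
    unfolding Lq_norm_mn[OF t q] using t q by (simp add: powr_mult powr_powr)
   also have "Lq_norm q {0..t} (H x) powr q = (LINT h|lborel. cmod (indicator {0..t} h *\<^sub>R H x h) powr q)"
    unfolding borel_Lq(2)[OF Hx] using q by (simp add: powr_powr)
   finally have "ennreal (cmod (avg t (H x)) powr q) <= ennreal ((LINT h|lborel. cmod (indicator {0..t} h *\<^sub>R H x h) powr q)/t)"
    by (rule ennreal_leI)
   also have "... = ennreal (LINT h|lborel. cmod (indicator {0..t} h *\<^sub>R H x h) powr q)/ennreal t"
    using t by (intro divide_ennreal[symmetric]) auto
   also have "ennreal (LINT h|lborel. cmod (indicator {0..t} h *\<^sub>R H x h) powr q) = (\<integral>\<^sup>+h. ennreal (cmod (indicator {0..t} h *\<^sub>R H x h) powr q) \<partial>lborel)"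
    by (rule nn_integral_eq_integral[symmetric, OF i]) simp
   also have "... = (\<integral>\<^sup>+h. ?P x h \<partial>lborel)"
    unfolding cmod_indicator_powr using x by (intro nn_integral_cong) simp
   finally show ?thesis using x by simp
  next
   \<comment> \<open>For such \<open>x\<close> nothing is known about the average, but the
     right-hand side is infinite.\<close>
   case False
   have "(\<integral>\<^sup>+h. ?P x h \<partial>lborel) = \<infinity>"
   proof (rule ccontr)
    assume "(\<integral>\<^sup>+h. ?P x h \<partial>lborel) \<noteq> \<infinity>"
    hence fin: "(\<integral>\<^sup>+h. ?P x h \<partial>lborel) < \<infinity>" by (simp add: top.not_eq_extremum)
    have "integrable lborel (\<lambda>h. cmod (indicator {0..t} h *\<^sub>R H x h) powr q)"
    proof (rule integrableI_bounded)
     have "(\<integral>\<^sup>+h. ennreal (norm (cmod (indicator {0..t} h *\<^sub>R H x h) powr q)) \<partial>lborel) = (\<integral>\<^sup>+h. ?P x h \<partial>lborel)"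
      unfolding cmod_indicator_powr using x by (intro nn_integral_cong) simp
     thus "(\<integral>\<^sup>+h. ennreal (norm (cmod (indicator {0..t} h *\<^sub>R H x h) powr q)) \<partial>lborel) < \<infinity>" using fin by simp
    qed measurable
    thus False using False borel_Lq(1)[OF Hx] by blast
   qed
   thus ?thesis using t by (simp add: ennreal_top_divide)
  qed
 qed simp
 have Pm: "(\<lambda>(x, h). ?P x h) \<in> borel_measurable (lborel \<Otimes>\<^sub>M lborel)" using H' by measurable
 have "(\<integral>\<^sup>+x. ennreal (cmod (indicator {a..b} x *\<^sub>R avg t (H x)) powr q) \<partial>lborel) <= (\<integral>\<^sup>+x. (\<integral>\<^sup>+h. ?P x h \<partial>lborel)/ennreal t \<partial>lborel)"
  by (intro nn_integral_mono pt)
 also have "... = (\<integral>\<^sup>+x. (\<integral>\<^sup>+h. ?P x h \<partial>lborel) \<partial>lborel)/ennreal t"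
  by (rule nn_integral_divide) (use Pm in measurable)
 also have "(\<integral>\<^sup>+x. (\<integral>\<^sup>+h. ?P x h \<partial>lborel) \<partial>lborel) = (\<integral>\<^sup>+h. (\<integral>\<^sup>+x. ?P x h \<partial>lborel) \<partial>lborel)"
  using lborel_pair.Fubini'[OF Pm] by simp
 also have "... <= (\<integral>\<^sup>+h. ennreal (\<omega> powr q) * indicator {0..t} h \<partial>lborel)"
 proof (rule nn_integral_mono)
  fix h :: real
  show "(\<integral>\<^sup>+x. ?P x h \<partial>lborel) <= ennreal (\<omega> powr q) * indicator {0..t} h"
  proof (cases "h \<in> {0..t}")
   case True
   have i: "integrable lborel (\<lambda>x. cmod (indicator {a..b} x *\<^sub>R H x h) powr q)" using bd(1)[OF True] borel_Lq(1)[OF Hh] by blast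
   have "(\<integral>\<^sup>+x. ?P x h \<partial>lborel) = (\<integral>\<^sup>+x. ennreal (cmod (indicator {a..b} x *\<^sub>R H x h) powr q) \<partial>lborel)"
   proof (rule nn_integral_cong)
    fix x show "?P x h = ennreal (cmod (indicator {a..b} x *\<^sub>R H x h) powr q)"
     using True by (cases "x \<in> {a..b}") simp_all
   qed
   also have "... = ennreal (LINT x|lborel. cmod (indicator {a..b} x *\<^sub>R H x h) powr q)"
    by (rule nn_integral_eq_integral[OF i]) simp
   also have "(LINT x|lborel. cmod (indicator {a..b} x *\<^sub>R H x h) powr q) = Lq_norm q {a..b} (\<lambda>x. H x h) powr q"
    unfolding borel_Lq(2)[OF Hh] using q by (simp add: powr_powr)
   also have "ennreal ... <= ennreal (\<omega> powr q)" using bd(2)[OF True] q by (intro ennreal_leI powr_mono2) auto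
   finally show ?thesis using True by simp
  qed simp
 qed
 also have "... = ennreal (\<omega> powr q) * ennreal t"
  by (subst nn_integral_cmult_indicator) (use t in \<open>auto simp: emeasure_lborel_Icc_eq\<close>)
 finally have "(\<integral>\<^sup>+x. ennreal (cmod (indicator {a..b} x *\<^sub>R avg t (H x)) powr q) \<partial>lborel) <= ennreal (\<omega> powr q) * ennreal t/ennreal t"
  by (simp add: divide_right_mono_ennreal)
 also have "... = ennreal (\<omega> powr q)" using t by (simp add: ennreal_mult_divide_eq)
 finally have le: "(\<integral>\<^sup>+x. ennreal (cmod (indicator {a..b} x *\<^sub>R avg t (H x)) powr q) \<partial>lborel) <= ennreal (\<omega> powr q)" .
 have i: "integrable lborel (\<lambda>x. cmod (indicator {a..b} x *\<^sub>R avg t (H x)) powr q)"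
 proof (rule integrableI_bounded)
  show "(\<integral>\<^sup>+x. ennreal (norm (cmod (indicator {a..b} x *\<^sub>R avg t (H x)) powr q)) \<partial>lborel) < \<infinity>"
   using le by (simp add: le_less_trans)
 qed measurable
 thus "(\<lambda>x. avg t (H x)) \<in> Lq q {a..b}" using borel_Lq(1)[OF Am] by blast
 have "ennreal (LINT x|lborel. cmod (indicator {a..b} x *\<^sub>R avg t (H x)) powr q) <= ennreal (\<omega> powr q)"
  using le nn_integral_eq_integral[OF i] by simp
 hence "(LINT x|lborel. cmod (indicator {a..b} x *\<^sub>R avg t (H x)) powr q) <= \<omega> powr q" by (subst (asm) ennreal_le_iff) auto
 hence "Lq_norm q {a..b} (\<lambda>x. avg t (H x)) <= (\<omega> powr q) powr (1/q)"
  unfolding borel_Lq(2)[OF Am] using q by (intro powr_mono2) auto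
 thus "Lq_norm q {a..b} (\<lambda>x. avg t (H x)) <= \<omega>" using q \<omega> by (simp add: powr_powr)
qed

lemma md_measurable2:
 assumes "(\<lambda>(x, h). K h x) \<in> borel_measurable (borel \<Otimes>\<^sub>M borel)"
 shows "(\<lambda>(x::real, h::real). md k c (K h) x) \<in> borel_measurable (borel \<Otimes>\<^sub>M borel)"
 using assms
proof (induction k arbitrary: K)
 case (Suc k)
 note [measurable] = Suc.prems
 have "(\<lambda>(x, h). K h (x+c k)-K h x) \<in> borel_measurable (borel \<Otimes>\<^sub>M borel)" by measurable
 from Suc.IH[OF this] show ?case by simp
qed simp

lemma md_avg:
 assumes t: "0 < t" and "\<And>x. set_integrable lborel {0..t} (\<lambda>h. K h x)"
 shows "md k c (\<lambda>x. avg t (\<lambda>h. K h x)) x = avg t (\<lambda>h. md k c (K h) x)"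
 using assms(2)
proof (induction k arbitrary: K)
 case (Suc k)
 have "avg t (\<lambda>h. K h (x+c k))-avg t (\<lambda>h. K h x) = avg t (\<lambda>h. K h (x+c k)-K h x)" for x
  unfolding avg_def using Suc.prems by (subst set_integral_diff(2)) (auto simp: scaleR_diff_right)
 thus ?case using Suc.IH[of "\<lambda>h x. K h (x+c k)-K h x"] Suc.prems by (simp add: set_integral_diff(1))
qed simp

lemma set_integral_Icc_Ioc:
 fixes f :: "real => complex"
 assumes [measurable]: "f \<in> borel_measurable borel"
 shows "(LINT s:{a..b}|lborel. f s) = (LINT s:{a<..b}|lborel. f s)"
proof -
 have "AE s in lborel. s \<noteq> a" by (rule AE_lborel_singleton)
 hence "AE s in lborel. cut {a..b} f s = cut {a<..b} f s"
  by (rule eventually_mono) (simp add: indicator_def)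
 thus ?thesis unfolding set_lebesgue_integral_def by (intro integral_cong_AE) measurable
qed

lemma borel_Lq_loc_integrable:
 assumes "f \<in> borel_measurable borel" "\<And>a b. f \<in> Lq 1 {a..b}"
 shows "set_integrable lborel {a..b} f"
proof -
 note [measurable] = assms(1)
 have "integrable lborel (\<lambda>x. norm (cut {a..b} f x))" using borel_Lq(1)[OF assms(1), of 1 a b] assms(2)[of a b] by simp
 thus ?thesis unfolding set_integrable_def by (subst (asm) integrable_norm_iff) measurable
qed

lemma avg_shift:
 fixes f :: "real => complex"
 assumes t: "0 < t" and f: "f \<in> borel_measurable borel"
 shows "avg t (\<lambda>h. f (x+h)) = (LINT s:{x..x+t}|lborel. f s) /\<^sub>R t"
proof -
 have "(LINT s:{x..x+t}|lborel. f s) = (LINT h|lborel. indicator {x..x+t} (x+1 * h) *\<^sub>R f (x+1 * h))"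
  unfolding set_lebesgue_integral_def by (subst lborel_integral_real_affine[of 1 _ x]) simp_all
 also have "... = (LINT h:{0..t}|lborel. f (x+h))"
  unfolding set_lebesgue_integral_def by (intro Bochner_Integration.integral_cong refl) (simp add: indicator_def)
 finally show ?thesis by (simp add: avg_def)
qed

lemma shift_integrable:
 fixes f :: "real => complex"
 assumes "set_integrable lborel {a+s..b+s} f"
 shows "set_integrable lborel {a..b} (\<lambda>h. f (h+s))"
proof -
 have "integrable lborel (\<lambda>x. (\<lambda>y. cut {a+s..b+s} f y) (s+1 * x))"
  using assms unfolding set_integrable_def by (intro lborel_integrable_real_affine) auto
 moreover have "(\<lambda>y. cut {a+s..b+s} f y) (s+1 * x) = indicator {a..b} x *\<^sub>R f (x+s)" for x
  by (auto simp: indicator_def add.commute)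
 ultimately show ?thesis unfolding set_integrable_def by simp
qed

lemma avg_increment:
 fixes f :: "real => complex"
 assumes t: "0 < t" and ax: "a <= x" and f: "f \<in> borel_measurable borel" "\<And>a b. f \<in> Lq 1 {a..b}"
 shows "avg t (\<lambda>h. f (x+h))-avg t (\<lambda>h. f (a+h)) = (LINT s:{a..x}|lborel. f (s+t)-f s) /\<^sub>R t"
proof -
 note [measurable] = f(1)
 note I = borel_Lq_loc_integrable[OF f]
 have Ioc: "set_integrable lborel {u<..v} f" for u v
  by (rule set_integrable_subset[OF I[of u v]]) auto
 have un: "(LINT s:{u<..w}|lborel. f s) = (LINT s:{u<..v}|lborel. f s)+(LINT s:{v<..w}|lborel. f s)" if "u <= v" "v <= w" for u v w
 proof -
  have "{u<..w} = {u<..v} \<union> {v<..w}" using that by auto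
  thus ?thesis by (simp add: set_integral_Un[OF _ Ioc Ioc])
 qed
 have sh: "(LINT s:{a..x}|lborel. f (s+t)) = (LINT s:{a+t..x+t}|lborel. f s)"
 proof -
  have "(LINT s:{a+t..x+t}|lborel. f s) = (LINT s|lborel. indicator {a+t..x+t} (t+1 * s) *\<^sub>R f (t+1 * s))"
   unfolding set_lebesgue_integral_def by (subst lborel_integral_real_affine[of 1 _ t]) simp_all
  also have "... = (LINT s:{a..x}|lborel. f (s+t))"
   unfolding set_lebesgue_integral_def by (intro Bochner_Integration.integral_cong refl) (simp add: indicator_def add.commute)
  finally show ?thesis ..
 qed
 have "(LINT s:{a..x}|lborel. f (s+t)-f s) = (LINT s:{a+t..x+t}|lborel. f s)-(LINT s:{a..x}|lborel. f s)"
  using sh by (simp add: set_integral_diff(2)[OF shift_integrable[OF I] I])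
 also have "... = (LINT s:{x..x+t}|lborel. f s)-(LINT s:{a..a+t}|lborel. f s)"
  unfolding set_integral_Icc_Ioc[OF f(1)]
  using un[of a x "x+t"] un[of a "a+t" "x+t"] ax t by (simp add: algebra_simps)
 finally show ?thesis unfolding avg_shift[OF t f(1)] by (simp add: scaleR_diff_right)
qed

lemma poly_antiderivative:
 assumes p: "\<And>i. k <= i ==> coeff p i = 0"
 shows "\<exists>P. (\<forall>i\<ge>Suc k. coeff P i = 0) \<and> (\<forall>a x. a <= x --> (LINT s:{a..x}|lborel. poly_fun p s) = poly_fun P x-poly_fun P a)"
proof -
 define P where "P = (\<Sum>i<k. monom (coeff p i/of_nat (Suc i)) (Suc i))"
 have cP: "coeff P j = 0" if "j \<ge> Suc k" for j unfolding P_def coeff_sum using that by (intro sum.neutral) auto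
 have dP: "pderiv P = p"
 proof (rule poly_eqI)
  fix j
  have "coeff P (Suc j) = (\<Sum>i<k. if i = j then coeff p i/of_nat (Suc i) else 0)"
   unfolding P_def coeff_sum by (intro sum.cong refl) auto
  thus "coeff (pderiv P) j = coeff p j" using p[of j] by (simp add: coeff_pderiv del: of_nat_Suc)
 qed
 have der: "(poly_fun P has_vector_derivative poly_fun p t) (at t within S)" for t S
 proof -
  have "((\<lambda>z. poly P z) has_field_derivative poly (pderiv P) (of_real t)) (at (of_real t))" by (rule poly_DERIV)
  hence "(poly P has_field_derivative poly p (of_real t)) (at (of_real t) within of_real ` S)" unfolding dP by (rule has_field_derivative_at_within)
  note chain = field_vector_diff_chain_within[of complex_of_real 1 t S "poly P" "poly p (of_real t)", OF _ this]
  have "(complex_of_real has_vector_derivative 1) (at t within S)"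
   unfolding has_vector_derivative_def scaleR_conv_of_real mult_1_right
   by (rule bounded_linear_imp_has_derivative[OF bounded_linear_of_real])
  from chain[OF this] show ?thesis by (simp add: poly_fun_def[abs_def] comp_def)
 qed
 have "(LINT s:{a..x}|lborel. poly_fun p s) = poly_fun P x-poly_fun P a" if "a <= x" for a x
  using integral_FTC_Icc[OF that der continuous_on_poly_fun]
  by (simp add: set_lebesgue_integral_def)
 thus ?thesis using cP by blast
qed

text \<open>Whitney's inequality by induction on the order: split \<open>f\<close> into a moving average \<open>F\<close> and \<open>f - F\<close>.
 The difference \<open>f - F\<close> is an average of the functions \<open>f - f(\<cdot> + h)\<close>, and the increments of \<open>F\<close> are
 integrals of \<open>f(\<cdot> + t) - f\<close>; both are controlled by differences of one order less.\<close>

lemma Whitney_md: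
 assumes q: "1 <= q" and t: "0 < t" and ab: "a < b" and \<omega>: "0 <= \<omega>"
  and f: "f \<in> borel_measurable borel" "\<And>u v. f \<in> Lq q {u..v}"
  and bd: "\<And>c. (\<And>j. j < k ==> c j \<in> {0..t}) ==> Lq_norm q {a..b} (md k c f) <= \<omega>"
 shows "\<exists>p. (\<forall>i\<ge>k. coeff p i = 0) \<and> Lq_norm q {a..b} (\<lambda>x. f x-poly_fun p x) <= (1+(b-a)/t) ^ k*\<omega>"
 using f bd
proof (induction k arbitrary: f)
 case 0
 have "Lq_norm q {a..b} (\<lambda>x. f x-poly_fun 0 x) <= \<omega>" using 0(3)[of "\<lambda>_. 0"] by (simp add: poly_fun_simps)
 thus ?case by (intro exI[of _ 0]) simp
next
 case (Suc k)
 note fb = Suc.prems(1) and fq = Suc.prems(2)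
 note [measurable] = fb
 define r where "r = (b-a)/t"
 have r0: "0 <= r" using ab t by (simp add: r_def)
 have f1: "f \<in> Lq 1 {u..v}" for u v by (rule Lq_integrable_norm(1)[OF q fq])
 have fsh: "(\<lambda>x. f (x+h)) \<in> Lq q {u..v}" for h u v by (rule Lq_shift(1)[OF q fq])
 define D where "D h = (\<lambda>x. f (x+h)-f x)" for h
 have Dq: "D h \<in> Lq q {u..v}" for h u v unfolding D_def by (intro Lq_diff(1) q fsh fq)
 have Db[measurable]: "D h \<in> borel_measurable borel" for h unfolding D_def by measurable
 have D2: "(\<lambda>(x, h). D h x) \<in> borel_measurable (borel \<Otimes>\<^sub>M borel)" unfolding D_def by measurable
 define G where "G = (\<lambda>x. avg t (\<lambda>h. D h x))"
 \<comment> \<open>The shift \<open>h\<close> becomes the step of index k. So the hypothesis for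
   order k+1 bounds the differences of order k of every \<open>D h\<close>, and thereby those of
   their average \<open>G\<close>.\<close>
 have mdD: "md k c (D h) = md (Suc k) (c(k := h)) f" for c h
 proof -
  have "md n c g = md n (c(k := h)) g" if "n <= k" for n g
   using that by (induction n arbitrary: g) auto
  thus ?thesis by (simp add: D_def)
 qed
 have bdD: "Lq_norm q {a..b} (md k c (D h)) <= \<omega>" if "\<And>j. j < k ==> c j \<in> {0..t}" "h \<in> {0..t}" for c h
  unfolding mdD by (rule Suc.prems(3)) (use that in \<open>auto simp: less_Suc_eq\<close>)
 have Dnorm: "Lq_norm q {u..v} (D h) <= 2 * Lq_norm q {u..v+t} f" if h: "h \<in> {0..t}" for h u v
 proof -
  have "Lq_norm q {u..v} (D h) <= Lq_norm q {u..v} (\<lambda>x. f (x+h))+Lq_norm q {u..v} f"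
   unfolding D_def by (intro Lq_diff(2) q fsh fq)
  also have "Lq_norm q {u..v} (\<lambda>x. f (x+h)) = Lq_norm q {u+h..v+h} f" by (rule Lq_shift(3)[OF q fq])
  also have "... <= Lq_norm q {u..v+t} f" by (rule Lq_subset(2)[OF q fq]) (use h in auto)
  also have "Lq_norm q {u..v} f <= Lq_norm q {u..v+t} f" by (rule Lq_subset(2)[OF q fq]) (use t in auto)
  finally show ?thesis by simp
 qed
 have GG: "G \<in> borel_measurable borel" "G \<in> Lq q {u..v}" if uv: "u < v" for u v
  using avg_Lq(1,2)[OF q t uv _ D2, of "2 * Lq_norm q {u..v+t} f"] Dq Dnorm unfolding G_def by auto
 have Gb[measurable]: "G \<in> borel_measurable borel" using GG(1)[of 0 1] by simp
 have Gq: "G \<in> Lq q {u..v}" for u v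
  by (rule Lq_subset(1)[OF q GG(2)[of "min u v-1" "max u v+1"]]) auto
 have Kint: "set_integrable lborel {0..t} (\<lambda>h. D h x)" for x
 proof -
  have "set_integrable lborel {0..t} (\<lambda>h. f (h+x))" by (rule shift_integrable[OF borel_Lq_loc_integrable[OF fb f1]])
  moreover have "set_integrable lborel {0..t} (\<lambda>h. f x)"
   unfolding set_integrable_def by (intro integrable_scaleR_left) (auto simp: integrable_indicator_iff emeasure_lborel_Icc_eq)
  ultimately show ?thesis unfolding D_def by (simp add: set_integral_diff(1) add.commute)
 qed
 have bdG: "Lq_norm q {a..b} (md k c G) <= \<omega>" if c: "\<And>j. j < k ==> c j \<in> {0..t}" for c
 proof -
  have e: "md k c G = (\<lambda>x. avg t (\<lambda>h. md k c (D h) x))"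
   unfolding G_def by (rule ext) (rule md_avg[OF t Kint])
  have mq: "md n c g \<in> Lq q {a..b}" if "\<And>u v. g \<in> Lq q {u..v}" for n c g
   using that
  proof (induction n arbitrary: g)
   case (Suc n)
   show ?case unfolding md.simps by (rule Suc.IH) (intro Lq_diff(1) q Lq_shift(1) Suc.prems)
  qed simp
  show ?thesis unfolding e
   by (rule avg_Lq(3)[OF q t ab \<omega> md_measurable2[OF D2]]) (auto intro!: mq Dq bdD c)
 qed
 obtain p1 where p1: "\<forall>i\<ge>k. coeff p1 i = 0" "Lq_norm q {a..b} (\<lambda>x. G x-poly_fun p1 x) <= (1+r) ^ k*\<omega>"
  using Suc.IH[OF Gb Gq bdG] unfolding r_def by blast
 obtain p2 where p2: "\<forall>i\<ge>k. coeff p2 i = 0" "Lq_norm q {a..b} (\<lambda>x. D t x-poly_fun p2 x) <= (1+r) ^ k*\<omega>"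
  using Suc.IH[OF Db[of t] Dq bdD] t unfolding r_def by auto
 obtain P where P: "\<forall>i\<ge>Suc k. coeff P i = 0" "\<And>a x. a <= x ==> (LINT s:{a..x}|lborel. poly_fun p2 s) = poly_fun P x-poly_fun P a"
  using poly_antiderivative[of k p2] p2(1) by auto
 define F where "F x = avg t (\<lambda>h. f (x+h))" for x
 have FG: "G x = F x-f x" for x
 proof -
  have "(LINT h:{0..t}|lborel. f x) = t *\<^sub>R f x" using t by (simp add: set_lebesgue_integral_def)
  moreover have "set_integrable lborel {0..t} (\<lambda>h. f (x+h))"
   using shift_integrable[OF borel_Lq_loc_integrable[OF fb f1], of 0 t x] by (simp add: add.commute)
  moreover have "set_integrable lborel {0..t} (\<lambda>h. f x)"
   unfolding set_integrable_def by (intro integrable_scaleR_left) (auto simp: integrable_indicator_iff emeasure_lborel_Icc_eq)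
  ultimately show ?thesis unfolding G_def F_def D_def avg_def using t
   by (simp add: set_integral_diff(2) scaleR_diff_right)
 qed
 define R where "R x = (LINT s:{a..x}|lborel. D t s-poly_fun p2 s) /\<^sub>R t" for x
 \<comment> \<open>Three parts: the value at \<open>a\<close> of the moving average F, the
   antiderivative of the polynomial approximating its increments, and the approximant
   \<open>p1\<close> of G = F - f.\<close>
 define p where "p = [:F a-poly_fun P a /\<^sub>R t:]+smult (of_real (1/t)) P-p1"
 have ps: "poly_fun p2 \<in> borel_measurable borel" using borel_measurable_continuous_onI[OF continuous_on_poly_fun] .
 have pI: "set_integrable lborel {u..v} (poly_fun p2)" for u v by (rule borel_Lq_loc_integrable[OF ps]) simp
 have DI: "set_integrable lborel {u..v} (D t)" for u v
  by (rule borel_Lq_loc_integrable[OF Db]) (rule Lq_integrable_norm(1)[OF q Dq])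
 have fR: "f x-poly_fun p x = R x-(G x-poly_fun p1 x)" if x: "a <= x" for x
 proof -
  have "F x-F a = (LINT s:{a..x}|lborel. D t s) /\<^sub>R t" unfolding F_def D_def by (rule avg_increment[OF t x fb f1])
  also have "(LINT s:{a..x}|lborel. D t s) = (LINT s:{a..x}|lborel. D t s-poly_fun p2 s)+(poly_fun P x-poly_fun P a)"
   unfolding P(2)[OF x, symmetric] set_integral_diff(2)[OF DI pI] by simp
  finally have "F x = F a+R x+(poly_fun P x-poly_fun P a) /\<^sub>R t" unfolding R_def by (simp add: scaleR_add_right algebra_simps)
  moreover have "poly_fun p x = F a-poly_fun P a /\<^sub>R t+poly_fun P x /\<^sub>R t-poly_fun p1 x"
   unfolding p_def poly_fun_simps poly_fun_const by (simp add: scaleR_conv_of_real inverse_eq_divide)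
  ultimately show ?thesis unfolding FG by (simp add: scaleR_diff_right)
 qed
 let ?w = "\<lambda>s. D t s-poly_fun p2 s"
 have wq: "?w \<in> Lq q {a..b}" by (intro Lq_diff(1) q Dq poly_fun_Lq)
 have wb: "?w \<in> borel_measurable borel" using ps by measurable
 have Rbd: "cmod (R x) <= r * mn q a b ?w" if x: "x \<in> {a..b}" for x
 proof -
  have wI: "set_integrable lborel {u..v} ?w" for u v by (intro set_integral_diff(1) DI pI)
  have wn: "set_integrable lborel {u..v} (\<lambda>s. cmod (?w s))" for u v using set_integrable_norm[OF wI] .
  have "cmod (LINT s:{a..x}|lborel. ?w s) <= (LINT s:{a..x}|lborel. cmod (?w s))" by (rule set_integral_norm_bound[OF wI])
  also have "... <= (LINT s:{a..b}|lborel. cmod (?w s))"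
   using wn[of a x] wn[of a b] x unfolding set_lebesgue_integral_def set_integrable_def
   by (intro integral_mono) (auto simp: indicator_def)
  also have "... = (b-a) * mn 1 a b ?w"
   unfolding mn_def borel_Lq(2)[OF wb] cmod_indicator_powr set_lebesgue_integral_def using ab by (simp add: powr_minus_divide)
  also have "... <= (b-a) * mn q a b ?w" using ab by (intro mult_left_mono Lq_integrable_norm(2) q wq) auto
  finally show ?thesis unfolding R_def r_def using t by (simp add: divide_inverse mult_ac mult_left_mono)
 qed
 have Rm: "R \<in> Lq q {a..b}"
 proof -
  have "(\<lambda>x. f x-poly_fun p x+(G x-poly_fun p1 x)) \<in> Lq q {a..b}" by (intro Lq_add(1) Lq_diff(1) q fq Gq poly_fun_Lq)
  thus ?thesis using Lq_cong[of "{a..b}" "\<lambda>x. f x-poly_fun p x+(G x-poly_fun p1 x)" R q] fR by simp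
 qed
 have "mn q a b R <= r * mn q a b ?w"
  by (rule mn_bounded[OF q ab _ Rbd]) (use Lq_measurable[OF Rm] in \<open>simp add: set_borel_measurable_def\<close>)
 hence "(b-a) powr (- 1/q) * Lq_norm q {a..b} R <= (b-a) powr (- 1/q)*(r * Lq_norm q {a..b} ?w)"
  unfolding mn_def by (simp add: mult_ac)
 hence RN: "Lq_norm q {a..b} R <= r * Lq_norm q {a..b} ?w" using ab by (subst (asm) mult_le_cancel_left_pos) auto
 have "Lq_norm q {a..b} (\<lambda>x. f x-poly_fun p x) = Lq_norm q {a..b} (\<lambda>x. R x-(G x-poly_fun p1 x))"
  by (rule Lq_norm_cong) (simp add: fR)
 also have "... <= Lq_norm q {a..b} R+Lq_norm q {a..b} (\<lambda>x. G x-poly_fun p1 x)"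
  by (intro Lq_diff q Rm Gq poly_fun_Lq)
 \<comment> \<open>Integrating the increments over at most the length b-a and dividing by t costs r,
   and the part from \<open>G\<close> costs 1: a factor 1+r for each order.\<close>
 also have "... <= r*((1+r) ^ k*\<omega>)+(1+r) ^ k*\<omega>"
  using order_trans[OF RN mult_left_mono[OF p2(2) r0]] p1(2) by (rule add_mono)
 also have "... = (1+r) ^ Suc k*\<omega>" by (simp add: algebra_simps)
 finally have "Lq_norm q {a..b} (\<lambda>x. f x-poly_fun p x) <= (1+r) ^ Suc k*\<omega>" .
 moreover have "\<forall>i\<ge>Suc k. coeff p i = 0" using P(1) p1(1) by (auto simp: p_def coeff_pCons split: nat.split)
 ultimately show ?case unfolding r_def by blast
qed

text \<open>\<open>f\<close> is cut off outside \<open>{A..B}\<close> and modified on a null set to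
  become Borel, so that \<open>Whitney_md\<close> applies; the margins guarantee that the mixed
  differences on \<open>{a..b}\<close> are controlled by values in \<open>{A..B}\<close>.\<close>

lemma Whitney:
 assumes q: "1 <= q" and k: "1 <= k" and t: "0 < t" and ab: "a < b" and f: "f \<in> Lq q {A..B}"
  and AB: "A <= a-real k*(real k * t)" "b+real k * t <= B"
 shows "\<exists>p\<in>Pi_poly k. Lq_norm q {a..b} (\<lambda>x. f x-poly_fun p x) <= (1+(b-a)/t) ^ k*2 ^ k * omega_k k q A B f"
proof -
 define F where "F = (\<lambda>x. cut {A..B} f x)"
 have Fm: "F \<in> borel_measurable lebesgue" using Lq_measurable[OF f] by (simp add: F_def)
 have "(\<lambda>x. Re (F x)) \<in> borel_measurable (completion lborel)" "(\<lambda>x. Im (F x)) \<in> borel_measurable (completion lborel)"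
  using Fm by measurable
 from this[THEN completion_ex_borel_measurable_real] obtain u v where
  u: "u \<in> borel_measurable lborel" "AE x in lborel. Re (F x) = u x" and v: "v \<in> borel_measurable lborel" "AE x in lborel. Im (F x) = v x"
  by blast
 define g where "g x = Complex (u x) (v x)" for x
 have gb: "g \<in> borel_measurable borel"
 proof -
  have "(\<lambda>x. complex_of_real (u x)+\<i> * complex_of_real (v x)) \<in> borel_measurable borel" using u(1) v(1) by measurable
  moreover have "g = (\<lambda>x. complex_of_real (u x)+\<i> * complex_of_real (v x))" by (simp add: g_def fun_eq_iff complex_eq_iff)
  ultimately show ?thesis by simp
 qed
 have "AE x in lborel. F x = g x" using u(2) v(2) by eventually_elim (simp add: g_def complex_eq_iff)
 hence ae: "AE x in lebesgue. F x = g x" by (rule AE_completion)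
 have FL: "F \<in> Lq q {a'..b'}" for a' b'
 proof -
  have "F \<in> Lq q {min A a'..max B b'}"
  proof (subst Lq_zero_outside(1)[of "{A..B}"])
   show "F \<in> Lq q {A..B}" using f Lq_cong[of "{A..B}" f F q] by (simp add: F_def)
  qed (auto simp: F_def)
  thus ?thesis by (rule Lq_subset(1)[OF q]) auto
 qed
 have gL: "g \<in> Lq q {a'..b'}" for a' b' by (rule Lq_AE_cong(1)[OF _ FL]) (use ae in \<open>auto elim: eventually_mono\<close>)
 have fg: "AE x in lebesgue. x \<in> {A..B} --> f x = g x" using ae by (rule eventually_mono) (auto simp: F_def split: split_indicator_asm)
 define \<omega> where "\<omega> = 2 ^ k * omega_k k q A B f"
 have \<omega>: "0 <= \<omega>" unfolding \<omega>_def using omega_nonneg[OF q f] by simp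
 have bd: "Lq_norm q {a..b} (md k c g) <= \<omega>" if c: "\<And>j. j < k ==> c j \<in> {0..t}" for c
 proof -
  have "Lq_norm q {a..b} (md k c g) <= 2 ^ k * omega_k k q A B g"
   by (rule md_le_omega[OF q gL _ c AB]) (use t in auto)
  also have "... <= \<omega>" unfolding \<omega>_def using omega_AE_le[OF q f fg] by (intro mult_left_mono) auto
  finally show ?thesis .
 qed
 obtain p where p: "\<forall>i\<ge>k. coeff p i = 0" "Lq_norm q {a..b} (\<lambda>x. g x-poly_fun p x) <= (1+(b-a)/t) ^ k*\<omega>"
  using Whitney_md[OF q t ab \<omega> gb gL bd] by blast
 have "Lq_norm q {a..b} (\<lambda>x. f x-poly_fun p x) = Lq_norm q {a..b} (\<lambda>x. g x-poly_fun p x)"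
 proof (rule Lq_AE_cong(2))
  have "0 <= real k*(real k * t)" "0 <= real k * t" using t by auto
  hence "A <= a" "b <= B" using AB by linarith+
  hence "{a..b} \<subseteq> {A..B}" by auto
  thus "AE x in lebesgue. x \<in> {a..b} --> g x-poly_fun p x = f x-poly_fun p x"
   using fg by (auto elim!: eventually_mono)
  show "(\<lambda>x. g x-poly_fun p x) \<in> Lq q {a..b}" by (intro Lq_diff(1) q gL poly_fun_Lq)
 qed
 thus ?thesis using p Pi_poly_iff[OF k] unfolding \<omega>_def by (intro bexI[of _ p]) (auto simp: mult.assoc)
qed

section \<open>Local polynomial approximation on the levels\<close>

definition Markov_const :: "nat => real => nat => real" where
 "Markov_const k N \<nu> = (SOME C. C > 0 \<and> (\<forall>p\<in>Pi_poly k. \<forall>a b t. a < b --> \<bar>t-a\<bar> <= N*(b-a) -->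
   cmod (poly_fun ((pderiv ^^ \<nu>) p) t) <= C/(b-a) ^ \<nu> * mn 1 a b (poly_fun p)))"

lemma Markov_const:
 assumes "1 <= k" "1 <= N"
 shows "Markov_const k N \<nu> > 0"
  "p \<in> Pi_poly k ==> a < b ==> \<bar>t-a\<bar> <= N*(b-a) ==>
   cmod (poly_fun ((pderiv ^^ \<nu>) p) t) <= Markov_const k N \<nu>/(b-a) ^ \<nu> * mn 1 a b (poly_fun p)"
proof -
 have "Markov_const k N \<nu> > 0 \<and> (\<forall>p\<in>Pi_poly k. \<forall>a b t. a < b --> \<bar>t-a\<bar> <= N*(b-a) -->
   cmod (poly_fun ((pderiv ^^ \<nu>) p) t) <= Markov_const k N \<nu>/(b-a) ^ \<nu> * mn 1 a b (poly_fun p))"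
  unfolding Markov_const_def by (rule someI_ex) (rule poly_higher_Markov[OF assms])
 thus "Markov_const k N \<nu> > 0"
  "p \<in> Pi_poly k ==> a < b ==> \<bar>t-a\<bar> <= N*(b-a) ==>
   cmod (poly_fun ((pderiv ^^ \<nu>) p) t) <= Markov_const k N \<nu>/(b-a) ^ \<nu> * mn 1 a b (poly_fun p)" by blast+
qed

context multilevel begin

definition "Whitney_const1 k = (1+2*(real k)\<^sup>2*(lam\<^sup>2+1)) ^ k*2 ^ k"

text \<open>Whitney's inequality consumes a margin. Since \<eta> is at most half of every interval
  of the level, the interval enlarged by \<eta> leaves another \<eta> within each neighbour, and for
  k \<ge> 2 both neighbours belong to the interval of \<open>E_coef\<close>.\<close>

lemma Whitney_local:
 assumes k: "2 <= k" and q: "1 <= q" and f: "f \<in> Lq_loc q" and \<eta>: "\<eta> = mesh x m/(2 * lam)"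
 shows "\<exists>p\<in>Pi_poly k. mn q (x m j-\<eta>) (x m (j+1)+\<eta>) (resid f p) <= Whitney_const1 k * E_coef x k q f (m, j)"
proof -
 let ?a = "x m j-\<eta>" and ?b = "x m (j+1)+\<eta>"
 let ?A = "x m (j+1-int k)" and ?B = "x m (j+int k)"
 have \<eta>0: "0 < \<eta>" using mesh_pos[of m] lam by (simp add: \<eta>)
 have k0: "0 < real k" using k by simp
 \<comment> \<open>Makes the larger of the two margins in \<open>Whitney\<close> equal to
   \<eta>.\<close>
 define t where "t = \<eta>/(real k * real k)"
 have t: "0 < t" "real k*(real k * t) = \<eta>" using \<eta>0 k0 by (simp_all add: t_def)
 have kt: "real k * t <= \<eta>"
 proof -
  have "1*(real k * t) <= real k*(real k * t)" using t(1) k by (intro mult_right_mono) auto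
  thus ?thesis using t(2) by simp
 qed
 have \<eta>2: "2*\<eta> <= len x m i" for i using mesh_le_len'[of m i] lam by (simp add: \<eta>)
 have Aa: "?A <= ?a-real k*(real k * t)"
 proof -
  have "?A <= x m (j-1)" using k by (simp add: x_le_iff)
  also have "x m (j-1) = x m j-len x m (j-1)" by (simp add: len_def)
  also have "... <= ?a-\<eta>" using \<eta>2[of "j-1"] by simp
  finally show ?thesis using t(2) by simp
 qed
 have Bb: "?b+real k * t <= ?B"
 proof -
  have "?b+real k * t <= x m (j+1)+2*\<eta>" using kt by simp
  also have "... <= x m (j+1)+len x m (j+1)" using \<eta>2[of "j+1"] by simp
  also have "... = x m (j+1+1)" by (simp add: len_def)
  also have "... <= ?B" using k by (simp add: x_le_iff)
  finally show ?thesis .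
 qed
 have ab: "?a < ?b" using \<eta>0 x_less_iff[of m j "j+1"] by simp
 obtain p where p: "p \<in> Pi_poly k" "Lq_norm q {?a..?b} (resid f p) <= (1+(?b-?a)/t) ^ k*2 ^ k * omega_k k q ?A ?B f"
  using Whitney[OF q _ t(1) ab Lq_locD[OF f] Aa Bb] k by auto
 have r: "(?b-?a)/t <= 2*(real k)\<^sup>2*(lam\<^sup>2+1)"
 proof -
  have "?b-?a = len x m j+2*\<eta>" by (simp add: len_def)
  also have "... <= lam * mesh x m+mesh x m/lam" using len_le_mesh[of m j] lam by (simp add: \<eta>)
  also have "... = 2*(lam\<^sup>2+1)*\<eta>" using lam by (simp add: \<eta> field_simps power2_eq_square)
  also have "... = 2*(lam\<^sup>2+1)*(real k)\<^sup>2 * t" using t(2) by (simp add: power2_eq_square)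
  finally show ?thesis using t(1) by (simp add: divide_le_eq algebra_simps)
 qed
 have om0: "0 <= omega_k k q ?A ?B f" by (intro omega_nonneg q Lq_locD f)
 have ba0: "0 <= (?b-?a)/t" using ab t(1) by simp
 have "Lq_norm q {?a..?b} (resid f p) <= Whitney_const1 k * omega_k k q ?A ?B f"
 proof -
  have "(1+(?b-?a)/t) ^ k <= (1+2*(real k)\<^sup>2*(lam\<^sup>2+1)) ^ k"
   using r ba0 by (intro power_mono) auto
  hence "(1+(?b-?a)/t) ^ k*2 ^ k * omega_k k q ?A ?B f <= Whitney_const1 k * omega_k k q ?A ?B f"
   unfolding Whitney_const1_def using om0 by (intro mult_right_mono) auto
  with p(2) show ?thesis by linarith
 qed
 moreover have "(?b-?a) powr (- 1/q) <= len x m j powr (- 1/q)"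
  using len_pos[of m j] \<eta>0 q by (intro powr_mono2') (auto simp: len_def)
 ultimately have "(?b-?a) powr (- 1/q) * Lq_norm q {?a..?b} (resid f p) <= len x m j powr (- 1/q)*(Whitney_const1 k * omega_k k q ?A ?B f)"
  by (intro mult_mono) auto
 thus ?thesis using p(1) by (intro bexI[of _ p]) (simp_all add: mn_def E_coef_def len_def mult_ac)
qed

definition "Whitney_const2 k N = Markov_const k (real (N+2) * lam\<^sup>2) 0*((lam\<^sup>2+1) * Whitney_const1 k)"
definition "Whitney_const k N = (lam\<^sup>2+1) * Whitney_const1 k+2 * Whitney_const2 k N"

lemma Whitney_const1_pos: "0 < Whitney_const1 k"
 unfolding Whitney_const1_def by (intro mult_pos_pos zero_less_power) (auto intro: add_pos_nonneg)

lemma Markov_N: "1 <= real (N+2) * lam\<^sup>2"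
proof -
 have "1*1 <= real (N+2) * lam\<^sup>2" using lam by (intro mult_mono) auto
 thus ?thesis by simp
qed

lemma Whitney_const2_pos: "1 <= k ==> 0 < Whitney_const2 k N"
 unfolding Whitney_const2_def using Markov_const(1)[OF _ Markov_N] Whitney_const1_pos by (intro mult_pos_pos) (auto intro: add_nonneg_pos)

lemma Whitney_const_pos: "1 <= k ==> 0 < Whitney_const k N"
 unfolding Whitney_const_def using Whitney_const2_pos[of k N] Whitney_const1_pos[of k]
 by (intro add_pos_pos mult_pos_pos add_nonneg_pos[OF zero_le_power2 zero_less_one]) simp_all

text \<open>One polynomial for 2N+1 consecutive intervals. Neighbouring enlarged intervals overlap
  in length 2\<eta> around their common knot; there their polynomials are compared through
  \<open>f\<close>, and Markov's inequality carries the comparison along the whole chain.\<close>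

lemma Whitney_chain:
 assumes k: "2 <= k" and q: "1 <= q" and f: "f \<in> Lq_loc q"
 shows "\<exists>p. \<forall>j. p j \<in> Pi_poly k \<and> (\<forall>i\<in>{j-int N..j+int N}.
   mnI q m i (resid f (p j)) <= Whitney_const k N*(\<Sum>l\<in>{j-int N..j+int N}. E_coef x k q f (m, l)))"
proof -
 have k1: "1 <= k" using k by simp
 define \<eta> where "\<eta> = mesh x m/(2 * lam)"
 have \<eta>0: "0 < \<eta>" using mesh_pos[of m] lam by (simp add: \<eta>_def)
 let ?t = "\<lambda>l. E_coef x k q f (m, l)"
 have t0: "0 <= ?t l" for l by (rule E_coef_nonneg[OF q f])
 have "\<forall>j. \<exists>p. p \<in> Pi_poly k \<and> mn q (x m j-\<eta>) (x m (j+1)+\<eta>) (resid f p) <= Whitney_const1 k*?t j"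
  using Whitney_local[OF k q f \<eta>_def] by blast
 hence "\<exists>p. \<forall>j. p j \<in> Pi_poly k \<and> mn q (x m j-\<eta>) (x m (j+1)+\<eta>) (resid f (p j)) <= Whitney_const1 k*?t j"
  by (rule choice)
 then obtain p where p': "\<forall>j. p j \<in> Pi_poly k \<and> mn q (x m j-\<eta>) (x m (j+1)+\<eta>) (resid f (p j)) <= Whitney_const1 k*?t j"
  by (elim exE)
 have p: "p j \<in> Pi_poly k" "mn q (x m j-\<eta>) (x m (j+1)+\<eta>) (resid f (p j)) <= Whitney_const1 k*?t j" for j
  using p' by simp_all
 let ?K = "lam\<^sup>2+1"
 have fp: "(resid f (p j)) \<in> Lq q {u..v}" for j u v by (intro Lq_diff(1) q Lq_locD f poly_fun_Lq)
 have wid: "(x m (j+1)+\<eta>)-(x m j-\<eta>) <= ?K*(2*\<eta>)" for j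
 proof -
  have "(x m (j+1)+\<eta>)-(x m j-\<eta>) = len x m j+2*\<eta>" by (simp add: len_def)
  also have "... <= lam * mesh x m+2*\<eta>" using len_le_mesh[of m j] by simp
  also have "lam * mesh x m = lam\<^sup>2*(2*\<eta>)" using lam by (simp add: \<eta>_def power2_eq_square)
  finally show ?thesis by (simp add: algebra_simps)
 qed
 have sub: "mn q a b (resid f (p j)) <= ?K*(Whitney_const1 k*?t j)"
  if "x m j-\<eta> <= a" "b <= x m (j+1)+\<eta>" "a+2*\<eta> <= b" for a b j
 proof -
  have "(x m (j+1)+\<eta>)-(x m j-\<eta>) <= ?K*(b-a)"
  proof -
   have "?K*(2*\<eta>) <= ?K*(b-a)" using that by (intro mult_left_mono) auto
   with wid[of j] show ?thesis by linarith
  qed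
  hence "mn q a b (resid f (p j)) <= ?K * mn q (x m j-\<eta>) (x m (j+1)+\<eta>) (resid f (p j))"
   using that \<eta>0 by (intro mn_mono(2)[OF q fp]) auto
  also have "... <= ?K*(Whitney_const1 k*?t j)" using p(2)[of j] by (intro mult_left_mono) auto
  finally show ?thesis .
 qed
 have jump: "cmod (poly_fun (p (j+1)) t-poly_fun (p j) t) <= Whitney_const2 k N*(?t j+?t (j+1))"
  if t: "\<bar>t-x m (j+1)\<bar> <= real (N+1)*(lam * mesh x m)" for t j
 proof -
  let ?a = "x m (j+1)-\<eta>" and ?b = "x m (j+1)+\<eta>"
  have ab: "?a < ?b" using \<eta>0 by simp
  have xj: "x m j <= x m (j+1)" "x m (j+1) <= x m (j+1+1)" by (simp_all add: x_le_iff)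
  have "mn 1 ?a ?b (poly_fun (p (j+1)-p j)) <= mn q ?a ?b (poly_fun (p (j+1)-p j))"
   by (rule Lq_integrable_norm(2)[OF q poly_fun_Lq[OF q] ab])
  also have "mn q ?a ?b (poly_fun (p (j+1)-p j)) = mn q ?a ?b (\<lambda>t. (f t-poly_fun (p j) t)-(f t-poly_fun (p (j+1)) t))"
   by (rule mn_cong) (simp add: poly_fun_simps)
  also have "... <= mn q ?a ?b (resid f (p j))+mn q ?a ?b (\<lambda>t. f t-poly_fun (p (j+1)) t)"
   by (intro mn_diff q fp)
  also have "... <= ?K*(Whitney_const1 k*?t j)+?K*(Whitney_const1 k*?t (j+1))"
  proof (rule add_mono)
   show "mn q ?a ?b (resid f (p j)) <= ?K*(Whitney_const1 k*?t j)"
    by (rule sub) (use xj \<eta>0 in linarith)+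
   show "mn q ?a ?b (\<lambda>t. f t-poly_fun (p (j+1)) t) <= ?K*(Whitney_const1 k*?t (j+1))"
    by (rule sub) (use xj \<eta>0 in linarith)+
  qed
  finally have m1: "mn 1 ?a ?b (poly_fun (p (j+1)-p j)) <= (?K * Whitney_const1 k)*(?t j+?t (j+1))"
   by (simp add: algebra_simps)
  have "\<bar>t-?a\<bar> <= real (N+2) * lam\<^sup>2*(?b-?a)"
  proof -
   have e: "lam\<^sup>2*(?b-?a) = lam * mesh x m" using lam by (simp add: \<eta>_def power2_eq_square)
   have "\<eta> <= lam * mesh x m"
   proof -
    have "\<eta> <= mesh x m/1" unfolding \<eta>_def using mesh_pos[of m] lam by (intro divide_left_mono) auto
    also have "... <= lam * mesh x m" using lam mesh_pos[of m] by simp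
    finally show ?thesis .
   qed
   hence "\<bar>t-?a\<bar> <= real (N+1)*(lam * mesh x m)+lam * mesh x m" using t \<eta>0 by linarith
   also have "... = real (N+2)*(lam * mesh x m)" by (simp add: algebra_simps)
   finally show ?thesis unfolding mult.assoc e .
  qed
  from Markov_const(2)[OF k1 Markov_N Pi_poly_diff[OF p(1) p(1)] ab this, of 0]
  have "cmod (poly_fun (p (j+1)-p j) t) <= Markov_const k (real (N+2) * lam\<^sup>2) 0 * mn 1 ?a ?b (poly_fun (p (j+1)-p j))" by simp
  also have "... <= Markov_const k (real (N+2) * lam\<^sup>2) 0*((?K * Whitney_const1 k)*(?t j+?t (j+1)))"
   using Markov_const(1)[OF k1 Markov_N, of N 0] by (intro mult_left_mono m1) auto
  finally show ?thesis by (simp add: poly_fun_simps Whitney_const2_def mult.assoc)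
 qed
 have C20: "0 < Whitney_const2 k N" by (rule Whitney_const2_pos[OF k1])
 have far: "cmod (poly_fun (p i) t-poly_fun (p j) t) <= 2 * Whitney_const2 k N*(\<Sum>l\<in>{j-int N..j+int N}. ?t l)"
  if i: "i \<in> {j-int N..j+int N}" and t: "t \<in> {x m i..x m (i+1)}" for i j t
 proof -
  define lo where "lo = min i j"
  define hi where "hi = max i j"
  have rng: "{lo..hi} \<subseteq> {j-int N..j+int N}" using i by (auto simp: lo_def hi_def)
  have tb: "\<bar>t-x m (l+1)\<bar> <= real (N+1)*(lam * mesh x m)" if l: "lo <= l" "l < hi" for l
  proof -
   have "x m (i+1) <= x m (l+1)+real N*(lam * mesh x m)"
    using x_shift_bounds(1)[of m "l+1" N] x_le_iff[of m "i+1" "l+1+int N"] i l by (auto simp: lo_def hi_def)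
   moreover have "x m (l+1)-real (N+1)*(lam * mesh x m) <= x m i"
    using x_shift_bounds(2)[of m "l+1" "N+1"] x_le_iff[of m "l+1-int (N+1)" i] i l by (auto simp: lo_def hi_def)
   moreover have "real N*(lam * mesh x m) <= real (N+1)*(lam * mesh x m)"
    using lam mesh_pos[of m] by (intro mult_right_mono) auto
   ultimately show ?thesis using t by auto
  qed
  \<comment> \<open>The jumps between neighbours are added up from the left end; each of them is
    evaluated at the same point \<open>t\<close>, at most N+1 intervals away.\<close>
  have tel: "lo <= l ==> l <= hi ==> cmod (poly_fun (p l) t-poly_fun (p lo) t) <= Whitney_const2 k N*(\<Sum>l'\<in>{lo..<l}. ?t l'+?t (l'+1))" for l
  proof (induction l rule: int_ge_induct)
   case (step l)
   have "poly_fun (p (l+1)) t-poly_fun (p lo) t = (poly_fun (p (l+1)) t-poly_fun (p l) t)+(poly_fun (p l) t-poly_fun (p lo) t)" by simp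
   hence "cmod (poly_fun (p (l+1)) t-poly_fun (p lo) t) <= cmod (poly_fun (p (l+1)) t-poly_fun (p l) t)+cmod (poly_fun (p l) t-poly_fun (p lo) t)"
    by (metis norm_triangle_ineq)
   also have "... <= Whitney_const2 k N*(?t l+?t (l+1))+Whitney_const2 k N*(\<Sum>l'\<in>{lo..<l}. ?t l'+?t (l'+1))"
    using step by (intro add_mono jump tb) auto
   also have "... = Whitney_const2 k N*(\<Sum>l'\<in>{lo..<l+1}. ?t l'+?t (l'+1))"
   proof -
    have "{lo..<l+1} = insert l {lo..<l}" using step by auto
    thus ?thesis by (simp add: distrib_left)
   qed
   finally show ?case .
  qed simp
  have Sle: "(\<Sum>l'\<in>{lo..<hi}. ?t l'+?t (l'+1)) <= 2*(\<Sum>l\<in>{j-int N..j+int N}. ?t l)"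
  proof -
   have "(\<Sum>l'\<in>{lo..<hi}. ?t (l'+1)) = (\<Sum>l'\<in>{lo+1..hi}. ?t l')"
    by (rule sum.reindex_bij_witness[of _ "\<lambda>l. l-1" "\<lambda>l. l+1"]) auto
   also have "... <= (\<Sum>l\<in>{j-int N..j+int N}. ?t l)" using rng t0 by (intro sum_mono2) auto
   finally have "(\<Sum>l'\<in>{lo..<hi}. ?t (l'+1)) <= (\<Sum>l\<in>{j-int N..j+int N}. ?t l)" .
   moreover have "(\<Sum>l'\<in>{lo..<hi}. ?t l') <= (\<Sum>l\<in>{j-int N..j+int N}. ?t l)"
    using rng t0 by (intro sum_mono2) auto
   ultimately show ?thesis by (simp add: sum.distrib)
  qed
  have lh: "lo <= hi" by (simp add: lo_def hi_def)
  have "cmod (poly_fun (p hi) t-poly_fun (p lo) t) <= Whitney_const2 k N*(2*(\<Sum>l\<in>{j-int N..j+int N}. ?t l))"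
   by (rule order_trans[OF tel[OF lh order_refl] mult_left_mono[OF Sle less_imp_le[OF C20]]])
  moreover have "cmod (poly_fun (p i) t-poly_fun (p j) t) = cmod (poly_fun (p hi) t-poly_fun (p lo) t)"
   unfolding lo_def hi_def by (cases "i <= j") (auto simp: norm_minus_commute)
  ultimately show ?thesis by simp
 qed
 have "mnI q m i (resid f (p j)) <= Whitney_const k N*(\<Sum>l\<in>{j-int N..j+int N}. ?t l)"
  if i: "i \<in> {j-int N..j+int N}" for i j
 proof -
  have ii: "x m i < x m (i+1)" by (simp add: x_less_iff)
  have \<eta>2: "2*\<eta> <= len x m i" using mesh_le_len'[of m i] lam by (simp add: \<eta>_def)
  have "mnI q m i (resid f (p j)) = mnI q m i (\<lambda>t. (f t-poly_fun (p i) t)+poly_fun (p i-p j) t)"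
   by (simp add: poly_fun_simps)
  also have "... <= mnI q m i (resid f (p i))+mnI q m i (poly_fun (p i-p j))"
   by (intro mn_add q fp poly_fun_Lq)
  also have "mnI q m i (resid f (p i)) <= ?K*(Whitney_const1 k*?t i)"
   using \<eta>0 \<eta>2 by (intro sub) (auto simp: len_def)
  also have "?K*(Whitney_const1 k*?t i) <= ?K*(Whitney_const1 k*(\<Sum>l\<in>{j-int N..j+int N}. ?t l))"
   using Whitney_const1_pos[of k] t0 i by (intro mult_left_mono member_le_sum) auto
  also have "mnI q m i (poly_fun (p i-p j)) <= 2 * Whitney_const2 k N*(\<Sum>l\<in>{j-int N..j+int N}. ?t l)"
   by (rule poly_fun_mn_bounded[OF q ii]) (use far[OF i] in \<open>simp add: poly_fun_simps\<close>)
  finally show ?thesis unfolding Whitney_const_def by (simp add: algebra_simps)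
 qed
 thus ?thesis using p(1) by blast
qed

definition "dual_const k = (\<Sum>\<nu><k. Markov_const k 1 (k-\<nu> - 1) * Markov_const k 1 \<nu>*(real k * lam\<^sup>2) ^ (k-1))"

lemma dual_const_pos: "1 <= k ==> 0 < dual_const k"
 unfolding dual_const_def using lam Markov_const(1)[of k 1] by (intro sum_pos) (auto intro!: mult_pos_pos simp: lessThan_empty_iff)

text \<open>In every summand of the pairing the orders of the two derivatives add up to k-1, so the
  powers of the interval length from Markov's inequality cancel against the size of
  \<open>dual_poly\<close>.\<close>

lemma dual_bound:
 assumes k: "1 <= k" and l: "j <= l" "l < j+int k" and p: "p \<in> Pi_poly k"
 shows "cmod (dual (x m) k j p) <= dual_const k * mnI 1 m l (poly_fun p)"
proof -
 obtain n where n: "k = Suc n" using k by (metis Suc_le_D One_nat_def)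
 let ?\<psi> = "dual_poly (x m) k j" and ?a = "x m l" and ?b = "x m (l+1)" and ?L = "len x m l"
 have L: "0 < ?L" by (rule len_pos)
 have ab: "?a < ?b" by (simp add: x_less_iff)
 have Lab: "?b-?a = ?L" by (simp add: len_def)
 have \<psi>: "?\<psi> \<in> Pi_poly k" unfolding n by (rule dual_poly_Pi)
 have \<psi>bd: "mn 1 ?a ?b (poly_fun ?\<psi>) <= (real k * lam\<^sup>2*?L) ^ (k-1)"
 proof (rule poly_fun_mn_bounded)
  fix t assume t: "t \<in> {?a..?b}"
  have fac: "\<bar>t-x m (j+int \<nu>)\<bar> <= real k * lam\<^sup>2*?L" if "\<nu> \<in> {1..k-1}" for \<nu>
  proof -
   have "x m j <= ?a" "?b <= x m (j+int k)" "x m j <= x m (j+int \<nu>)" "x m (j+int \<nu>) <= x m (j+int k)"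
    using l that by (auto simp: x_le_iff)
   hence "\<bar>t-x m (j+int \<nu>)\<bar> <= x m (j+int k)-x m j" using t by auto
   also have "... <= real k*(lam * mesh x m)" using x_diff_bounds(1)[of j "j+int k" m] by simp
   also have "... <= real k*(lam*(lam*?L))" using lam by (intro mult_left_mono mesh_le_len) auto
   finally show ?thesis by (simp add: power2_eq_square mult_ac)
  qed
  have "poly_fun ?\<psi> t = of_real (1/fact (k-1)*(\<Prod>\<nu>=1..k-1. t-x m (j+int \<nu>)))"
   by (simp add: poly_fun_def dual_poly_def poly_prod)
  hence "cmod (poly_fun ?\<psi> t) = 1/fact (k-1)*(\<Prod>\<nu>=1..k-1. \<bar>t-x m (j+int \<nu>)\<bar>)"
   by (simp only: norm_of_real abs_mult abs_prod) simp
  also have "... <= 1*(\<Prod>\<nu>=1..k-1. \<bar>t-x m (j+int \<nu>)\<bar>)"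
   by (intro mult_right_mono prod_nonneg) (auto simp: divide_le_eq fact_ge_1)
  also have "(\<Prod>\<nu>=1..k-1. \<bar>t-x m (j+int \<nu>)\<bar>) <= (\<Prod>\<nu>=1..k-1. real k * lam\<^sup>2*?L)"
   by (intro prod_mono) (use fac in auto)
  finally show "cmod (poly_fun ?\<psi> t) <= (real k * lam\<^sup>2*?L) ^ (k-1)" by simp
 qed (use ab in auto)
 have "dual (x m) k j p = poly (pairing k ?\<psi> p) (of_real ?a)" unfolding n by (rule dual_eval) (use p n in simp)
 also have "... = (\<Sum>\<nu><k. (-1) ^ \<nu>*(poly_fun ((pderiv ^^ (k-\<nu> - 1)) ?\<psi>) ?a * poly_fun ((pderiv ^^ \<nu>) p) ?a))"
  unfolding pairing_def poly_sum poly_fun_def by simp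
 finally have "cmod (dual (x m) k j p) <= (\<Sum>\<nu><k. cmod ((-1) ^ \<nu>*(poly_fun ((pderiv ^^ (k-\<nu> - 1)) ?\<psi>) ?a * poly_fun ((pderiv ^^ \<nu>) p) ?a)))"
  by (simp only: norm_sum)
 also have "... <= (\<Sum>\<nu><k. Markov_const k 1 (k-\<nu> - 1) * Markov_const k 1 \<nu>*(real k * lam\<^sup>2) ^ (k-1) * mn 1 ?a ?b (poly_fun p))"
 proof (rule sum_mono)
  fix \<nu> assume "\<nu> \<in> {..<k}"
  hence \<nu>: "(k-\<nu> - 1)+\<nu> = k-1" by auto
  have dist: "\<bar>?a-?a\<bar> <= 1*(?b-?a)" using ab by simp
  have 1: "cmod (poly_fun ((pderiv ^^ (k-\<nu> - 1)) ?\<psi>) ?a) <= Markov_const k 1 (k-\<nu> - 1)/?L ^ (k-\<nu> - 1)*(real k * lam\<^sup>2*?L) ^ (k-1)"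
  proof -
   have "cmod (poly_fun ((pderiv ^^ (k-\<nu> - 1)) ?\<psi>) ?a) <= Markov_const k 1 (k-\<nu> - 1)/?L ^ (k-\<nu> - 1) * mn 1 ?a ?b (poly_fun ?\<psi>)"
    using Markov_const(2)[OF k _ \<psi> ab dist, of "k-\<nu> - 1"] unfolding Lab by simp
   also have "... <= Markov_const k 1 (k-\<nu> - 1)/?L ^ (k-\<nu> - 1)*(real k * lam\<^sup>2*?L) ^ (k-1)"
    using Markov_const(1)[OF k, of 1 "k-\<nu> - 1"] L by (intro mult_left_mono \<psi>bd divide_nonneg_nonneg) auto
   finally show ?thesis .
  qed
  have 2: "cmod (poly_fun ((pderiv ^^ \<nu>) p) ?a) <= Markov_const k 1 \<nu>/?L ^ \<nu> * mn 1 ?a ?b (poly_fun p)"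
   using Markov_const(2)[OF k _ p ab dist, of \<nu>] unfolding Lab by simp
  have "cmod ((-1) ^ \<nu>*(poly_fun ((pderiv ^^ (k-\<nu> - 1)) ?\<psi>) ?a * poly_fun ((pderiv ^^ \<nu>) p) ?a))
   = cmod (poly_fun ((pderiv ^^ (k-\<nu> - 1)) ?\<psi>) ?a) * cmod (poly_fun ((pderiv ^^ \<nu>) p) ?a)"
   by (simp add: norm_mult norm_power)
  also have "... <= (Markov_const k 1 (k-\<nu> - 1)/?L ^ (k-\<nu> - 1)*(real k * lam\<^sup>2*?L) ^ (k-1))*(Markov_const k 1 \<nu>/?L ^ \<nu> * mn 1 ?a ?b (poly_fun p))"
   by (rule mult_mono[OF 1 2]) (use order_trans[OF norm_ge_zero 1] in auto)
  also have "... = Markov_const k 1 (k-\<nu> - 1) * Markov_const k 1 \<nu>*(real k * lam\<^sup>2) ^ (k-1) * mn 1 ?a ?b (poly_fun p)*(?L ^ (k-1)/(?L ^ (k-\<nu> - 1)*?L ^ \<nu>))"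
   by (simp add: power_mult_distrib)
  also have "?L ^ (k-1)/(?L ^ (k-\<nu> - 1)*?L ^ \<nu>) = 1" unfolding power_add[symmetric] \<nu> using L by simp
  finally show "cmod ((-1) ^ \<nu>*(poly_fun ((pderiv ^^ (k-\<nu> - 1)) ?\<psi>) ?a * poly_fun ((pderiv ^^ \<nu>) p) ?a))
   <= Markov_const k 1 (k-\<nu> - 1) * Markov_const k 1 \<nu>*(real k * lam\<^sup>2) ^ (k-1) * mn 1 ?a ?b (poly_fun p)" by simp
 qed
 finally show ?thesis unfolding dual_const_def sum_distrib_right .
qed

section \<open>Quasi-interpolants\<close>

text \<open>Continuity, available from order 2 on, extends the identity to the right end
  point.\<close>

lemma lev_cpiece_closed:
 assumes k: "2 <= k" and t: "t \<in> {x m l..x m (l+1)}"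
 shows "lev x k a m t = poly_fun (cpiece (x m) k (\<lambda>j. a (m, j)) l) t"
proof -
 let ?g = "\<lambda>t. lev x k a m t-poly_fun (cpiece (x m) k (\<lambda>j. a (m, j)) l) t"
 have cl: "closure {x m l..<x m (l+1)} = {x m l..x m (l+1)}" by (simp add: x_less_iff closure_atLeastLessThan)
 have "norm (?g t) <= 0"
 proof (rule continuous_on_closure_norm_le[where s="{x m l..<x m (l+1)}" and f="?g"])
  show "continuous_on (closure {x m l..<x m (l+1)}) ?g"
   unfolding cl by (intro continuous_intros lev_continuous[OF k] continuous_on_poly_fun)
  show "\<forall>y\<in>{x m l..<x m (l+1)}. norm (?g y) <= 0" using lev_cpiece[of k m l _ a] k by auto
  show "t \<in> closure {x m l..<x m (l+1)}" unfolding cl by (rule t)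
 qed
 thus ?thesis by simp
qed

lemma lev_bound_closed:
 assumes k: "2 <= k" and t: "t \<in> {x m l..x m (l+1)}" and B: "\<And>j. j \<in> {l-int (k-1)..l} ==> cmod (a (m, j)) <= B"
 shows "cmod (lev x k a m t) <= B"
proof -
 have cl: "closure {x m l..<x m (l+1)} = {x m l..x m (l+1)}" by (simp add: x_less_iff closure_atLeastLessThan)
 have "norm (lev x k a m t) <= B"
 proof (rule continuous_on_closure_norm_le[where s="{x m l..<x m (l+1)}" and f="lev x k a m"])
  show "continuous_on (closure {x m l..<x m (l+1)}) (lev x k a m)" unfolding cl by (rule lev_continuous[OF k])
  show "\<forall>y\<in>{x m l..<x m (l+1)}. norm (lev x k a m y) <= B" using lev_bound_pt[of k m l _ a B] k B by auto
  show "t \<in> closure {x m l..<x m (l+1)}" unfolding cl by (rule t)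
 qed
 thus ?thesis .
qed

lemma lev_linear:
 assumes "0 < k"
 shows "lev x k (\<lambda>p. a p-b p) m t = lev x k a m t-lev x k b m t"
  "lev x k (\<lambda>p. a p+b p) m t = lev x k a m t+lev x k b m t"
proof -
 obtain l where l: "x m l <= t" "t < x m (l+1)" by (rule x_cover)
 note e = lev_eq_sum[OF assms l, of "{l-int (k-1)..l}", simplified]
 show "lev x k (\<lambda>p. a p-b p) m t = lev x k a m t-lev x k b m t"
  "lev x k (\<lambda>p. a p+b p) m t = lev x k a m t+lev x k b m t"
  unfolding e by (simp_all add: sum_subtractf sum.distrib algebra_simps)
qed

lemma lev_cong: "(\<And>j. a (m, j) = b (m, j)) ==> lev x k a m t = lev x k b m t"
 by (simp add: lev_def)

lemma lev_eq_imp_coeffs_eq: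
 assumes k: "0 < k" and eq: "\<And>t. lev x k a m t = lev x k b m t"
 shows "a (m, j) = b (m, j)"
proof -
 obtain n where n: "k = Suc n" using k gr0_conv_Suc by blast
 have c: "cpiece (x m) k (\<lambda>j. a (m, j)) j = cpiece (x m) k (\<lambda>j. b (m, j)) j"
 proof (rule poly_eqI_interval)
  show "x m j < x m (j+1)" by (simp add: x_less_iff)
  fix t assume "x m j <= t" "t < x m (j+1)"
  thus "poly_fun (cpiece (x m) k (\<lambda>j. a (m, j)) j) t = poly_fun (cpiece (x m) k (\<lambda>j. b (m, j)) j) t"
   using lev_cpiece[OF k, of m j t a] lev_cpiece[OF k, of m j t b] eq[of t] by simp
 qed
 show ?thesis using dual_cpiece[OF knots, of j j n m "\<lambda>j. a (m, j)"] dual_cpiece[OF knots, of j j n m "\<lambda>j. b (m, j)"] c n by simp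
qed

definition par :: "int => int => int" where
 "par m i = (SOME j. x (m-1) j <= x m i \<and> x m (i+1) <= x (m-1) (j+1))"

lemma par: "x (m-1) (par m i) <= x m i" "x m (i+1) <= x (m-1) (par m i+1)"
proof -
 obtain j where "x (m-1) j <= x (m-1+1) i" "x (m-1+1) (i+1) <= x (m-1) (j+1)" by (rule parent)
 hence "\<exists>j. x (m-1) j <= x m i \<and> x m (i+1) <= x (m-1) (j+1)" by auto
 hence "x (m-1) (par m i) <= x m i \<and> x m (i+1) <= x (m-1) (par m i+1)"
  unfolding par_def by (rule someI_ex)
 thus "x (m-1) (par m i) <= x m i" "x m (i+1) <= x (m-1) (par m i+1)" by auto
qed

text \<open>At a fine knot either both adjacent fine intervals have the same parent and there is no
  jump, or the knot is also a coarse one and the parent advances by one.\<close>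

lemma spline_refine:
 assumes p: "spline (x (m-1)) k p"
 shows "spline (x m) k (\<lambda>l. p (par m l))"
 unfolding spline_def
proof (intro allI conjI)
 fix l
 show "p (par m l) \<in> Pi_poly k" using p by (simp add: spline_def)
 let ?j = "par m (l-1)" and ?j' = "par m l"
 have b: "x m l <= x (m-1) (?j+1)" "x (m-1) ?j' <= x m l" "x (m-1) ?j <= x m (l-1)" "x m (l+1) <= x (m-1) (?j'+1)"
  using par(2)[of m "l-1"] par(1)[of m l] par(1)[of m "l-1"] par(2)[of m l] by auto
 have "x m (l-1) < x m (l+1)" by (simp add: x_less_iff)
 hence "x (m-1) ?j < x (m-1) (?j'+1)" using b by linarith
 hence le: "?j <= ?j'" by (simp add: x_less_iff)
 show "\<exists>c. p (par m l)-p (par m (l-1)) = smult c ([:- complex_of_real (x m l), 1:] ^ (k-1))"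
 proof (cases "?j = ?j'")
  case True
  thus ?thesis by (intro exI[of _ 0]) simp
 next
  case False
  hence "x (m-1) (?j+1) <= x (m-1) ?j'" using le by (simp add: x_le_iff)
  hence e: "x (m-1) ?j' = x m l" "x (m-1) (?j+1) = x (m-1) ?j'" using b by linarith+
  have "?j+1 = ?j'" using e(2) by (simp only: x_eq_iff)
  hence "?j = ?j'-1" by simp
  thus ?thesis using p[unfolded spline_def, rule_format, of ?j'] e(1) by simp
 qed
qed

text \<open>Coefficients of the quasi-interpolant built from the local polynomials \<open>R\<close>, and of the difference
 of two consecutive quasi-interpolants written over the finer level.\<close>

definition gam :: "nat => (int => int => int) => (int => int => complex poly) => int \<times> int => complex" where
 "gam k sel R = (\<lambda>(m, j). dual (x m) k j (R m (sel m j)))"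

definition bco :: "nat => (int => int => int) => (int => int => complex poly) => int \<times> int => complex" where
 "bco k sel R = (\<lambda>(m, j). gam k sel R (m, j)-dual (x m) k j (cpiece (x (m-1)) k (\<lambda>i. gam k sel R (m-1, i)) (par m (sel m j))))"

lemma spline_lev:
 assumes k: "0 < k" and p: "spline (x m) k p" and s: "\<And>j. j <= s j \<and> s j < j+int k"
  and t: "x m l <= t" "t < x m (l+1)"
 shows "lev x k (\<lambda>(m, j). dual (x m) k j (p (s j))) m t = poly_fun (p l) t"
proof -
 obtain n where n: "k = Suc n" using k gr0_conv_Suc by blast
 show ?thesis using spline_eq_cpiece[OF knots p[unfolded n] s[unfolded n], of l] lev_cpiece[OF k t] by (simp add: n)
qed

text \<open>By \<open>spline_refine\<close> the coarser quasi-interpolant is a spline of level m.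
  Reading its coefficients with the dual functionals gives the term subtracted in
  \<open>bco\<close>.\<close>

lemma bco_refines:
 assumes k: "2 <= k" and sel: "\<And>m j. j <= sel m j \<and> sel m j < j+int k"
 shows "lev x k (bco k sel R) m t = lev x k (gam k sel R) m t-lev x k (gam k sel R) (m-1) t"
proof -
 have k0: "0 < k" using k by simp
 obtain n where n: "k = Suc n" using k0 gr0_conv_Suc by blast
 obtain l where l: "x m l <= t" "t < x m (l+1)" by (rule x_cover)
 let ?p = "\<lambda>l. cpiece (x (m-1)) k (\<lambda>i. gam k sel R (m-1, i)) (par m l)"
 have sp: "spline (x m) k ?p" unfolding n by (rule spline_refine[OF spline_cpiece[OF knots]])
 have "lev x k (gam k sel R) (m-1) t = poly_fun (?p l) t"
  by (rule lev_cpiece_closed[OF k]) (use par[of m l] l in auto)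
 also have "... = lev x k (\<lambda>(m', j). dual (x m') k j (?p (sel m j))) m t"
  by (rule spline_lev[OF k0 sp sel l, symmetric])
 finally have "lev x k (gam k sel R) m t-lev x k (gam k sel R) (m-1) t =
  lev x k (\<lambda>p. gam k sel R p-(case p of (m', j) => dual (x m') k j (?p (sel m j)))) m t"
  by (simp add: lev_linear[OF k0])
 also have "... = lev x k (bco k sel R) m t" by (rule lev_cong) (simp add: bco_def)
 finally show ?thesis ..
qed

lemma gam_diff_poly:
 assumes k: "2 <= k" and sel: "\<And>m j. j <= sel m j \<and> sel m j < j+int k" and R: "R m (sel m j) \<in> Pi_poly k" and p: "p \<in> Pi_poly k"
  and f: "f \<in> Lq_loc q" and q: "1 <= q"
 shows "cmod (gam k sel R (m, j)-dual (x m) k j p) <= dual_const k *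
  (mn q (x m (sel m j)) (x m (sel m j+1)) (\<lambda>t. f t-poly_fun (R m (sel m j)) t)+mn q (x m (sel m j)) (x m (sel m j+1)) (resid f p))"
proof -
 let ?l = "sel m j" and ?a = "x m (sel m j)" and ?b = "x m (sel m j+1)"
 have k1: "1 <= k" using k by simp
 have ab: "?a < ?b" by (simp add: x_less_iff)
 have fp: "(resid f r) \<in> Lq q {u..v}" for r u v by (intro Lq_diff(1) q Lq_locD f poly_fun_Lq)
 have "gam k sel R (m, j)-dual (x m) k j p = dual (x m) k j (R m ?l-p)" by (simp add: gam_def dual_diff)
 hence "cmod (gam k sel R (m, j)-dual (x m) k j p) <= dual_const k * mn 1 ?a ?b (poly_fun (R m ?l-p))"
  using dual_bound[OF k1, of j ?l "R m ?l-p" m] sel[of j m] Pi_poly_diff[OF R p] by simp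
 also have "mn 1 ?a ?b (poly_fun (R m ?l-p)) <= mn q ?a ?b (poly_fun (R m ?l-p))"
  by (rule Lq_integrable_norm(2)[OF q poly_fun_Lq[OF q] ab])
 also have "mn q ?a ?b (poly_fun (R m ?l-p)) = mn q ?a ?b (\<lambda>t. (f t-poly_fun p t)-(f t-poly_fun (R m ?l) t))"
  by (rule mn_cong) (simp add: poly_fun_simps)
 also have "... <= mn q ?a ?b (resid f p)+mn q ?a ?b (resid f (R m ?l))"
  by (intro mn_diff q fp)
 finally show ?thesis using dual_const_pos[OF k1] by (simp add: add.commute mult_left_mono)
qed

lemma lev_poly_diff:
 assumes k: "2 <= k" and p: "p \<in> Pi_poly k" and t: "t \<in> {x m l..x m (l+1)}"
  and B: "\<And>j. j \<in> {l-int (k-1)..l} ==> cmod (a (m, j)-dual (x m) k j p) <= B"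
 shows "cmod (lev x k a m t-poly_fun p t) <= B"
proof -
 have k0: "0 < k" using k by simp
 let ?d = "\<lambda>(m, j). dual (x m) k j p"
 have sp: "spline (x m) k (\<lambda>_. p)" unfolding spline_def using p by (auto intro!: exI[of _ 0])
 have d: "lev x k ?d m u = poly_fun p u" for u
 proof -
  obtain l where l: "x m l <= u" "u < x m (l+1)" by (rule x_cover)
  show ?thesis using spline_lev[OF k0 sp _ l, of "\<lambda>j. j"] k0 by simp
 qed
 have "lev x k a m t-poly_fun p t = lev x k (\<lambda>p. a p-?d p) m t" by (simp add: lev_linear[OF k0] d)
 also have "cmod ... <= B" by (rule lev_bound_closed[OF k t]) (use B in simp)
 finally show ?thesis .
qed

text \<open>The polynomials \<open>R m i\<close> need only approximate \<open>f\<close> on single intervals up to the local moduli;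
 they are taken from Whitney's inequality or from the projectors, as needed.\<close>

definition approximates :: "nat => real => real => (real => complex) => (int => int => complex poly) => bool" where
 "approximates k q A f R \<longleftrightarrow> (\<forall>m i. R m i \<in> Pi_poly k \<and>
   mnI q m i (resid f (R m i)) <= A * E_coef x k q f (m, i))"

definition "gam_const k A = dual_const k*(A+Whitney_const k (k+1))"

lemma gam_const_nonneg: "1 <= k ==> 0 <= A ==> 0 <= gam_const k A"
 unfolding gam_const_def using dual_const_pos[of k] Whitney_const_pos[of k "k+1"] by simp

text \<open>Quasi-interpolation reproduces polynomials, so coefficients are compared with those of a
  polynomial near \<open>f\<close>. The range of j covers all B-splines active on the intervals l-1,
  l and l+1, and their selected intervals are within distance k of l.\<close>

lemma gam_near_poly:
 fixes m :: int
 assumes k: "2 <= k" and q: "1 <= q" and f: "f \<in> Lq_loc q" and A: "0 <= A" and R: "approximates k q A f R"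
  and sel: "\<And>m j. j <= sel m j \<and> sel m j < j+int k"
 shows "\<exists>p. \<forall>l. p l \<in> Pi_poly k \<and>
   (\<forall>i\<in>{l-int (k+1)..l+int (k+1)}. mnI q m i (resid f (p l)) <= Whitney_const k (k+1)*(\<Sum>i\<in>{l-int (k+1)..l+int (k+1)}. E_coef x k q f (m, i))) \<and>
   (\<forall>j\<in>{l-int k..l+1}. cmod (gam k sel R (m, j)-dual (x m) k j (p l)) <= gam_const k A*(\<Sum>i\<in>{l-int (k+1)..l+int (k+1)}. E_coef x k q f (m, i)))"
proof -
 obtain p where p: "\<forall>l. p l \<in> Pi_poly k \<and> (\<forall>i\<in>{l-int (k+1)..l+int (k+1)}.
   mnI q m i (resid f (p l)) <= Whitney_const k (k+1)*(\<Sum>i\<in>{l-int (k+1)..l+int (k+1)}. E_coef x k q f (m, i)))"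
  using Whitney_chain[where m=m and N="k+1", OF k q f] by (elim exE)
 have t0: "0 <= E_coef x k q f g" for g by (rule E_coef_nonneg[OF q f])
 have "cmod (gam k sel R (m, j)-dual (x m) k j (p l)) <= gam_const k A*(\<Sum>i\<in>{l-int (k+1)..l+int (k+1)}. E_coef x k q f (m, i))"
  if j: "j \<in> {l-int k..l+1}" for l j
 proof -
  let ?S = "\<Sum>i\<in>{l-int (k+1)..l+int (k+1)}. E_coef x k q f (m, i)"
  have s: "sel m j \<in> {l-int (k+1)..l+int (k+1)}" using sel[of j m] j by auto
  have Rm: "R m (sel m j) \<in> Pi_poly k" using R by (simp add: approximates_def)
  have "cmod (gam k sel R (m, j)-dual (x m) k j (p l)) <= dual_const k *
   (mn q (x m (sel m j)) (x m (sel m j+1)) (\<lambda>t. f t-poly_fun (R m (sel m j)) t)+mn q (x m (sel m j)) (x m (sel m j+1)) (resid f (p l)))"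
   by (rule gam_diff_poly[where sel=sel and R=R and m=m and j=j, OF k sel Rm _ f q]) (rule conjunct1[OF spec[OF p, of l]])
  also have "... <= dual_const k*(A*?S+Whitney_const k (k+1)*?S)"
  proof (intro mult_left_mono add_mono)
   have "mn q (x m (sel m j)) (x m (sel m j+1)) (\<lambda>t. f t-poly_fun (R m (sel m j)) t) <= A * E_coef x k q f (m, sel m j)"
    using R by (simp add: approximates_def)
   also have "... <= A*?S" using A s t0 by (intro mult_left_mono member_le_sum) auto
   finally show "mn q (x m (sel m j)) (x m (sel m j+1)) (\<lambda>t. f t-poly_fun (R m (sel m j)) t) <= A*?S" .
   show "mn q (x m (sel m j)) (x m (sel m j+1)) (resid f (p l)) <= Whitney_const k (k+1)*?S"
    by (rule conjunct2[OF spec[OF p, of l], THEN bspec, OF s])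
   show "0 <= dual_const k" using dual_const_pos[of k] k by simp
  qed
  finally show ?thesis by (simp add: gam_const_def algebra_simps)
 qed
 note g = this
 show ?thesis
 proof (intro exI[of _ p] allI conjI ballI)
  fix l
  show "p l \<in> Pi_poly k" by (rule conjunct1[OF spec[OF p, of l]])
  show "mnI q m i (resid f (p l)) <= Whitney_const k (k+1)*(\<Sum>i\<in>{l-int (k+1)..l+int (k+1)}. E_coef x k q f (m, i))"
   if "i \<in> {l-int (k+1)..l+int (k+1)}" for i by (rule conjunct2[OF spec[OF p, of l], THEN bspec, OF that])
 qed (rule g)
qed

definition "bco_const k A = dual_const k*(A+real M\<^sub>0 * lam ^ 3 * Whitney_const k (k+1))+dual_const k * gam_const k A"

lemma len_par_le: "len x (m-1) (par m i) <= (real M\<^sub>0 * lam ^ 3) * len x m i"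
proof -
 have "len x (m-1) (par m i) <= lam * mesh x (m-1)" by (rule len_le_mesh)
 also have "... <= lam*(real M\<^sub>0 * lam * mesh x m)" using mesh_le_child[of "m-1"] lam by (intro mult_left_mono) auto
 also have "... <= lam*(real M\<^sub>0 * lam*(lam * len x m i))" using lam by (intro mult_left_mono mesh_le_len) auto
 finally show ?thesis by (simp add: power3_eq_cube mult_ac)
qed

text \<open>The moduli used for one coefficient: that of the selected interval, and a window of
  level m-1 around its parent.\<close>

definition bnbr :: "nat => (int => int => int) => int \<times> int => (int \<times> int) set" where
 "bnbr k sel = (\<lambda>(m, j). insert (m, sel m j) (Pair (m-1) ` {par m (sel m j)-int (k+1)..par m (sel m j)+int (k+1)}))"

text \<open>A single polynomial near \<open>f\<close> around the parent interval serves both levels.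
  Since both quasi-interpolants reproduce it, inserting it splits \<open>bco\<close> into two terms
  that measure only the local error.\<close>

lemma bco_bound:
 assumes k: "2 <= k" and q: "1 <= q" and f: "f \<in> Lq_loc q" and A: "0 <= A" and R: "approximates k q A f R"
  and sel: "\<And>m j. j <= sel m j \<and> sel m j < j+int k"
 shows "cmod (bco k sel R g) <= bco_const k A*(\<Sum>g'\<in>bnbr k sel g. E_coef x k q f g')"
proof -
 obtain m j where g: "g = (m, j)" by force
 have k1: "1 <= k" and k0: "0 < k" using k by simp_all
 obtain n where n: "k = Suc n" using k0 gr0_conv_Suc by blast
 define l where "l = sel m j"
 define l' where "l' = par m l"
 let ?I = "{l'-int (k+1)..l'+int (k+1)}"
 define S where "S = (\<Sum>i\<in>?I. E_coef x k q f (m-1, i))"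
 define T where "T = (\<Sum>g'\<in>bnbr k sel g. E_coef x k q f g')"
 have t0: "0 <= E_coef x k q f g" for g by (rule E_coef_nonneg[OF q f])
 have T: "T = E_coef x k q f (m, l)+S"
  unfolding T_def S_def bnbr_def g by (simp add: l_def l'_def) (subst sum.insert, auto simp: sum.reindex inj_on_def)
 have S0: "0 <= S" unfolding S_def using t0 by (intro sum_nonneg)
 have ST: "S <= T" "E_coef x k q f (m, l) <= T" using T S0 t0[of "(m, l)"] by linarith+
 obtain p' where p': "\<forall>l. p' l \<in> Pi_poly k \<and>
   (\<forall>i\<in>{l-int (k+1)..l+int (k+1)}. mnI q (m-1) i (resid f (p' l)) <= Whitney_const k (k+1)*(\<Sum>i\<in>{l-int (k+1)..l+int (k+1)}. E_coef x k q f (m-1, i))) \<and>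
   (\<forall>j\<in>{l-int k..l+1}. cmod (gam k sel R (m-1, j)-dual (x (m-1)) k j (p' l)) <= gam_const k A*(\<Sum>i\<in>{l-int (k+1)..l+int (k+1)}. E_coef x k q f (m-1, i)))"
  using gam_near_poly[where sel=sel and m="m-1", OF k q f A R sel] by (elim exE)
 define p where "p = p' l'"
 have p: "p \<in> Pi_poly k" "mn q (x (m-1) l') (x (m-1) (l'+1)) (resid f p) <= Whitney_const k (k+1) * S"
  "\<And>i. i \<in> {l'-int k..l'+1} ==> cmod (gam k sel R (m-1, i)-dual (x (m-1)) k i p) <= gam_const k A * S"
 proof -
  note c = spec[OF p', of l']
  show "p \<in> Pi_poly k" unfolding p_def by (rule conjunct1[OF c])
  show "mn q (x (m-1) l') (x (m-1) (l'+1)) (resid f p) <= Whitney_const k (k+1) * S"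
   unfolding p_def S_def by (rule conjunct1[OF conjunct2[OF c], THEN bspec]) simp
  show "cmod (gam k sel R (m-1, i)-dual (x (m-1)) k i p) <= gam_const k A * S" if "i \<in> {l'-int k..l'+1}" for i
   unfolding p_def S_def by (rule conjunct2[OF conjunct2[OF c], THEN bspec, OF that])
 qed
 have jl: "j <= l" "l < j+int k" using sel[of j m] by (simp_all add: l_def)
 have lp: "x (m-1) l' <= x m l" "x m (l+1) <= x (m-1) (l'+1)" unfolding l'_def by (rule par)+
 have ll: "x m l < x m (l+1)" by (simp add: x_less_iff)
 let ?c = "cpiece (x (m-1)) k (\<lambda>i. gam k sel R (m-1, i)) l'"
 have cP: "?c \<in> Pi_poly k" unfolding n by (rule cpiece_Pi)
 have 1: "cmod (gam k sel R (m, j)-dual (x m) k j p) <= dual_const k*(A+real M\<^sub>0 * lam ^ 3 * Whitney_const k (k+1)) * T"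
 proof -
  have Rm: "R m (sel m j) \<in> Pi_poly k" using R by (simp add: approximates_def)
  have fp: "(resid f p) \<in> Lq q {u..v}" for u v by (intro Lq_diff(1) q Lq_locD f poly_fun_Lq)
  have "cmod (gam k sel R (m, j)-dual (x m) k j p) <= dual_const k *
   (mnI q m l (resid f (R m l))+mnI q m l (resid f p))"
   unfolding l_def by (rule gam_diff_poly[where sel=sel and R=R and m=m and j=j, OF k sel Rm p(1) f q])
  also have "... <= dual_const k*(A * T+real M\<^sub>0 * lam ^ 3*(Whitney_const k (k+1) * T))"
  proof (intro mult_left_mono add_mono)
   have "mnI q m l (resid f (R m l)) <= A * E_coef x k q f (m, l)"
    using R by (simp add: approximates_def)
   also have "... <= A * T" using A ST by (intro mult_left_mono) auto
   finally show "mnI q m l (resid f (R m l)) <= A * T" .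
   have "mnI q m l (resid f p) <= real M\<^sub>0 * lam ^ 3 * mn q (x (m-1) l') (x (m-1) (l'+1)) (resid f p)"
    using len_par_le[of m l] by (intro mn_mono(2)[OF q fp lp(1) ll lp(2)]) (simp add: len_def l'_def)
   also have "... <= real M\<^sub>0 * lam ^ 3*(Whitney_const k (k+1) * T)"
    using p(2) ST(1) lam Whitney_const_pos[OF k1, of "k+1"]
    by (intro mult_left_mono order_trans[OF p(2)]) auto
   finally show "mnI q m l (resid f p) <= real M\<^sub>0 * lam ^ 3*(Whitney_const k (k+1) * T)" .
   show "0 <= dual_const k" using dual_const_pos[OF k1] by simp
  qed
  finally show ?thesis by (simp add: algebra_simps)
 qed
 have 2: "cmod (dual (x m) k j (?c-p)) <= dual_const k*(gam_const k A * T)"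
 proof -
  have "cmod (dual (x m) k j (?c-p)) <= dual_const k * mnI 1 m l (poly_fun (?c-p))"
   by (rule dual_bound[OF k1 jl Pi_poly_diff[OF cP p(1)]])
  also have "mnI 1 m l (poly_fun (?c-p)) <= gam_const k A * S"
  proof (rule poly_fun_mn_bounded[OF _ ll])
   fix t assume t: "t \<in> {x m l..x m (l+1)}"
   hence t': "t \<in> {x (m-1) l'..x (m-1) (l'+1)}" using lp by auto
   have "cmod (lev x k (gam k sel R) (m-1) t-poly_fun p t) <= gam_const k A * S"
    by (rule lev_poly_diff[OF k p(1) t']) (rule p(3), use k in auto)
   thus "cmod (poly_fun (?c-p) t) <= gam_const k A * S"
    by (simp add: poly_fun_simps lev_cpiece_closed[OF k t'])
  qed simp
  also have "gam_const k A * S <= gam_const k A * T" using gam_const_nonneg[OF k1 A] ST by (intro mult_left_mono) auto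
  finally show ?thesis using dual_const_pos[OF k1] by (simp add: mult_left_mono)
 qed
 have "bco k sel R g = (gam k sel R (m, j)-dual (x m) k j p)-dual (x m) k j (?c-p)"
  by (simp add: bco_def g dual_diff l_def l'_def)
 hence "cmod (bco k sel R g) <= cmod (gam k sel R (m, j)-dual (x m) k j p)+cmod (dual (x m) k j (?c-p))"
  by (simp add: norm_triangle_ineq4)
 also have "... <= bco_const k A * T" using 1 2 unfolding bco_const_def by (simp add: algebra_simps)
 finally show ?thesis unfolding T_def .
qed

lemma bnbr_finite: "finite (bnbr k sel g)" "card (bnbr k sel g) <= 2 * k+4"
proof -
 obtain m j where g: "g = (m, j)" by force
 show "finite (bnbr k sel g)" by (simp add: g bnbr_def)
 let ?B = "Pair (m-1) ` {par m (sel m j)-int (k+1)..par m (sel m j)+int (k+1)}"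
 have "card (bnbr k sel g) <= Suc (card ?B)" unfolding g bnbr_def by (simp add: card_insert_le_m1 card_insert_if)
 also have "card ?B <= card {par m (sel m j)-int (k+1)..par m (sel m j)+int (k+1)}" by (rule card_image_le) simp
 also have "... = 2 * k+3" by simp
 finally show "card (bnbr k sel g) <= 2 * k+4" by simp
qed

definition "bnbr_const k = real k+(2*((real (2 * k+3) * lam+real k * lam)*(real M\<^sub>0 * lam)+real k * lam) * lam+3)"

text \<open>The column count for Schur's test: a modulus of level m enters only coefficients of the
  levels m and m+1, and boundedly many of each.\<close>

lemma bnbr_column:
 assumes k: "1 <= k" and sel: "\<And>m j. j <= sel m j \<and> sel m j < j+int k" and G: "finite G"
 shows "real (card {g\<in>G. g' \<in> bnbr k sel g}) <= bnbr_const k"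
proof -
 obtain m i where g': "g' = (m, i)" by force
 let ?A = "Pair m ` {i-int (k-1)..i}"
 let ?lo = "x m (i-int (k+1))-real k*(lam * mesh x (m+1))" and ?hi = "x m (i+int (k+2))"
 let ?B = "Pair (m+1) ` {j. ?lo <= x (m+1) j \<and> x (m+1) j <= ?hi}"
 have sub: "{g\<in>G. g' \<in> bnbr k sel g} \<subseteq> ?A \<union> ?B"
 proof
  fix g assume gG: "g \<in> {g\<in>G. g' \<in> bnbr k sel g}"
  obtain m' j where g: "g = (m', j)" by force
  from gG have "(m, i) = (m', sel m' j) \<or> m = m'-1 \<and> i \<in> {par m' (sel m' j)-int (k+1)..par m' (sel m' j)+int (k+1)}"
   by (auto simp: g g' bnbr_def)
  thus "g \<in> ?A \<union> ?B"
  proof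
   assume "(m, i) = (m', sel m' j)"
   hence "m' = m" "i = sel m j" by auto
   thus ?thesis using sel[of j m] k by (auto simp: g)
  next
   assume *: "m = m'-1 \<and> i \<in> {par m' (sel m' j)-int (k+1)..par m' (sel m' j)+int (k+1)}"
   hence m': "m' = m+1" by simp
   let ?s = "sel m' j"
   have pr: "x m (par m' ?s) <= x m' ?s" "x m' (?s+1) <= x m (par m' ?s+1)" using par[of m' ?s] m' by simp_all
   have "x m (i-int (k+1)) <= x m (par m' ?s)" using * by (simp add: x_le_iff)
   moreover have "x m (par m' ?s+1) <= x m (i+int (k+2))" using * by (simp add: x_le_iff)
   moreover have "x m' j <= x m' (?s+1)" using sel[of j m'] by (simp add: x_le_iff)
   moreover have "x m' ?s-real k*(lam * mesh x m') <= x m' j"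
    using x_shift_bounds(2)[of m' ?s k] x_le_iff[of m' "?s-int k" j] sel[of j m'] by auto
   ultimately have "?lo <= x (m+1) j \<and> x (m+1) j <= ?hi" using pr m' by auto
   thus ?thesis by (simp add: g m')
  qed
 qed
 have finB: "finite ?B" by (intro finite_imageI knot_count(1))
 have cB: "real (card ?B) <= 2*((real (2 * k+3) * lam+real k * lam)*(real M\<^sub>0 * lam)+real k * lam) * lam+3"
 proof -
  have "card ?B <= card {j. ?lo <= x (m+1) j \<and> x (m+1) j <= ?hi}" by (rule card_image_le[OF knot_count(1)])
  hence "real (card ?B) <= real (card {j. ?lo <= x (m+1) j \<and> x (m+1) j <= ?hi})" by simp
  also have "... <= 2*((real (2 * k+3) * lam+real k * lam)*(real M\<^sub>0 * lam)+real k * lam) * lam+3"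
  proof (rule knot_count(2))
   show "0 <= (real (2 * k+3) * lam+real k * lam)*(real M\<^sub>0 * lam)+real k * lam" using lam by simp
   have "?hi-x m (i-int (k+1)) <= real (2 * k+3)*(lam * mesh x m)"
    using x_diff_bounds(1)[of "i-int (k+1)" "i+int (k+2)" m] by (simp add: algebra_simps)
   also have "... <= (real (2 * k+3) * lam+real k * lam) * mesh x m"
    using lam mesh_pos[of m] by (simp add: distrib_right)
   also have "... <= (real (2 * k+3) * lam+real k * lam)*(real M\<^sub>0 * lam * mesh x (m+1))"
    using lam by (intro mult_left_mono mesh_le_child) auto
   finally show "?hi-?lo <= ((real (2 * k+3) * lam+real k * lam)*(real M\<^sub>0 * lam)+real k * lam) * mesh x (m+1)"
    by (simp add: algebra_simps)
  qed
  finally show ?thesis .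
 qed
 have cA: "card ?A <= k" using card_image_le[of "{i-int (k-1)..i}" "Pair m"] k by simp
 have "card {g\<in>G. g' \<in> bnbr k sel g} <= card (?A \<union> ?B)" by (rule card_mono[OF _ sub]) (use finB in auto)
 also have "... <= card ?A+card ?B" by (rule card_Un_le)
 finally show ?thesis unfolding bnbr_const_def using cA cB by linarith
qed

lemma bnbr_const_nonneg: "0 <= bnbr_const k"
 unfolding bnbr_const_def using lam by (intro add_nonneg_nonneg mult_nonneg_nonneg) auto

definition "E_bco_const k A \<tau> = bco_const k A * real (2 * k+4) * bnbr_const k powr (1/\<tau>)"

lemma bco_const_nonneg: "1 <= k ==> 0 <= A ==> 0 <= bco_const k A"
 unfolding bco_const_def using dual_const_pos[of k] gam_const_nonneg[of k A] Whitney_const_pos[of k "k+1"] lam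
 by (intro add_nonneg_nonneg mult_nonneg_nonneg) auto

lemma E_bco:
 assumes k: "2 <= k" and q: "1 <= q" and \<tau>: "0 < \<tau>" and f: "f \<in> besov_E x k \<tau> q" and A: "0 <= A" and R: "approximates k q A f R"
  and sel: "\<And>m j. j <= sel m j \<and> sel m j < j+int k"
 shows "(\<lambda>g. cmod (bco k sel R g) powr \<tau>) summable_on UNIV"
  "ell_norm \<tau> (\<lambda>g. cmod (bco k sel R g)) <= E_bco_const k A \<tau> * besov_E_norm x k \<tau> q f"
proof -
 have fl: "f \<in> Lq_loc q" and Es: "(\<lambda>g. E_coef x k q f g powr \<tau>) summable_on UNIV" using f by (auto simp: besov_E_def)
 have k1: "1 <= k" using k by simp
 have t0: "0 <= E_coef x k q f g" for g by (rule E_coef_nonneg[OF q fl])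
 let ?C = "(bco_const k A * real (2 * k+4)) powr \<tau>"
 have B0: "0 <= bco_const k A" by (rule bco_const_nonneg[OF k1 A])
 define w where "w g g' = (if g' \<in> bnbr k sel g then 1 else 0 :: real)" for g g'
 have w0: "0 <= w g g'" for g g' by (simp add: w_def)
 have col: "(\<Sum>g\<in>G. w g g') <= bnbr_const k" if "finite G" for G g'
 proof -
  have "(\<Sum>g\<in>G. w g g') = real (card {g\<in>G. g' \<in> bnbr k sel g})"
   unfolding w_def using that by (simp add: sum.If_cases Int_def conj_commute)
  thus ?thesis using bnbr_column[where sel=sel and g'=g', OF k1 sel that] by simp
 qed
 note Schur = Schur_infsum[where w=w and s="\<lambda>g. E_coef x k q f g powr \<tau>", OF w0 powr_ge_zero Es bnbr_const_nonneg col]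
 have pt: "cmod (bco k sel R g) powr \<tau> <= ?C*(\<Sum>\<^sub>\<infinity>g'. w g g' * E_coef x k q f g' powr \<tau>)" for g
 proof -
  let ?N = "bnbr k sel g"
  define M where "M = (\<Sum>g'\<in>?N. E_coef x k q f g' powr \<tau>)"
  have M0: "0 <= M" by (simp add: M_def sum_nonneg)
  have "(\<Sum>g'\<in>?N. E_coef x k q f g') <= (\<Sum>g'\<in>?N. M powr (1/\<tau>))"
   unfolding M_def by (intro sum_mono le_powr_sum[OF bnbr_finite(1) _ \<tau>] t0)
  also have "... <= real (2 * k+4) * M powr (1/\<tau>)"
   using bnbr_finite(2)[of k sel g] by (simp add: mult_right_mono)
  finally have h: "(\<Sum>g'\<in>?N. E_coef x k q f g') <= real (2 * k+4) * M powr (1/\<tau>)" .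
  have "cmod (bco k sel R g) <= bco_const k A*(real (2 * k+4) * M powr (1/\<tau>))"
   by (rule order_trans[OF bco_bound[where sel=sel and g=g, OF k q fl A R sel] mult_left_mono[OF h B0]])
  hence "cmod (bco k sel R g) powr \<tau> <= (bco_const k A * real (2 * k+4) * M powr (1/\<tau>)) powr \<tau>"
   using \<tau> by (intro powr_mono2) (auto simp: mult.assoc)
  also have "... = ?C*(M powr (1/\<tau>)) powr \<tau>" by (rule powr_mult)
  also have "(M powr (1/\<tau>)) powr \<tau> = M" using \<tau> M0 by (simp add: powr_powr)
  also have "M = (\<Sum>g'\<in>?N. w g g' * E_coef x k q f g' powr \<tau>)" unfolding M_def w_def by simp
  also have "... <= (\<Sum>\<^sub>\<infinity>g'. w g g' * E_coef x k q f g' powr \<tau>)"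
   by (rule sum_le_infsum[OF Schur(1)]) (auto simp: w_def bnbr_finite)
  finally show ?thesis by (simp add: mult_left_mono)
 qed
 have CU: "(\<lambda>g. ?C*(\<Sum>\<^sub>\<infinity>g'. w g g' * E_coef x k q f g' powr \<tau>)) summable_on UNIV"
  by (rule summable_on_cmult_right[OF Schur(2)])
 show sm: "(\<lambda>g. cmod (bco k sel R g) powr \<tau>) summable_on UNIV"
  by (rule summable_on_comparison_test[OF CU]) (use pt in auto)
 have "(\<Sum>\<^sub>\<infinity>g. cmod (bco k sel R g) powr \<tau>) <= (\<Sum>\<^sub>\<infinity>g. ?C*(\<Sum>\<^sub>\<infinity>g'. w g g' * E_coef x k q f g' powr \<tau>))"
  by (rule infsum_mono[OF sm CU pt])
 also have "... = ?C*(\<Sum>\<^sub>\<infinity>g. \<Sum>\<^sub>\<infinity>g'. w g g' * E_coef x k q f g' powr \<tau>)" by (rule infsum_cmult_right')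
 also have "... <= ?C*(bnbr_const k*(\<Sum>\<^sub>\<infinity>g. E_coef x k q f g powr \<tau>))" by (rule mult_left_mono[OF Schur(3) powr_ge_zero])
 finally have "(\<Sum>\<^sub>\<infinity>g. cmod (bco k sel R g) powr \<tau>) powr (1/\<tau>) <= (?C*(bnbr_const k*(\<Sum>\<^sub>\<infinity>g. E_coef x k q f g powr \<tau>))) powr (1/\<tau>)"
  using \<tau> by (intro powr_mono2) (auto intro: infsum_nonneg)
 also have "... = ?C powr (1/\<tau>)*(bnbr_const k powr (1/\<tau>)*(\<Sum>\<^sub>\<infinity>g. E_coef x k q f g powr \<tau>) powr (1/\<tau>))"
  using bnbr_const_nonneg infsum_nonneg[of UNIV "\<lambda>g. E_coef x k q f g powr \<tau>"] by (simp add: powr_mult)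
 also have "?C powr (1/\<tau>) = bco_const k A * real (2 * k+4)" using \<tau> B0 by (simp add: powr_powr)
 finally show "ell_norm \<tau> (\<lambda>g. cmod (bco k sel R g)) <= E_bco_const k A \<tau> * besov_E_norm x k \<tau> q f"
  by (simp add: ell_norm_def besov_E_norm_def E_bco_const_def mult.assoc)
qed

end

section \<open>Synthesis in BMO\<close>

lemma mn_cont_bounded:
 assumes "1 <= q" "a < b" "continuous_on {a..b} f" "\<And>t. t \<in> {a..b} ==> cmod (f t) <= B"
 shows "mn q a b f <= B"
proof (rule mn_bounded[OF assms(1,2) _ assms(4)])
 show "set_borel_measurable lebesgue {a..b} f"
  using Lq_measurable[OF continuous_on_Lq[OF assms(1,3)]] by (simp add: set_borel_measurable_def)
qed

text \<open>Only finitely many terms reach \<open>e\<close>, so they occupy finitely many levels.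
  This gives uniform smallness within a level, at both ends of the scale.\<close>

lemma summable_levels_small:
 fixes s :: "int \<times> int => real"
 assumes s: "(\<lambda>g. s g powr \<tau>) summable_on UNIV" "\<And>g. 0 <= s g" and \<tau>: "0 < \<tau>" and e: "0 < e"
 shows "\<exists>N::nat. \<forall>m i. int N <= \<bar>m\<bar> --> s (m, i) < e"
proof -
 let ?I = "\<Sum>\<^sub>\<infinity>g. s g powr \<tau>"
 have "finite {g. e <= s g} \<and> card {g. e <= s g} <= nat \<lceil>?I/e powr \<tau>\<rceil>"
 proof (rule finite_if_finite_subsets_card_bdd)
  fix G assume G: "G \<subseteq> {g. e <= s g}" "finite G"
  have "real (card G) * e powr \<tau> = (\<Sum>g\<in>G. e powr \<tau>)" by simp
  also have "... <= (\<Sum>g\<in>G. s g powr \<tau>)" using G e \<tau> by (intro sum_mono powr_mono2) auto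
  also have "... <= ?I" by (rule sum_le_infsum[OF s(1) _ G(2)]) simp
  finally have "real (card G) <= ?I/e powr \<tau>" using e by (simp add: le_divide_eq)
  thus "card G <= nat \<lceil>?I/e powr \<tau>\<rceil>" by linarith
 qed
 hence fin: "finite {g. e <= s g}" by simp
 define N where "N = nat (1+(\<Sum>g\<in>{g. e <= s g}. \<bar>fst g\<bar>))"
 have "s (m, i) < e" if "int N <= \<bar>m\<bar>" for m i
 proof (rule ccontr)
  assume "\<not> s (m, i) < e"
  hence "\<bar>fst (m, i)\<bar> <= (\<Sum>g\<in>{g. e <= s g}. \<bar>fst g\<bar>)" by (intro member_le_sum fin) auto
  thus False using that by (simp add: N_def)
 qed
 thus ?thesis by blast
qed

text \<open>A coefficient is a derivative at 0 up to a factorial, and \<open>N\<close> is chosen so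
  that 0 lies in the range of Markov's inequality.\<close>

lemma poly_coeff_bound:
 assumes k: "1 <= k" and ab: "a < b"
 shows "\<exists>C>0. \<forall>p\<in>Pi_poly k. \<forall>i. cmod (coeff p i) <= C * mn 1 a b (poly_fun p)"
proof -
 define N where "N = max 1 (\<bar>a\<bar>/(b-a))"
 have N: "1 <= N" "\<bar>0-a\<bar> <= N*(b-a)" 
 proof -
  have "\<bar>a\<bar> = \<bar>a\<bar>/(b-a)*(b-a)" using ab by simp
  also have "... <= N*(b-a)" unfolding N_def using ab by (intro mult_right_mono) auto
  finally show "\<bar>0-a\<bar> <= N*(b-a)" by simp
 qed (simp add: N_def)
 have "\<forall>i. \<exists>C>0. \<forall>p\<in>Pi_poly k. cmod (coeff p i) <= C * mn 1 a b (poly_fun p)"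
 proof
  fix i
  obtain C where C: "C > 0" "\<forall>p\<in>Pi_poly k. \<forall>a b t. a < b --> \<bar>t-a\<bar> <= N*(b-a) -->
    cmod (poly_fun ((pderiv ^^ i) p) t) <= C/(b-a) ^ i * mn 1 a b (poly_fun p)"
   using poly_higher_Markov[OF k N(1), of i] by blast
  show "\<exists>C>0. \<forall>p\<in>Pi_poly k. cmod (coeff p i) <= C * mn 1 a b (poly_fun p)"
  proof (intro exI[of _ "C/(b-a) ^ i"] conjI ballI)
   fix p :: "complex poly" assume p: "p \<in> Pi_poly k"
   have "poly_fun ((pderiv ^^ i) p) 0 = fact i * coeff p i"
    by (simp add: poly_fun_def poly_0_coeff_0 coeff_higher_pderiv pochhammer_fact)
   hence "cmod (poly_fun ((pderiv ^^ i) p) 0) = fact i * cmod (coeff p i)" by (simp add: norm_mult)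
   moreover have "1 * cmod (coeff p i) <= fact i * cmod (coeff p i)" by (intro mult_right_mono) auto
   ultimately show "cmod (coeff p i) <= C/(b-a) ^ i * mn 1 a b (poly_fun p)"
    using C(2)[rule_format, OF p ab N(2)] by simp
  qed (use C ab in simp)
 qed
 then obtain C where C: "\<forall>i. C i > 0 \<and> (\<forall>p\<in>Pi_poly k. cmod (coeff p i) <= C i * mn 1 a b (poly_fun p))"
  by (rule choice[THEN exE])
 show ?thesis
 proof (intro exI[of _ "\<Sum>i<k. C i"] conjI ballI allI)
  show "0 < (\<Sum>i<k. C i)" using C k by (intro sum_pos) (auto simp: lessThan_empty_iff)
  fix p :: "complex poly" and i assume p: "p \<in> Pi_poly k"
  show "cmod (coeff p i) <= (\<Sum>i<k. C i) * mn 1 a b (poly_fun p)"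
  proof (cases "i < k")
   case True
   have "cmod (coeff p i) <= C i * mn 1 a b (poly_fun p)" using C p by blast
   also have "... <= (\<Sum>i<k. C i) * mn 1 a b (poly_fun p)"
    using C True by (intro mult_right_mono member_le_sum) (auto intro: less_imp_le)
   finally show ?thesis .
  next
   case False
   hence "coeff p i = 0" using p Pi_poly_iff[OF k] by simp
   thus ?thesis using C by (simp add: sum_nonneg less_imp_le)
  qed
 qed
qed

definition trunc :: "nat => real => real => complex" where
 "trunc k s t = of_real (max 0 (t-s)) ^ (k-1)"

lemma continuous_trunc: "continuous_on S (trunc k s)"
 unfolding trunc_def by (intro continuous_intros)

lemma trunc_Lq: "1 <= q ==> trunc k s \<in> Lq q {a..b}"
 by (intro continuous_on_Lq continuous_trunc)

lemma trunc_left: "2 <= k ==> t <= s ==> trunc k s t = 0"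
 by (simp add: trunc_def)

lemma trunc_right: "s <= t ==> trunc k s t = poly_fun ([:- of_real s, 1:] ^ (k-1)) t"
 by (simp add: trunc_def poly_fun_simps poly_fun_lin)

text \<open>Left of \<open>s\<close> only \<open>p\<close> is present, which bounds its
  coefficients. Right of \<open>s\<close> the sum is a polynomial whose coefficient of order k-1 is
  that of \<open>p\<close> plus \<open>c\<close>.\<close>

lemma trunc_coeff_bound:
 assumes k: "2 <= k"
 shows "\<exists>C>0. \<forall>p\<in>Pi_poly k. \<forall>c D. mn 1 (s-1) (s+1) (\<lambda>t. poly_fun p t+c * trunc k s t) <= D -->
  (\<forall>i. cmod (coeff p i) <= C * D) \<and> cmod c <= C * D"
proof -
 have k1: "1 <= k" using k by simp
 obtain C1 where C1: "C1 > 0" "\<forall>p\<in>Pi_poly k. \<forall>i. cmod (coeff p i) <= C1 * mn 1 (s-1) s (poly_fun p)"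
  using poly_coeff_bound[OF k1, of "s-1" s] by auto
 obtain C2 where C2: "C2 > 0" "\<forall>p\<in>Pi_poly k. \<forall>i. cmod (coeff p i) <= C2 * mn 1 s (s+1) (poly_fun p)"
  using poly_coeff_bound[OF k1, of s "s+1"] by auto
 show ?thesis
 proof (intro exI[of _ "2 * C1+2 * C2"] conjI ballI allI impI)
  show "0 < 2 * C1+2 * C2" using C1 C2 by simp
  fix p c D assume p: "p \<in> Pi_poly k" and D: "mn 1 (s-1) (s+1) (\<lambda>t. poly_fun p t+c * trunc k s t) <= D"
  let ?h = "\<lambda>t. poly_fun p t+c * trunc k s t"
  have h: "?h \<in> Lq 1 {s-1..s+1}" by (intro Lq_add(1) Lq_cmult(1) trunc_Lq poly_fun_Lq) simp_all
  have D0: "0 <= D" using D mn_nonneg[of 1 "s-1" "s+1" ?h] by linarith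
  have "mn 1 (s-1) s (poly_fun p) = mn 1 (s-1) s ?h" by (rule mn_cong) (simp add: trunc_left[OF k])
  also have "... <= 2 * mn 1 (s-1) (s+1) ?h" by (rule mn_mono(2)[OF _ h]) simp_all
  finally have l: "mn 1 (s-1) s (poly_fun p) <= 2 * D" using D by simp
  have 1: "cmod (coeff p i) <= 2 * C1 * D" for i
   using order_trans[OF C1(2)[rule_format, OF p] mult_left_mono[OF l]] C1(1) by (simp add: mult_ac)
  let ?r = "p+smult c ([:- of_real s, 1:] ^ (k-1))"
  have r: "?r \<in> Pi_poly k" using Pi_poly_lin_power[of "- of_real s" "k-1"] k1 by (intro Pi_poly_add Pi_poly_smult p) simp
  have "mn 1 s (s+1) (poly_fun ?r) = mn 1 s (s+1) ?h" by (rule mn_cong) (simp add: trunc_right poly_fun_simps)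
  also have "... <= 2 * mn 1 (s-1) (s+1) ?h" by (rule mn_mono(2)[OF _ h]) simp_all
  finally have rr: "mn 1 s (s+1) (poly_fun ?r) <= 2 * D" using D by simp
  have 2: "cmod (coeff ?r (k-1)) <= 2 * C2 * D"
   using order_trans[OF C2(2)[rule_format, OF r] mult_left_mono[OF rr]] C2(1) by (simp add: mult_ac)
  have "coeff ?r (k-1) = coeff p (k-1)+c"
   by (simp only: coeff_add coeff_smult coeff_linear_power mult_1_right)
  hence e: "coeff ?r (k-1)-coeff p (k-1) = c" by (simp only: add_diff_cancel_left')
  have "cmod c <= cmod (coeff ?r (k-1))+cmod (coeff p (k-1))"
   using norm_triangle_ineq4[of "coeff ?r (k-1)" "coeff p (k-1)"] unfolding e .
  thus "cmod c <= (2 * C1+2 * C2) * D" using 2 1[of "k-1"] by (simp add: algebra_simps)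
  show "cmod (coeff p i) <= (2 * C1+2 * C2) * D" for i
   using 1[of i] mult_nonneg_nonneg[of "2 * C2" D] D0 C2(1) unfolding distrib_right by linarith
 qed
qed

context multilevel begin

lemma ell_norm_tail:
 fixes b :: "int \<times> int => complex"
 assumes b: "(\<lambda>p. cmod (b p) powr \<tau>) summable_on UNIV" and \<tau>: "0 < \<tau>"
 shows "((\<lambda>F. ell_norm \<tau> (\<lambda>p. cmod (restr (- F) b p))) \<longlongrightarrow> 0) (finite_subsets_at_top UNIV)"
proof -
 let ?s = "\<lambda>p. cmod (b p) powr \<tau>"
 have "((\<lambda>F. infsum ?s UNIV-sum ?s F) \<longlongrightarrow> infsum ?s UNIV-infsum ?s UNIV) (finite_subsets_at_top UNIV)"
  by (intro tendsto_diff tendsto_const infsum_tendsto b)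
 hence t0: "((\<lambda>F. infsum ?s UNIV-sum ?s F) \<longlongrightarrow> 0) (finite_subsets_at_top UNIV)" by simp
 have ge: "\<forall>\<^sub>F F in finite_subsets_at_top UNIV. 0 <= infsum ?s UNIV-sum ?s F"
  by (intro eventually_finite_subsets_at_top_weakI) (use sum_le_infsum[OF b] in simp)
 have "((\<lambda>F. (infsum ?s UNIV-sum ?s F) powr (1/\<tau>)) \<longlongrightarrow> 0 powr (1/\<tau>)) (finite_subsets_at_top UNIV)"
  by (rule tendsto_powr'[OF t0 tendsto_const]) (use \<tau> ge in auto)
 hence lim: "((\<lambda>F. (infsum ?s UNIV-sum ?s F) powr (1/\<tau>)) \<longlongrightarrow> 0) (finite_subsets_at_top UNIV)" by simp
 have eq: "ell_norm \<tau> (\<lambda>p. cmod (restr (- F) b p)) = (infsum ?s UNIV-sum ?s F) powr (1/\<tau>)" if F: "finite F" for F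
 proof -
  have "infsum ?s UNIV = (\<Sum>\<^sub>\<infinity>p. cmod (restr F b p) powr \<tau>+cmod (restr (- F) b p) powr \<tau>)"
   by (rule infsum_cong) (simp add: restr_def)
  also have "... = (\<Sum>\<^sub>\<infinity>p. cmod (restr F b p) powr \<tau>)+(\<Sum>\<^sub>\<infinity>p. cmod (restr (- F) b p) powr \<tau>)"
   by (intro infsum_add restr_summable b)
  also have "(\<Sum>\<^sub>\<infinity>p. cmod (restr F b p) powr \<tau>) = infsum ?s F"
   by (rule infsum_cong_neutral) (auto simp: restr_def)
  finally show ?thesis using F by (simp add: ell_norm_def)
 qed
 show ?thesis
  by (rule Lim_transform_eventually[OF lim]) (intro eventually_finite_subsets_at_top_weakI, simp add: eq)
qed

lemma len_sum: "a <= b ==> (\<Sum>l\<in>{a..<b}. len x m l) = x m b-x m a"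
proof (induction b rule: int_ge_induct)
 case (step i)
 have "{a..<i+1} = insert i {a..<i}" using step(1) by auto
 thus ?case using step by (simp add: len_def)
qed simp

lemma cover_split:
 assumes uv: "x m a <= u" "u < v" "v <= x m b" and h: "\<And>c d. h \<in> Lq 1 {c..d}"
 shows "(v-u) * mn 1 u v h <= (\<Sum>l\<in>{a..<b}. len x m l * mnI 1 m l h)"
proof -
 have "(v-u) * mn 1 u v h = Lq_norm 1 {u..v} h" using Lq_norm_mn[of u v 1 h] uv(2) by simp
 also have "... <= Lq_norm 1 {x m a..x m b} h" by (rule Lq_subset(2)[OF _ h]) (use uv in auto)
 also have "... <= (\<Sum>l\<in>{a..<b}. Lq_norm 1 {x m l..x m (l+1)} h)" using Lq_split[OF knots[of m] _ h, where a=a and b=b] by simp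
 also have "... = (\<Sum>l\<in>{a..<b}. len x m l * mnI 1 m l h)"
  by (intro sum.cong refl) (simp add: Lq_norm_mn x_less_iff x_le_iff len_def abs_of_nonneg)
 finally show ?thesis .
qed

text \<open>The N spare intervals on either side, still within distance 1, are for estimates that
  involve neighbouring intervals.\<close>

lemma fine_cover:
 assumes m: "real (N+1)*(lam * mesh x m) <= 1" and uv: "u < v"
 obtains a b where "a < b" "x m a <= u" "v <= x m b" "u-1 <= x m (a-int N)" "x m (b+int N) <= v+1"
proof -
 obtain a where a: "x m a <= u" "u < x m (a+1)" by (rule x_cover)
 obtain b where b: "x m b <= v" "v < x m (b+1)" by (rule x_cover)
 show ?thesis
 proof (rule that[of a "b+1"])
  have "x m a < x m (b+1)" using a b uv by linarith
  thus "a < b+1" by (simp only: x_less_iff)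
  have "x m (a+1)-real (N+1)*(lam * mesh x m) <= x m (a+1-int (N+1))" by (rule x_shift_bounds(2))
  thus "u-1 <= x m (a-int N)" using a m by simp
  have "x m (b+int (N+1)) <= x m b+real (N+1)*(lam * mesh x m)" by (rule x_shift_bounds(1))
  thus "x m (b+1+int N) <= v+1" using b m by (simp add: algebra_simps)
 qed (use a b in auto)
qed

lemma sum_phi_C0:
 assumes k: "2 <= k" and F: "finite F"
 shows "(\<lambda>t. \<Sum>(m, j)\<in>F. b (m, j) * phi x k m j t) \<in> C0"
proof -
 define R where "R = (\<Sum>(m, j)\<in>F. \<bar>x m j\<bar>+\<bar>x m (j+int k)\<bar>)"
 have z: "phi x k m j t = 0" if "(m, j) \<in> F" "R < \<bar>t\<bar>" for m j t
 proof -
  have "(case (m, j) of (m, j) => \<bar>x m j\<bar>+\<bar>x m (j+int k)\<bar>) <= R"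
   unfolding R_def by (rule member_le_sum[OF that(1)]) (use F in auto)
  hence "t < x m j \<or> x m (j+int k) <= t" using that(2) x_le_iff[of m j "j+int k"] by auto
  thus ?thesis using k by (intro phi_eq_0) auto
 qed
 have "(\<Sum>(m, j)\<in>F. b (m, j) * phi x k m j t) = 0" if "R < \<bar>t\<bar>" for t
  by (rule sum.neutral) (use z that in auto)
 moreover have "continuous_on UNIV (\<lambda>t. \<Sum>(m, j)\<in>F. b (m, j) * phi x k m j t)"
  unfolding case_prod_beta by (intro continuous_intros phi_continuous k)
 ultimately show ?thesis unfolding C0_def by blast
qed

text \<open>Complete levels minus a finite partial sum form a spline sum with the coefficients
  outside \<open>F\<close>, so the oscillation is governed by the tail of the l^\<tau> norm.\<close>

lemma partial_sum_osc:
 assumes k: "2 <= k" and \<tau>: "0 < \<tau>" and b: "(\<lambda>p. cmod (b p) powr \<tau>) summable_on UNIV"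
  and F: "finite F" "fst ` F \<subseteq> NN" "finite NN" and uv: "u < v"
 shows "\<exists>e. mn 1 u v (\<lambda>t. (\<Sum>m\<in>NN. lev x k b m t)-(\<Sum>(m, j)\<in>F. b (m, j) * phi x k m j t)-e)
  <= bmo_const k \<tau> * ell_norm \<tau> (\<lambda>p. cmod (restr (- F) b p))"
proof -
 let ?r = "restr (- F) b"
 have k0: "0 < k" using k by simp
 have eq: "(\<Sum>m\<in>NN. lev x k b m t)-(\<Sum>(m, j)\<in>F. b (m, j) * phi x k m j t) = (\<Sum>m\<in>NN. lev x k ?r m t)" for t
 proof -
  have "lev x k (restr F b) m t = 0" if "m \<notin> fst ` F" for m
   unfolding lev_def using that by (intro infsum_0) (force simp: restr_def)
  hence "(\<Sum>(m, j)\<in>F. b (m, j) * phi x k m j t) = (\<Sum>m\<in>NN. lev x k (restr F b) m t)"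
   unfolding sum_phi_lev[OF F(1)] by (intro sum.mono_neutral_left F) auto
  hence "(\<Sum>m\<in>NN. lev x k b m t)-(\<Sum>(m, j)\<in>F. b (m, j) * phi x k m j t) =
   (\<Sum>m\<in>NN. lev x k (\<lambda>p. b p-restr F b p) m t)" by (simp add: lev_linear[OF k0] sum_subtractf)
  also have "... = (\<Sum>m\<in>NN. lev x k ?r m t)" by (intro sum.cong refl lev_cong) (simp add: restr_def)
  finally show ?thesis .
 qed
 show ?thesis unfolding eq
  by (intro exI, rule bmo_est[OF k \<tau> F(3) ell_norm_nonneg uv])
    (rule level_norm_le[OF restr_summable[OF b] \<tau>])
qed

text \<open>The hypothesis presents \<open>g\<close> as a limit of level sums plus unknown elements
  of a finite-dimensional space. Control of the oscillation makes their coefficients Cauchy except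
  for the constant terms, which BMO ignores. The lemma serves functions with summable moduli, where
  \<open>c\<close> is 0, and functions with summable coefficients, where the truncated power can
  occur.\<close>

lemma synthesis:
 fixes p :: "nat => complex poly" and c :: "nat => complex"
 assumes k: "2 <= k" and \<tau>: "0 < \<tau>" and b: "(\<lambda>p. cmod (b p) powr \<tau>) summable_on UNIV"
  and g: "\<And>u v. g \<in> Lq 1 {u..v}" and p: "\<And>n. p n \<in> Pi_poly k"
  and lim: "\<And>u v. u < v ==> (\<lambda>n. mn 1 u v (\<lambda>t. g t-(\<Sum>m\<in>{- int n<..int n}. lev x k b m t) -
   (poly_fun (p n) t+c n * trunc k s t))) \<longlonglongrightarrow> 0"
 shows "\<exists>c'. ((\<forall>n. c n = 0) --> c' = 0) \<and> Phi_rep x k \<tau> (\<lambda>t. g t-c' * trunc k s t) b"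
proof -
 define S where "S n t = (\<Sum>m\<in>{- int n<..int n}. lev x k b m t)" for n t
 define SF where "SF F t = (\<Sum>(m, j)\<in>F. b (m, j) * phi x k m j t)" for F t
 define B where "B F = bmo_const k \<tau> * ell_norm \<tau> (\<lambda>p. cmod (restr (- F) b p))" for F
 define r where "r n t = g t-S n t-(poly_fun (p n) t+c n * trunc k s t)" for n t
 have k0: "0 < k" and k1: "1 <= k" using k by simp_all
 have const: "(\<lambda>t. d) \<in> Lq 1 {u..v}" for d :: complex and u v by (intro continuous_on_Lq continuous_intros) simp
 have S: "S n \<in> Lq 1 {u..v}" for n u v unfolding S_def by (rule levs_Lq[OF k]) simp
 have SF: "SF F \<in> Lq 1 {u..v}" if "finite F" for F u v
  using sum_phi_C0[OF k that, of b] continuous_on_subset[of UNIV "SF F" "{u..v}"] unfolding SF_def C0_def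
  by (intro continuous_on_Lq) auto
 have pw: "(\<lambda>t. poly_fun (p n) t+c n * trunc k s t) \<in> Lq 1 {u..v}" for n u v
  by (intro Lq_add(1) Lq_cmult(1) trunc_Lq poly_fun_Lq) simp_all
 have r: "r n \<in> Lq 1 {u..v}" for n u v unfolding r_def by (intro Lq_diff(1) g S pw) simp_all
 have rlim: "(\<lambda>n. mn 1 u v (r n)) \<longlonglongrightarrow> 0" if "u < v" for u v unfolding r_def[abs_def] S_def by (rule lim[OF that])
 have osc: "\<exists>e. mn 1 u v (\<lambda>t. S n t-SF F t-e) <= B F" if "finite F" "fst ` F \<subseteq> {- int n<..int n}" "u < v" for F n u v
  unfolding S_def SF_def B_def by (rule partial_sum_osc[OF k \<tau> b that(1,2) _ that(3)]) simp
 have Blim: "(B \<longlongrightarrow> 0) (finite_subsets_at_top UNIV)"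
  unfolding B_def using tendsto_mult_left[OF ell_norm_tail[OF b \<tau>], of "bmo_const k \<tau>"] by simp
 have Bsmall: "\<exists>F. finite F \<and> B F < e" if "0 < e" for e
  using eventually_happens'[OF _ eventually_conj[OF order_tendstoD(2)[OF Blim that] eventually_finite_subsets_at_top_weakI[of UNIV finite]]] by auto
 have levels: "\<exists>N. \<forall>n\<ge>N. fst ` F \<subseteq> {- int n<..int n}" if F: "finite F" for F :: "(int \<times> int) set"
 proof (intro exI allI impI subsetI)
  fix n m assume n: "n \<ge> nat (1+(\<Sum>z\<in>F. \<bar>fst z\<bar>))" and "m \<in> fst ` F"
  then obtain z where z: "z \<in> F" "m = fst z" by blast
  have "\<bar>fst z\<bar> <= (\<Sum>z\<in>F. \<bar>fst z\<bar>)" by (rule member_le_sum[OF z(1)]) (use F in auto)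
  thus "m \<in> {- int n<..int n}" using n z by auto
 qed
 obtain C where C: "C > 0" "\<forall>p\<in>Pi_poly k. \<forall>c D. mn 1 (s-1) (s+1) (\<lambda>t. poly_fun p t+c * trunc k s t) <= D -->
  (\<forall>i. cmod (coeff p i) <= C * D) \<and> cmod c <= C * D"
  using trunc_coeff_bound[OF k, of s] by blast
 \<comment> \<open>For large indices both level sums are close, up to constants, to the same finite
   partial sum. Hence the two corrections differ on \<open>{s-1..s+1}\<close> by nearly a constant,
   and \<open>trunc_coeff_bound\<close> applies to their difference.\<close>
 have close: "\<exists>N. \<forall>n\<ge>N. \<forall>n'\<ge>N. cmod (c n-c n') < e \<and> (\<forall>i\<ge>1. cmod (coeff (p n) i-coeff (p n') i) < e)" if e: "0 < e" for e
 proof -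
  define d where "d = e/(5 * C)"
  have d: "0 < d" and dC: "C*(4 * d) < e" using e C(1) by (simp_all add: d_def field_simps)
  obtain F where F: "finite F" "B F < d" using Bsmall[OF d] by blast
  obtain N1 where N1: "\<forall>n\<ge>N1. fst ` F \<subseteq> {- int n<..int n}" using levels[OF F(1)] by blast
  obtain N2 where N2: "\<forall>n\<ge>N2. mn 1 (s-1) (s+1) (r n) < d"
   using order_tendstoD(2)[OF rlim[of "s-1" "s+1"] d] unfolding eventually_sequentially by auto
  have "cmod (c n-c n') < e \<and> (\<forall>i\<ge>1. cmod (coeff (p n) i-coeff (p n') i) < e)" if n: "max N1 N2 <= n" "max N1 N2 <= n'" for n n'
  proof -
   obtain a where a: "mn 1 (s-1) (s+1) (\<lambda>t. S n t-SF F t-a) <= B F" using osc[OF F(1), of n "s-1" "s+1"] N1 n by auto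
   obtain a' where a': "mn 1 (s-1) (s+1) (\<lambda>t. S n' t-SF F t-a') <= B F" using osc[OF F(1), of n' "s-1" "s+1"] N1 n by auto
   let ?A = "\<lambda>t. S n t-SF F t-a" and ?A' = "\<lambda>t. S n' t-SF F t-a'" and ?P = "p n-p n'-[:a'-a:]"
   have A: "?A \<in> Lq 1 {s-1..s+1}" "?A' \<in> Lq 1 {s-1..s+1}" by (intro Lq_diff(1) S SF[OF F(1)] const; simp)+
   have "mn 1 (s-1) (s+1) (\<lambda>t. poly_fun ?P t+(c n-c n') * trunc k s t) =
    mn 1 (s-1) (s+1) (\<lambda>t. (r n' t-r n t)+(?A' t-?A t))"
    by (rule mn_cong) (simp add: r_def poly_fun_simps poly_fun_const algebra_simps)
   also have "... <= mn 1 (s-1) (s+1) (\<lambda>t. r n' t-r n t)+mn 1 (s-1) (s+1) (\<lambda>t. ?A' t-?A t)"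
    by (intro mn_add Lq_diff(1) r A) simp_all
   also have "... <= (mn 1 (s-1) (s+1) (r n')+mn 1 (s-1) (s+1) (r n))+(mn 1 (s-1) (s+1) ?A'+mn 1 (s-1) (s+1) ?A)"
    by (intro add_mono mn_diff r A) simp_all
   also have "... <= 4 * d"
   proof -
    have "mn 1 (s-1) (s+1) (r n') < d" "mn 1 (s-1) (s+1) (r n) < d" using N2 n by auto
    thus ?thesis using a a' F(2) by linarith
   qed
   finally have "(\<forall>i. cmod (coeff ?P i) <= C*(4 * d)) \<and> cmod (c n-c n') <= C*(4 * d)"
    using C(2) Pi_poly_diff[OF Pi_poly_diff[OF p p] Pi_poly_const[OF k0]] by blast
   hence 1: "cmod (coeff ?P i) <= C*(4 * d)" and 2: "cmod (c n-c n') <= C*(4 * d)" for i by auto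
   have "cmod (coeff (p n) i-coeff (p n') i) < e" if "i \<ge> 1" for i
   proof -
    have "coeff [:a'-a:] i = 0" using that by (simp add: coeff_eq_0)
    thus ?thesis using le_less_trans[OF 1[of i] dC] by simp
   qed
   thus ?thesis using 2 dC by auto
  qed
  thus ?thesis by blast
 qed
 have "Cauchy c" unfolding Cauchy_def dist_norm using close by meson
 then obtain c' where c': "c \<longlonglongrightarrow> c'" using Cauchy_convergent_iff convergent_def by blast
 have "\<forall>i. \<exists>L. 1 <= i --> (\<lambda>n. coeff (p n) i) \<longlonglongrightarrow> L"
 proof
  fix i
  show "\<exists>L. 1 <= i --> (\<lambda>n. coeff (p n) i) \<longlonglongrightarrow> L"
  proof (cases "1 <= i")
   case True
   have "Cauchy (\<lambda>n. coeff (p n) i)" unfolding Cauchy_def dist_norm using close True by meson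
   thus ?thesis using Cauchy_convergent_iff convergent_def by blast
  qed simp
 qed
 then obtain L where L: "\<forall>i. 1 <= i --> (\<lambda>n. coeff (p n) i) \<longlonglongrightarrow> L i" by (rule choice[THEN exE])
 define P where "P = (\<Sum>i\<in>{1..<k}. monom (L i) i)"
 have PPi: "P \<in> Pi_poly k" unfolding P_def
  by (intro Pi_poly_sum) (use k0 in \<open>auto simp: Pi_poly_def intro: le_less_trans[OF degree_monom_le]\<close>)
 have Pf: "poly_fun P t = (\<Sum>i\<in>{1..<k}. L i * of_real t ^ i)" for t
  by (simp add: P_def poly_fun_def poly_sum poly_monom)
 have pf: "poly_fun (p n) t = coeff (p n) 0+(\<Sum>i\<in>{1..<k}. coeff (p n) i * of_real t ^ i)" for n t
 proof -
  have "poly_fun (p n) t = (\<Sum>i\<in>{0..<k}. coeff (p n) i * of_real t ^ i)"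
   unfolding poly_fun_def poly_altdef using p[of n] Pi_poly_iff[OF k1, of "p n"]
   by (intro sum.mono_neutral_left) (auto simp: Pi_poly_def intro: le_degree)
  thus ?thesis using k0 by (simp add: sum.atLeast_Suc_lessThan)
 qed
 \<comment> \<open>The error of replacing the n-th correction by its limit, apart from the constant
   term.\<close>
 define w where "w n t = poly_fun (p n) t+c n * trunc k s t-poly_fun P t-c' * trunc k s t-coeff (p n) 0" for n t
 have w_eq: "w n t = (\<Sum>i\<in>{1..<k}. (coeff (p n) i-L i) * of_real t ^ i)+(c n-c') * trunc k s t" for n t
  by (simp add: w_def pf Pf algebra_simps sum_subtractf)
 have pwr: "(\<lambda>t. complex_of_real t ^ i) \<in> Lq 1 {u..v}" for i u v by (intro continuous_on_Lq continuous_intros) simp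
 have w: "w n \<in> Lq 1 {u..v}" for n u v unfolding w_def
  by (intro Lq_diff(1) pw Lq_cmult(1) trunc_Lq poly_fun_Lq const) simp_all
 have wlim: "(\<lambda>n. mn 1 u v (w n)) \<longlonglongrightarrow> 0" for u v
 proof (rule tendsto_sandwich[OF _ _ tendsto_const])
  let ?b = "\<lambda>n. (\<Sum>i\<in>{1..<k}. cmod (coeff (p n) i-L i) * mn 1 u v (\<lambda>t. of_real t ^ i))+cmod (c n-c') * mn 1 u v (trunc k s)"
  have "mn 1 u v (w n) <= ?b n" for n
  proof -
   have "mn 1 u v (w n) = mn 1 u v (\<lambda>t. (\<Sum>i\<in>{1..<k}. (coeff (p n) i-L i) * of_real t ^ i)+(c n-c') * trunc k s t)"
    by (rule mn_cong) (rule w_eq)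
   also have "... <= mn 1 u v (\<lambda>t. \<Sum>i\<in>{1..<k}. (coeff (p n) i-L i) * of_real t ^ i)+mn 1 u v (\<lambda>t. (c n-c') * trunc k s t)"
    by (intro mn_add Lq_sum(1) Lq_cmult(1) trunc_Lq pwr) simp_all
   also have "mn 1 u v (\<lambda>t. \<Sum>i\<in>{1..<k}. (coeff (p n) i-L i) * of_real t ^ i) <= (\<Sum>i\<in>{1..<k}. mn 1 u v (\<lambda>t. (coeff (p n) i-L i) * of_real t ^ i))"
    by (intro mn_sum Lq_cmult(1) pwr) simp_all
   finally show ?thesis by (simp add: mn_cmult pwr trunc_Lq)
  qed
  thus "\<forall>\<^sub>F n in sequentially. mn 1 u v (w n) <= ?b n" by simp
  have "?b \<longlonglongrightarrow> (\<Sum>i\<in>{1..<k}. cmod (L i-L i) * mn 1 u v (\<lambda>t. of_real t ^ i))+cmod (c'-c') * mn 1 u v (trunc k s)"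
   using L by (intro tendsto_intros c') auto
  thus "?b \<longlonglongrightarrow> 0" by simp
 qed simp
 define G where "G t = g t-c' * trunc k s t-poly_fun P t" for t
 have G: "G \<in> Lq 1 {u..v}" for u v unfolding G_def by (intro Lq_diff(1) g Lq_cmult(1) trunc_Lq poly_fun_Lq) simp_all
 \<comment> \<open>For fixed \<open>F\<close> the means of \<open>r n\<close> and \<open>w n\<close>
   tend to 0, so only the oscillation of the tail remains; the factor 2 is the price of passing to
   the average.\<close>
 have GF: "bmo_norm (\<lambda>t. G t-SF F t) <= ennreal (2 * B F)" if F: "finite F" for F
 proof (rule bmo_norm_leI)
  fix u v :: real assume uv: "u < v"
  let ?h = "\<lambda>t. G t-SF F t"
  have h: "?h \<in> Lq 1 {u..v}" by (intro Lq_diff(1) G SF[OF F]) simp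
  show "mn 1 u v (\<lambda>t. ?h t-Avg u v ?h) <= 2 * B F"
  proof (rule field_le_epsilon)
   fix e :: real assume e: "0 < e"
   obtain N1 where N1: "\<forall>n\<ge>N1. fst ` F \<subseteq> {- int n<..int n}" using levels[OF F] by blast
   have e4: "0 < e/4" using e by simp
   obtain N2 where N2: "\<forall>n\<ge>N2. mn 1 u v (r n) < e/4"
    using order_tendstoD(2)[OF rlim[OF uv] e4] unfolding eventually_sequentially by auto
   obtain N3 where N3: "\<forall>n\<ge>N3. mn 1 u v (w n) < e/4"
    using order_tendstoD(2)[OF wlim e4, of u v] unfolding eventually_sequentially by auto
   define n where "n = N1+N2+N3"
   obtain a where a: "mn 1 u v (\<lambda>t. S n t-SF F t-a) <= B F" using osc[OF F N1[rule_format, of n] uv] by (auto simp: n_def)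
   have "mn 1 u v (\<lambda>t. ?h t-(coeff (p n) 0+a)) = mn 1 u v (\<lambda>t. (r n t+w n t)+(S n t-SF F t-a))"
    by (rule mn_cong) (simp add: G_def r_def w_def)
   also have "... <= mn 1 u v (\<lambda>t. r n t+w n t)+mn 1 u v (\<lambda>t. S n t-SF F t-a)"
    by (intro mn_add Lq_add(1) Lq_diff(1) r w S SF[OF F] const) simp_all
   also have "mn 1 u v (\<lambda>t. r n t+w n t) <= mn 1 u v (r n)+mn 1 u v (w n)" by (intro mn_add r w) simp
   finally have "mn 1 u v (\<lambda>t. ?h t-(coeff (p n) 0+a)) <= mn 1 u v (r n)+mn 1 u v (w n)+B F" using a by simp
   moreover have "mn 1 u v (r n) < e/4" "mn 1 u v (w n) < e/4" using N2 N3 by (auto simp: n_def)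
   ultimately show "mn 1 u v (\<lambda>t. ?h t-Avg u v ?h) <= 2 * B F+e"
    using mn_Avg_le[OF uv h, of "coeff (p n) 0+a"] by linarith
  qed
 qed
 have e1: "\<forall>\<^sub>F F in finite_subsets_at_top UNIV. bmo_norm (\<lambda>t. G t-SF F t) <= ennreal (2 * B F)"
  by (intro eventually_finite_subsets_at_top_weakI GF)
 have e2: "((\<lambda>F. ennreal (2 * B F)) \<longlongrightarrow> 0) (finite_subsets_at_top UNIV)"
  using tendsto_ennrealI[OF tendsto_mult_left[OF Blim, of 2]] by simp
 have e0: "\<forall>\<^sub>F F in finite_subsets_at_top UNIV. 0 <= bmo_norm (\<lambda>t. G t-SF F t)" by simp
 have conv: "((\<lambda>F. bmo_norm (\<lambda>t. G t-SF F t)) \<longlongrightarrow> 0) (finite_subsets_at_top UNIV)"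
  by (rule tendsto_sandwich[OF e0 e1 tendsto_const e2])
 have "G \<in> VMO"
  unfolding VMO_def BMO_def mem_Collect_eq
 proof (intro conjI allI impI)
  show "G absolutely_integrable_on {u..v}" for u v using G Lq1_set_integrable by blast
  have "bmo_norm G <= ennreal (2 * B {})" using GF[of "{}"] by (simp add: SF_def)
  thus "bmo_norm G < \<infinity>" using ennreal_less_top le_less_trans by fastforce
  fix e :: ennreal assume "0 < e"
  then obtain F where F: "finite F" "bmo_norm (\<lambda>t. G t-SF F t) < e"
   using eventually_happens'[OF _ eventually_conj[OF order_tendstoD(2)[OF conv] eventually_finite_subsets_at_top_weakI[of UNIV finite]]] by auto
  have "SF F \<in> C0" unfolding SF_def[abs_def] by (rule sum_phi_C0[OF k F(1)])
  thus "\<exists>h\<in>C0. bmo_norm (\<lambda>t. G t-h t) < e" by (rule bexI[where x="SF F", rotated]) (rule F(2))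
 qed
 hence "Phi_rep x k \<tau> (\<lambda>t. g t-c' * trunc k s t) b"
  unfolding Phi_rep_def
  by (intro conjI bexI[OF _ PPi] b conv[unfolded G_def SF_def]) (simp add: G_def[abs_def])
 moreover have "c' = 0" if "\<forall>n. c n = 0" 
 proof -
  have "c = (\<lambda>n. 0)" using that by auto
  thus ?thesis using LIMSEQ_unique[OF c', of 0] by simp
 qed
 ultimately show ?thesis by blast
qed

end

section \<open>Representation of functions with summable moduli\<close>

lemma LIMSEQ_0_I:
 fixes a :: "nat => real"
 assumes "\<And>n. 0 <= a n" "0 <= K" "\<And>d. 0 < d ==> \<exists>N. \<forall>n\<ge>N. a n <= K * d"
 shows "a \<longlonglongrightarrow> 0"
proof (rule LIMSEQ_I)
 fix e :: real assume "0 < e"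
 hence "0 < e/(K+1)" using assms(2) by simp
 then obtain N where N: "\<forall>n\<ge>N. a n <= K*(e/(K+1))" using assms(3) by blast
 have "K*(e/(K+1)) < e" using \<open>0 < e\<close> assms(2) by (simp add: field_simps)
 thus "\<exists>N. \<forall>n\<ge>N. norm (a n-0) < e" using N assms(1) by (intro exI[of _ N]) (auto intro: le_less_trans)
qed

context multilevel begin

lemma lev_telescope:
 assumes k: "2 <= k" and sel: "\<And>m j. j <= sel m j \<and> sel m j < j+int k"
 shows "(\<Sum>m\<in>{- int n<..int n}. lev x k (bco k sel R) m t) = lev x k (gam k sel R) (int n) t-lev x k (gam k sel R) (- int n) t"
proof (induction n)
 case (Suc n)
 have e: "{- int (Suc n)<..int (Suc n)} = insert (int n+1) (insert (- int n) {- int n<..int n})" by auto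
 have c: "lev x k (gam k sel R) (- 1-int n) t = lev x k (gam k sel R) (- int n-1) t"
  by (rule arg_cong[where f="\<lambda>i. lev x k (gam k sel R) i t"]) simp
 show ?case unfolding e using Suc bco_refines[where sel=sel and R=R and m="int n+1" and t=t, OF k sel]
  bco_refines[where sel=sel and R=R and m="- int n" and t=t, OF k sel] c by (simp add: add.commute)
qed simp

text \<open>The polynomial is good on three consecutive intervals, so that on coarse levels every
  bounded set is eventually inside, wherever the knots lie.\<close>

lemma gam_lev_near_poly:
 fixes m :: int
 assumes k: "2 <= k" and q: "1 <= q" and f: "f \<in> Lq_loc q" and A: "0 <= A" and R: "approximates k q A f R"
  and sel: "\<And>m j. j <= sel m j \<and> sel m j < j+int k" and d: "0 <= d" "\<And>i. E_coef x k q f (m, i) <= d"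
 shows "\<exists>p\<in>Pi_poly k. (\<forall>t\<in>{x m (l-1)..x m (l+2)}. cmod (lev x k (gam k sel R) m t-poly_fun p t) <= gam_const k A * real (2 * k+3) * d) \<and>
  mnI q m l (resid f p) <= Whitney_const k (k+1) * real (2 * k+3) * d"
proof -
 have k1: "1 <= k" using k by simp
 obtain p where p: "\<forall>l. p l \<in> Pi_poly k \<and>
   (\<forall>i\<in>{l-int (k+1)..l+int (k+1)}. mnI q m i (resid f (p l)) <= Whitney_const k (k+1)*(\<Sum>i\<in>{l-int (k+1)..l+int (k+1)}. E_coef x k q f (m, i))) \<and>
   (\<forall>j\<in>{l-int k..l+1}. cmod (gam k sel R (m, j)-dual (x m) k j (p l)) <= gam_const k A*(\<Sum>i\<in>{l-int (k+1)..l+int (k+1)}. E_coef x k q f (m, i)))"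
  using gam_near_poly[where sel=sel and m=m, OF k q f A R sel] by (elim exE)
 note c = spec[OF p, of l]
 let ?S = "\<Sum>i\<in>{l-int (k+1)..l+int (k+1)}. E_coef x k q f (m, i)"
 have "?S <= real (card {l-int (k+1)..l+int (k+1)}) * d" by (rule sum_bounded_above) (rule d(2))
 also have "card {l-int (k+1)..l+int (k+1)} = 2 * k+3" by simp
 finally have S: "?S <= real (2 * k+3) * d" .
 have B: "gam_const k A*?S <= gam_const k A * real (2 * k+3) * d"
  unfolding mult.assoc by (rule mult_left_mono[OF S gam_const_nonneg[OF k1 A]])
 show ?thesis
 proof (intro bexI[of _ "p l"] conjI ballI)
  show "p l \<in> Pi_poly k" by (rule conjunct1[OF c])
  fix t assume t: "t \<in> {x m (l-1)..x m (l+2)}"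
  obtain i where i: "i \<in> {l-1, l, l+1}" "t \<in> {x m i..x m (i+1)}"
  proof (cases "t <= x m l")
   case True thus ?thesis using that[of "l-1"] t by simp
  next
   case False thus ?thesis using that[of l] that[of "l+1"] t by (cases "t <= x m (l+1)") (auto simp: algebra_simps)
  qed
  show "cmod (lev x k (gam k sel R) m t-poly_fun (p l) t) <= gam_const k A * real (2 * k+3) * d"
  proof (rule lev_poly_diff[OF k conjunct1[OF c] i(2)])
   fix j assume "j \<in> {i-int (k-1)..i}"
   hence "j \<in> {l-int k..l+1}" using i(1) k by auto
   thus "cmod (gam k sel R (m, j)-dual (x m) k j (p l)) <= gam_const k A * real (2 * k+3) * d"
    by (rule order_trans[OF conjunct2[OF conjunct2[OF c], THEN bspec] B])
  qed
 next
  have "mnI q m l (resid f (p l)) <= Whitney_const k (k+1)*?S"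
   by (rule conjunct1[OF conjunct2[OF c], THEN bspec]) simp
  also have "... <= Whitney_const k (k+1) * real (2 * k+3) * d"
   unfolding mult.assoc by (rule mult_left_mono[OF S less_imp_le[OF Whitney_const_pos[OF k1]]])
  finally show "mnI q m l (resid f (p l)) <= Whitney_const k (k+1) * real (2 * k+3) * d" .
 qed
qed

text \<open>Checks the hypothesis of \<open>synthesis\<close> without truncated power. As the moduli
  of a level tend uniformly to 0, the quasi-interpolant of level n tends to \<open>f\<close>, and
  that of level -n is on a fixed interval close to one polynomial.\<close>

theorem E_Phi_rep:
 assumes k: "2 <= k" and q: "1 <= q" and \<tau>: "0 < \<tau>" and f: "f \<in> besov_E x k \<tau> q" and A: "0 <= A" and R: "approximates k q A f R"
  and sel: "\<And>m j. j <= sel m j \<and> sel m j < j+int k"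
 shows "Phi_rep x k \<tau> f (bco k sel R)"
proof -
 have fl: "f \<in> Lq_loc q" and Es: "(\<lambda>g. E_coef x k q f g powr \<tau>) summable_on UNIV" using f by (auto simp: besov_E_def)
 have k1: "1 <= k" using k by simp
 have fq: "f \<in> Lq q {u..v}" for u v by (rule Lq_locD[OF fl])
 have f1: "f \<in> Lq 1 {u..v}" for u v by (rule Lq_integrable_norm(1)[OF q fq])
 let ?T = "lev x k (gam k sel R)"
 have Tq: "?T m \<in> Lq q {u..v}" for m u v by (rule lev_Lq[OF k q])
 have T1: "?T m \<in> Lq 1 {u..v}" for m u v by (rule lev_Lq[OF k]) simp
 have t0: "0 <= E_coef x k q f g" for g by (rule E_coef_nonneg[OF q fl])
 define K where "K = (Whitney_const k (k+1)+gam_const k A) * real (2 * k+3)"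
 have K0: "0 <= K" unfolding K_def using gam_const_nonneg[OF k1 A] Whitney_const_pos[OF k1, of "k+1"] by simp
 have gK: "gam_const k A * real (2 * k+3) * d <= K * d" if "0 <= d" for d
  unfolding K_def using that Whitney_const_pos[OF k1, of "k+1"] by (intro mult_right_mono) auto
 have "\<forall>n::nat. \<exists>l. x (- int n) l <= 0 \<and> 0 < x (- int n) (l+1)"
 proof
  fix n :: nat
  obtain l where "x (- int n) l <= 0" "0 < x (- int n) (l+1)" by (rule x_cover)
  thus "\<exists>l. x (- int n) l <= 0 \<and> 0 < x (- int n) (l+1)" by (intro exI[of _ l] conjI)
 qed
 \<comment> \<open>The interval containing 0 together with its two neighbours covers any bounded set
   for large n, even if a knot stays near 0.\<close>
 then obtain l0 where l0: "\<forall>n::nat. x (- int n) (l0 n) <= 0 \<and> 0 < x (- int n) (l0 n+1)" by (rule choice[THEN exE])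
 define good where "good n p d \<longleftrightarrow> (\<forall>t\<in>{x (- int n) (l0 n-1)..x (- int n) (l0 n+2)}. cmod (?T (- int n) t-poly_fun p t) <= K * d)" for n :: nat and p d
 \<comment> \<open>With the supremum as error bound, the polynomials \<open>p n\<close> can be fixed
   before the interval and the tolerance.\<close>
 define sup where "sup n = (SUP i. E_coef x k q f (- int n, i))" for n :: nat
 have Ele: "E_coef x k q f g <= besov_E_norm x k \<tau> q f" for g
 proof -
  have "E_coef x k q f g powr \<tau> <= (\<Sum>\<^sub>\<infinity>g. E_coef x k q f g powr \<tau>)" using sum_le_infsum[OF Es, of "{g}"] by simp
  hence "(E_coef x k q f g powr \<tau>) powr (1/\<tau>) <= besov_E_norm x k \<tau> q f"
   unfolding besov_E_norm_def ell_norm_def using \<tau> by (intro powr_mono2) auto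
  thus ?thesis using t0[of g] \<tau> by (simp add: powr_powr)
 qed
 have sup: "E_coef x k q f (- int n, i) <= sup n" for n i
  unfolding sup_def by (rule cSUP_upper) (auto intro!: bdd_aboveI Ele)
 have sup0: "0 <= sup n" for n using order_trans[OF t0 sup] .
 have "\<forall>n. \<exists>p. p \<in> Pi_poly k \<and> good n p (sup n)"
 proof
  fix n
  obtain p where p: "p \<in> Pi_poly k" "\<forall>t\<in>{x (- int n) (l0 n-1)..x (- int n) (l0 n+2)}. cmod (?T (- int n) t-poly_fun p t) <= gam_const k A * real (2 * k+3) * sup n"
   using gam_lev_near_poly[where sel=sel and m="- int n" and l="l0 n", OF k q fl A R sel sup0 sup] by (elim bexE conjE)
  show "\<exists>p. p \<in> Pi_poly k \<and> good n p (sup n)" unfolding good_def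
   by (intro exI[of _ p] conjI ballI p(1)) (rule order_trans[OF p(2)[rule_format] gK[OF sup0]])
 qed
 then obtain p where p: "\<forall>n. p n \<in> Pi_poly k \<and> good n (p n) (sup n)" by (rule choice[THEN exE])
 have pPi: "p n \<in> Pi_poly k" for n using p by blast
 have "\<exists>c'. ((\<forall>n::nat. (0::complex) = 0) --> c' = 0) \<and> Phi_rep x k \<tau> (\<lambda>t. f t-c' * trunc k 0 t) (bco k sel R)"
 proof (rule synthesis[where p=p and c="\<lambda>_::nat. 0", OF k \<tau> E_bco(1)[where sel=sel, OF k q \<tau> f A R sel] f1 pPi])
  fix u v :: real assume uv: "u < v"
  have "(\<lambda>n. mn 1 u v (\<lambda>t. (f t-?T (int n) t)+(?T (- int n) t-poly_fun (p n) t))) \<longlonglongrightarrow> 0"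
  proof (rule LIMSEQ_0_I[where K="K*((v-u+2)/(v-u))+K"])
   show "0 <= K*((v-u+2)/(v-u))+K" using K0 uv by simp
   fix d :: real assume d: "0 < d"
   obtain N1 :: nat where N1: "\<forall>m i. int N1 <= \<bar>m\<bar> --> E_coef x k q f (m, i) < d"
    using summable_levels_small[OF Es t0 \<tau> d] by blast
   obtain N2 where N2: "0 <= N2" "\<forall>n\<ge>N2. mesh x n < 1/lam" using mesh_small[of "1/lam"] lam by auto
   obtain N3 where N3: "0 <= N3" "\<forall>n\<ge>N3. lam*(\<bar>u\<bar>+\<bar>v\<bar>) < mesh x (- n)" using mesh_large by blast
   have "mn 1 u v (\<lambda>t. (f t-?T (int n) t)+(?T (- int n) t-poly_fun (p n) t)) <= (K*((v-u+2)/(v-u))+K) * d"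
    if n: "n \<ge> N1+nat N2+nat N3" for n
   proof -
    have nn: "int n \<ge> int N1" "int n \<ge> N2" "int n \<ge> N3" using n N2(1) N3(1) by auto
    have Ed: "E_coef x k q f (int n, i) <= d" "E_coef x k q f (- int n, i) <= d" for i using N1 nn by (auto intro: less_imp_le)
    have "mesh x (int n) < 1/lam" using N2 nn by blast
    hence "real (0+1)*(lam * mesh x (int n)) <= 1" using lam by (simp add: field_simps)
    then obtain a b where ab: "a < b" "x (int n) a <= u" "v <= x (int n) b" "u-1 <= x (int n) (a-int 0)" "x (int n) (b+int 0) <= v+1"
     by (rule fine_cover[OF _ uv])
    let ?h = "\<lambda>t. f t-?T (int n) t"
    have h1: "?h \<in> Lq 1 {u..v}" for u v by (intro Lq_diff(1) f1 T1) simp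
    have hl: "mnI 1 (int n) l ?h <= K * d" for l
    proof -
     let ?a = "x (int n) l" and ?b = "x (int n) (l+1)"
     have lt: "?a < ?b" by (simp add: x_less_iff)
     obtain r where r: "r \<in> Pi_poly k" "\<forall>t\<in>{x (int n) (l-1)..x (int n) (l+2)}. cmod (?T (int n) t-poly_fun r t) <= gam_const k A * real (2 * k+3) * d"
      "mn q ?a ?b (resid f r) <= Whitney_const k (k+1) * real (2 * k+3) * d"
      using gam_lev_near_poly[where sel=sel and m="int n" and l=l, OF k q fl A R sel less_imp_le[OF d] Ed(1)] by (elim bexE conjE)
     have sub: "{?a..?b} \<subseteq> {x (int n) (l-1)..x (int n) (l+2)}" by (auto simp: x_le_iff intro: order_trans)
     have "mn 1 ?a ?b ?h <= mn q ?a ?b ?h" by (rule Lq_integrable_norm(2)[OF q Lq_diff(1)[OF q fq Tq] lt])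
     also have "... = mn q ?a ?b (\<lambda>t. (f t-poly_fun r t)-(?T (int n) t-poly_fun r t))" by simp
     also have "... <= mn q ?a ?b (resid f r)+mn q ?a ?b (\<lambda>t. ?T (int n) t-poly_fun r t)"
      by (intro mn_diff Lq_diff(1) fq Tq poly_fun_Lq q)
     also have "mn q ?a ?b (\<lambda>t. ?T (int n) t-poly_fun r t) <= gam_const k A * real (2 * k+3) * d"
      by (rule mn_cont_bounded[OF q lt]) (use r(2) sub in \<open>auto intro!: continuous_intros lev_continuous k continuous_on_poly_fun\<close>)
     finally show ?thesis using r(3) unfolding K_def by (simp add: algebra_simps)
    qed
    have "(v-u) * mn 1 u v ?h <= (\<Sum>l\<in>{a..<b}. len x (int n) l * mnI 1 (int n) l ?h)"
     by (rule cover_split[OF ab(2) uv ab(3) h1])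
    also have "... <= (\<Sum>l\<in>{a..<b}. len x (int n) l*(K * d))"
     by (intro sum_mono mult_left_mono hl less_imp_le[OF len_pos])
    also have "... = (x (int n) b-x (int n) a)*(K * d)" using len_sum[of a b "int n"] ab(1) by (simp add: sum_distrib_right[symmetric])
    also have "... <= (v-u+2)*(K * d)" using ab(4,5) K0 d by (intro mult_right_mono) auto
    finally have 1: "mn 1 u v ?h <= K*((v-u+2)/(v-u)) * d" using uv by (simp add: field_simps)
    have 2: "mn 1 u v (\<lambda>t. ?T (- int n) t-poly_fun (p n) t) <= K * d"
    proof (rule mn_cont_bounded)
     fix t assume t: "t \<in> {u..v}"
     let ?l = "l0 n"
     have "lam*(\<bar>u\<bar>+\<bar>v\<bar>) < mesh x (- int n)" using N3 nn by blast
     hence M: "\<bar>u\<bar>+\<bar>v\<bar> <= mesh x (- int n)/lam" using lam by (simp add: field_simps)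
     have "x (- int n) (?l-1) <= x (- int n) ?l-mesh x (- int n)/lam"
      using mesh_le_len'[of "- int n" "?l-1"] by (simp add: len_def)
     moreover have "x (- int n) (?l+1)+mesh x (- int n)/lam <= x (- int n) (?l+2)"
      using mesh_le_len'[of "- int n" "?l+1"] by (simp add: len_def add.commute)
     ultimately have "t \<in> {x (- int n) (?l-1)..x (- int n) (?l+2)}" using t M l0[rule_format, of n] by auto
     hence "cmod (?T (- int n) t-poly_fun (p n) t) <= K * sup n" by (rule bspec[OF conjunct2[OF spec[OF p, of n], unfolded good_def]])
     also have "... <= K * d" using K0 Ed(2) unfolding sup_def by (intro mult_left_mono cSUP_least) auto
     finally show "cmod (?T (- int n) t-poly_fun (p n) t) <= K * d" .
    qed (use uv in \<open>auto intro!: continuous_intros lev_continuous k continuous_on_poly_fun\<close>)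
    have "mn 1 u v (\<lambda>t. (f t-?T (int n) t)+(?T (- int n) t-poly_fun (p n) t)) <= mn 1 u v ?h+mn 1 u v (\<lambda>t. ?T (- int n) t-poly_fun (p n) t)"
     by (intro mn_add h1 Lq_diff(1) T1 poly_fun_Lq) simp_all
    thus ?thesis using 1 2 by (simp add: algebra_simps)
   qed
   thus "\<exists>N. \<forall>n\<ge>N. mn 1 u v (\<lambda>t. (f t-?T (int n) t)+(?T (- int n) t-poly_fun (p n) t)) <= (K*((v-u+2)/(v-u))+K) * d" by blast
  qed simp
  thus "(\<lambda>n. mn 1 u v (\<lambda>t. f t-(\<Sum>m\<in>{- int n<..int n}. lev x k (bco k sel R) m t)-(poly_fun (p n) t+0 * trunc k 0 t))) \<longlonglongrightarrow> 0"
   unfolding lev_telescope[where sel=sel, OF k sel] by (simp add: algebra_simps)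
 qed
 thus ?thesis by simp
qed

lemma Whitney_approximates:
 assumes k: "2 <= k" and q: "1 <= q" and f: "f \<in> Lq_loc q"
 obtains R where "approximates k q (Whitney_const k 0) f R"
proof -
 have "\<forall>m. \<exists>p. \<forall>j. p j \<in> Pi_poly k \<and> mnI q m j (resid f (p j)) <= Whitney_const k 0 * E_coef x k q f (m, j)"
 proof
  fix m
  obtain p where "\<forall>j. p j \<in> Pi_poly k \<and> (\<forall>i\<in>{j-int 0..j+int 0}.
    mnI q m i (resid f (p j)) <= Whitney_const k 0*(\<Sum>l\<in>{j-int 0..j+int 0}. E_coef x k q f (m, l)))"
   using Whitney_chain[where m=m and N=0, OF k q f] by (elim exE)
  thus "\<exists>p. \<forall>j. p j \<in> Pi_poly k \<and> mnI q m j (resid f (p j)) <= Whitney_const k 0 * E_coef x k q f (m, j)"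
   by (intro exI[of _ p]) simp
 qed
 then obtain R where "\<forall>m j. R m j \<in> Pi_poly k \<and> mnI q m j (resid f (R m j)) <= Whitney_const k 0 * E_coef x k q f (m, j)"
  by (rule choice[THEN exE])
 thus ?thesis by (intro that) (simp add: approximates_def)
qed

theorem Phi_eq_E:
 assumes k: "2 <= k" and q: "1 <= q" and \<tau>: "0 < \<tau>"
 shows "besov_Phi x k \<tau> = besov_E x k \<tau> q"
  "f \<in> besov_E x k \<tau> q ==> besov_Phi_norm x k \<tau> f <= E_bco_const k (Whitney_const k 0) \<tau> * besov_E_norm x k \<tau> q f"
  "f \<in> besov_E x k \<tau> q ==> besov_E_norm x k \<tau> q f <= PhiE_const k q \<tau> * besov_Phi_norm x k \<tau> f"
proof -
 have k1: "1 <= k" using k by simp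
 have W0: "0 <= Whitney_const k 0" using Whitney_const_pos[OF k1, of 0] by simp
 \<comment> \<open>The selection is free here; the first interval of each support is taken.\<close>
 have sel: "j <= (\<lambda>m j. j) m j \<and> (\<lambda>m j. j) m j < j+int k" for m j :: int using k by simp
 have rep: "\<exists>a. Phi_rep x k \<tau> f a \<and> ell_norm \<tau> (\<lambda>i. cmod (a i)) <= E_bco_const k (Whitney_const k 0) \<tau> * besov_E_norm x k \<tau> q f"
  if f: "f \<in> besov_E x k \<tau> q" for f
 proof -
  have "f \<in> Lq_loc q" using f by (simp add: besov_E_def)
  then obtain R where R: "approximates k q (Whitney_const k 0) f R" by (rule Whitney_approximates[OF k q])
  show ?thesis by (intro exI[of _ "bco k (\<lambda>m j. j) R"] conjI
   E_Phi_rep[where sel="\<lambda>m j. j", OF k q \<tau> f W0 R sel] E_bco(2)[where sel="\<lambda>m j. j", OF k q \<tau> f W0 R sel])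
 qed
 show "besov_Phi x k \<tau> = besov_E x k \<tau> q"
  unfolding besov_Phi_def using rep Phi_to_E(1)[OF k q \<tau>] by blast
 assume f: "f \<in> besov_E x k \<tau> q"
 obtain a where a: "Phi_rep x k \<tau> f a" "ell_norm \<tau> (\<lambda>i. cmod (a i)) <= E_bco_const k (Whitney_const k 0) \<tau> * besov_E_norm x k \<tau> q f"
  using rep[OF f] by blast
 have "besov_Phi_norm x k \<tau> f <= ell_norm \<tau> (\<lambda>i. cmod (a i))"
  unfolding besov_Phi_norm_def by (rule cINF_lower) (use a in \<open>auto intro!: bdd_belowI2[of _ 0] ell_norm_nonneg\<close>)
 thus "besov_Phi_norm x k \<tau> f <= E_bco_const k (Whitney_const k 0) \<tau> * besov_E_norm x k \<tau> q f" using a(2) by simp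
 let ?C = "PhiE_const k q \<tau>"
 have C0: "0 <= ?C" by (simp add: PhiE_const_def)
 have le: "besov_E_norm x k \<tau> q f <= ?C * ell_norm \<tau> (\<lambda>i. cmod (a i))" if "Phi_rep x k \<tau> f a" for a
  by (rule Phi_to_E(2)[OF k q \<tau> that])
 show "besov_E_norm x k \<tau> q f <= ?C * besov_Phi_norm x k \<tau> f"
 proof (cases "?C = 0")
  case True thus ?thesis using le[OF a(1)] by simp
 next
  case False
  hence C: "0 < ?C" using C0 by simp
  have "besov_E_norm x k \<tau> q f/?C <= besov_Phi_norm x k \<tau> f"
   unfolding besov_Phi_norm_def by (rule cINF_greatest) (use a(1) le C in \<open>auto simp: divide_le_eq mult.commute\<close>)
  thus ?thesis using C by (simp add: divide_le_eq mult.commute)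
 qed
qed

end

section \<open>Quasi-interpolants of locally integrable functions\<close>

text \<open>Replaces a mean by its q-th power, since the q-th powers, weighted by lengths, are
  additive over intervals. If the powers add up to order d^q, both terms contribute order d.\<close>

lemma le_Young:
 fixes y d :: real
 assumes "1 <= q" "0 <= y" "0 < d"
 shows "y <= d+d powr (1-q) * y powr q"
proof (cases "y <= d")
 case False
 hence y: "0 < y" "d <= y" using assms by auto
 have "y = y powr (1-q) * y powr q" using y by (simp add: powr_add[symmetric])
 also have "... <= d powr (1-q) * y powr q" using y assms by (intro mult_right_mono powr_mono2') auto
 finally show ?thesis using assms by simp
qed (use assms in \<open>simp add: add_increasing2\<close>)

lemma ell_norm_mono:
 fixes s t :: "int \<times> int => real"
 assumes t: "(\<lambda>g. t g powr \<tau>) summable_on UNIV" and st: "\<And>g. 0 <= s g" "\<And>g. s g <= C * t g" "\<And>g. 0 <= t g" and C: "0 <= C" and \<tau>: "0 < \<tau>"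
 shows "(\<lambda>g. s g powr \<tau>) summable_on UNIV" "ell_norm \<tau> s <= C * ell_norm \<tau> t"
proof -
 have le: "s g powr \<tau> <= C powr \<tau> * t g powr \<tau>" for g
  using powr_mono2[OF less_imp_le[OF \<tau>] st(1) st(2), of g] by (simp add: powr_mult)
 have Ct: "(\<lambda>g. C powr \<tau> * t g powr \<tau>) summable_on UNIV" by (rule summable_on_cmult_right[OF t])
 show s: "(\<lambda>g. s g powr \<tau>) summable_on UNIV" by (rule summable_on_comparison_test[OF Ct]) (use le in auto)
 have "(\<Sum>\<^sub>\<infinity>g. s g powr \<tau>) <= C powr \<tau>*(\<Sum>\<^sub>\<infinity>g. t g powr \<tau>)"
  using infsum_mono[OF s Ct le] by (simp add: infsum_cmult_right')
 hence "ell_norm \<tau> s <= (C powr \<tau>*(\<Sum>\<^sub>\<infinity>g. t g powr \<tau>)) powr (1/\<tau>)"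
  unfolding ell_norm_def using \<tau> by (intro powr_mono2) (auto intro: infsum_nonneg)
 also have "... = C * ell_norm \<tau> t" using C \<tau> by (simp add: powr_mult powr_powr ell_norm_def)
 finally show "ell_norm \<tau> s <= C * ell_norm \<tau> t" .
qed

context multilevel begin

text \<open>A point lies in at most 2N+2 of the enlarged intervals.\<close>

lemma sum_overlap:
 assumes q: "1 <= q" and f: "f \<in> Lq q {u..v}" and A: "finite A"
  and sub: "\<And>l. l \<in> A ==> u <= x m (l-int N) \<and> x m (l+int N+1) <= v"
 shows "(\<Sum>l\<in>A. Lq_norm q {x m (l-int N)..x m (l+int N+1)} f powr q) <= real (2 * N+2) * Lq_norm q {u..v} f powr q"
proof -
 let ?J = "\<lambda>l. {x m (l-int N)..x m (l+int N+1)}"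
 let ?g = "\<lambda>l t. cmod (cut (?J l) f t) powr q" and ?G = "\<lambda>t. cmod (cut {u..v} f t) powr q"
 have fl: "f \<in> Lq q (?J l)" if "l \<in> A" for l
  by (rule Lq_subset(1)[OF q f]) (use sub[OF that] in auto)
 have pw: "(\<Sum>l\<in>A. ?g l t) <= real (2 * N+2)*?G t" for t
 proof -
  obtain i where i: "x m i <= t" "t < x m (i+1)" by (rule x_cover)
  let ?B = "{i-int N-1..i+int N}"
  have z: "?g l t = 0" if "l \<notin> ?B" for l
  proof -
   have "t \<notin> ?J l"
   proof
    assume "t \<in> ?J l"
    hence "x m (l-int N) < x m (i+1)" "x m i <= x m (l+int N+1)" using i by auto
    thus False using that by (simp add: x_less_iff x_le_iff)
   qed
   thus ?thesis by simp
  qed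
  have le: "?g l t <= ?G t" if "l \<in> A" for l
  proof (cases "t \<in> ?J l")
   case True
   hence "t \<in> {u..v}" using sub[OF that] by auto
   thus ?thesis using True by simp
  qed simp
  have "(\<Sum>l\<in>A. ?g l t) = (\<Sum>l\<in>A \<inter> ?B. ?g l t)" by (rule sum.mono_neutral_right) (use A z in auto)
  also have "... <= real (card (A \<inter> ?B))*?G t" by (rule sum_bounded_above) (use le in auto)
  also have "... <= real (2 * N+2)*?G t"
  proof (rule mult_right_mono)
   have "card (A \<inter> ?B) <= card ?B" by (rule card_mono) auto
   thus "real (card (A \<inter> ?B)) <= real (2 * N+2)" by simp
  qed simp
  finally show ?thesis .
 qed
 have "(\<Sum>l\<in>A. Lq_norm q (?J l) f powr q) = (LINT t|lebesgue. (\<Sum>l\<in>A. ?g l t))"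
  unfolding Lq_norm_powr[OF q] by (intro Bochner_Integration.integral_sum[symmetric] Lq_integrable fl)
 also have "... <= (LINT t|lebesgue. real (2 * N+2)*?G t)"
  by (intro integral_mono pw Bochner_Integration.integrable_sum integrable_mult_right Lq_integrable f fl)
 also have "... = real (2 * N+2) * Lq_norm q {u..v} f powr q" unfolding Lq_norm_powr[OF q] by simp
 finally show ?thesis .
qed

text \<open>In contrast to \<open>approximates\<close>, the error is compared with that of other
  polynomials on the same interval instead of a modulus.\<close>

definition near_best :: "nat => real => real => (real => complex) => (int => int => complex poly) => bool" where
 "near_best k q A f R \<longleftrightarrow> (\<forall>m i. R m i \<in> Pi_poly k \<and>
   (\<forall>p\<in>Pi_poly k. mnI q m i (resid f (R m i)) <= A * mnI q m i (resid f p)))"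

definition "loc_const k A = (1+dual_const k*(A+1))*(real (2 * k+1) * lam\<^sup>2)"

text \<open>Because constants are reproduced, the error is controlled by the near-best property on
  the intervals selected by the B-splines active on interval l, all within distance k of l.\<close>

lemma quasi_interp_local:
 assumes k: "2 <= k" and q: "1 <= q" and f: "f \<in> Lq_loc q" and A: "0 <= A" and R: "near_best k q A f R"
  and sel: "\<And>m j. j <= sel m j \<and> sel m j < j+int k"
 shows "mnI q m l (\<lambda>t. f t-lev x k (gam k sel R) m t) <=
  loc_const k A * mn q (x m (l-int k)) (x m (l+int k+1)) (\<lambda>t. f t-c)"
proof -
 have k1: "1 <= k" and k0: "0 < k" using k by simp_all
 let ?p = "[:c:]" and ?K = "real (2 * k+1) * lam\<^sup>2" and ?Y = "mn q (x m (l-int k)) (x m (l+int k+1)) (\<lambda>t. f t-c)"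
 have p: "?p \<in> Pi_poly k" by (rule Pi_poly_const[OF k0])
 have fp: "(resid f r) \<in> Lq q {u..v}" for r u v by (intro Lq_diff(1) q Lq_locD f poly_fun_Lq)
 have Y: "mnI q m i (resid f ?p) <= ?K*?Y" if i: "i \<in> {l-int k..l+int k}" for i
 proof -
  have "x m (l+int k+1)-x m (l-int k) <= real (2 * k+1)*(lam * mesh x m)"
   using x_diff_bounds(1)[of "l-int k" "l+int k+1" m] by (simp add: algebra_simps)
  also have "... <= real (2 * k+1)*(lam*(lam * len x m i))"
   using lam mesh_le_len[of m i] by (intro mult_left_mono) auto
  finally have K: "x m (l+int k+1)-x m (l-int k) <= ?K*(x m (i+1)-x m i)"
   by (simp add: len_def power2_eq_square mult.assoc)
  have "mnI q m i (resid f ?p) <= ?K * mn q (x m (l-int k)) (x m (l+int k+1)) (resid f ?p)"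
   by (rule mn_mono(2)[OF q fp _ _ _ K]) (use i in \<open>auto simp: x_le_iff x_less_iff\<close>)
  thus ?thesis by (simp add: poly_fun_const)
 qed
 have g: "cmod (gam k sel R (m, j)-dual (x m) k j ?p) <= dual_const k*(A+1)*(?K*?Y)" if j: "j \<in> {l-int (k-1)..l}" for j
 proof -
  let ?s = "sel m j"
  have s: "?s \<in> {l-int k..l+int k}" using sel[of j m] j by auto
  have Rs: "R m ?s \<in> Pi_poly k" and nb: "mnI q m ?s (resid f (R m ?s)) <= A * mnI q m ?s (resid f ?p)"
   using R p unfolding near_best_def by blast+
  have "cmod (gam k sel R (m, j)-dual (x m) k j ?p) <= dual_const k *
   (mnI q m ?s (resid f (R m ?s))+mnI q m ?s (resid f ?p))"
   by (rule gam_diff_poly[where sel=sel and R=R and m=m and j=j, OF k sel Rs p f q])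
  also have "... <= dual_const k*(A*(?K*?Y)+?K*?Y)"
   using dual_const_pos[OF k1] by (intro mult_left_mono add_mono order_trans[OF nb] Y[OF s] A) auto
  finally show ?thesis by (simp add: algebra_simps)
 qed
 have lt: "x m l < x m (l+1)" by (simp add: x_less_iff)
 have T: "lev x k (gam k sel R) m \<in> Lq q {u..v}" for u v by (rule lev_Lq[OF k q])
 have "mnI q m l (\<lambda>t. f t-lev x k (gam k sel R) m t) =
  mnI q m l (\<lambda>t. (f t-poly_fun ?p t)-(lev x k (gam k sel R) m t-poly_fun ?p t))" by simp
 also have "... <= mnI q m l (resid f ?p)+mnI q m l (\<lambda>t. lev x k (gam k sel R) m t-poly_fun ?p t)"
  by (intro mn_diff fp Lq_diff(1) T poly_fun_Lq q)
 also have "... <= ?K*?Y+dual_const k*(A+1)*(?K*?Y)"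
 proof (rule add_mono)
  show "mnI q m l (resid f ?p) <= ?K*?Y" by (rule Y) simp
  show "mnI q m l (\<lambda>t. lev x k (gam k sel R) m t-poly_fun ?p t) <= dual_const k*(A+1)*(?K*?Y)"
  proof (rule mn_cont_bounded[OF q lt])
   show "continuous_on {x m l..x m (l+1)} (\<lambda>t. lev x k (gam k sel R) m t-poly_fun ?p t)"
    by (intro continuous_intros lev_continuous k continuous_on_poly_fun)
   show "cmod (lev x k (gam k sel R) m t-poly_fun ?p t) <= dual_const k*(A+1)*(?K*?Y)" if "t \<in> {x m l..x m (l+1)}" for t
    by (rule lev_poly_diff[OF k p that g])
  qed
 qed
 also have "... = loc_const k A*?Y" by (simp add: loc_const_def algebra_simps)
 finally show ?thesis .
qed

text \<open>No decay of moduli is assumed, so a density argument is used. A continuous function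
  close to \<open>f\<close> in L^q is almost constant on short intervals; the local estimate with
  that constant is summed by means of \<open>le_Young\<close> and
  \<open>sum_overlap\<close>.\<close>

lemma quasi_interp_conv:
 assumes k: "2 <= k" and q: "1 <= q" and f: "f \<in> Lq_loc q" and A: "0 <= A" and R: "near_best k q A f R"
  and sel: "\<And>m j. j <= sel m j \<and> sel m j < j+int k" and uv: "u < v"
 shows "(\<lambda>n. mn 1 u v (\<lambda>t. f t-lev x k (gam k sel R) (int n) t)) \<longlonglongrightarrow> 0"
proof -
 let ?C = "loc_const k A" and ?L = "v-u+2"
 have k1: "1 <= k" using k by simp
 have C0: "0 <= ?C" unfolding loc_const_def using A lam dual_const_pos[OF k1] by (intro mult_nonneg_nonneg add_nonneg_nonneg) auto
 have fq: "f \<in> Lq q {a..b}" for a b by (rule Lq_locD[OF f])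
 let ?T = "lev x k (gam k sel R)"
 show ?thesis
 proof (rule LIMSEQ_0_I[where K="?C*(2*?L+real (2 * k+2))/(v-u)"])
  show "0 <= ?C*(2*?L+real (2 * k+2))/(v-u)" using C0 uv by simp
  fix d :: real assume d: "0 < d"
  have uv1: "u-1 < v+1" using uv by simp
  have e0: "0 < d/?L powr (1/q)" using d uv by simp
  obtain g where g: "continuous_on UNIV g" "mn q (u-1) (v+1) (\<lambda>t. f t-g t) < d/?L powr (1/q)"
   using Lq_continuous_dense[OF q uv1 fq e0] by blast
  have gq: "g \<in> Lq q {a..b}" for a b by (intro continuous_on_Lq q continuous_on_subset[OF g(1)]) simp
  have fg: "(\<lambda>t. f t-g t) \<in> Lq q {a..b}" for a b by (intro Lq_diff(1) q fq gq)
  have "Lq_norm q {u-1..v+1} (\<lambda>t. f t-g t) = ?L powr (1/q) * mn q (u-1) (v+1) (\<lambda>t. f t-g t)"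
   using Lq_norm_mn[OF uv1 q] by (simp add: add.commute)
  also have "... <= ?L powr (1/q)*(d/?L powr (1/q))" using g(2) by (intro mult_left_mono) auto
  also have "... = d" using uv by simp
  finally have nfg: "Lq_norm q {u-1..v+1} (\<lambda>t. f t-g t) powr q <= d powr q" using q by (intro powr_mono2) auto
  have "uniformly_continuous_on {u-1..v+1} g"
   by (intro compact_uniformly_continuous continuous_on_subset[OF g(1)]) auto
  then obtain \<eta> where \<eta>: "0 < \<eta>" "\<forall>s\<in>{u-1..v+1}. \<forall>t\<in>{u-1..v+1}. dist t s < \<eta> --> dist (g t) (g s) < d"
   unfolding uniformly_continuous_on_def using d by blast
  \<comment> \<open>The 2k+1 intervals entering one local estimate then have total length below
    \<eta> and stay within distance 1 of \<open>{u..v}\<close>.\<close>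
  define \<mu> where "\<mu> = min 1 \<eta>/(real (2 * k+2) * lam)"
  have \<mu>: "0 < \<mu>" unfolding \<mu>_def using \<eta>(1) lam by simp
  obtain N where N: "0 <= N" "\<forall>n\<ge>N. mesh x n < \<mu>" using mesh_small[OF \<mu>] by blast
  have "mn 1 u v (\<lambda>t. f t-?T (int n) t) <= ?C*(2*?L+real (2 * k+2))/(v-u) * d" if n: "nat N <= n" for n
  proof -
   have "mesh x (int n) < \<mu>" using N n by (simp add: nat_le_iff)
   moreover have "0 < real (2 * k+2) * lam" using lam by simp
   ultimately have "mesh x (int n)*(real (2 * k+2) * lam) < min 1 \<eta>" unfolding \<mu>_def by (simp only: pos_less_divide_eq)
   hence ms: "real (2 * k+2)*(lam * mesh x (int n)) < min 1 \<eta>" by (simp only: mult_ac)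
   have pos: "0 < lam * mesh x (int n)" using lam mesh_pos[of "int n"] by simp
   have m1: "real (k+1)*(lam * mesh x (int n)) <= 1"
   proof -
    have "real (k+1)*(lam * mesh x (int n)) <= real (2 * k+2)*(lam * mesh x (int n))" using pos by (intro mult_right_mono) auto
    thus ?thesis using ms by simp
   qed
   have m2: "real (2 * k+1)*(lam * mesh x (int n)) < \<eta>"
   proof -
    have "real (2 * k+1)*(lam * mesh x (int n)) <= real (2 * k+2)*(lam * mesh x (int n))" using pos by (intro mult_right_mono) auto
    thus ?thesis using ms by simp
   qed
   obtain a b where ab: "a < b" "x (int n) a <= u" "v <= x (int n) b" "u-1 <= x (int n) (a-int k)" "x (int n) (b+int k) <= v+1"
    by (rule fine_cover[OF m1 uv])
   let ?I = "\<lambda>l. x (int n) (l-int k)" and ?I' = "\<lambda>l. x (int n) (l+int k+1)"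
   have sub: "u-1 <= ?I l \<and> ?I' l <= v+1" if l: "l \<in> {a..<b}" for l
   proof -
    have "x (int n) (a-int k) <= ?I l" "?I' l <= x (int n) (b+int k)" using l by (auto simp: x_le_iff)
    thus ?thesis using ab by linarith
   qed
   define y where "y l = mn q (?I l) (?I' l) (\<lambda>t. f t-g t)" for l
   have ylen: "len x (int n) l * y l powr q <= Lq_norm q {?I l..?I' l} (\<lambda>t. f t-g t) powr q" for l
   proof -
    have lt: "?I l < ?I' l" by (simp add: x_less_iff)
    have "Lq_norm q {?I l..?I' l} (\<lambda>t. f t-g t) powr q = (?I' l-?I l) * y l powr q"
     unfolding Lq_norm_mn[OF lt q] y_def using lt q by (simp add: powr_mult powr_powr)
    moreover have "len x (int n) l <= ?I' l-?I l"
    proof -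
     have "?I l <= x (int n) l" "x (int n) (l+1) <= ?I' l" by (simp_all add: x_le_iff)
     thus ?thesis by (simp add: len_def)
    qed
    ultimately show ?thesis by (simp add: mult_right_mono)
   qed
   have loc: "mnI 1 (int n) l (\<lambda>t. f t-?T (int n) t) <= ?C*(2 * d+d powr (1-q) * y l powr q)" if l: "l \<in> {a..<b}" for l
   proof -
    let ?c = "g (x (int n) l)"
    have lt: "?I l < ?I' l" and lt1: "x (int n) l < x (int n) (l+1)" by (simp_all add: x_less_iff)
    have "mnI 1 (int n) l (\<lambda>t. f t-?T (int n) t) <= mnI q (int n) l (\<lambda>t. f t-?T (int n) t)"
     by (intro Lq_integrable_norm(2)[OF q _ lt1] Lq_diff(1) q fq lev_Lq k)
    also have "... <= ?C * mn q (?I l) (?I' l) (\<lambda>t. f t-?c)"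
     by (rule quasi_interp_local[where sel=sel, OF k q f A R sel])
    also have "mn q (?I l) (?I' l) (\<lambda>t. f t-?c) = mn q (?I l) (?I' l) (\<lambda>t. (f t-g t)+(g t-?c))" by simp
    also have "... <= y l+mn q (?I l) (?I' l) (\<lambda>t. g t-?c)"
     unfolding y_def by (intro mn_add fg q Lq_diff(1) gq continuous_on_Lq continuous_intros)
    also have "mn q (?I l) (?I' l) (\<lambda>t. g t-?c) <= d"
    proof (rule mn_cont_bounded[OF q lt])
     show "continuous_on {?I l..?I' l} (\<lambda>t. g t-?c)" by (intro continuous_intros continuous_on_subset[OF g(1)]) simp
     fix t assume t: "t \<in> {?I l..?I' l}"
     have xl: "x (int n) l \<in> {?I l..?I' l}" by (simp add: x_le_iff)
     have "?I' l-?I l <= real (2 * k+1)*(lam * mesh x (int n))"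
      using x_diff_bounds(1)[of "l-int k" "l+int k+1" "int n"] by (simp add: algebra_simps)
     hence "dist t (x (int n) l) < \<eta>" using t xl m2 by (auto simp: dist_real_def)
     hence "dist (g t) ?c < d" using \<eta>(2) t xl sub[OF l] by auto
     thus "cmod (g t-?c) <= d" by (simp add: dist_norm)
    qed
    finally have "mnI 1 (int n) l (\<lambda>t. f t-?T (int n) t) <= ?C*(y l+d)" using C0 by (simp add: mult_left_mono)
    also have "... <= ?C*(2 * d+d powr (1-q) * y l powr q)"
     using le_Young[OF q _ d, of "y l"] C0 by (intro mult_left_mono) (auto simp: y_def)
    finally show ?thesis .
   qed
   have f1: "(\<lambda>t. f t-?T (int n) t) \<in> Lq 1 {a..b}" for a b
    by (rule Lq_integrable_norm(1)[OF q]) (intro Lq_diff(1) q fq lev_Lq k)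
   have "(v-u) * mn 1 u v (\<lambda>t. f t-?T (int n) t) <= (\<Sum>l\<in>{a..<b}. len x (int n) l * mnI 1 (int n) l (\<lambda>t. f t-?T (int n) t))"
    by (rule cover_split[OF ab(2) uv ab(3) f1])
   also have "... <= (\<Sum>l\<in>{a..<b}. ?C*(2 * d) * len x (int n) l+?C * d powr (1-q) * Lq_norm q {?I l..?I' l} (\<lambda>t. f t-g t) powr q)"
   proof (rule sum_mono)
    fix l assume l: "l \<in> {a..<b}"
    have "len x (int n) l * mnI 1 (int n) l (\<lambda>t. f t-?T (int n) t) <= len x (int n) l*(?C*(2 * d+d powr (1-q) * y l powr q))"
     by (intro mult_left_mono loc l less_imp_le[OF len_pos])
    also have "... = ?C*(2 * d) * len x (int n) l+?C * d powr (1-q)*(len x (int n) l * y l powr q)" by (simp add: algebra_simps)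
    also have "... <= ?C*(2 * d) * len x (int n) l+?C * d powr (1-q) * Lq_norm q {?I l..?I' l} (\<lambda>t. f t-g t) powr q"
     by (intro add_left_mono mult_left_mono ylen) (use C0 in simp)
    finally show "len x (int n) l * mnI 1 (int n) l (\<lambda>t. f t-?T (int n) t) <=
     ?C*(2 * d) * len x (int n) l+?C * d powr (1-q) * Lq_norm q {?I l..?I' l} (\<lambda>t. f t-g t) powr q" .
   qed
   also have "... = ?C*(2 * d)*(x (int n) b-x (int n) a)+?C * d powr (1-q)*(\<Sum>l\<in>{a..<b}. Lq_norm q {?I l..?I' l} (\<lambda>t. f t-g t) powr q)"
    using len_sum[of a b "int n"] ab(1) by (simp add: sum.distrib sum_distrib_left[symmetric])
   also have "... <= ?C*(2 * d)*?L+?C * d powr (1-q)*(real (2 * k+2) * d powr q)"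
   proof (intro add_mono mult_left_mono)
    show "x (int n) b-x (int n) a <= ?L"
     using ab x_le_iff[of "int n" "a-int k" a] x_le_iff[of "int n" b "b+int k"] by auto
    have "(\<Sum>l\<in>{a..<b}. Lq_norm q {?I l..?I' l} (\<lambda>t. f t-g t) powr q) <= real (2 * k+2) * Lq_norm q {u-1..v+1} (\<lambda>t. f t-g t) powr q"
     by (rule sum_overlap[OF q fg _ sub]) simp
    also have "... <= real (2 * k+2) * d powr q" using nfg by (intro mult_left_mono) auto
    finally show "(\<Sum>l\<in>{a..<b}. Lq_norm q {?I l..?I' l} (\<lambda>t. f t-g t) powr q) <= real (2 * k+2) * d powr q" .
   qed (use C0 d in auto)
   also have "?C * d powr (1-q)*(real (2 * k+2) * d powr q) = ?C * real (2 * k+2)*(d powr (1-q) * d powr q)" by (simp add: mult_ac)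
   also have "d powr (1-q) * d powr q = d" using d by (simp add: powr_add[symmetric])
   finally show ?thesis using uv by (simp add: pos_le_divide_eq algebra_simps)
  qed
  thus "\<exists>N. \<forall>n\<ge>N. mn 1 u v (\<lambda>t. f t-?T (int n) t) <= ?C*(2*?L+real (2 * k+2))/(v-u) * d" by blast
 qed simp
qed

text \<open>On a fixed compact interval a spline of a sufficiently coarse level has at most one knot,
 and only if that knot is common to all levels.\<close>

lemma coarse_spline:
 assumes k: "2 <= k"
 shows "\<exists>s p c. (\<forall>n. p n \<in> Pi_poly k) \<and>
  (\<forall>u v. \<exists>N. \<forall>n\<ge>N. \<forall>t\<in>{u..v}. lev x k a (- int n) t = poly_fun (p n) t+c n * trunc k s t) \<and>
  ((\<Inter>m. range (x m)) = {} --> (\<forall>n. c n = 0)) \<and> ((\<forall>n. c n = 0) \<or> (\<forall>m. s \<in> range (x m)))"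
proof -
 have "0 < k" using k by simp
 then obtain K where K: "k = Suc K" using gr0_conv_Suc by blast
 let ?P = "\<lambda>n. cpiece (x (- int n)) k (\<lambda>j. a (- int n, j))"
 have PPi: "?P n l \<in> Pi_poly k" for n l unfolding K by (rule cpiece_Pi)
 show ?thesis
 proof (cases "(\<Inter>m. range (x m)) = {}")
  case True
  have "\<forall>n::nat. \<exists>l. x (- int n) l <= 0 \<and> 0 < x (- int n) (l+1)"
  proof
   fix n :: nat
   obtain l where "x (- int n) l <= 0" "0 < x (- int n) (l+1)" by (rule x_cover)
   thus "\<exists>l. x (- int n) l <= 0 \<and> 0 < x (- int n) (l+1)" by (intro exI[of _ l] conjI)
  qed
  then obtain l0 where l0: "\<forall>n::nat. x (- int n) (l0 n) <= 0 \<and> 0 < x (- int n) (l0 n+1)" by (rule choice[THEN exE])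
  have far: "\<exists>N. \<forall>n\<ge>N. \<forall>t\<in>{u..v}. lev x k a (- int n) t = poly_fun (?P n (l0 n)) t" for u v
  proof -
   let ?w = "\<bar>u\<bar>+\<bar>v\<bar>"
   let ?D = "x 0 ` {j. - ?w <= x 0 j \<and> x 0 j <= ?w}"
   have fin: "finite ?D" by (intro finite_imageI knot_count(1))
   \<comment> \<open>Each knot of level 0 is missing from some coarser level, and then from all
     coarser ones by nestedness. Finitely many of them lie in the window, so beyond some level the
     window contains no knot at all.\<close>
   have "\<forall>y. \<exists>N. y \<in> range (x 0) --> y \<notin> range (x (- int N))"
   proof
    fix y
    show "\<exists>N. y \<in> range (x 0) --> y \<notin> range (x (- int N))"
    proof (cases "y \<in> range (x 0)")
     case yr: True
     obtain m where m: "y \<notin> range (x m)" using True by blast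
     hence "m < 0" using knots_nested[of 0 m] yr by (cases "m < 0") auto
     hence "m = - int (nat (- m))" by simp
     thus ?thesis using m by (intro exI[of _ "nat (- m)"]) simp
    qed simp
   qed
   then obtain N where N: "\<forall>y. y \<in> range (x 0) --> y \<notin> range (x (- int (N y)))" by (rule choice[THEN exE])
   have "lev x k a (- int n) t = poly_fun (?P n (l0 n)) t" if n: "n \<ge> (\<Sum>y\<in>?D. N y)" and t: "t \<in> {u..v}" for n t
   proof -
    have no: "\<not> (- ?w <= x (- int n) j \<and> x (- int n) j <= ?w)" for j
    proof
     assume j: "- ?w <= x (- int n) j \<and> x (- int n) j <= ?w"
     have "x (- int n) j \<in> range (x 0)" using knots_nested[of "- int n" 0] by auto
     then obtain i where i: "x (- int n) j = x 0 i" by auto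
     hence D: "x 0 i \<in> ?D" using j by auto
     have "N (x 0 i) <= (\<Sum>y\<in>?D. N y)" by (rule member_le_sum[OF D _ fin]) simp
     hence "range (x (- int n)) \<subseteq> range (x (- int (N (x 0 i))))" using n by (intro knots_nested) simp
     thus False using N i rangeI[of "x (- int n)" j] by auto
    qed
    have "x (- int n) (l0 n) < - ?w" "?w < x (- int n) (l0 n+1)"
     using no[of "l0 n"] no[of "l0 n+1"] l0[rule_format, of n] by (auto simp: not_le)
    thus ?thesis by (intro lev_cpiece_closed[OF k]) (use t in auto)
   qed
   thus ?thesis by blast
  qed
  show ?thesis
   by (intro exI[of _ 0] exI[of _ "\<lambda>n. ?P n (l0 n)"] exI[of _ "\<lambda>_. 0"]) (use PPi far in simp)
 next
  case False
  then obtain s where s: "\<forall>m. s \<in> range (x m)" by blast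
  \<comment> \<open>On coarse levels the two intervals adjacent to the common knot \<open>s\<close>
    cover the window, and the jump between their polynomials is the multiple of the truncated
    power.\<close>
  have "\<forall>n::nat. \<exists>i. x (- int n) i = s" using s by (metis rangeE)
  then obtain i where i: "\<forall>n::nat. x (- int n) (i n) = s" by (rule choice[THEN exE])
  have "\<forall>n. \<exists>c. ?P n (i n)-?P n (i n-1) = smult c ([:- complex_of_real s, 1:] ^ (k-1))"
  proof
   fix n
   have "spline (x (- int n)) k (?P n)" unfolding K by (rule spline_cpiece[OF knots])
   thus "\<exists>c. ?P n (i n)-?P n (i n-1) = smult c ([:- complex_of_real s, 1:] ^ (k-1))"
    using i[rule_format, of n] unfolding spline_def by metis
  qed
  then obtain c where c: "\<forall>n. ?P n (i n)-?P n (i n-1) = smult (c n) ([:- complex_of_real s, 1:] ^ (k-1))"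
   by (rule choice[THEN exE])
  have far: "\<exists>N. \<forall>n\<ge>N. \<forall>t\<in>{u..v}. lev x k a (- int n) t = poly_fun (?P n (i n-1)) t+c n * trunc k s t" for u v
  proof -
   obtain N where N: "0 <= N" "\<forall>n\<ge>N. lam*(\<bar>u\<bar>+\<bar>v\<bar>+\<bar>s\<bar>) < mesh x (- n)" using mesh_large by blast
   have "lev x k a (- int n) t = poly_fun (?P n (i n-1)) t+c n * trunc k s t" if n: "n \<ge> nat N" and t: "t \<in> {u..v}" for n t
   proof -
    have "lam*(\<bar>u\<bar>+\<bar>v\<bar>+\<bar>s\<bar>) < mesh x (- int n)" using N n by (simp add: nat_le_iff)
    hence M: "\<bar>u\<bar>+\<bar>v\<bar>+\<bar>s\<bar> <= mesh x (- int n)/lam" using lam by (simp add: field_simps)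
    have xi: "x (- int n) (i n) = s" using i by blast
    show ?thesis
    proof (cases "t <= s")
     case True
     have "x (- int n) (i n-1)+mesh x (- int n)/lam <= s"
      using mesh_le_len'[of "- int n" "i n-1"] xi by (simp add: len_def)
     hence "t \<in> {x (- int n) (i n-1)..x (- int n) (i n-1+1)}" using t True M xi by auto
     thus ?thesis using trunc_left[OF k True] by (simp add: lev_cpiece_closed[OF k])
    next
     case False
     have "s+mesh x (- int n)/lam <= x (- int n) (i n+1)"
      using mesh_le_len'[of "- int n" "i n"] xi by (simp add: len_def)
     hence "t \<in> {x (- int n) (i n)..x (- int n) (i n+1)}" using t False M xi by auto
     hence "lev x k a (- int n) t = poly_fun (?P n (i n)) t" by (rule lev_cpiece_closed[OF k])
     also have "?P n (i n) = ?P n (i n-1)+smult (c n) ([:- complex_of_real s, 1:] ^ (k-1))"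
      using c[rule_format, of n] by (simp add: algebra_simps)
     finally show ?thesis using False trunc_right[of s t k] by (simp add: poly_fun_simps)
    qed
   qed
   thus ?thesis by blast
  qed
  show ?thesis
   by (intro exI[of _ s] exI[of _ "\<lambda>n. ?P n (i n-1)"] exI[of _ c]) (use PPi far s False in simp)
 qed
qed

end

section \<open>Projectors and the coefficients of the quasi-interpolants\<close>

lemma near_best_projectorsD:
 assumes P: "near_best_projectors k q A P" and ab: "a < b" and f: "f \<in> Lq q {a..b}"
 shows "P a b f \<in> Pi_poly k"
  "\<And>g. g \<in> Lq q {a..b} ==> (AE t\<in>{a..b} in lebesgue. f t = g t) ==> P a b f = P a b g"
  "\<And>g. g \<in> Lq q {a..b} ==> P a b (\<lambda>t. f t+g t) = P a b f+P a b g"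
  "\<And>R. R \<in> Pi_poly k ==> P a b (poly_fun R) = R"
  "Lq_norm q {a..b} (resid f (P a b f)) <= A * E_k k q a b f"
proof -
 note c = P[unfolded near_best_projectors_def, THEN spec, THEN spec, THEN mp, OF ab]
 note c2 = conjunct2[OF c]
 note c3 = conjunct2[OF c2]
 note c5 = conjunct2[OF conjunct2[OF c3]]
 show "P a b f \<in> Pi_poly k" by (rule bspec[OF conjunct1[OF c] f])
 show "P a b f = P a b g" if "g \<in> Lq q {a..b}" "AE t\<in>{a..b} in lebesgue. f t = g t" for g
  by (rule mp[OF bspec[OF bspec[OF conjunct1[OF c2] f] that(1)] that(2)])
 show "P a b (\<lambda>t. f t+g t) = P a b f+P a b g" if "g \<in> Lq q {a..b}" for g
  by (rule bspec[OF bspec[OF conjunct1[OF c3] f] that])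
 show "P a b (poly_fun R) = R" if "R \<in> Pi_poly k" for R by (rule bspec[OF conjunct1[OF c5] that])
 show "Lq_norm q {a..b} (resid f (P a b f)) <= A * E_k k q a b f" by (rule bspec[OF conjunct2[OF c5] f])
qed

context multilevel begin

lemma x_lt: "x m i < x m (i+1)" by (simp add: x_less_iff)

definition locproj :: "projectors => (real => complex) => int => int => complex poly" where
 "locproj P f m i = P (x m i) (x m (i+1)) f"

definition bq :: "nat => projectors => (int => int => int) => (real => complex) => int \<times> int => complex" where
 "bq k P l f = bco k l (locproj P f)"

lemma locproj_Pi: "near_best_projectors k q A P ==> f \<in> Lq_loc q ==> locproj P f m i \<in> Pi_poly k"
 unfolding locproj_def by (rule near_best_projectorsD(1)[OF _ x_lt Lq_locD])

lemma locproj_add: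
 assumes "near_best_projectors k q A P" "f \<in> Lq_loc q" "h \<in> Lq_loc q"
 shows "locproj P (\<lambda>t. f t+h t) m i = locproj P f m i+locproj P h m i"
 unfolding locproj_def by (rule near_best_projectorsD(3)[OF assms(1) x_lt Lq_locD[OF assms(2)] Lq_locD[OF assms(3)]])

lemma locproj_near_best:
 assumes P: "near_best_projectors k q A P" and f: "f \<in> Lq_loc q" and q: "1 <= q" and A: "0 <= A"
 shows "near_best k q A f (locproj P f)"
 unfolding near_best_def
proof (intro allI conjI ballI)
 fix m i
 show "locproj P f m i \<in> Pi_poly k" by (rule locproj_Pi[OF P f])
 fix p assume p: "p \<in> Pi_poly k"
 let ?a = "x m i" and ?b = "x m (i+1)"
 have "Lq_norm q {?a..?b} (resid f (locproj P f m i)) <= A * E_k k q ?a ?b f"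
  unfolding locproj_def by (rule near_best_projectorsD(5)[OF P x_lt Lq_locD[OF f]])
 also have "E_k k q ?a ?b f <= Lq_norm q {?a..?b} (resid f p)"
  unfolding E_k_def by (rule cINF_lower[OF _ p]) (auto intro!: bdd_belowI2[of _ 0])
 finally have *: "Lq_norm q {?a..?b} (resid f (locproj P f m i)) <= A * Lq_norm q {?a..?b} (resid f p)"
  using A by (simp add: mult_left_mono)
 show "mn q ?a ?b (resid f (locproj P f m i)) <= A * mn q ?a ?b (resid f p)"
  unfolding mn_def using mult_left_mono[OF *, of "(?b-?a) powr (- 1/q)"] by (simp add: mult_ac)
qed

lemma locproj_approximates:
 assumes P: "near_best_projectors k q A P" and f: "f \<in> Lq_loc q" and q: "1 <= q" and A: "0 <= A" and k: "2 <= k"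
 shows "approximates k q (A * Whitney_const k 0) f (locproj P f)"
proof -
 obtain R where R: "approximates k q (Whitney_const k 0) f R" by (rule Whitney_approximates[OF k q f])
 show ?thesis unfolding approximates_def
 proof (intro allI conjI)
  fix m i
  show "locproj P f m i \<in> Pi_poly k" by (rule locproj_Pi[OF P f])
  have Rm: "R m i \<in> Pi_poly k" and Rb: "mnI q m i (resid f (R m i)) <= Whitney_const k 0 * E_coef x k q f (m, i)"
   using R unfolding approximates_def by auto
  have "mnI q m i (resid f (locproj P f m i)) <= A * mnI q m i (resid f (R m i))"
   using locproj_near_best[OF P f q A] Rm unfolding near_best_def by blast
  also have "... <= A*(Whitney_const k 0 * E_coef x k q f (m, i))" by (rule mult_left_mono[OF Rb A])
  finally show "mnI q m i (resid f (locproj P f m i)) <= A * Whitney_const k 0 * E_coef x k q f (m, i)"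
   by (simp add: mult.assoc)
 qed
qed

lemma valid_sel: "valid_choice x k l \<xi> ==> j <= l m j \<and> l m j < j+int k"
 unfolding valid_choice_def by blast

text \<open>\<open>beta\<close> is the pairing evaluated at \<xi>, and \<open>dual\<close> is the
  same constant evaluated at 0.\<close>

lemma T_op_lev:
 assumes k: "2 <= k" and P: "near_best_projectors k q A P" and f: "f \<in> Lq_loc q"
 shows "T_op x k P l \<xi> m f t = lev x k (gam k l (locproj P f)) m t"
proof -
 obtain n where n: "k = Suc n" using k by (metis Suc_le_D numeral_2_eq_2)
 have "beta x k l \<xi> m j (piecewise_proj x P m f) = gam k l (locproj P f) (m, j)" for j
 proof -
  let ?p = "locproj P f m (l m j)"
  have "dual (x m) k j ?p = poly (pairing k (dual_poly (x m) k j) ?p) (of_real (\<xi> m j))"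
   unfolding n by (rule dual_eval) (use locproj_Pi[OF P f] n in simp)
  thus ?thesis
   by (simp add: beta_def gam_def pairing_def piecewise_proj_def locproj_def varpi_def dual_poly_def poly_sum poly_fun_def mult.assoc)
 qed
 thus ?thesis unfolding T_op_def lev_def by simp
qed

text \<open>Existence is \<open>bco_refines\<close>; uniqueness is the linear independence of the
  B-splines of one level, read off by the dual functionals.\<close>

lemma b_coef_bq:
 assumes k: "2 <= k" and P: "near_best_projectors k q A P" and f: "f \<in> Lq_loc q" and v: "valid_choice x k l \<xi>"
 shows "b_coef x k P l \<xi> f m j = bq k P l f (m, j)"
proof -
 have k0: "0 < k" using k by simp
 have "b_coef x k P l \<xi> f m = (\<lambda>j. bq k P l f (m, j))"
  unfolding b_coef_def T_op_lev[OF k P f]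
 proof (rule the_equality)
  show "\<forall>t. lev x k (gam k l (locproj P f)) m t-lev x k (gam k l (locproj P f)) (m-1) t = (\<Sum>\<^sub>\<infinity>j. bq k P l f (m, j) * phi x k m j t)"
   using bco_refines[where sel=l and R="locproj P f" and m=m, OF k valid_sel[OF v]] by (simp add: bq_def lev_def)
  fix b assume b: "\<forall>t. lev x k (gam k l (locproj P f)) m t-lev x k (gam k l (locproj P f)) (m-1) t = (\<Sum>\<^sub>\<infinity>j. b j * phi x k m j t)"
  have "lev x k (\<lambda>(m, j). b j) m t = lev x k (bq k P l f) m t" for t
   using b bco_refines[where sel=l and R="locproj P f" and m=m and t=t, OF k valid_sel[OF v]] by (simp add: bq_def lev_def)
  hence "(\<lambda>(m, j). b j) (m, j) = bq k P l f (m, j)" for j by (rule lev_eq_imp_coeffs_eq[OF k0])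
  thus "b = (\<lambda>j. bq k P l f (m, j))" by auto
 qed
 thus ?thesis by simp
qed

definition "phi_const k = dual_const k*(real k * lam\<^sup>2)"

lemma phi_const_nonneg: "1 <= k ==> 0 <= phi_const k"
 unfolding phi_const_def using dual_const_pos[of k] by simp

text \<open>The lower bound comes from duality: the dual functional takes the value 1 on its
  B-spline and is bounded by the mean over the first interval of the support.\<close>

lemma mn_phi:
 assumes k: "2 <= k" and q: "1 <= q"
 shows "mn q (x m j) (x m (j+int k)) (phi x k m j) <= 1" "1 <= phi_const k * mn q (x m j) (x m (j+int k)) (phi x k m j)"
proof -
 have k0: "0 < k" and k1: "1 <= k" using k by simp_all
 obtain n where n: "k = Suc n" using k0 gr0_conv_Suc by blast
 let ?a = "x m j" and ?b = "x m (j+1)" and ?c = "x m (j+int k)"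
 have ab: "?a < ?b" "?b <= ?c" "?a < ?c" using k by (simp_all add: x_less_iff x_le_iff)
 show "mn q ?a ?c (phi x k m j) <= 1" by (rule mn_cont_bounded[OF q ab(3) phi_continuous[OF k] phi_le_1[OF k0]])
 define a where "a = (\<lambda>p :: int \<times> int. if p = (m, j) then 1 else 0 :: complex)"
 have lev: "lev x k a m t = phi x k m j t" for t
 proof -
  have "lev x k a m t = (\<Sum>\<^sub>\<infinity>i\<in>{j}. a (m, i) * phi x k m i t)"
   unfolding lev_def by (rule infsum_cong_neutral) (auto simp: a_def)
  thus ?thesis by (simp add: a_def)
 qed
 let ?p = "cpiece (x m) k (\<lambda>i. a (m, i)) j"
 have p: "?p \<in> Pi_poly k" unfolding n by (rule cpiece_Pi)
 have "dual (x m) k j ?p = 1" unfolding n using dual_cpiece[OF knots, of j j n m "\<lambda>i. a (m, i)"] by (simp add: a_def)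
 hence "1 <= dual_const k * mn 1 ?a ?b (poly_fun ?p)" using dual_bound[OF k1, of j j ?p m] p k by simp
 also have "mn 1 ?a ?b (poly_fun ?p) <= mn q ?a ?b (poly_fun ?p)" by (rule Lq_integrable_norm(2)[OF q poly_fun_Lq[OF q] ab(1)])
 also have "mn q ?a ?b (poly_fun ?p) = mn q ?a ?b (phi x k m j)"
  by (rule mn_cong) (simp add: lev[symmetric] lev_cpiece_closed[OF k])
 also have "mn q ?a ?b (phi x k m j) <= (real k * lam\<^sup>2) * mn q ?a ?c (phi x k m j)"
 proof (rule mn_mono(2)[OF q continuous_on_Lq[OF q phi_continuous[OF k]] order_refl ab(1,2)])
  have "?c-?a <= real k*(lam * mesh x m)" using x_diff_bounds(1)[of j "j+int k" m] by simp
  also have "... <= real k*(lam*(lam * len x m j))" using lam mesh_le_len[of m j] by (intro mult_left_mono) auto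
  finally show "?c-?a <= real k * lam\<^sup>2*(?b-?a)" by (simp add: len_def power2_eq_square mult.assoc)
 qed
 finally show "1 <= phi_const k * mn q ?a ?c (phi x k m j)"
  using dual_const_pos[OF k1] by (simp add: phi_const_def mult.assoc)
qed

lemma Q_coef_eq:
 assumes k: "2 <= k" and q: "1 <= q" and P: "near_best_projectors k q A P" and f: "f \<in> Lq_loc q" and v: "valid_choice x k l \<xi>"
 shows "Q_coef x k q P l \<xi> f (m, j) = cmod (bq k P l f (m, j)) * mn q (x m j) (x m (j+int k)) (phi x k m j)"
proof -
 let ?b = "bq k P l f (m, j)"
 have "Lq_norm q UNIV (\<lambda>t. ?b * phi x k m j t) = Lq_norm q {x m j..x m (j+int k)} (\<lambda>t. ?b * phi x k m j t)"
  using k by (intro Lq_zero_outside(2)) (auto simp: phi_eq_0 not_le)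
 thus ?thesis
  using mn_cmult[where c="?b" and a="x m j" and b="x m (j+int k)", OF q continuous_on_Lq[OF q phi_continuous[OF k]]]
  by (simp add: Q_coef_def b_coef_bq[OF k P f v] mn_def)
qed

lemma Q_coef_bounds:
 assumes k: "2 <= k" and q: "1 <= q" and P: "near_best_projectors k q A P" and f: "f \<in> Lq_loc q" and v: "valid_choice x k l \<xi>"
 shows "0 <= Q_coef x k q P l \<xi> f g" "Q_coef x k q P l \<xi> f g <= 1 * cmod (bq k P l f g)" "cmod (bq k P l f g) <= phi_const k * Q_coef x k q P l \<xi> f g"
proof -
 obtain m j where g: "g = (m, j)" by force
 note e = Q_coef_eq[OF k q P f v, of m j]
 show "0 <= Q_coef x k q P l \<xi> f g" unfolding g e by simp
 show "Q_coef x k q P l \<xi> f g <= 1 * cmod (bq k P l f g)" unfolding g e using mn_phi(1)[OF k q, of m j] by (simp add: mult_left_le)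
 show "cmod (bq k P l f g) <= phi_const k * Q_coef x k q P l \<xi> f g"
  unfolding g e using mult_left_mono[OF mn_phi(2)[OF k q, of m j], of "cmod (bq k P l f (m, j))"] by (simp add: mult_ac)
qed

lemma besov_Q_iff:
 assumes k: "2 <= k" and q: "1 <= q" and \<tau>: "0 < \<tau>" and P: "near_best_projectors k q A P" and v: "valid_choice x k l \<xi>"
 shows "f \<in> besov_Q x k \<tau> q P l \<xi> \<longleftrightarrow> f \<in> Lq_loc q \<and> (\<lambda>g. cmod (bq k P l f g) powr \<tau>) summable_on UNIV"
  "f \<in> besov_Q x k \<tau> q P l \<xi> ==> besov_Q_norm x k \<tau> q P l \<xi> f <= ell_norm \<tau> (\<lambda>g. cmod (bq k P l f g))"
  "f \<in> besov_Q x k \<tau> q P l \<xi> ==> ell_norm \<tau> (\<lambda>g. cmod (bq k P l f g)) <= phi_const k * besov_Q_norm x k \<tau> q P l \<xi> f"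
proof -
 have C: "0 <= phi_const k" using phi_const_nonneg[of k] k by simp
 let ?Q = "Q_coef x k q P l \<xi> f" and ?b = "\<lambda>g. cmod (bq k P l f g)"
 have bd: "0 <= ?Q g" "?Q g <= 1*?b g" "?b g <= phi_const k*?Q g" if "f \<in> Lq_loc q" for g
  by (rule Q_coef_bounds[OF k q P that v])+
 show iff: "f \<in> besov_Q x k \<tau> q P l \<xi> \<longleftrightarrow> f \<in> Lq_loc q \<and> (\<lambda>g. ?b g powr \<tau>) summable_on UNIV"
 proof
  assume "f \<in> besov_Q x k \<tau> q P l \<xi>"
  hence f: "f \<in> Lq_loc q" and s: "(\<lambda>g. ?Q g powr \<tau>) summable_on UNIV" by (auto simp: besov_Q_def)
  show "f \<in> Lq_loc q \<and> (\<lambda>g. ?b g powr \<tau>) summable_on UNIV"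
   using f ell_norm_mono(1)[where s="?b" and t="?Q", OF s norm_ge_zero bd(3)[OF f] bd(1)[OF f] C \<tau>] by simp
 next
  assume "f \<in> Lq_loc q \<and> (\<lambda>g. ?b g powr \<tau>) summable_on UNIV"
  hence f: "f \<in> Lq_loc q" and s: "(\<lambda>g. ?b g powr \<tau>) summable_on UNIV" by auto
  show "f \<in> besov_Q x k \<tau> q P l \<xi>"
   unfolding besov_Q_def using f ell_norm_mono(1)[where s="?Q" and t="?b", OF s bd(1)[OF f] bd(2)[OF f] norm_ge_zero zero_le_one \<tau>] by simp
 qed
 assume fQ: "f \<in> besov_Q x k \<tau> q P l \<xi>"
 hence f: "f \<in> Lq_loc q" and s: "(\<lambda>g. ?Q g powr \<tau>) summable_on UNIV" by (auto simp: besov_Q_def)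
 have sb: "(\<lambda>g. ?b g powr \<tau>) summable_on UNIV" using iff fQ by blast
 show "besov_Q_norm x k \<tau> q P l \<xi> f <= ell_norm \<tau> ?b"
  unfolding besov_Q_norm_def using ell_norm_mono(2)[where s="?Q" and t="?b", OF sb bd(1)[OF f] bd(2)[OF f] norm_ge_zero zero_le_one \<tau>] by simp
 show "ell_norm \<tau> ?b <= phi_const k * besov_Q_norm x k \<tau> q P l \<xi> f"
  unfolding besov_Q_norm_def by (rule ell_norm_mono(2)[where s="?b" and t="?Q", OF s norm_ge_zero bd(3)[OF f] bd(1)[OF f] C \<tau>])
qed

text \<open>Additivity of the projectors enters here; it is what makes adding a null function leave
  the coefficients unchanged.\<close>

lemma bq_add:
 assumes P: "near_best_projectors k q A P" and f: "f \<in> Lq_loc q" and h: "h \<in> Lq_loc q"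
 shows "bq k P l (\<lambda>t. f t+h t) g = bq k P l f g+bq k P l h g"
proof -
 have c: "cpiece y k (\<lambda>j. a j+b j) i = cpiece y k a i+cpiece y k b i" for y a b i
  by (simp add: cpiece_def smult_add_left sum.distrib)
 have ga: "gam k l (locproj P (\<lambda>t. f t+h t)) p = gam k l (locproj P f) p+gam k l (locproj P h) p" for p
  by (cases p) (simp add: gam_def locproj_add[OF P f h] dual_linear)
 show ?thesis by (cases g) (simp add: bq_def bco_def ga c dual_linear)
qed

lemma Lq_loc_add: "1 <= q ==> f \<in> Lq_loc q ==> h \<in> Lq_loc q ==> (\<lambda>t. f t+h t) \<in> Lq_loc q"
 unfolding Lq_loc_def by (simp add: Lq_add(1))

lemma null_bq:
 assumes k: "2 <= k" and q: "1 <= q" and \<tau>: "0 < \<tau>" and P: "near_best_projectors k q A P" and v: "valid_choice x k l \<xi>"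
  and h: "h \<in> besov_Q_null x k \<tau> q P l \<xi>"
 shows "bq k P l h g = 0"
proof -
 have hQ: "h \<in> besov_Q x k \<tau> q P l \<xi>" and h0: "besov_Q_norm x k \<tau> q P l \<xi> h = 0" using h by (auto simp: besov_Q_null_def)
 have s: "(\<lambda>g. cmod (bq k P l h g) powr \<tau>) summable_on UNIV" using besov_Q_iff(1)[OF k q \<tau> P v] hQ by blast
 have "ell_norm \<tau> (\<lambda>g. cmod (bq k P l h g)) = 0"
  using besov_Q_iff(3)[OF k q \<tau> P v hQ] h0 ell_norm_nonneg[of \<tau> "\<lambda>g. cmod (bq k P l h g)"] by simp
 hence "(\<Sum>\<^sub>\<infinity>g. cmod (bq k P l h g) powr \<tau>) = 0" by (simp add: ell_norm_def)
 hence "cmod (bq k P l h g) powr \<tau> <= 0" using sum_le_infsum[OF s, of "{g}"] by simp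
 thus ?thesis by simp
qed

text \<open>At a common knot the truncated power is a spline of every level, with the pieces
  \<open>H m\<close>. It is therefore reproduced by every quasi-interpolant, and all differences of
  consecutive levels vanish.\<close>

lemma trunc_null:
 assumes k: "2 <= k" and q: "1 <= q" and \<tau>: "0 < \<tau>" and P: "near_best_projectors k q A P" and v: "valid_choice x k l \<xi>"
  and s: "c = 0 \<or> (\<forall>m. s \<in> range (x m))"
 shows "(\<lambda>t. c * trunc k s t) \<in> besov_Q_null x k \<tau> q P l \<xi>"
proof -
 have k0: "0 < k" using k by simp
 let ?h = "\<lambda>t. c * trunc k s t"
 have hl: "?h \<in> Lq_loc q" unfolding Lq_loc_def by (simp add: Lq_cmult(1) q trunc_Lq)
 define H where "H m i = (if s <= x m i then smult c ([:- of_real s, 1:] ^ (k-1)) else 0)" for m i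
 have HPi: "H m i \<in> Pi_poly k" for m i
  unfolding H_def using Pi_poly_lin_power[of "- of_real s" "k-1"] k0 by (auto intro!: Pi_poly_smult simp: Pi_poly_def)
 have Hh: "?h t = poly_fun (H m i) t" if t: "t \<in> {x m i..x m (i+1)}" for m i t
 proof (cases "s <= x m i")
  case True
  thus ?thesis using t trunc_right[of s t k] by (simp add: H_def poly_fun_simps)
 next
  case False
  have "c = 0 \<or> t <= s"
  proof (cases "c = 0")
   case nz: False
   then obtain j where j: "s = x m j" using s by (metis rangeE)
   hence "x m (i+1) <= s" using False by (simp add: x_le_iff)
   thus ?thesis using t by simp
  qed simp
  thus ?thesis using False trunc_left[OF k] by (auto simp: H_def poly_fun_simps)
 qed
 have lp: "locproj P ?h m i = H m i" for m i
 proof -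
  let ?S = "{x m i..x m (i+1)}"
  \<comment> \<open>A projector sees only the values on its own interval, where the function is one
    polynomial.\<close>
  have "AE t\<in>?S in lebesgue. ?h t = poly_fun (H m i) t" using Hh by (intro AE_I2) blast
  hence "P (x m i) (x m (i+1)) ?h = P (x m i) (x m (i+1)) (poly_fun (H m i))"
   by (rule near_best_projectorsD(2)[OF P x_lt Lq_locD[OF hl] poly_fun_Lq[OF q]])
  also have "... = H m i" by (rule near_best_projectorsD(4)[OF P x_lt poly_fun_Lq[OF q] HPi])
  finally show ?thesis by (simp add: locproj_def)
 qed
 have sp: "spline (x m) k (H m)" for m
  unfolding spline_def
 proof (intro allI conjI HPi)
  fix i
  show "\<exists>d. H m i-H m (i-1) = smult d ([:- complex_of_real (x m i), 1:] ^ (k-1))"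
  proof (cases "s <= x m i \<and> \<not> s <= x m (i-1) \<and> c \<noteq> 0")
   case True
   then obtain j where j: "s = x m j" using s by (metis rangeE)
   hence "j = i" using True by (auto simp: x_le_iff)
   hence "s = x m i" using j by simp
   thus ?thesis using True by (intro exI[of _ c]) (simp add: H_def)
  next
   case False
   have "x m (i-1) <= x m i" by (simp add: x_le_iff)
   hence "H m i = H m (i-1)" using False by (auto simp: H_def)
   thus ?thesis by (intro exI[of _ 0]) simp
  qed
 qed
 have T: "lev x k (gam k l (locproj P ?h)) m t = ?h t" for m t
 proof -
  obtain i where i: "x m i <= t" "t < x m (i+1)" by (rule x_cover)
  have "lev x k (gam k l (locproj P ?h)) m t = lev x k (\<lambda>(m', j). dual (x m') k j (H m (l m j))) m t"
   by (rule lev_cong) (simp add: gam_def lp)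
  also have "... = poly_fun (H m i) t"
   by (rule spline_lev[where s="l m", OF k0 sp valid_sel[OF v] i])
  also have "... = ?h t" using Hh[of t m i] i by simp
  finally show ?thesis .
 qed
 have "bq k P l ?h (m, j) = 0" for m j
 proof -
  have "lev x k (bq k P l ?h) m t = lev x k (\<lambda>_. 0) m t" for t
   using bco_refines[where sel=l and R="locproj P ?h" and m=m and t=t, OF k valid_sel[OF v]] T by (simp add: bq_def lev_def[of _ _ "\<lambda>_. 0"])
  thus ?thesis by (rule lev_eq_imp_coeffs_eq[OF k0])
 qed
 hence b0: "bq k P l ?h g = 0" for g by (cases g) simp
 hence Q: "?h \<in> besov_Q x k \<tau> q P l \<xi>" unfolding besov_Q_iff(1)[OF k q \<tau> P v] using hl by simp
 moreover have "besov_Q_norm x k \<tau> q P l \<xi> ?h <= 0" using besov_Q_iff(2)[OF k q \<tau> P v Q] by (simp add: b0 ell_norm_def)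
 moreover have "0 <= besov_Q_norm x k \<tau> q P l \<xi> ?h" unfolding besov_Q_norm_def by (rule ell_norm_nonneg)
 ultimately show ?thesis unfolding besov_Q_null_def by simp
qed

text \<open>The fine limit comes from \<open>quasi_interp_conv\<close>, the coarse behaviour from
  \<open>coarse_spline\<close>. Then \<open>synthesis\<close> represents \<open>f\<close> minus a
  multiple of the truncated power, and \<open>Phi_to_E\<close> supplies its moduli.\<close>

lemma Q_decomposition:
 assumes k: "2 <= k" and q: "1 <= q" and \<tau>: "0 < \<tau>" and P: "near_best_projectors k q A P" and v: "valid_choice x k l \<xi>" and A: "0 <= A"
  and f: "f \<in> besov_Q x k \<tau> q P l \<xi>"
 obtains c s where "c = 0 \<or> (\<forall>m. s \<in> range (x m))" "(\<Inter>m. range (x m)) = {} --> c = 0" "(\<lambda>t. f t-c * trunc k s t) \<in> besov_E x k \<tau> q"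
proof -
 have fl: "f \<in> Lq_loc q" and b: "(\<lambda>g. cmod (bq k P l f g) powr \<tau>) summable_on UNIV" using f besov_Q_iff(1)[OF k q \<tau> P v] by auto
 have f1: "f \<in> Lq 1 {u..v}" for u v by (rule Lq_integrable_norm(1)[OF q Lq_locD[OF fl]])
 note sel = valid_sel[OF v]
 let ?T = "lev x k (gam k l (locproj P f))"
 obtain s p c where p: "\<forall>n. p n \<in> Pi_poly k"
  and far: "\<forall>u v. \<exists>N. \<forall>n\<ge>N. \<forall>t\<in>{u..v}. ?T (- int n) t = poly_fun (p n) t+c n * trunc k s t"
  and c0: "(\<Inter>m. range (x m)) = {} --> (\<forall>n. c n = 0)" and cs: "(\<forall>n. c n = 0) \<or> (\<forall>m. s \<in> range (x m))"
  using coarse_spline[where a="gam k l (locproj P f)", OF k] by (elim exE conjE)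
 have "\<exists>c'. ((\<forall>n. c n = 0) --> c' = 0) \<and> Phi_rep x k \<tau> (\<lambda>t. f t-c' * trunc k s t) (bq k P l f)"
 proof (rule synthesis[where p=p and c=c, OF k \<tau> b f1])
  show "p n \<in> Pi_poly k" for n using p by blast
  fix u v :: real assume uv: "u < v"
  obtain N where N: "\<forall>n\<ge>N. \<forall>t\<in>{u..v}. ?T (- int n) t = poly_fun (p n) t+c n * trunc k s t" using far by blast
  have "\<forall>\<^sub>F n in sequentially. mn 1 u v (\<lambda>t. f t-?T (int n) t) =
   mn 1 u v (\<lambda>t. f t-(\<Sum>m\<in>{- int n<..int n}. lev x k (bq k P l f) m t)-(poly_fun (p n) t+c n * trunc k s t))"
   unfolding eventually_sequentially
  proof (intro exI[of _ N] allI impI mn_cong)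
   fix n t assume "N <= n" "u <= t" "t <= v"
   hence "?T (- int n) t = poly_fun (p n) t+c n * trunc k s t" using N by auto
   thus "f t-?T (int n) t = f t-(\<Sum>m\<in>{- int n<..int n}. lev x k (bq k P l f) m t)-(poly_fun (p n) t+c n * trunc k s t)"
    unfolding bq_def lev_telescope[where sel=l, OF k sel] by simp
  qed
  thus "(\<lambda>n. mn 1 u v (\<lambda>t. f t-(\<Sum>m\<in>{- int n<..int n}. lev x k (bq k P l f) m t)-(poly_fun (p n) t+c n * trunc k s t))) \<longlonglongrightarrow> 0"
   by (rule Lim_transform_eventually[OF quasi_interp_conv[where sel=l, OF k q fl A locproj_near_best[OF P fl q A] sel uv]])
 qed
 then obtain c' where c': "(\<forall>n. c n = 0) --> c' = 0" "Phi_rep x k \<tau> (\<lambda>t. f t-c' * trunc k s t) (bq k P l f)" by (elim exE conjE)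
 show ?thesis
  by (rule that[OF _ _ Phi_to_E(1)[OF k q \<tau> c'(2)]]) (use c0 cs c'(1) in auto)
qed

text \<open>For \<open>f\<close> in \<open>besov_E\<close> the coefficients \<open>bq\<close>
  themselves give a representation, so \<open>Phi_to_E\<close> bounds the moduli by them and
  \<open>E_bco\<close> bounds them by the moduli. Adding a null function changes none of
  them.\<close>

theorem Q_eq_E:
 assumes k: "2 <= k" and q: "1 <= q" and \<tau>: "0 < \<tau>" and P: "near_best_projectors k q A P" and v: "valid_choice x k l \<xi>" and A: "0 <= A"
 shows "besov_Q x k \<tau> q P l \<xi> = {\<lambda>t. f t+h t | f h. f \<in> besov_E x k \<tau> q \<and> h \<in> besov_Q_null x k \<tau> q P l \<xi>}"
  "(\<Inter>m. range (x m)) = {} ==> besov_Q x k \<tau> q P l \<xi> = besov_E x k \<tau> q"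
  "f \<in> besov_E x k \<tau> q ==> h \<in> besov_Q_null x k \<tau> q P l \<xi> ==>
   besov_E_norm x k \<tau> q f <= PhiE_const k q \<tau> * phi_const k * besov_Q_norm x k \<tau> q P l \<xi> (\<lambda>t. f t+h t)"
  "f \<in> besov_E x k \<tau> q ==> h \<in> besov_Q_null x k \<tau> q P l \<xi> ==>
   besov_Q_norm x k \<tau> q P l \<xi> (\<lambda>t. f t+h t) <= E_bco_const k (A * Whitney_const k 0) \<tau> * besov_E_norm x k \<tau> q f"
proof -
 note sel = valid_sel[OF v]
 have W: "0 <= A * Whitney_const k 0" using A Whitney_const_pos[of k 0] k by simp
 have E: "(\<lambda>g. cmod (bq k P l f g) powr \<tau>) summable_on UNIV"
  "ell_norm \<tau> (\<lambda>g. cmod (bq k P l f g)) <= E_bco_const k (A * Whitney_const k 0) \<tau> * besov_E_norm x k \<tau> q f"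
  "besov_E_norm x k \<tau> q f <= PhiE_const k q \<tau> * ell_norm \<tau> (\<lambda>g. cmod (bq k P l f g))" "f \<in> Lq_loc q"
  if f: "f \<in> besov_E x k \<tau> q" for f
 proof -
  show fl: "f \<in> Lq_loc q" using f by (simp add: besov_E_def)
  note ap = locproj_approximates[OF P fl q A k]
  show "(\<lambda>g. cmod (bq k P l f g) powr \<tau>) summable_on UNIV"
   unfolding bq_def by (rule E_bco(1)[where sel=l, OF k q \<tau> f W ap sel])
  show "ell_norm \<tau> (\<lambda>g. cmod (bq k P l f g)) <= E_bco_const k (A * Whitney_const k 0) \<tau> * besov_E_norm x k \<tau> q f"
   unfolding bq_def by (rule E_bco(2)[where sel=l, OF k q \<tau> f W ap sel])
  show "besov_E_norm x k \<tau> q f <= PhiE_const k q \<tau> * ell_norm \<tau> (\<lambda>g. cmod (bq k P l f g))"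
   unfolding bq_def by (rule Phi_to_E(2)[OF k q \<tau> E_Phi_rep[where sel=l, OF k q \<tau> f W ap sel]])
 qed
 have add: "bq k P l (\<lambda>t. f t+h t) g = bq k P l f g" "(\<lambda>t. f t+h t) \<in> besov_Q x k \<tau> q P l \<xi>"
  if f: "f \<in> besov_E x k \<tau> q" and h: "h \<in> besov_Q_null x k \<tau> q P l \<xi>" for f h g
 proof -
  have hl: "h \<in> Lq_loc q" using h by (simp add: besov_Q_null_def besov_Q_def)
  have e: "bq k P l (\<lambda>t. f t+h t) g = bq k P l f g" for g
   using bq_add[OF P E(4)[OF f] hl, of l g] null_bq[OF k q \<tau> P v h, of g] by simp
  thus "bq k P l (\<lambda>t. f t+h t) g = bq k P l f g" .
  show "(\<lambda>t. f t+h t) \<in> besov_Q x k \<tau> q P l \<xi>"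
   unfolding besov_Q_iff(1)[OF k q \<tau> P v] e using E(1)[OF f] Lq_loc_add[OF q E(4)[OF f] hl] by simp
 qed
 show "besov_Q x k \<tau> q P l \<xi> = {\<lambda>t. f t+h t | f h. f \<in> besov_E x k \<tau> q \<and> h \<in> besov_Q_null x k \<tau> q P l \<xi>}"
 proof (intro equalityI subsetI)
  fix F assume F: "F \<in> besov_Q x k \<tau> q P l \<xi>"
  obtain c s where cs: "c = 0 \<or> (\<forall>m. s \<in> range (x m))" "(\<Inter>m. range (x m)) = {} --> c = 0" "(\<lambda>t. F t-c * trunc k s t) \<in> besov_E x k \<tau> q"
   by (rule Q_decomposition[OF k q \<tau> P v A F])
  have "F = (\<lambda>t. (F t-c * trunc k s t)+c * trunc k s t)" by simp
  thus "F \<in> {\<lambda>t. f t+h t | f h. f \<in> besov_E x k \<tau> q \<and> h \<in> besov_Q_null x k \<tau> q P l \<xi>}"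
   using cs(3) trunc_null[OF k q \<tau> P v cs(1)]
   by (intro CollectI exI[of _ "\<lambda>t. F t-c * trunc k s t"] exI[of _ "\<lambda>t. c * trunc k s t"] conjI) simp_all
 next
  fix F assume "F \<in> {\<lambda>t. f t+h t | f h. f \<in> besov_E x k \<tau> q \<and> h \<in> besov_Q_null x k \<tau> q P l \<xi>}"
  then obtain f h where F: "F = (\<lambda>t. f t+h t)" "f \<in> besov_E x k \<tau> q" "h \<in> besov_Q_null x k \<tau> q P l \<xi>" by (elim CollectE exE conjE)
  show "F \<in> besov_Q x k \<tau> q P l \<xi>" unfolding F(1) by (rule add(2)[OF F(2,3)])
 qed
 show "besov_Q x k \<tau> q P l \<xi> = besov_E x k \<tau> q" if no: "(\<Inter>m. range (x m)) = {}"
 proof (intro equalityI subsetI)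
  fix F assume F: "F \<in> besov_Q x k \<tau> q P l \<xi>"
  obtain c s where cs: "c = 0 \<or> (\<forall>m. s \<in> range (x m))" "(\<Inter>m. range (x m)) = {} --> c = 0" "(\<lambda>t. F t-c * trunc k s t) \<in> besov_E x k \<tau> q"
   by (rule Q_decomposition[OF k q \<tau> P v A F])
  show "F \<in> besov_E x k \<tau> q" using cs(3) by (simp add: mp[OF cs(2) no])
 next
  fix F assume "F \<in> besov_E x k \<tau> q"
  thus "F \<in> besov_Q x k \<tau> q P l \<xi>" unfolding besov_Q_iff(1)[OF k q \<tau> P v] using E(1,4) by simp
 qed
 assume f: "f \<in> besov_E x k \<tau> q" and h: "h \<in> besov_Q_null x k \<tau> q P l \<xi>"
 note fh = add(2)[OF f h]
 have "besov_E_norm x k \<tau> q f <= PhiE_const k q \<tau> * ell_norm \<tau> (\<lambda>g. cmod (bq k P l f g))" by (rule E(3)[OF f])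
 also have "... <= PhiE_const k q \<tau>*(phi_const k * besov_Q_norm x k \<tau> q P l \<xi> (\<lambda>t. f t+h t))"
  using besov_Q_iff(3)[OF k q \<tau> P v fh] by (intro mult_left_mono) (simp_all add: add(1)[OF f h] PhiE_const_def)
 finally show "besov_E_norm x k \<tau> q f <= PhiE_const k q \<tau> * phi_const k * besov_Q_norm x k \<tau> q P l \<xi> (\<lambda>t. f t+h t)"
  by (simp add: mult.assoc)
 have "besov_Q_norm x k \<tau> q P l \<xi> (\<lambda>t. f t+h t) <= ell_norm \<tau> (\<lambda>g. cmod (bq k P l f g))"
  using besov_Q_iff(2)[OF k q \<tau> P v fh] by (simp add: add(1)[OF f h])
 thus "besov_Q_norm x k \<tau> q P l \<xi> (\<lambda>t. f t+h t) <= E_bco_const k (A * Whitney_const k 0) \<tau> * besov_E_norm x k \<tau> q f"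
  using E(2)[OF f] by simp
qed

end

text \<open>The maximum with 1 makes the constants positive, as an equivalence requires.\<close>

lemma norm_equivalence_constants:
 fixes a b e C D :: real
 assumes "a <= C * b" "b <= D * a" "0 <= a" "0 <= b"
 shows "1/max C 1 * a <= b" "b <= max D 1 * a"
proof -
 have "a <= max C 1 * b" using assms(1) mult_right_mono[OF max.cobounded1[of C 1] assms(4)] by simp
 thus "1/max C 1 * a <= b" by (simp add: divide_le_eq mult.commute)
 show "b <= max D 1 * a" using assms(2) mult_right_mono[OF max.cobounded1[of D 1] assms(3)] by simp
qed

text \<open>The constants are quantified before partition, projectors and points of evaluation,
  which expresses that they depend on \<alpha>, k, q, \<open>M\<^sub>0\<close>, \<open>lam\<close>
  and, in the second part, \<open>A\<close> alone. Writing \<open>besov_Q\<close> as a sum with its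
  null space states equality up to elements of norm zero.\<close>

theorem theorem3p9:
  fixes \<alpha> q lam :: real and k M\<^sub>0 :: nat
  assumes "\<alpha> > 0" and "k \<ge> 2" and "q \<ge> 1" and "M\<^sub>0 \<ge> 2" and "lam \<ge> 1"
  shows
    "(\<exists>c\<^sub>1>0. \<exists>c\<^sub>2>0. \<forall>x. regular_multilevel_partition M\<^sub>0 lam x \<longrightarrow>
        besov_Phi x k (1 / \<alpha>) = besov_E x k (1 / \<alpha>) q \<and>
        (\<forall>f\<in>besov_E x k (1 / \<alpha>) q.
           c\<^sub>1 * besov_E_norm x k (1 / \<alpha>) q f \<le> besov_Phi_norm x k (1 / \<alpha>) f \<and>
           besov_Phi_norm x k (1 / \<alpha>) f \<le> c\<^sub>2 * besov_E_norm x k (1 / \<alpha>) q f)) \<and>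
     (\<forall>A\<ge>1. \<exists>c\<^sub>1>0. \<exists>c\<^sub>2>0. \<forall>x P l \<xi>.
        regular_multilevel_partition M\<^sub>0 lam x \<and> near_best_projectors k q A P \<and>
        valid_choice x k l \<xi> \<longrightarrow>
        besov_Q x k (1 / \<alpha>) q P l \<xi> =
          {\<lambda>t. f t + h t | f h. f \<in> besov_E x k (1 / \<alpha>) q \<and>
                                h \<in> besov_Q_null x k (1 / \<alpha>) q P l \<xi>} \<and>
        ((\<Inter>m. range (x m)) = {} \<longrightarrow>
           besov_Q x k (1 / \<alpha>) q P l \<xi> = besov_E x k (1 / \<alpha>) q) \<and>
        (\<forall>f\<in>besov_E x k (1 / \<alpha>) q. \<forall>h\<in>besov_Q_null x k (1 / \<alpha>) q P l \<xi>.
           c\<^sub>1 * besov_E_norm x k (1 / \<alpha>) q f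
             \<le> besov_Q_norm x k (1 / \<alpha>) q P l \<xi> (\<lambda>t. f t + h t) \<and>
           besov_Q_norm x k (1 / \<alpha>) q P l \<xi> (\<lambda>t. f t + h t)
             \<le> c\<^sub>2 * besov_E_norm x k (1 / \<alpha>) q f))"
proof (intro conjI allI impI)
 let ?\<tau> = "1/\<alpha>"
 \<comment> \<open>Outside the locale these constants take \<open>lam\<close>, and where needed
   \<open>M\<^sub>0\<close>, as arguments, but not \<open>x\<close>, so they can serve as witnesses
   before \<open>x\<close> is fixed.\<close>
 let ?W = "multilevel.Whitney_const lam k 0" and ?D = "multilevel.E_bco_const M\<^sub>0 lam k" and ?C = "multilevel.PhiE_const lam k q ?\<tau>"
 note [simp] = assms(2,3)
 have \<tau>: "0 < ?\<tau>" using assms(1) by simp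
 have loc: "multilevel M\<^sub>0 lam x" if "regular_multilevel_partition M\<^sub>0 lam x" for x
  using that assms(5) by unfold_locales
 have E0: "0 <= besov_E_norm x k ?\<tau> q f" for x f by (simp add: besov_E_norm_def ell_norm_def)
 have Q0: "0 <= besov_Q_norm x k ?\<tau> q P l \<xi> f" for x P l \<xi> f by (simp add: besov_Q_norm_def ell_norm_def)
 have Phi0: "0 <= besov_Phi_norm x k ?\<tau> f" if "f \<in> besov_Phi x k ?\<tau>" for x f
  unfolding besov_Phi_norm_def using that by (intro cINF_greatest) (auto simp: besov_Phi_def ell_norm_def)
 show "\<exists>c\<^sub>1>0. \<exists>c\<^sub>2>0. \<forall>x. regular_multilevel_partition M\<^sub>0 lam x -->
    besov_Phi x k (1/\<alpha>) = besov_E x k (1/\<alpha>) q \<and>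
    (\<forall>f\<in>besov_E x k (1/\<alpha>) q.
      c\<^sub>1 * besov_E_norm x k (1/\<alpha>) q f <= besov_Phi_norm x k (1/\<alpha>) f \<and>
      besov_Phi_norm x k (1/\<alpha>) f <= c\<^sub>2 * besov_E_norm x k (1/\<alpha>) q f)"
 proof (intro exI conjI allI impI ballI)
  show "0 < 1/max ?C 1" "0 < max (?D ?W ?\<tau>) 1" by simp_all
  fix x assume x: "regular_multilevel_partition M\<^sub>0 lam x"
  note thms = multilevel.Phi_eq_E[OF loc[OF x] assms(2,3) \<tau>]
  show eq: "besov_Phi x k ?\<tau> = besov_E x k ?\<tau> q" by (rule thms(1))
  fix f assume f: "f \<in> besov_E x k ?\<tau> q"
  have fP: "f \<in> besov_Phi x k ?\<tau>" unfolding eq by (rule f)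
  note n = norm_equivalence_constants[OF thms(3)[OF f] thms(2)[OF f] E0 Phi0[OF fP]]
  show "1/max ?C 1 * besov_E_norm x k ?\<tau> q f <= besov_Phi_norm x k ?\<tau> f" by (rule n(1))
  show "besov_Phi_norm x k ?\<tau> f <= max (?D ?W ?\<tau>) 1 * besov_E_norm x k ?\<tau> q f" by (rule n(2))
 qed
 fix A :: real assume A: "1 <= A"
 hence A0: "0 <= A" by simp
 let ?C' = "?C * multilevel.phi_const lam k" and ?D' = "?D (A*?W) ?\<tau>"
 show "\<exists>c\<^sub>1>0. \<exists>c\<^sub>2>0. \<forall>x P l \<xi>.
    regular_multilevel_partition M\<^sub>0 lam x \<and> near_best_projectors k q A P \<and>
    valid_choice x k l \<xi> -->
    besov_Q x k (1/\<alpha>) q P l \<xi> =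
     {\<lambda>t. f t+h t | f h. f \<in> besov_E x k (1/\<alpha>) q \<and>
                h \<in> besov_Q_null x k (1/\<alpha>) q P l \<xi>} \<and>
    ((\<Inter>m. range (x m)) = {} -->
      besov_Q x k (1/\<alpha>) q P l \<xi> = besov_E x k (1/\<alpha>) q) \<and>
    (\<forall>f\<in>besov_E x k (1/\<alpha>) q. \<forall>h\<in>besov_Q_null x k (1/\<alpha>) q P l \<xi>.
      c\<^sub>1 * besov_E_norm x k (1/\<alpha>) q f
       <= besov_Q_norm x k (1/\<alpha>) q P l \<xi> (\<lambda>t. f t+h t) \<and>
      besov_Q_norm x k (1/\<alpha>) q P l \<xi> (\<lambda>t. f t+h t)
       <= c\<^sub>2 * besov_E_norm x k (1/\<alpha>) q f)"
 proof (intro exI conjI allI impI ballI)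
  show "0 < 1/max ?C' 1" "0 < max ?D' 1" by simp_all
  fix x P l \<xi> assume *: "regular_multilevel_partition M\<^sub>0 lam x \<and> near_best_projectors k q A P \<and> valid_choice x k l \<xi>"
  hence x: "regular_multilevel_partition M\<^sub>0 lam x" and P: "near_best_projectors k q A P" and v: "valid_choice x k l \<xi>" by blast+
  note thms = multilevel.Q_eq_E[OF loc[OF x] assms(2,3) \<tau> P v A0]
  show "besov_Q x k ?\<tau> q P l \<xi> = {\<lambda>t. f t+h t | f h. f \<in> besov_E x k ?\<tau> q \<and> h \<in> besov_Q_null x k ?\<tau> q P l \<xi>}" by (rule thms(1))
  show "besov_Q x k ?\<tau> q P l \<xi> = besov_E x k ?\<tau> q" if "(\<Inter>m. range (x m)) = {}" by (rule thms(2)[OF that])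
  fix f h assume f: "f \<in> besov_E x k ?\<tau> q" and h: "h \<in> besov_Q_null x k ?\<tau> q P l \<xi>"
  note n = norm_equivalence_constants[OF thms(3)[OF f h] thms(4)[OF f h] E0 Q0]
  show "1/max ?C' 1 * besov_E_norm x k ?\<tau> q f <= besov_Q_norm x k ?\<tau> q P l \<xi> (\<lambda>t. f t+h t)" by (rule n(1))
  show "besov_Q_norm x k ?\<tau> q P l \<xi> (\<lambda>t. f t+h t) <= max ?D' 1 * besov_E_norm x k ?\<tau> q f" by (rule n(2))
 qed
qed

end
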